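(* Let $\xi\in C_\Gamma$ be a cusp with scaling matrix $\sigma_\xi$, let $Q\in\mathbb{H}^3$, let $P=z+rj\in\mathbb{H}^3$ with $r>r(\sigma_\xi^{-1}\gamma Q)$ for any $\gamma\in\Gamma$, and let $s\in\mathbb{C}$ with $\operatorname{Re}(s)>1$. Then $$G_s(\sigma_\xi P,Q)=\frac{1}{\operatorname{covol}(\Lambda_\xi)}\left(\frac{r^{1-s}}{s}E_\xi(Q,s)+2\sum_{\mu\in\Lambda_\xi^*,\ \mu\neq0}F_{\xi,-\mu}(Q,s)\,r\,K_s(4\pi|\mu|r)\,e^{2\pi i\operatorname{tr}(\mu z)}\right).$$
   Context: $\mathbb{H}^3=\{P=z+rj: z\in\mathbb{C},\,r\in\mathbb{R}_{>0}\}$ with coordinates $z(P)=z$, $r(P)=r$; the hyperbolic distance $d$ satisfies $\cosh d(z_1+r_1j,z_2+r_2j)=\frac{|z_1-z_2|^2+r_1^2+r_2^2}{2r_1r_2}$. A matrix $\gamma=\begin{pmatrix}a&b\\c&d\end{pmatrix}\in\mathrm{PSL}_2(\mathbb{C})$ acts by $\gamma(z+rj)=\frac{(az+b)\overline{(cz+d)}+a\bar c r^2}{|cz+d|^2+|c|^2r^2}+\frac{r}{|cz+d|^2+|c|^2r^2}j$. $K$ is an imaginary quadratic field with ring of integers $\mathcal{O}_K$, and $\Gamma=\mathrm{PSL}_2(\mathcal{O}_K)$. $\operatorname{tr}(z)=z+\bar z$. $I_s,K_s$ are the modified Bessel functions of the first and second kind. **Cusps.** $C_\Gamma\subseteq\mathbb{P}^1(K)$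 is a fixed complete set of representatives of the $\Gamma$-orbits of cusps, written $[a:b]$ with $a,b\in\mathcal{O}_K$ not both $0$, containing $\infty=[1:0]$. For $\kappa=[a:b]\in C_\Gamma$, $\Gamma_\kappa$ is its stabilizer in $\Gamma$, $\Gamma_\kappa'$ is the maximal unipotent subgroup of $\Gamma_\kappa$ (parabolic elements and the identity), $\Lambda_\kappa=(a\mathcal{O}_K+b\mathcal{O}_K)^{-2}$ (a lattice in $\mathbb{C}$, with euclidean covolume $\operatorname{covol}(\Lambda_\kappa)$), and $\sigma_\kappa=\begin{pmatrix}a&*\\ b&*\end{pmatrix}\in\mathrm{PSL}_2(K)$ is a fixed scaling matrix with $\sigma_\kappa\infty=\kappa$, $\sigma_\kappa^{-1}\Gamma_\kappa\sigma_\kappa=\{\begin{pmatrix}u&\lambda\\0&u^{-1}\end{pmatrix}:u\in\mathcal{O}_K^\times,\lambda\in\Lambda_\kappa\}$ and $\sigma_\kappa^{-1}\Gamma_\kappa'\sigma_\kappa=\{\begin{pmatrix}1&\lambda\\0&1\end{pmatrix}:\lambda\in\Lambda_\kappa\}$; $\sigma_\infty$ is the identity. $\Lambda_\kappa^*=\{\nu\in\mathbb{C}:\operatorname{tr}(\nu\lambda)\in\mathbb{Z}\ \forall\lambda\in\Lambda_\kappa\}$. **Series**, for $\operatorname{Re}(s)>1$: - Eisenstein series $E_\kappa(P,s)=\sum_{\gamma\in\Gamma_\kappa'\backslash\Gamma}r(\sigma_\kappa^{-1}\gamma P)^{s+1}$. - Niebur–Poincaré series, for $\nu\in\Lambda_\kappa^*$,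 $\nu\ne0$: $F_{\kappa,\nu}(P,s)=\sum_{\gamma\in\Gamma_\kappa'\backslash\Gamma}r(\sigma_\kappa^{-1}\gamma P)\,I_s(4\pi|\nu|r(\sigma_\kappa^{-1}\gamma P))\,e^{2\pi i\operatorname{tr}(\nu z(\sigma_\kappa^{-1}\gamma P))}$. - Automorphic Green's function, for $P\neq\gamma Q$ for all $\gamma\in\Gamma$: $G_s(P,Q)=\frac1{2\pi}\sum_{\gamma\in\Gamma}\varphi_s(\cosh d(P,\gamma Q))$ with $\varphi_s(t)=(t+\sqrt{t^2-1})^{-s}(t^2-1)^{-1/2}$. *)

theory Defs
  imports
    "HOL-Algebra.Group_Action"
    "HOL-Analysis.Analysis"
    "HOL-Computational_Algebra.Squarefree"
begin

section \<open>Imaginary quadratic fields, ideals and lattices in the complex plane\<close>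

text \<open>Number fields, their rings of integers and fractional ideals are subsets of the type
  \<open>complex\<close>; the embedding into the complex numbers is inclusion.\<close>

definition imaginary_quadratic_field :: "complex set \<Rightarrow> bool" where
  "imaginary_quadratic_field K \<longleftrightarrow>
     (\<exists>D::int. D < 0 \<and> squarefree D \<and> K = {x + y * csqrt (of_int D) | x y. x \<in> \<rat> \<and> y \<in> \<rat>})"

definition ring_of_integers :: "complex set \<Rightarrow> complex set" where
  "ring_of_integers K = {x \<in> K. algebraic_int x}"

definition ideal_gen2 :: "complex set \<Rightarrow> complex \<Rightarrow> complex \<Rightarrow> complex set" where
  "ideal_gen2 R a b = {a * x + b * y | x y. x \<in> R \<and> y \<in> R}"

definition ideal_mult :: "complex set \<Rightarrow> complex set \<Rightarrow> complex set" where
  "ideal_mult I J =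
     {\<Sum>i<n. f i * g i | (n::nat) f g. (\<forall>i<n. f i \<in> I \<and> g i \<in> J)}"

definition ideal_inverse :: "complex set \<Rightarrow> complex set \<Rightarrow> complex set" where
  "ideal_inverse K I = {x \<in> K. \<forall>y\<in>I. x * y \<in> ring_of_integers K}"

definition complex_tr :: "complex \<Rightarrow> complex" where
  "complex_tr z = z + cnj z"

definition dual_lattice :: "complex set \<Rightarrow> complex set" where
  "dual_lattice L = {\<nu>. \<forall>l\<in>L. complex_tr (\<nu> * l) \<in> \<int>}"

definition lattice_basis :: "complex set \<Rightarrow> complex \<Rightarrow> complex \<Rightarrow> bool" where
  "lattice_basis L w1 w2 \<longleftrightarrow>
     w1 \<noteq> w2 \<and> independent {w1, w2} \<and> L = {of_int m * w1 + of_int n * w2 | m n. True}"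

text \<open>The covolume is the area of a fundamental parallelogram; it does not depend on the
  choice of the lattice basis.\<close>

definition covol :: "complex set \<Rightarrow> real" where
  "covol L = (let (w1, w2) = (SOME (w1, w2). lattice_basis L w1 w2) in
     measure lborel {of_real s * w1 + of_real t * w2 | s t. s \<in> {0..<1} \<and> t \<in> {0..<1}})"


section \<open>The groups SL2 and PSL2\<close>

text \<open>For a subring \<open>R\<close> of the complex numbers, the elements of \<open>PSL2 R\<close> are the cosets
  \<open>{A, - A}\<close>. Hence \<open>PSL2 R\<close> is a subgroup of \<open>PSL2 S\<close> whenever \<open>R \<subseteq> S\<close>.\<close>

definition SL2 :: "complex set \<Rightarrow> (complex^2^2) monoid" where
  "SL2 R = \<lparr>carrier = {A. (\<forall>i j. A $ i $ j \<in> R) \<and> det A = 1}, monoid.mult = (**), one = mat 1\<rparr>"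

definition PSL2 :: "complex set \<Rightarrow> (complex^2^2) set monoid" where
  "PSL2 R = SL2 R Mod {mat 1, - mat 1}"

definition psl_class :: "complex \<Rightarrow> complex \<Rightarrow> complex \<Rightarrow> complex \<Rightarrow> (complex^2^2) set" where
  "psl_class a b c d = (let A = vector [vector [a, b], vector [c, d]] in {A, - A})"

abbreviation Bianchi :: "complex set \<Rightarrow> (complex^2^2) set monoid" where
  "Bianchi K \<equiv> PSL2 (ring_of_integers K)"


section \<open>Hyperbolic 3-space\<close>

text \<open>The point \<open>z + r j\<close> is the pair \<open>(z, r)\<close>, so the coordinate functions are \<open>fst\<close> and \<open>snd\<close>.\<close>

definition hyp3 :: "(complex \<times> real) set" where
  "hyp3 = {(z, r). r > 0}"

definition hyp_dist :: "complex \<times> real \<Rightarrow> complex \<times> real \<Rightarrow> real" where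
  "hyp_dist P Q =
     arcosh (((cmod (fst P - fst Q))\<^sup>2 + (snd P)\<^sup>2 + (snd Q)\<^sup>2) / (2 * snd P * snd Q))"

definition mat_act :: "complex^2^2 \<Rightarrow> complex \<times> real \<Rightarrow> complex \<times> real" where
  "mat_act A P =
     (let a = A $ 1 $ 1; b = A $ 1 $ 2; c = A $ 2 $ 1; d = A $ 2 $ 2;
          z = fst P; r = snd P;
          N = (cmod (c * z + d))\<^sup>2 + (cmod c)\<^sup>2 * r\<^sup>2
      in (((a * z + b) * cnj (c * z + d) + a * cnj c * of_real (r\<^sup>2)) / of_real N, r / N))"

text \<open>\<open>mat_act A = mat_act (- A)\<close>, so the choice of the representative is immaterial.\<close>

definition psl_act :: "(complex^2^2) set \<Rightarrow> complex \<times> real \<Rightarrow> complex \<times> real" where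
  "psl_act g P = mat_act (SOME A. A \<in> g) P"


section \<open>Cusps and scaling matrices\<close>

text \<open>The point \<open>[v1 : v2]\<close> of the projective line is the set of nonzero multiples of \<open>v\<close>.\<close>

definition proj_point :: "complex^2 \<Rightarrow> (complex^2) set" where
  "proj_point v = {c *s v | c. c \<noteq> 0}"

definition proj_line :: "complex set \<Rightarrow> (complex^2) set set" where
  "proj_line K = {proj_point v | v. v \<noteq> 0 \<and> (\<forall>i. v $ i \<in> K)}"

definition proj_act :: "(complex^2^2) set \<Rightarrow> (complex^2) set \<Rightarrow> (complex^2) set" where
  "proj_act g p = {A *v v | A v. A \<in> g \<and> v \<in> p}"

abbreviation cusp_inf :: "complex^2" where
  "cusp_inf \<equiv> vector [1, 0]"

text \<open>A cusp \<open>[a : b]\<close> is given by its chosen integral coordinate vector \<open>(a, b)\<close>, since the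
  lattice and the scaling matrix depend on these coordinates.\<close>

definition cusp_representatives :: "complex set \<Rightarrow> (complex^2) set \<Rightarrow> bool" where
  "cusp_representatives K C \<longleftrightarrow>
     (\<forall>\<kappa>\<in>C. \<kappa> \<noteq> 0 \<and> (\<forall>i. \<kappa> $ i \<in> ring_of_integers K)) \<and>
     cusp_inf \<in> C \<and>
     (\<forall>p\<in>proj_line K. \<exists>!\<kappa>. \<kappa> \<in> C \<and> p \<in> orbit (Bianchi K) proj_act (proj_point \<kappa>))"

definition cusp_stabilizer :: "complex set \<Rightarrow> complex^2 \<Rightarrow> (complex^2^2) set set" where
  "cusp_stabilizer K \<kappa> = stabilizer (Bianchi K) proj_act (proj_point \<kappa>)"

text \<open>An element of PSL2 is parabolic if it is nontrivial and has trace \<open>\<plusminus>2\<close>; as \<open>g = {A, - A}\<close>,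
  one of the two matrices then has trace 2.\<close>

definition parabolic :: "(complex^2^2) set \<Rightarrow> bool" where
  "parabolic g \<longleftrightarrow> g \<noteq> \<one>\<^bsub>PSL2 UNIV\<^esub> \<and> (\<exists>A\<in>g. trace A = 2)"

definition cusp_unipotent :: "complex set \<Rightarrow> complex^2 \<Rightarrow> (complex^2^2) set set" where
  "cusp_unipotent K \<kappa> = {g \<in> cusp_stabilizer K \<kappa>. parabolic g \<or> g = \<one>\<^bsub>PSL2 UNIV\<^esub>}"

definition cusp_lattice :: "complex set \<Rightarrow> complex^2 \<Rightarrow> complex set" where
  "cusp_lattice K \<kappa> =
     (let I = ideal_gen2 (ring_of_integers K) (\<kappa> $ 1) (\<kappa> $ 2)
      in ideal_inverse K (ideal_mult I I))"

definition scaling_matrix :: "complex set \<Rightarrow> complex^2 \<Rightarrow> (complex^2^2) set \<Rightarrow> bool" where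
  "scaling_matrix K \<kappa> \<sigma> \<longleftrightarrow>
     \<sigma> \<in> carrier (PSL2 K) \<and>
     (\<exists>A\<in>\<sigma>. column 1 A = \<kappa>) \<and>
     proj_act \<sigma> (proj_point cusp_inf) = proj_point \<kappa> \<and>
     {inv\<^bsub>PSL2 K\<^esub> \<sigma> \<otimes>\<^bsub>PSL2 K\<^esub> g \<otimes>\<^bsub>PSL2 K\<^esub> \<sigma> | g. g \<in> cusp_stabilizer K \<kappa>} =
       {psl_class u l 0 (inverse u) | u l.
          u \<noteq> 0 \<and> u \<in> ring_of_integers K \<and> inverse u \<in> ring_of_integers K \<and>
          l \<in> cusp_lattice K \<kappa>} \<and>
     {inv\<^bsub>PSL2 K\<^esub> \<sigma> \<otimes>\<^bsub>PSL2 K\<^esub> g \<otimes>\<^bsub>PSL2 K\<^esub> \<sigma> | g. g \<in> cusp_unipotent K \<kappa>} =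
       {psl_class 1 l 0 1 | l. l \<in> cusp_lattice K \<kappa>}"


section \<open>Modified Bessel functions\<close>

text \<open>Both functions are only used for complex order and positive real argument.
  The integral representation of the second kind function (DLMF 10.32.9) holds for all complex
  orders, in particular without an exception at the integers.\<close>

definition bessel_I :: "complex \<Rightarrow> real \<Rightarrow> complex" where
  "bessel_I s x =
     (\<Sum>k. of_real (x / 2) powr (s + 2 * of_nat k) * rGamma (s + of_nat k + 1) / fact k)"

definition bessel_K :: "complex \<Rightarrow> real \<Rightarrow> complex" where
  "bessel_K s x =
     (LINT t:{0..}|lborel. of_real (exp (- x * cosh t)) * cosh (s * of_real t))"


section \<open>Eisenstein, Niebur--Poincare and Green series\<close>

text \<open>The translates \<open>\<sigma>\<inverse> \<gamma> P\<close>, with \<open>\<gamma>\<close> a representative of a coset \<open>c\<close> in \<open>\<Gamma>'\<^sub>\<kappa>\<setminus>\<Gamma>\<close>. Another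
  representative changes the point by a translation by an element of the lattice of the cusp,
  which affects neither of the two summands below.\<close>

definition coset_translate ::
  "complex set \<Rightarrow> (complex^2^2) set \<Rightarrow> (complex^2^2) set set \<Rightarrow> complex \<times> real \<Rightarrow> complex \<times> real" where
  "coset_translate K \<sigma> c P = psl_act (inv\<^bsub>PSL2 K\<^esub> \<sigma>) (psl_act (SOME g. g \<in> c) P)"

definition eisenstein ::
  "complex set \<Rightarrow> complex^2 \<Rightarrow> (complex^2^2) set \<Rightarrow> complex \<times> real \<Rightarrow> complex \<Rightarrow> complex" where
  "eisenstein K \<kappa> \<sigma> P s =
     (\<Sum>\<^sub>\<infinity>c\<in>rcosets\<^bsub>Bianchi K\<^esub> (cusp_unipotent K \<kappa>).
        of_real (snd (coset_translate K \<sigma> c P)) powr (s + 1))"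

definition niebur_poincare ::
  "complex set \<Rightarrow> complex^2 \<Rightarrow> (complex^2^2) set \<Rightarrow> complex \<Rightarrow> complex \<times> real \<Rightarrow> complex \<Rightarrow> complex"
where
  "niebur_poincare K \<kappa> \<sigma> \<nu> P s =
     (\<Sum>\<^sub>\<infinity>c\<in>rcosets\<^bsub>Bianchi K\<^esub> (cusp_unipotent K \<kappa>).
        let (z, r) = coset_translate K \<sigma> c P in
        of_real r * bessel_I s (4 * pi * cmod \<nu> * r) *
        exp (2 * of_real pi * \<i> * complex_tr (\<nu> * z)))"

definition green_phi :: "complex \<Rightarrow> real \<Rightarrow> complex" where
  "green_phi s t =
     of_real (t + sqrt (t\<^sup>2 - 1)) powr (- s) * of_real ((t\<^sup>2 - 1) powr (- 1 / 2))"

definition green :: "complex set \<Rightarrow> complex \<Rightarrow> complex \<times> real \<Rightarrow> complex \<times> real \<Rightarrow> complex" where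
  "green K s P Q =
     1 / (2 * of_real pi) *
     (\<Sum>\<^sub>\<infinity>g\<in>carrier (Bianchi K). green_phi s (cosh (hyp_dist P (psl_act g Q))))"

end

theory Submission
  imports Defs "HOL-Complex_Analysis.Complex_Analysis" "HOL-Probability.Probability" "HOL-Real_Asymp.Real_Asymp"
begin

text \<open>Isometries preserve the distance, so \<open>G\<^sub>s(\<sigma> P, Q)\<close> is the sum of \<open>\<phi>\<^sub>s (cosh d(P, \<sigma>\<inverse> \<gamma> Q))\<close> over \<open>\<Gamma>\<close>,
  up to the factor \<open>1 / (2 \<pi>)\<close>. The scaling matrix conjugates the unipotent group \<open>\<Gamma>'\<close> of the cusp to
  the translations by the lattice \<open>\<Lambda>\<close>. Hence the sum over one coset \<open>\<Gamma>' \<gamma>\<close> is a sum over the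
  \<open>\<Lambda>\<close>-translates of the single point \<open>\<sigma>\<inverse> \<gamma> Q = w + r' j\<close> (\<open>coset_lattice_bij\<close>,
  \<open>cosh_hyp_dist_coset\<close>), and Poisson summation in the variable \<open>x = z - w\<close> turns it into a sum over the
  dual lattice (\<open>green_phi_Poisson\<close>). The frequency \<open>0\<close> contributes a multiple of \<open>r' powr (s + 1)\<close>, the
  summand of the Eisenstein series. The frequency \<open>\<mu> \<noteq> 0\<close> contributes
  \<open>4 \<pi> r r' I\<^sub>s(4 \<pi> \<bar>\<mu>\<bar> r') K\<^sub>s(4 \<pi> \<bar>\<mu>\<bar> r)\<close> times a character of \<open>z - w\<close>, and the factors that depend on
  \<open>w\<close> and \<open>r'\<close> form the summand of the Niebur--Poincare series. Exchanging the sums over the cosets and the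
  frequencies gives the formula.

  The Fourier transform of \<open>x \<mapsto> \<phi>\<^sub>s ((\<bar>x\<bar>\<^sup>2 + r\<^sup>2 + r'\<^sup>2) / (2 r r'))\<close> is found in three steps. The Laplace
  transform of \<open>I\<^sub>s\<close> is \<open>\<phi>\<^sub>s\<close> (\<open>bessel_Laplace\<close>), so the function is a superposition of Gaussians in \<open>x\<close>. The
  Gaussians are transformed under the integral sign (\<open>green_phi_Fourier_Gaussian\<close>). The remaining integral is
  the classical integral for a product \<open>I\<^sub>s(x) K\<^sub>s(X)\<close> with \<open>x < X\<close> (\<open>bessel_product_formula\<close>). Here power
  series do the work: the closed form of the Laplace transform obeys differential equations that determine its
  coefficients, and the product integral, in which \<open>x\<^sup>2\<close> is replaced by a complex variable, is holomorphic
  with coefficients that collapse because of the recurrence for \<open>K\<^sub>s\<close>. All integrals over a half-line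
  \<open>v > 0\<close> are written in the variable \<open>v = exp u\<close>, so that scaling and inversion become translation and
  reflection of the whole line.

  Every exchange of sums rests on absolute convergence. A coset is determined by the bottom row of
  \<open>\<sigma>\<inverse> \<gamma>\<close>, which is a pair of algebraic integers, and these pairs form a lattice of rank four; therefore the
  sum of \<open>r' powr p\<close> over the cosets converges for \<open>p > 2\<close> (\<open>Eisenstein_summable\<close>). In particular the heights
  \<open>r'\<close> accumulate only at \<open>0\<close>, and being smaller than \<open>r\<close> they are at most some \<open>\<rho> < r\<close>. This gap makes the
  lattice sums \<open>O(r' powr (1 + Re s))\<close> uniformly in the cosets (\<open>green_phi_lattice_sum_bound\<close>) and the
  frequencies decay like \<open>exp (- 4 \<pi> \<bar>\<mu>\<bar> (r - \<rho>))\<close> (\<open>bessel_IK_bound\<close>).\<close>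

text \<open>From here on, the dollar sign selects the components of vectors.\<close>

no_notation fps_nth (infixl \<open>$\<close> 75)

section \<open>The ring of integers of an imaginary quadratic field\<close>

definition quadratic_order :: "complex \<Rightarrow> complex set" where
  "quadratic_order w = {of_int m + of_int n * w | m n. True}"

text \<open>Almost integral elements: the powers have a common denominator. Unlike the existence of a monic
  equation, this property is visibly stable under sums and products.\<close>

definition bounded_powers :: "complex \<Rightarrow> complex \<Rightarrow> bool" where
  "bounded_powers w a \<longleftrightarrow> (\<exists>d::int. d \<noteq> 0 \<and> (\<forall>k. of_int d * a ^ k \<in> quadratic_order w))"

lemma quadratic_order_of_int [simp, intro]: "of_int m \<in> quadratic_order w"
  unfolding quadratic_order_def by (rule CollectI, rule exI[of _ m], rule exI[of _ 0]) simp

lemma quadratic_order_add: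
  "a \<in> quadratic_order w \<Longrightarrow> b \<in> quadratic_order w \<Longrightarrow> a + b \<in> quadratic_order w"
proof -
  assume "a \<in> quadratic_order w" "b \<in> quadratic_order w"
  then obtain m n m' n' where "a = of_int m + of_int n * w" "b = of_int m' + of_int n' * w"
    unfolding quadratic_order_def by blast
  then have "a + b = of_int (m + m') + of_int (n + n') * w" by (simp add: algebra_simps)
  then show ?thesis unfolding quadratic_order_def by blast
qed

lemma quadratic_order_sum:
  "(\<And>i. i \<in> A \<Longrightarrow> f i \<in> quadratic_order w) \<Longrightarrow> sum f A \<in> quadratic_order w"
  using quadratic_order_of_int[of 0 w]
  by (induction A rule: infinite_finite_induct) (auto intro: quadratic_order_add)

lemma quadratic_order_mult:
  assumes w: "w * w = of_int D" and "a \<in> quadratic_order w" "b \<in> quadratic_order w"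
  shows "a * b \<in> quadratic_order w"
proof -
  obtain m n m' n' where ab: "a = of_int m + of_int n * w" "b = of_int m' + of_int n' * w"
    using assms unfolding quadratic_order_def by blast
  have "a * b = of_int m * of_int m' + of_int n * of_int n' * (w * w)
                  + (of_int m * of_int n' + of_int n * of_int m') * w"
    unfolding ab by (simp add: algebra_simps)
  also have "\<dots> = of_int (m * m' + n * n' * D) + of_int (m * n' + n * m') * w"
    unfolding w by simp
  finally show ?thesis unfolding quadratic_order_def by blast
qed

lemma quadratic_order_of_nat [simp, intro]: "of_nat m \<in> quadratic_order w"
  using quadratic_order_of_int[of "int m"] by simp

text \<open>In the binomial expansion, the product of the two common denominators clears every summand.\<close>

lemma bounded_powers_add:
  assumes w: "w * w = of_int D" and "bounded_powers w a" "bounded_powers w b"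
  shows "bounded_powers w (a + b)"
proof -
  obtain d e where d: "d \<noteq> 0" "\<And>k. of_int d * a ^ k \<in> quadratic_order w"
    and e: "e \<noteq> 0" "\<And>k. of_int e * b ^ k \<in> quadratic_order w"
    using assms(2,3) unfolding bounded_powers_def by blast
  have "of_int (d * e) * (a + b) ^ k \<in> quadratic_order w" for k
  proof -
    have "of_int (d * e) * (a + b) ^ k =
        (\<Sum>i\<le>k. of_nat (k choose i) * ((of_int d * a ^ i) * (of_int e * b ^ (k - i))))"
      unfolding binomial_ring sum_distrib_left by (intro sum.cong) (auto simp: algebra_simps)
    also have "\<dots> \<in> quadratic_order w"
      by (intro quadratic_order_sum quadratic_order_mult[OF w] d(2) e(2) quadratic_order_of_nat)
    finally show ?thesis .
  qed
  then show ?thesis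
    unfolding bounded_powers_def using d(1) e(1) by (intro exI[of _ "d * e"]) auto
qed

lemma bounded_powers_mult:
  assumes w: "w * w = of_int D" and "bounded_powers w a" "bounded_powers w b"
  shows "bounded_powers w (a * b)"
proof -
  obtain d e where d: "d \<noteq> 0" "\<And>k. of_int d * a ^ k \<in> quadratic_order w"
    and e: "e \<noteq> 0" "\<And>k. of_int e * b ^ k \<in> quadratic_order w"
    using assms(2,3) unfolding bounded_powers_def by blast
  have "of_int (d * e) * (a * b) ^ k \<in> quadratic_order w" for k
    using quadratic_order_mult[OF w d(2)[of k] e(2)[of k]] by (simp add: power_mult_distrib mult_ac)
  then show ?thesis
    unfolding bounded_powers_def using d(1) e(1) by (intro exI[of _ "d * e"]) auto
qed

text \<open>If the reduced denominator \<open>b\<close> of \<open>q\<close> were not 1, the unbounded powers of \<open>b\<close> would all divide \<open>d\<close>.\<close>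

lemma rational_bounded_denominators_imp_int:
  fixes q :: complex
  assumes "q \<in> \<rat>" "d \<noteq> 0" and pow: "\<And>k. of_int d * q ^ k \<in> \<int>"
  shows "q \<in> \<int>"
proof -
  obtain a b :: int where b: "b > 0" "coprime a b" and q: "q = of_int a / of_int b"
    using assms(1) by (elim Rats_cases')
  have dvd: "b ^ k dvd d" for k
  proof -
    obtain m where "of_int d * q ^ k = of_int m" using pow[of k] Ints_cases by blast
    then have "(of_int (d * a ^ k) :: complex) = of_int (m * b ^ k)"
      unfolding q using b(1) by (simp add: field_simps)
    then have "d * a ^ k = m * b ^ k" unfolding of_int_eq_iff .
    then have "b ^ k dvd d * a ^ k" by simp
    moreover have "coprime (b ^ k) (a ^ k)" using b(2) by (simp add: coprime_commute)
    ultimately show ?thesis by (simp add: coprime_dvd_mult_left_iff)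
  qed
  have "b = 1"
  proof (rule ccontr)
    assume "b \<noteq> 1"
    then have "b \<ge> 2" using b(1) by simp
    then have "(2::int) ^ nat \<bar>d\<bar> \<le> b ^ nat \<bar>d\<bar>" by (intro power_mono) auto
    also have "\<dots> \<le> \<bar>d\<bar>" using dvd[of "nat \<bar>d\<bar>"] assms(2) by (meson abs_dvd_iff dvd_abs_iff zdvd_imp_le zero_less_abs_iff)
    finally have "int (2 ^ nat \<bar>d\<bar>) \<le> int (nat \<bar>d\<bar>)" by simp
    then show False using less_exp[of "nat \<bar>d\<bar>"] by linarith
  qed
  then show ?thesis using q by simp
qed

lemma quadratic_field_common_denominator:
  assumes "x \<in> \<rat>" "y \<in> \<rat>"
  shows "\<exists>d::int. d \<noteq> 0 \<and> of_int d * (x + y * w) \<in> quadratic_order w"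
proof -
  obtain a b c e :: int where "b > 0" "e > 0" and xy: "x = of_int a / of_int b" "y = of_int c / of_int e"
    using assms by (elim Rats_cases')
  then have "of_int (b * e) * (x + y * w) = of_int (a * e) + of_int (b * c) * w"
    by (simp add: field_simps)
  then have "of_int (b * e) * (x + y * w) \<in> quadratic_order w"
    unfolding quadratic_order_def by blast
  then show ?thesis using \<open>b > 0\<close> \<open>e > 0\<close> by (intro exI[of _ "b * e"]) auto
qed

lemma cnj_rational: "q \<in> \<rat> \<Longrightarrow> cnj q = q"
  by (elim Rats_cases') simp

locale imag_quadratic =
  fixes D :: int and w :: complex and K :: "complex set"
  assumes D_neg: "D < 0" and w_def: "w = csqrt (of_int D)"
    and K_def: "K = {x + y * w | x y. x \<in> \<rat> \<and> y \<in> \<rat>}"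
begin

lemma ww: "w * w = of_int D"
  unfolding w_def using power2_csqrt by (metis power2_eq_square)

lemma w_eq: "w = \<i> * of_real (sqrt (- of_int D))"
  unfolding w_def using D_neg csqrt_of_real_nonpos[of "of_int D"] by simp

lemma cnj_w [simp]: "cnj w = - w" unfolding w_eq by simp

lemma Im_w: "Im w = sqrt (- of_int D)" "Re w = 0" "Im w > 0" 
  unfolding w_eq using D_neg by auto

lemma K_I: "x \<in> \<rat> \<Longrightarrow> y \<in> \<rat> \<Longrightarrow> x + y * w \<in> K" unfolding K_def by blast

lemma K_E:
  assumes "a \<in> K" obtains x y where "a = x + y * w" "x \<in> \<rat>" "y \<in> \<rat>"
  using assms unfolding K_def by blast

lemma Rats_K: "x \<in> \<rat> \<Longrightarrow> x \<in> K" using K_I[of x 0] by simp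

lemma K_add: "a \<in> K \<Longrightarrow> b \<in> K \<Longrightarrow> a + b \<in> K"
proof (elim K_E)
  fix x y x' y' assume "a = x + y * w" "b = x' + y' * w" "x \<in> \<rat>" "y \<in> \<rat>" "x' \<in> \<rat>" "y' \<in> \<rat>"
  then show ?thesis using K_I[of "x + x'" "y + y'"] by (simp add: algebra_simps)
qed

lemma K_mult: "a \<in> K \<Longrightarrow> b \<in> K \<Longrightarrow> a * b \<in> K"
proof (elim K_E)
  fix x y x' y' assume *: "a = x + y * w" "b = x' + y' * w" "x \<in> \<rat>" "y \<in> \<rat>" "x' \<in> \<rat>" "y' \<in> \<rat>"
  have "a * b = x * x' + y * y' * (w * w) + (x * y' + y * x') * w" unfolding * by (simp add: algebra_simps)
  then show ?thesis using K_I[of "x * x' + y * y' * of_int D" "x * y' + y * x'"] * unfolding ww by simp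
qed

lemma K_minus: "a \<in> K \<Longrightarrow> - a \<in> K" 
  using K_mult[of "-1" a] Rats_K[of "-1"] by simp

lemma K_power: "a \<in> K \<Longrightarrow> a ^ n \<in> K"
  using Rats_K[of 1] by (induction n) (auto intro: K_mult)

text \<open>The monic equation expresses \<open>a ^ n\<close>, and by induction every higher power, through
  \<open>1, a, \<dots>, a ^ (n - 1)\<close> with integer coefficients, so a common denominator of these serves for all powers.\<close>

lemma bounded_powers_if_algebraic_int:
  assumes "a \<in> K" "algebraic_int a" shows "bounded_powers w a"
proof -
  obtain p where p: "poly (map_poly of_int p) a = 0" "lead_coeff p = 1"
    using assms(2) unfolding algebraic_int_altdef_ipoly by blast
  define n where "n = degree p"
  have an: "a ^ n = - (\<Sum>i<n. of_int (coeff p i) * a ^ i)"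
  proof -
    have "0 = (\<Sum>i\<le>n. of_int (coeff p i) * a ^ i)"
      using p(1) unfolding poly_altdef n_def by (simp add: coeff_map_poly degree_map_poly)
    also have "\<dots> = (\<Sum>i<n. of_int (coeff p i) * a ^ i) + a ^ n"
      using p(2) by (simp add: n_def flip: lessThan_Suc_atMost)
    finally show ?thesis by (simp add: eq_neg_iff_add_eq_0 add.commute)
  qed
  have "\<exists>d::int. d \<noteq> 0 \<and> of_int d * a ^ i \<in> quadratic_order w" for i
    using K_power[OF assms(1), of i] quadratic_field_common_denominator by (elim K_E) metis
  then obtain d where d: "\<And>i::nat. d i \<noteq> 0 \<and> of_int (d i) * a ^ i \<in> quadratic_order w" by metis
  define e where "e = (\<Prod>i<n. d i)"
  have base: "of_int e * a ^ i \<in> quadratic_order w" if "i < n" for i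
  proof -
    have "e = d i * (\<Prod>j\<in>{..<n}-{i}. d j)" unfolding e_def using that by (subst prod.remove[of _ i]) auto
    then have "of_int e * a ^ i = of_int (\<Prod>j\<in>{..<n}-{i}. d j) * (of_int (d i) * a ^ i)"
      by (simp add: mult_ac)
    then show ?thesis using d[of i] quadratic_order_mult[OF ww] quadratic_order_of_int by metis
  qed
  have "of_int e * a ^ k \<in> quadratic_order w" for k
  proof (induction k rule: less_induct)
    case (less k)
    show ?case
    proof (cases "k < n")
      case False
      then have "a ^ k = a ^ (k - n) * a ^ n" by (simp flip: power_add)
      then have "of_int e * a ^ k = (\<Sum>i<n. of_int (- coeff p i) * (of_int e * a ^ (k - n + i)))"
        unfolding an by (simp add: sum_distrib_left sum_negf power_add mult_ac)
      also have "\<dots> \<in> quadratic_order w"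
        using False by (intro quadratic_order_sum quadratic_order_mult[OF ww] quadratic_order_of_int less) auto
      finally show ?thesis .
    qed (rule base)
  qed
  moreover have "e \<noteq> 0" unfolding e_def using d by auto
  ultimately show ?thesis unfolding bounded_powers_def by blast
qed

lemma bounded_powers_cnj: "bounded_powers w a \<Longrightarrow> bounded_powers w (cnj a)"
proof -
  have "cnj x \<in> quadratic_order w" if x: "x \<in> quadratic_order w" for x
  proof -
    obtain m n where "x = of_int m + of_int n * w" using x unfolding quadratic_order_def by blast
    then have "cnj x = of_int m + of_int (- n) * w" by simp
    then show ?thesis unfolding quadratic_order_def by blast
  qed
  then show "bounded_powers w a \<Longrightarrow> bounded_powers w (cnj a)"
    unfolding bounded_powers_def by (metis complex_cnj_mult complex_cnj_power complex_cnj_of_int)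
qed

text \<open>A rational number is real, so its multiples in the order have no component along \<open>w\<close>.\<close>

lemma rational_bounded_powers_imp_int:
  assumes "q \<in> \<rat>" "bounded_powers w q" shows "q \<in> \<int>"
proof -
  obtain d where d: "d \<noteq> 0" "\<And>k. of_int d * q ^ k \<in> quadratic_order w"
    using assms(2) unfolding bounded_powers_def by blast
  have "of_int d * q ^ k \<in> \<int>" for k
  proof -
    obtain m n where mn: "of_int d * q ^ k = of_int m + of_int n * w"
      using d(2) unfolding quadratic_order_def by blast
    have "cnj (of_int d * q ^ k) = of_int d * q ^ k" using cnj_rational[OF assms(1)] by simp
    then have "Im (of_int d * q ^ k) = 0" by (metis Reals_cnj_iff complex_is_Real_iff)
    then have "n = 0" unfolding mn using Im_w by simp
    then show ?thesis using mn by simp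
  qed
  then show ?thesis using rational_bounded_denominators_imp_int[OF assms(1) d(1)] by blast
qed

lemma K_trace_norm_rational:
  assumes "a \<in> K" shows "a + cnj a \<in> \<rat>" "a * cnj a \<in> \<rat>"
proof -
  obtain x y where a: "a = x + y * w" "x \<in> \<rat>" "y \<in> \<rat>" using assms by (rule K_E)
  then have c: "cnj x = x" "cnj y = y" using cnj_rational by blast+
  show "a + cnj a \<in> \<rat>" using a c by simp
  have "a * cnj a = x * x - y * y * (w * w)" using a c by (simp add: algebra_simps)
  then show "a * cnj a \<in> \<rat>" using a unfolding ww by simp
qed

text \<open>If the powers of \<open>a\<close> have bounded denominators, so have those of its conjugate, its trace and its norm.
  The last two are rational, hence integers, and \<open>a\<close> is a root of a monic quadratic polynomial. The
  characterization shows that the integers form a ring.\<close>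

lemma ring_of_integers_iff: "a \<in> ring_of_integers K \<longleftrightarrow> a \<in> K \<and> bounded_powers w a"
proof
  assume a: "a \<in> K \<and> bounded_powers w a"
  have "a + cnj a \<in> \<int>" "a * cnj a \<in> \<int>"
    using a K_trace_norm_rational bounded_powers_cnj bounded_powers_add[OF ww] bounded_powers_mult[OF ww]
      rational_bounded_powers_imp_int by metis+
  then obtain t n :: int where tn: "a + cnj a = of_int t" "a * cnj a = of_int n"
    by (metis Ints_cases)
  have "poly (map_poly of_int [:n, - t, 1:]) a = of_int n - a * of_int t + a * a"
    by (simp add: algebra_simps map_poly_pCons)
  also have "\<dots> = 0" unfolding tn[symmetric] by (simp add: algebra_simps)
  finally have "algebraic_int a"
    unfolding algebraic_int_altdef_ipoly by (intro exI[of _ "[:n, - t, 1:]"]) simp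
  with a show "a \<in> ring_of_integers K" unfolding ring_of_integers_def by simp
qed (auto simp: ring_of_integers_def intro: bounded_powers_if_algebraic_int)

lemma integers_add: "a \<in> ring_of_integers K \<Longrightarrow> b \<in> ring_of_integers K \<Longrightarrow> a + b \<in> ring_of_integers K"
  unfolding ring_of_integers_iff using K_add bounded_powers_add[OF ww] by blast

lemma integers_mult: "a \<in> ring_of_integers K \<Longrightarrow> b \<in> ring_of_integers K \<Longrightarrow> a * b \<in> ring_of_integers K"
  unfolding ring_of_integers_iff using K_mult bounded_powers_mult[OF ww] by blast

lemma integers_minus: "a \<in> ring_of_integers K \<Longrightarrow> - a \<in> ring_of_integers K"
  unfolding ring_of_integers_def using K_minus by auto

lemma integers_of_int [simp, intro]: "of_int n \<in> ring_of_integers K"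
  unfolding ring_of_integers_def using Rats_K by (auto intro: int_imp_algebraic_int)

lemma integers_0_1 [simp, intro]: "0 \<in> ring_of_integers K" "1 \<in> ring_of_integers K"
  using integers_of_int[of 0] integers_of_int[of 1] by simp_all

lemma integers_w: "w \<in> ring_of_integers K"
proof -
  have "w \<in> K" using K_I[of 0 1] by simp
  moreover have "algebraic_int w" unfolding w_def by (intro algebraic_int_csqrt int_imp_algebraic_int) auto
  ultimately show ?thesis unfolding ring_of_integers_def by simp
qed

lemma integers_diff: "a \<in> ring_of_integers K \<Longrightarrow> b \<in> ring_of_integers K \<Longrightarrow> a - b \<in> ring_of_integers K"
  using integers_add[of a "- b"] integers_minus[of b] by simp

text \<open>The coordinates of an integer \<open>a\<close> are \<open>tr a / 2\<close> and \<open>tr (a w) / (2 D)\<close>, whose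
  denominators divide \<open>2 D\<close>.\<close>

lemma integers_in_lattice:
  assumes "a \<in> ring_of_integers K"
  shows "\<exists>m n. a = (of_int m + of_int n * w) / of_int (2 * D)"
proof -
  have int: "b + cnj b \<in> \<int>" if "b \<in> ring_of_integers K" for b
    using that K_trace_norm_rational bounded_powers_cnj bounded_powers_add[OF ww]
      rational_bounded_powers_imp_int unfolding ring_of_integers_iff by metis
  obtain t u :: int where tu: "a + cnj a = of_int t" "a * w + cnj (a * w) = of_int u"
    using int[OF assms] int[OF integers_mult[OF assms integers_w]] by (metis Ints_cases)
  have "of_int (2 * D) * a = of_int D * (a + cnj a) + (a * w + cnj (a * w)) * w"
    by (simp add: algebra_simps flip: ww)
  also have "\<dots> = of_int (D * t) + of_int u * w" unfolding tu by simp
  finally show ?thesis using D_neg by (intro exI[of _ "D * t"] exI[of _ u]) (auto simp: field_simps)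
qed

end

lemma imaginary_quadratic_field_imp_imag_quadratic:
  "imaginary_quadratic_field K \<Longrightarrow> \<exists>D w. imag_quadratic D w K"
  unfolding imaginary_quadratic_field_def imag_quadratic_def by auto

section \<open>Integrating unordered sums term by term\<close>

lemma infsum_eq_suminf_reindex:
  fixes f :: "'a \<Rightarrow> 'b :: banach"
  assumes e: "bij_betw e (UNIV :: nat set) A" and f: "(\<lambda>a. norm (f a)) summable_on A"
  shows "summable (\<lambda>n. norm (f (e n)))" "infsum f A = (\<Sum>n. f (e n))"
proof -
  have "(\<lambda>n. norm (f (e n))) summable_on UNIV"
    using summable_on_reindex_bij_betw[OF e, of "\<lambda>a. norm (f a)"] f by simp
  then show s: "summable (\<lambda>n. norm (f (e n)))"
    using summable_on_imp_summable by blast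
  then have "((\<lambda>n. f (e n)) has_sum (\<Sum>n. f (e n))) UNIV"
    by (intro norm_summable_imp_has_sum) (auto intro: summable_sums summable_norm_cancel)
  then show "infsum f A = (\<Sum>n. f (e n))"
    using infsum_reindex_bij_betw[OF e, of f] infsumI by metis
qed

text \<open>An enumeration of the index set reduces the exchange to series.\<close>

lemma integral_infsum:
  fixes f :: "'a \<Rightarrow> 'b \<Rightarrow> complex"
  assumes A: "countable A" and int: "\<And>a. a \<in> A \<Longrightarrow> integrable M (f a)"
    and sum: "(\<lambda>a. LINT x|M. norm (f a x)) summable_on A"
    and pt: "\<And>x. x \<in> space M \<Longrightarrow> (\<lambda>a. norm (f a x)) summable_on A"
  shows "(LINT x|M. (\<Sum>\<^sub>\<infinity>a\<in>A. f a x)) = (\<Sum>\<^sub>\<infinity>a\<in>A. integral\<^sup>L M (f a))"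
    and "(\<lambda>a. norm (integral\<^sup>L M (f a))) summable_on A"
proof -
  show s2: "(\<lambda>a. norm (integral\<^sup>L M (f a))) summable_on A"
    by (rule summable_on_comparison_test[OF sum]) auto
  show "(LINT x|M. (\<Sum>\<^sub>\<infinity>a\<in>A. f a x)) = (\<Sum>\<^sub>\<infinity>a\<in>A. integral\<^sup>L M (f a))"
  proof (cases "finite A")
    case True
    then show ?thesis using int by simp
  next
    case False
    define e where "e = from_nat_into A"
    have e: "bij_betw e UNIV A" unfolding e_def using bij_betw_from_nat_into[OF A False] .
    then have eA: "e n \<in> A" for n by (auto simp: bij_betw_def)
    have "(LINT x|M. (\<Sum>\<^sub>\<infinity>a\<in>A. f a x)) = (LINT x|M. (\<Sum>n. f (e n) x))"
      using infsum_eq_suminf_reindex(2)[OF e pt] by (intro Bochner_Integration.integral_cong) auto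
    also have "\<dots> = (\<Sum>n. integral\<^sup>L M (f (e n)))"
    proof (rule integral_suminf)
      show "AE x in M. summable (\<lambda>i. norm (f (e i) x))"
        by (rule AE_I2) (rule infsum_eq_suminf_reindex(1)[OF e pt])
      show "summable (\<lambda>i. LINT x|M. norm (f (e i) x))"
        using infsum_eq_suminf_reindex(1)[OF e, of "\<lambda>a. LINT x|M. norm (f a x)"] sum by simp
    qed (use int eA in auto)
    also have "\<dots> = (\<Sum>\<^sub>\<infinity>a\<in>A. integral\<^sup>L M (f a))"
      using infsum_eq_suminf_reindex(2)[OF e s2] by simp
    finally show ?thesis .
  qed
qed

lemma lborel_integral_translate:
  fixes f :: "'a::euclidean_space \<Rightarrow> 'b::{banach, second_countable_topology}"
  assumes [measurable]: "f \<in> borel_measurable borel"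
  shows "(LINT x|lborel. f (x + c)) = (LINT x|lborel. f x)"
  by (subst (2) lborel_distr_plus[of c, symmetric]) (simp add: integral_distr add.commute)

lemma lborel_integrable_translate:
  fixes f :: "'a::euclidean_space \<Rightarrow> 'b::{banach, second_countable_topology}"
  assumes "integrable lborel f"
  shows "integrable lborel (\<lambda>x. f (x + c))"
proof -
  have [measurable]: "f \<in> borel_measurable borel" using assms by auto
  have "integrable (distr lborel borel ((+) c)) f" using assms by (simp add: lborel_distr_plus)
  then have "integrable lborel (\<lambda>x. f (c + x))" by (subst (asm) integrable_distr_eq) auto
  then show ?thesis by (simp add: add.commute)
qed

section \<open>Lattices in the complex plane\<close>

definition lattice_char :: "complex \<Rightarrow> complex \<Rightarrow> complex" where
  "lattice_char \<mu> x = exp (2 * of_real pi * \<i> * complex_tr (\<mu> * x))"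

lemma complex_tr_eq: "complex_tr z = of_real (2 * Re z)"
  unfolding complex_tr_def by (simp add: complex_eq_iff)

lemma lattice_char_altdef: "lattice_char \<mu> x = exp (\<i> * of_real (4 * pi * Re (\<mu> * x)))"
  unfolding lattice_char_def complex_tr_eq by (simp add: algebra_simps)

lemma norm_lattice_char [simp]: "norm (lattice_char \<mu> x) = 1"
  unfolding lattice_char_altdef by (rule norm_exp_i_times)

lemma lattice_char_add_right: "lattice_char \<mu> (x + y) = lattice_char \<mu> x * lattice_char \<mu> y"
  unfolding lattice_char_altdef exp_add[symmetric] by (simp add: algebra_simps)

lemma lattice_char_add_left: "lattice_char (\<mu> + \<nu>) x = lattice_char \<mu> x * lattice_char \<nu> x"
  unfolding lattice_char_altdef exp_add[symmetric] by (simp add: algebra_simps)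

lemma lattice_char_0 [simp]: "lattice_char 0 x = 1" "lattice_char \<mu> 0 = 1"
  unfolding lattice_char_altdef by simp_all

lemma cnj_lattice_char: "cnj (lattice_char \<mu> x) = lattice_char (- \<mu>) x"
proof -
  have "cnj (lattice_char \<mu> x) = exp (cnj (\<i> * of_real (4 * pi * Re (\<mu> * x))))"
    unfolding lattice_char_altdef by (simp only: exp_cnj)
  also have "cnj (\<i> * of_real a) = \<i> * of_real (- a)" for a by simp
  also have "- (4 * pi * Re (\<mu> * x)) = 4 * pi * Re (- \<mu> * x)" by (simp add: algebra_simps)
  finally show ?thesis unfolding lattice_char_altdef .
qed

lemma continuous_on_lattice_char [continuous_intros]:
  "continuous_on A f \<Longrightarrow> continuous_on A (\<lambda>x. lattice_char \<mu> (f x))"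
  unfolding lattice_char_altdef by (intro continuous_intros)

lemma measurable_lattice_char [measurable]: "lattice_char \<mu> \<in> borel_measurable borel"
  by (intro borel_measurable_continuous_onI continuous_on_lattice_char continuous_on_id)

lemma lattice_char_eq_1_if_int: "complex_tr (\<mu> * x) \<in> \<int> \<Longrightarrow> lattice_char \<mu> x = 1"
proof (elim Ints_cases)
  fix n assume "complex_tr (\<mu> * x) = of_int n"
  then have "lattice_char \<mu> x = exp (2 * of_int n * of_real pi * \<i>)"
    unfolding lattice_char_def by (simp add: mult_ac)
  also have "\<dots> = 1" using exp_integer_2pi[of "of_int n"] by (simp add: mult_ac)
  finally show ?thesis .
qed

lemma dual_lattice_group:
  "0 \<in> dual_lattice L" "\<mu> \<in> dual_lattice L \<Longrightarrow> - \<mu> \<in> dual_lattice L"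
  "\<mu> \<in> dual_lattice L \<Longrightarrow> \<nu> \<in> dual_lattice L \<Longrightarrow> \<mu> + \<nu> \<in> dual_lattice L"
proof -
  have tr: "complex_tr (- \<mu> * l) = - complex_tr (\<mu> * l)"
    "complex_tr ((\<mu> + \<nu>) * l) = complex_tr (\<mu> * l) + complex_tr (\<nu> * l)" for \<mu> \<nu> l
    unfolding complex_tr_def by (simp_all add: algebra_simps)
  show "0 \<in> dual_lattice L" unfolding dual_lattice_def complex_tr_def by simp
  show "\<mu> \<in> dual_lattice L \<Longrightarrow> - \<mu> \<in> dual_lattice L" unfolding dual_lattice_def mem_Collect_eq tr by auto
  show "\<mu> \<in> dual_lattice L \<Longrightarrow> \<nu> \<in> dual_lattice L \<Longrightarrow> \<mu> + \<nu> \<in> dual_lattice L"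
    unfolding dual_lattice_def mem_Collect_eq tr by auto
qed

locale planar_lattice =
  fixes L :: "complex set" and w1 w2 :: complex
  assumes basis: "lattice_basis L w1 w2"
begin

definition coord_det :: real where "coord_det = Im (w1 * cnj w2)"

lemma coord_det_nonzero: "coord_det \<noteq> 0"
proof
  assume 0: "coord_det = 0"
  have ind: "w1 \<noteq> w2" "independent {w1, w2}" using basis unfolding lattice_basis_def by auto
  have "w2 \<noteq> 0" using ind(2) dependent_zero[of "{w1, w2}"] by auto
  have "w1 * cnj w2 = of_real (Re (w1 * cnj w2))" using 0 by (simp add: coord_det_def complex_eq_iff)
  then have "w1 * (w2 * cnj w2) = of_real (Re (w1 * cnj w2)) * w2" by (simp add: mult_ac)
  then have "w1 = (Re (w1 * cnj w2) / (cmod w2)\<^sup>2) *\<^sub>R w2"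
    using \<open>w2 \<noteq> 0\<close> unfolding complex_norm_square[symmetric]
    by (simp add: scaleR_conv_of_real field_simps)
  then have "w1 \<in> span {w2}" by (metis span_base span_scale singletonI)
  then show False using ind by (simp add: independent_insert)
qed

text \<open>The elements of the dual basis; pairing with them gives the coordinates of a point.\<close>

definition dual1 where "dual1 = - \<i> * cnj w2 / of_real (2 * coord_det)"
definition dual2 where "dual2 = \<i> * cnj w1 / of_real (2 * coord_det)"

definition co1 :: "complex \<Rightarrow> real" where "co1 x = Im (x * cnj w2) / coord_det"
definition co2 :: "complex \<Rightarrow> real" where "co2 x = - (Im (x * cnj w1) / coord_det)"

lemma co_dual_basis: "2 * Re (dual1 * x) = co1 x" "2 * Re (dual2 * x) = co2 x"
proof -
  have "dual1 * x = of_real (1 / (2 * coord_det)) * (- \<i> * (x * cnj w2))"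
    "dual2 * x = of_real (1 / (2 * coord_det)) * (\<i> * (x * cnj w1))"
    unfolding dual1_def dual2_def by simp_all
  moreover have "Re (of_real r * y) = r * Re y" for r y by simp
  moreover have "Re (- \<i> * y) = Im y" "Re (\<i> * y) = - Im y" for y by simp_all
  ultimately have "Re (dual1 * x) = 1 / (2 * coord_det) * Im (x * cnj w2)"
    "Re (dual2 * x) = 1 / (2 * coord_det) * - Im (x * cnj w1)"
    by presburger+
  then show "2 * Re (dual1 * x) = co1 x" "2 * Re (dual2 * x) = co2 x"
    unfolding co1_def co2_def by (simp_all only:) (use coord_det_nonzero in \<open>simp_all add: field_simps\<close>)
qed

lemma co_add: "co1 (x + y) = co1 x + co1 y" "co2 (x + y) = co2 x + co2 y"
  "co1 (x - y) = co1 x - co1 y" "co2 (x - y) = co2 x - co2 y"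
  "co1 (- x) = - co1 x" "co2 (- x) = - co2 x" "co1 0 = 0" "co2 0 = 0"
  unfolding co1_def co2_def by (simp_all add: algebra_simps add_divide_distrib diff_divide_distrib)

lemma co_basis: "co1 w1 = 1" "co2 w1 = 0" "co1 w2 = 0" "co2 w2 = 1"
proof -
  have "Im (w2 * cnj w1) = - coord_det" "Im (w1 * cnj w2) = coord_det"
    "Im (w1 * cnj w1) = 0" "Im (w2 * cnj w2) = 0"
    unfolding coord_det_def by simp_all
  then show "co1 w1 = 1" "co2 w1 = 0" "co1 w2 = 0" "co2 w2 = 1"
    unfolding co1_def co2_def using coord_det_nonzero by (simp_all del: times_complex.sel)
qed

lemma co_scale: "co1 (of_real r * x) = r * co1 x" "co2 (of_real r * x) = r * co2 x"
  unfolding co1_def co2_def mult.assoc by simp_all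

lemma co_eq: "x = of_real (co1 x) * w1 + of_real (co2 x) * w2"
proof -
  have "of_real coord_det * (of_real (co1 x) * w1 + of_real (co2 x) * w2)
      = of_real (coord_det * co1 x) * w1 + of_real (coord_det * co2 x) * w2"
    by (simp add: algebra_simps)
  also have "\<dots> = of_real (Im (x * cnj w2)) * w1 + of_real (- Im (x * cnj w1)) * w2"
    unfolding co1_def co2_def using coord_det_nonzero by simp
  also have "\<dots> = of_real coord_det * x"
    unfolding coord_det_def by (simp add: complex_eq_iff algebra_simps)
  finally show ?thesis using coord_det_nonzero by simp
qed

lemma co_coords: "co1 (of_real s * w1 + of_real t * w2) = s" "co2 (of_real s * w1 + of_real t * w2) = t"
  by (simp_all add: co_add co_scale co_basis)

lemma continuous_on_co [continuous_intros]:
  "continuous_on A f \<Longrightarrow> continuous_on A (\<lambda>x. co1 (f x))"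
  "continuous_on A f \<Longrightarrow> continuous_on A (\<lambda>x. co2 (f x))"
  unfolding co1_def co2_def divide_inverse by (intro continuous_intros; assumption)+

lemma L_iff: "x \<in> L \<longleftrightarrow> co1 x \<in> \<int> \<and> co2 x \<in> \<int>"
proof
  assume "x \<in> L"
  then obtain m n where "x = of_real (of_int m) * w1 + of_real (of_int n) * w2"
    using basis unfolding lattice_basis_def by auto
  then show "co1 x \<in> \<int> \<and> co2 x \<in> \<int>" by (simp only: co_coords) auto
next
  assume "co1 x \<in> \<int> \<and> co2 x \<in> \<int>"
  then obtain m n where "co1 x = of_int m" "co2 x = of_int n" by (auto elim!: Ints_cases)
  then show "x \<in> L" using co_eq[of x] basis unfolding lattice_basis_def by auto
qed

lemma L_group: "0 \<in> L" "x \<in> L \<Longrightarrow> - x \<in> L" "x \<in> L \<Longrightarrow> y \<in> L \<Longrightarrow> x + y \<in> L"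
  "x \<in> L \<Longrightarrow> y \<in> L \<Longrightarrow> x - y \<in> L"
  unfolding L_iff by (auto simp: co_add)

lemma L_eq: "L = (\<lambda>(m, n). of_int m * w1 + of_int n * w2) ` UNIV"
  using basis unfolding lattice_basis_def by auto

lemma countable_L: "countable L" unfolding L_eq by auto

lemma co_dual: assumes "\<mu> \<in> dual_lattice L"
  shows "2 * Re (\<mu> * w1) \<in> \<int>" "2 * Re (\<mu> * w2) \<in> \<int>"
proof -
  have "complex_tr (\<mu> * w1) \<in> \<int>" "complex_tr (\<mu> * w2) \<in> \<int>"
    using assms L_iff[of w1] L_iff[of w2] unfolding dual_lattice_def by (auto simp: co_basis)
  then show "2 * Re (\<mu> * w1) \<in> \<int>" "2 * Re (\<mu> * w2) \<in> \<int>"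
    unfolding complex_tr_eq by (metis Ints_cases of_real_of_int_eq of_real_eq_iff Ints_of_int)+
qed

lemma dual_in_dual: "dual1 \<in> dual_lattice L" "dual2 \<in> dual_lattice L"
proof -
  have tr: "complex_tr (dual1 * x) = of_real (co1 x)" "complex_tr (dual2 * x) = of_real (co2 x)" for x
    unfolding complex_tr_eq co_dual_basis by (rule refl)+
  show "dual1 \<in> dual_lattice L" "dual2 \<in> dual_lattice L"
    unfolding dual_lattice_def mem_Collect_eq tr using L_iff by (auto elim!: Ints_cases)
qed

text \<open>For \<open>\<mu>\<close> in the dual lattice, \<open>tr (\<mu> w1)\<close> and \<open>tr (\<mu> w2)\<close> are integers, and the floor function only
  changes their type.\<close>

definition dual_co :: "complex \<Rightarrow> int \<times> int" where
  "dual_co \<mu> = (\<lfloor>2 * Re (\<mu> * w1)\<rfloor>, \<lfloor>2 * Re (\<mu> * w2)\<rfloor>)"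

lemma dual_co_inj: "inj_on dual_co (dual_lattice L)"
proof (rule inj_onI)
  fix \<mu> \<nu> assume *: "\<mu> \<in> dual_lattice L" "\<nu> \<in> dual_lattice L" "dual_co \<mu> = dual_co \<nu>"
  have eq: "Re (\<mu> * w1) = Re (\<nu> * w1)" "Re (\<mu> * w2) = Re (\<nu> * w2)"
    using co_dual[OF *(1)] co_dual[OF *(2)] *(3) unfolding dual_co_def by (auto elim!: Ints_cases)
  have "Re ((\<mu> - \<nu>) * x) = 0" for x
  proof -
    have "(\<mu> - \<nu>) * x = of_real (co1 x) * (\<mu> * w1 - \<nu> * w1) + of_real (co2 x) * (\<mu> * w2 - \<nu> * w2)"
      by (subst co_eq[of x]) (simp add: algebra_simps)
    then show ?thesis using eq by simp
  qed
  from this[of "cnj (\<mu> - \<nu>)"] have "Re (of_real ((cmod (\<mu> - \<nu>))\<^sup>2)) = 0"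
    unfolding complex_norm_square by simp
  then show "\<mu> = \<nu>" by simp
qed

lemma countable_dual: "countable (dual_lattice L)"
  using dual_co_inj countable_image_inj_on by (metis countableI_type)

subsection \<open>The fundamental parallelogram\<close>

definition fund :: "complex set" where
  "fund = {x. co1 x \<in> {0..<1} \<and> co2 x \<in> {0..<1}}"

lemma fund_eq: "fund = {of_real s * w1 + of_real t * w2 | s t. s \<in> {0..<1} \<and> t \<in> {0..<1}}"
  (is "_ = ?R")
proof
  show "fund \<subseteq> ?R" unfolding fund_def by (rule subsetI, rule CollectI) (use co_eq in blast)
  show "?R \<subseteq> fund" unfolding fund_def by (auto simp: co_coords)
qed

lemma fund_sets [measurable]: "fund \<in> sets borel"
proof -
  have [measurable]: "co1 \<in> borel_measurable borel" "co2 \<in> borel_measurable borel"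
    by (intro borel_measurable_continuous_onI continuous_on_co continuous_on_id)+
  have "fund = (co1 -` {0..<1} \<inter> space borel) \<inter> (co2 -` {0..<1} \<inter> space borel)" unfolding fund_def by auto
  also have "\<dots> \<in> sets borel" by measurable
  finally show ?thesis .
qed

lemma fund_bounded: "x \<in> fund \<Longrightarrow> norm x \<le> norm w1 + norm w2"
proof -
  assume x: "x \<in> fund"
  have "norm x \<le> norm (of_real (co1 x) * w1) + norm (of_real (co2 x) * w2)"
    by (subst co_eq[of x]) (rule norm_triangle_ineq)
  also have "\<dots> \<le> 1 * norm w1 + 1 * norm w2"
    unfolding norm_mult using x by (intro add_mono mult_right_mono) (auto simp: fund_def)
  finally show ?thesis by simp
qed

lemma fund_unique_translate: "\<exists>!l. l \<in> L \<and> x + l \<in> fund"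
proof
  let ?l = "- (of_int \<lfloor>co1 x\<rfloor> * w1 + of_int \<lfloor>co2 x\<rfloor> * w2)"
  have "of_int \<lfloor>co1 x\<rfloor> * w1 + of_int \<lfloor>co2 x\<rfloor> * w2 \<in> L" unfolding L_eq by auto
  then have "?l \<in> L" using L_group by blast
  moreover have "co1 (x + ?l) = frac (co1 x)" "co2 (x + ?l) = frac (co2 x)"
    using co_coords[of "of_int \<lfloor>co1 x\<rfloor>" "of_int \<lfloor>co2 x\<rfloor>"] unfolding frac_def
    by (simp_all only: co_add of_real_of_int_eq)
  ultimately show "?l \<in> L \<and> x + ?l \<in> fund" unfolding fund_def by (simp add: frac_lt_1)
next
  fix l assume l: "l \<in> L \<and> x + l \<in> fund"
  obtain m n where mn: "co1 l = of_int m" "co2 l = of_int n" using l L_iff by (metis Ints_cases)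
  have "\<lfloor>co1 x\<rfloor> = - m" "\<lfloor>co2 x\<rfloor> = - n"
    using l mn unfolding fund_def by (auto simp: co_add intro!: floor_unique)
  then show "l = - (of_int \<lfloor>co1 x\<rfloor> * w1 + of_int \<lfloor>co2 x\<rfloor> * w2)"
    using co_eq[of l] mn by simp
qed

text \<open>Exactly one translate of the point lies in the parallelogram, so the sum has one nonzero summand.\<close>

lemma has_sum_fund:
  fixes g :: "complex \<Rightarrow> 'b::real_normed_vector"
  assumes "\<And>l. l \<in> L \<Longrightarrow> g (x + l) = c"
  shows "((\<lambda>l. indicator fund (x + l) *\<^sub>R g (x + l)) has_sum c) L"
proof -
  obtain l0 where l0: "l0 \<in> L" "x + l0 \<in> fund" "\<And>l. l \<in> L \<Longrightarrow> x + l \<in> fund \<Longrightarrow> l = l0"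
    using fund_unique_translate[of x] by blast
  show ?thesis
  proof (rule has_sum_finite_neutralI[where B = "{l0}"])
    show "indicator fund (x + l) *\<^sub>R g (x + l) = 0" if "l \<in> L - {l0}" for l
      using that l0(3)[of l] by (auto simp: indicator_def)
  qed (use l0(1,2) assms[OF l0(1)] in simp_all)
qed

text \<open>The translates of the parallelogram are disjoint, so finite partial sums are at most the integral of the
  absolute value of \<open>f\<close>.\<close>

lemma unfold_integrable_norm:
  assumes f: "integrable lborel f"
  shows "(\<lambda>l. LINT x|lborel. norm (indicat_real fund x *\<^sub>R f (x + l) :: complex)) summable_on L"
proof (rule nonneg_bdd_above_summable_on)
  have [measurable]: "f \<in> borel_measurable borel" using f by auto
  have eq: "(LINT x|lborel. norm (indicat_real fund x *\<^sub>R f (x + l))) =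
         (LINT x|lborel. indicat_real fund (x - l) * norm (f x))" for l
    using lborel_integral_translate[of "\<lambda>x. indicat_real fund (x - l) * norm (f x)" l] by simp
  have int: "integrable lborel (\<lambda>x. indicat_real fund (x - l) * norm (f x))" for l
    by (rule Bochner_Integration.integrable_bound[OF f]) (auto simp: indicator_def)
  show "bdd_above (sum (\<lambda>l. LINT x|lborel. norm (indicat_real fund x *\<^sub>R f (x + l))) ` {F. F \<subseteq> L \<and> finite F})"
  proof (rule bdd_aboveI2)
    fix F assume F: "F \<in> {F. F \<subseteq> L \<and> finite F}"
    have le1: "(\<Sum>l\<in>F. indicat_real fund (x - l)) \<le> 1" for x
    proof -
      obtain l0 where l0: "\<And>l. l \<in> L \<Longrightarrow> x + l \<in> fund \<Longrightarrow> l = l0"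
        using fund_unique_translate[of x] by blast
      have "(\<Sum>l\<in>F. indicat_real fund (x - l)) \<le> (\<Sum>l\<in>F. if l = - l0 then 1 else 0)"
        using F l0[of "- _"] L_group(2) by (intro sum_mono) (force simp: indicator_def)
      also have "\<dots> \<le> 1" using F by simp
      finally show ?thesis .
    qed
    have "(\<Sum>l\<in>F. LINT x|lborel. norm (indicat_real fund x *\<^sub>R f (x + l)))
        = (LINT x|lborel. (\<Sum>l\<in>F. indicat_real fund (x - l)) * norm (f x))"
      unfolding eq sum_distrib_right using int by (subst Bochner_Integration.integral_sum) auto
    also have "\<dots> \<le> (LINT x|lborel. norm (f x))"
    proof (rule integral_mono)
      show "integrable lborel (\<lambda>x. (\<Sum>l\<in>F. indicat_real fund (x - l)) * norm (f x))"
        unfolding sum_distrib_right using int by auto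
    qed (use f le1 in \<open>auto intro!: mult_left_le_one_le sum_nonneg\<close>)
    finally show "(\<Sum>l\<in>F. LINT x|lborel. norm (indicat_real fund x *\<^sub>R f (x + l))) \<le> (LINT x|lborel. norm (f x))" .
  qed
qed auto

text \<open>The translates of the parallelogram tile the plane.\<close>

lemma unfold_integral:
  fixes f :: "complex \<Rightarrow> complex"
  assumes f: "integrable lborel f" and pt: "\<And>x. (\<lambda>l. norm (f (x + l))) summable_on L"
  shows "(LINT x|lborel. indicat_real fund x *\<^sub>R (\<Sum>\<^sub>\<infinity>l\<in>L. f (x + l))) = (LINT x|lborel. f x)"
proof -
  have [measurable]: "f \<in> borel_measurable borel" using f by auto
  have int: "integrable lborel (\<lambda>x. indicat_real fund x *\<^sub>R f (x + l))" for l
    by (rule Bochner_Integration.integrable_bound[OF lborel_integrable_translate[OF f, of l]])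
       (auto simp: indicator_def)
  have int2: "integrable lborel (\<lambda>x. indicat_real fund (x + l) *\<^sub>R f x)" for l
    by (rule Bochner_Integration.integrable_bound[OF f]) (auto simp: indicator_def)
  have inv: "bij_betw uminus L L"
    by (rule bij_betw_byWitness[where f' = uminus]) (auto simp: L_group)
  have one: "((\<lambda>l. indicat_real fund (x + l) *\<^sub>R f x) has_sum f x) L" for x
    using has_sum_fund[where x = x and g = "\<lambda>_. f x"] by auto
  have one_n: "((\<lambda>l. norm (indicat_real fund (x + l) *\<^sub>R f x)) has_sum norm (f x)) L" for x
    using has_sum_fund[where x = x and g = "\<lambda>_. norm (f x)"] by auto
  have tr: "(LINT x|lborel. indicat_real fund x *\<^sub>R f (x + l)) = (LINT x|lborel. indicat_real fund (x + - l) *\<^sub>R f x)" for l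
    using lborel_integral_translate[of "\<lambda>x. indicat_real fund (x - l) *\<^sub>R f x" l] by simp
  have trn: "(LINT x|lborel. norm (indicat_real fund x *\<^sub>R f (x + l))) = (LINT x|lborel. norm (indicat_real fund (x + - l) *\<^sub>R f x))" for l
    using lborel_integral_translate[of "\<lambda>x. norm (indicat_real fund (x - l) *\<^sub>R f x)" l] by simp
  have "(LINT x|lborel. indicat_real fund x *\<^sub>R (\<Sum>\<^sub>\<infinity>l\<in>L. f (x + l)))
      = (LINT x|lborel. (\<Sum>\<^sub>\<infinity>l\<in>L. indicat_real fund x *\<^sub>R f (x + l)))"
    by (simp add: infsum_scaleR_right)
  also have "\<dots> = (\<Sum>\<^sub>\<infinity>l\<in>L. LINT x|lborel. indicat_real fund x *\<^sub>R f (x + l))"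
  proof (rule integral_infsum(1)[OF countable_L int])
    show "(\<lambda>l. norm (indicat_real fund x *\<^sub>R f (x + l))) summable_on L" for x
      using pt[of x] by (auto simp: indicator_def)
  qed (rule unfold_integrable_norm[OF f])
  also have "\<dots> = (\<Sum>\<^sub>\<infinity>l\<in>L. LINT x|lborel. indicat_real fund (x + l) *\<^sub>R f x)"
    unfolding tr by (rule infsum_reindex_bij_betw[OF inv])
  also have "\<dots> = (LINT x|lborel. (\<Sum>\<^sub>\<infinity>l\<in>L. indicat_real fund (x + l) *\<^sub>R f x))"
  proof (rule integral_infsum(1)[OF countable_L int2, symmetric])
    show "(\<lambda>l. LINT x|lborel. norm (indicat_real fund (x + l) *\<^sub>R f x)) summable_on L"
      using unfold_integrable_norm[OF f] unfolding trn by (subst (asm) summable_on_reindex_bij_betw[OF inv])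
    show "(\<lambda>l. norm (indicat_real fund (x + l) *\<^sub>R f x)) summable_on L" for x
      using one_n has_sum_imp_summable by blast
  qed
  also have "\<dots> = (LINT x|lborel. f x)" using infsumI[OF one] by simp
  finally show ?thesis .
qed

lemma integrable_bounded_set:
  fixes g :: "complex \<Rightarrow> complex"
  assumes g: "continuous_on UNIV g" and A: "A \<in> sets borel" "A \<subseteq> cball 0 R"
  shows "integrable lborel (\<lambda>x. indicat_real A x *\<^sub>R g x)"
proof -
  have "integrable lborel (\<lambda>x. indicat_real (cball 0 R) x *\<^sub>R g x)"
    by (rule borel_integrable_compact) (auto intro: continuous_on_subset[OF g])
  then have "set_integrable lborel (cball 0 R) g" unfolding set_integrable_def .
  then show ?thesis
    using set_integrable_subset[of lborel "cball 0 R" g A] A unfolding set_integrable_def by auto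
qed

lemma fund_integrable:
  fixes g :: "complex \<Rightarrow> complex"
  assumes "continuous_on UNIV g" shows "integrable lborel (\<lambda>x. indicat_real fund x *\<^sub>R g x)"
  by (rule integrable_bounded_set[OF assms, where R = "norm w1 + norm w2"]) (auto simp: fund_bounded)

text \<open>Translation invariance of the mean has two uses: a translation by half a period shows that nontrivial
  characters have mean zero, and a suitable translation moves any given point to the centre of the
  parallelogram.\<close>

lemma fund_integral_translate:
  fixes g :: "complex \<Rightarrow> complex"
  assumes g: "continuous_on UNIV g" and per: "\<And>x l. l \<in> L \<Longrightarrow> g (x + l) = g x"
  shows "(LINT x|lborel. indicat_real fund x *\<^sub>R g (x + v)) = (LINT x|lborel. indicat_real fund x *\<^sub>R g x)"
proof -
  define f where "f = (\<lambda>x. indicat_real fund (x - v) *\<^sub>R g x)"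
  have "(\<lambda>x. indicat_real {x. x - v \<in> fund} x *\<^sub>R g x) = f" unfolding f_def by (auto simp: indicator_def)
  moreover have "integrable lborel (\<lambda>x. indicat_real {x. x - v \<in> fund} x *\<^sub>R g x)"
  proof (rule integrable_bounded_set[OF g, where R = "norm w1 + norm w2 + norm v"])
    show "{x. x - v \<in> fund} \<subseteq> cball 0 (norm w1 + norm w2 + norm v)"
    proof
      fix x assume "x \<in> {x. x - v \<in> fund}"
      then show "x \<in> cball 0 (norm w1 + norm w2 + norm v)"
        using fund_bounded[of "x - v"] norm_triangle_ineq[of "x - v" v] by simp
    qed
    have "{x. x - v \<in> fund} = (\<lambda>x. x - v) -` fund \<inter> space borel" by auto
    also have "\<dots> \<in> sets borel" by measurable
    finally show "{x. x - v \<in> fund} \<in> sets borel" .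
  qed
  ultimately have f: "integrable lborel f" by simp
  then have [measurable]: "f \<in> borel_measurable borel" by auto
  have sum: "((\<lambda>l. f (x + l)) has_sum g x) L" for x
    using has_sum_fund[where x = "x - v" and g = "\<lambda>y. g (y + v)" and c = "g x"] per unfolding f_def
    by (simp add: algebra_simps)
  have sumn: "((\<lambda>l. norm (f (x + l))) has_sum norm (g x)) L" for x
    using has_sum_fund[where x = "x - v" and g = "\<lambda>y. norm (g (y + v))" and c = "norm (g x)"] per unfolding f_def
    by (simp add: algebra_simps)
  have "(LINT x|lborel. indicat_real fund x *\<^sub>R g (x + v)) = (LINT x|lborel. f x)"
    using lborel_integral_translate[of f v] unfolding f_def by (simp add: f_def[symmetric])
  also have "\<dots> = (LINT x|lborel. indicat_real fund x *\<^sub>R (\<Sum>\<^sub>\<infinity>l\<in>L. f (x + l)))"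
    using unfold_integral[OF f] sumn has_sum_imp_summable by (metis (no_types, lifting))
  also have "\<dots> = (LINT x|lborel. indicat_real fund x *\<^sub>R g x)" using infsumI[OF sum] by simp
  finally show ?thesis .
qed

lemma lattice_char_periodic:
  "\<mu> \<in> dual_lattice L \<Longrightarrow> l \<in> L \<Longrightarrow> lattice_char \<mu> (x + l) = lattice_char \<mu> x"
  unfolding lattice_char_add_right dual_lattice_def by (simp add: lattice_char_eq_1_if_int)

definition fund_area where "fund_area = measure lborel fund"

lemma fund_emeasure: "emeasure lborel fund < \<infinity>"
  by (rule emeasure_bounded_finite, rule boundedI[where B = "norm w1 + norm w2"], rule fund_bounded)

lemma lattice_char_integral:
  assumes "\<mu> \<in> dual_lattice L"
  shows "(LINT x|lborel. indicat_real fund x *\<^sub>R lattice_char \<mu> x) = (if \<mu> = 0 then of_real fund_area else 0)"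
proof (cases "\<mu> = 0")
  case True
  then show ?thesis using fund_emeasure unfolding fund_area_def
    by (simp add: scaleR_conv_of_real)
next
  case False
  \<comment> \<open>a translation by half a period changes the sign of the character, but not its mean\<close>
  have "lattice_char \<mu> (1 / (4 * \<mu>)) = -1"
    using False exp_pi_i' unfolding lattice_char_altdef by (simp add: mult.commute)
  then have "(LINT x|lborel. indicat_real fund x *\<^sub>R lattice_char \<mu> x) =
      (LINT x|lborel. - (indicat_real fund x *\<^sub>R lattice_char \<mu> x))"
    using fund_integral_translate[of "lattice_char \<mu>" "1 / (4 * \<mu>)"] lattice_char_periodic[OF assms]
    by (simp add: lattice_char_add_right continuous_intros)
  then show ?thesis using False by (simp add: eq_neg_iff_add_eq_0)
qed

subsection \<open>Trigonometric polynomials and uniqueness of Fourier coefficients\<close>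

inductive trig_poly :: "(complex \<Rightarrow> complex) \<Rightarrow> bool" where
  char: "\<mu> \<in> dual_lattice L \<Longrightarrow> trig_poly (\<lambda>x. c * lattice_char \<mu> x)"
| add: "trig_poly f \<Longrightarrow> trig_poly g \<Longrightarrow> trig_poly (\<lambda>x. f x + g x)"

lemma trig_poly_const: "trig_poly (\<lambda>x. c)"
  using trig_poly.char[OF dual_lattice_group(1), of c] by simp

lemma trig_poly_mult:
  assumes "trig_poly f" "trig_poly g" shows "trig_poly (\<lambda>x. f x * g x)"
  using assms(1)
proof induction
  case (char \<mu> c)
  note \<mu> = char
  show ?case using assms(2)
  proof induction
    case (char \<nu> d)
    have "trig_poly (\<lambda>x. (c * d) * lattice_char (\<mu> + \<nu>) x)"
      using \<mu> char dual_lattice_group(3) by (intro trig_poly.char)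
    then show ?case by (simp add: lattice_char_add_left mult_ac)
  next
    case (add f g)
    then show ?case using trig_poly.add[of "\<lambda>x. c * lattice_char \<mu> x * f x"] by (simp add: distrib_left)
  qed
next
  case (add f h)
  then show ?case using trig_poly.add[of "\<lambda>x. f x * g x"] by (simp add: distrib_right)
qed

lemma trig_poly_cmult: "trig_poly f \<Longrightarrow> trig_poly (\<lambda>x. c * f x)"
  using trig_poly_mult[OF trig_poly_const] .

lemma trig_poly_cnj: "trig_poly f \<Longrightarrow> trig_poly (\<lambda>x. cnj (f x))"
proof (induction rule: trig_poly.induct)
  case (char \<mu> c)
  then show ?case using trig_poly.char[OF dual_lattice_group(2)] by (simp add: cnj_lattice_char)
next
  case (add f g)
  then show ?case using trig_poly.add by simp
qed

lemma trig_poly_continuous: "trig_poly f \<Longrightarrow> continuous_on UNIV f"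
  by (induction rule: trig_poly.induct) (intro continuous_intros; assumption)+

lemma trig_poly_orthogonal:
  assumes H: "continuous_on UNIV H"
    and zero: "\<And>\<mu>. \<mu> \<in> dual_lattice L \<Longrightarrow> (LINT x|lborel. indicat_real fund x *\<^sub>R (H x * lattice_char \<mu> x)) = 0"
  shows "trig_poly f \<Longrightarrow> (LINT x|lborel. indicat_real fund x *\<^sub>R (H x * f x)) = 0"
proof (induction rule: trig_poly.induct)
  case (char \<mu> c)
  have "(LINT x|lborel. indicat_real fund x *\<^sub>R (H x * (c * lattice_char \<mu> x)))
      = (LINT x|lborel. c * (indicat_real fund x *\<^sub>R (H x * lattice_char \<mu> x)))"
    by (intro Bochner_Integration.integral_cong) (simp_all add: mult_ac scaleR_conv_of_real)
  also have "\<dots> = c * (LINT x|lborel. indicat_real fund x *\<^sub>R (H x * lattice_char \<mu> x))"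
    by (rule integral_mult_right_zero)
  finally show ?case using zero[OF char] by simp
next
  case (add f g)
  have "integrable lborel (\<lambda>x. indicat_real fund x *\<^sub>R (H x * f x))"
    "integrable lborel (\<lambda>x. indicat_real fund x *\<^sub>R (H x * g x))"
    using add.hyps trig_poly_continuous by (auto intro!: fund_integrable continuous_on_mult H)
  then show ?case using add.IH by (simp add: distrib_left scaleR_right_distrib)
qed

text \<open>The torus is embedded into the product of two unit circles, a compact subset of a Euclidean space, where
  the Stone--Weierstrass theorem for polynomials applies.\<close>

definition torus_map :: "complex \<Rightarrow> complex \<times> complex" where
  "torus_map x = (lattice_char dual1 x, lattice_char dual2 x)"

lemma lattice_char_dual: "lattice_char dual1 x = cis (2 * pi * co1 x)" "lattice_char dual2 x = cis (2 * pi * co2 x)"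
  unfolding lattice_char_altdef co_dual_basis[symmetric] cis_conv_exp by (simp_all add: mult_ac)

lemma torus_map_eq_imp: assumes "torus_map x = torus_map y" shows "x - y \<in> L"
proof -
  have "a - b \<in> \<int>" if "cis (2 * pi * a) = cis (2 * pi * b)" for a b :: real
  proof -
    have "cis (2 * pi * (a - b)) = cis (2 * pi * a) / cis (2 * pi * b)"
      by (simp add: cis_divide algebra_simps)
    also have "\<dots> = 1" using that by simp
    finally have "cos (2 * pi * (a - b)) = 1" by (simp add: complex_eq_iff)
    then obtain n :: int where "2 * pi * (a - b) = of_int n * 2 * pi" by (auto simp: cos_one_2pi_int)
    then have "a - b = of_int n" by simp
    then show ?thesis by simp
  qed
  then show ?thesis using assms unfolding torus_map_def lattice_char_dual L_iff co_add by simp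
qed

lemma trig_poly_real_polynomial:
  "real_polynomial_function p \<Longrightarrow> trig_poly (\<lambda>x. of_real (p (torus_map x)))"
proof (induction rule: real_polynomial_function.induct)
  case (linear f)
  have f: "linear f" using linear bounded_linear.linear by blast
  have re_im: "trig_poly (\<lambda>x. of_real (Re (lattice_char \<mu> x)))" "trig_poly (\<lambda>x. of_real (Im (lattice_char \<mu> x)))"
    if \<mu>: "\<mu> \<in> dual_lattice L" for \<mu>
  proof -
    have "of_real (Re (lattice_char \<mu> x)) = 1/2 * lattice_char \<mu> x + 1/2 * lattice_char (- \<mu>) x"
      "of_real (Im (lattice_char \<mu> x)) = (- \<i>/2) * lattice_char \<mu> x + (\<i>/2) * lattice_char (- \<mu>) x" for x
      unfolding cnj_lattice_char[symmetric] by (simp_all add: complex_eq_iff)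
    then show "trig_poly (\<lambda>x. of_real (Re (lattice_char \<mu> x)))" "trig_poly (\<lambda>x. of_real (Im (lattice_char \<mu> x)))"
      by (simp_all only:) (intro trig_poly.add trig_poly.char \<mu> dual_lattice_group(2)[OF \<mu>])+
  qed
  have f_eq: "f (z, w) = Re z * f (1, 0) + Im z * f (\<i>, 0) + Re w * f (0, 1) + Im w * f (0, \<i>)" for z w
  proof -
    have "(z, w) = Re z *\<^sub>R (1, 0) + Im z *\<^sub>R (\<i>, 0) + Re w *\<^sub>R (0, 1) + Im w *\<^sub>R (0, \<i>)"
      by (simp add: complex_eq_iff)
    then show ?thesis by (simp only: linear_add[OF f] linear_cmul[OF f]) simp
  qed
  have "(\<lambda>x. of_real (f (torus_map x))) = (\<lambda>x. of_real (f (1, 0)) * of_real (Re (lattice_char dual1 x))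
      + of_real (f (\<i>, 0)) * of_real (Im (lattice_char dual1 x)) + of_real (f (0, 1)) * of_real (Re (lattice_char dual2 x))
      + of_real (f (0, \<i>)) * of_real (Im (lattice_char dual2 x)) :: complex)"
    unfolding torus_map_def by (rule ext, subst f_eq) (simp add: mult.commute)
  moreover have "trig_poly (\<lambda>x. of_real (f (1, 0)) * of_real (Re (lattice_char dual1 x))
      + of_real (f (\<i>, 0)) * of_real (Im (lattice_char dual1 x)) + of_real (f (0, 1)) * of_real (Re (lattice_char dual2 x))
      + of_real (f (0, \<i>)) * of_real (Im (lattice_char dual2 x)))"
    by (rule trig_poly.add trig_poly_cmult re_im dual_in_dual)+
  ultimately show ?case by (simp only:)
next
  case (const c)
  show ?case by (rule trig_poly_const)
next
  case (add f g)
  then show ?case using trig_poly.add by simp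
next
  case (mult f g)
  then show ?case using trig_poly_mult by simp
qed

text \<open>By the Stone--Weierstrass theorem on the torus, trigonometric polynomials are uniformly
  dense in the continuous periodic functions.\<close>

lemma trig_poly_dense_real:
  fixes H :: "complex \<Rightarrow> real"
  assumes H: "continuous_on UNIV H" and per: "\<And>x l. l \<in> L \<Longrightarrow> H (x + l) = H x" and e: "e > 0"
  obtains T where "trig_poly T" "\<And>x. norm (of_real (H x) - T x) \<le> e"
proof -
  define S where "S = (\<lambda>(s, t). of_real s * w1 + of_real t * w2) ` ({0..1} \<times> {0..1::real})"
  have S: "compact S" unfolding S_def
    by (intro compact_continuous_image compact_Times compact_Icc) (auto simp: case_prod_unfold intro!: continuous_intros)
  have ct: "continuous_on A torus_map" for A unfolding torus_map_def by (intro continuous_intros)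
  have red: "\<exists>y\<in>S. x - y \<in> L" for x
  proof -
    obtain l where "l \<in> L" "x + l \<in> fund" using fund_unique_translate by blast
    moreover have "fund \<subseteq> S"
    proof
      fix y assume "y \<in> fund"
      then have "(co1 y, co2 y) \<in> {0..1} \<times> {0..1}" unfolding fund_def by auto
      moreover have "y = (\<lambda>(s, t). of_real s * w1 + of_real t * w2) (co1 y, co2 y)" using co_eq by simp
      ultimately show "y \<in> S" unfolding S_def by blast
    qed
    ultimately show ?thesis using L_group(2)[of l] by (intro bexI[of _ "x + l"]) auto
  qed
  have tper: "torus_map (x + l) = torus_map x" if "l \<in> L" for x l
    unfolding torus_map_def using that by (simp add: lattice_char_periodic dual_in_dual)
  \<comment> \<open>\<open>H\<close> as a function on the torus; by periodicity the choice of the preimage does not matter\<close>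
  define h where "h = (\<lambda>p. H (SOME x. torus_map x = p))"
  have h: "h (torus_map x) = H x" for x
  proof -
    have "torus_map (SOME y. torus_map y = torus_map x) = torus_map x"
      by (rule someI[where P = "\<lambda>y. torus_map y = torus_map x"]) simp
    then have "(SOME y. torus_map y = torus_map x) - x \<in> L" by (rule torus_map_eq_imp)
    from per[OF this, of x] show ?thesis unfolding h_def by simp
  qed
  have img: "range torus_map = torus_map ` S"
  proof -
    have "torus_map x \<in> torus_map ` S" for x
    proof -
      obtain y where "y \<in> S" "x - y \<in> L" using red by blast
      then show ?thesis using tper[of "x - y" y] by auto
    qed
    then show ?thesis by auto
  qed
  have "compact (range torus_map)" unfolding img by (rule compact_continuous_image[OF ct S])
  moreover have "continuous_on (range torus_map) h"
  proof -
    have "closed (range torus_map)" using calculation by (rule compact_imp_closed)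
    then show ?thesis
    proof (subst continuous_on_closed_vimage, simp, intro allI impI)
      \<comment> \<open>closed sets have closed preimages, because these are images of compact subsets of the parallelogram\<close>
      fix B :: "real set" assume "closed B"
      then have "closed (H -` B)" using H by (simp add: continuous_closed_vimage continuous_on_eq_continuous_at)
      then have "compact (S \<inter> H -` B)" using S by (simp add: compact_Int_closed)
      then have "compact (torus_map ` (S \<inter> H -` B))" by (rule compact_continuous_image[OF ct])
      moreover have "h -` B \<inter> range torus_map = torus_map ` (S \<inter> H -` B)"
        unfolding img using h by auto
      ultimately show "closed (h -` B \<inter> range torus_map)" using compact_imp_closed by simp
    qed
  qed
  ultimately obtain p where p: "real_polynomial_function p" "\<And>x. x \<in> range torus_map \<Longrightarrow> \<bar>h x - p x\<bar> < e"
    using Stone_Weierstrass_real_polynomial_function e by metis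
  show ?thesis
  proof (rule that[OF trig_poly_real_polynomial[OF p(1)]])
    fix x
    have "norm (of_real (H x) - of_real (p (torus_map x)) :: complex) = \<bar>h (torus_map x) - p (torus_map x)\<bar>"
      unfolding h by (simp flip: of_real_diff)
    then show "norm (of_real (H x) - of_real (p (torus_map x)) :: complex) \<le> e" using p(2)[of "torus_map x"] by auto
  qed
qed

lemma trig_poly_dense:
  assumes H: "continuous_on UNIV H" and per: "\<And>x l. l \<in> L \<Longrightarrow> H (x + l) = H x" and e: "e > 0"
  obtains T where "trig_poly T" "\<And>x. norm (H x - T x) \<le> e"
proof -
  have "e / 2 > 0" using e by simp
  obtain S where S: "trig_poly S" "\<And>x. norm (of_real (Re (H x)) - S x) \<le> e / 2"
    by (rule trig_poly_dense_real[of "\<lambda>x. Re (H x)", OF _ _ \<open>e / 2 > 0\<close>]) (auto intro!: continuous_intros H simp: per)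
  obtain T where T: "trig_poly T" "\<And>x. norm (of_real (Im (H x)) - T x) \<le> e / 2"
    by (rule trig_poly_dense_real[of "\<lambda>x. Im (H x)", OF _ _ \<open>e / 2 > 0\<close>]) (auto intro!: continuous_intros H simp: per)
  show ?thesis
  proof (rule that[OF trig_poly.add[OF S(1) trig_poly_cmult[OF T(1), of \<i>]]])
    fix x
    have "H x - (S x + \<i> * T x) = (of_real (Re (H x)) - S x) + \<i> * (of_real (Im (H x)) - T x)"
      by (subst complex_eq[of "H x"]) (simp add: algebra_simps)
    also have "norm \<dots> \<le> e / 2 + e / 2"
      using S(2)[of x] T(2)[of x] by (intro norm_triangle_le) (auto simp: norm_mult)
    finally show "norm (H x - (S x + \<i> * T x)) \<le> e" by simp
  qed
qed

text \<open>The centre is an interior point of the half-open parallelogram, where a positive value of a continuous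
  function would make the integral positive.\<close>

lemma fund_zero_integral:
  fixes g :: "complex \<Rightarrow> real"
  assumes g: "continuous_on UNIV g" "\<And>x. g x \<ge> 0"
    and int: "integrable lborel (\<lambda>x. indicat_real fund x * g x)"
    and zero: "(LINT x|lborel. indicat_real fund x * g x) = 0"
  shows "g (of_real (1/2) * w1 + of_real (1/2) * w2) = 0"
proof (rule ccontr)
  assume ne: "g (of_real (1/2) * w1 + of_real (1/2) * w2) \<noteq> 0"
  define U where "U = {x. 0 < co1 x} \<inter> {x. co1 x < 1} \<inter> {x. 0 < co2 x} \<inter> {x. co2 x < 1} \<inter> {x. 0 < g x}"
  have "open U" unfolding U_def
    by (intro open_Int open_Collect_less continuous_intros g)
  moreover have "of_real (1/2) * w1 + of_real (1/2) * w2 \<in> U"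
    using ne g(2)[of "of_real (1/2) * w1 + of_real (1/2) * w2"]
    unfolding U_def by (simp only: Int_iff mem_Collect_eq co_coords) auto
  ultimately have "\<not> negligible U" using open_not_negligible by blast
  have "AE x in lborel. indicat_real fund x * g x = 0"
    using integral_nonneg_eq_0_iff_AE[OF int] zero g(2) by simp
  then have "AE x in lborel. x \<notin> U" by eventually_elim (auto simp: U_def fund_def indicator_def split: if_splits)
  moreover have "U \<in> sets lborel" using \<open>open U\<close> by simp
  ultimately have "U \<in> null_sets lborel" by (subst AE_iff_null_sets) auto
  then have "negligible U" using negligible_iff_null_sets null_sets_completionI by blast
  with \<open>\<not> negligible U\<close> show False by simp
qed

lemma fund_area_pos: "fund_area > 0"
proof (rule ccontr)
  assume "\<not> fund_area > 0"
  then have "measure lborel fund = 0" unfolding fund_area_def by (simp add: measure_le_0_iff[symmetric] not_less)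
  then show False
    using fund_zero_integral[of "\<lambda>_. 1"] fund_emeasure by (simp add: integrable_indicator_iff)
qed

text \<open>\<open>H\<close> is orthogonal to the trigonometric polynomials, which approximate \<open>H\<close> itself, so the integral of
  \<open>\<bar>H\<bar>\<^sup>2\<close> vanishes.\<close>

theorem Fourier_uniqueness:
  assumes H: "continuous_on UNIV H" and per: "\<And>x l. l \<in> L \<Longrightarrow> H (x + l) = H x"
    and zero: "\<And>\<mu>. \<mu> \<in> dual_lattice L \<Longrightarrow> (LINT x|lborel. indicat_real fund x *\<^sub>R (H x * lattice_char \<mu> x)) = 0"
  shows "H x0 = 0"
proof -
  define N where "N = (LINT x|lborel. indicat_real fund x *\<^sub>R (H x * cnj (H x)))"
  have "norm N \<le> e * (LINT x|lborel. indicat_real fund x * norm (H x))" if e: "e > 0" for e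
  proof -
    obtain T where T: "trig_poly T" "\<And>x. norm (H x - T x) \<le> e" using trig_poly_dense[OF H per e] by blast
    have cT: "continuous_on UNIV T" using trig_poly_continuous[OF T(1)] .
    have i: "integrable lborel (\<lambda>x. indicat_real fund x *\<^sub>R (H x * cnj (H x)))"
      "integrable lborel (\<lambda>x. indicat_real fund x *\<^sub>R (H x * cnj (T x)))"
      by (intro fund_integrable continuous_intros H cT)+
    have i3: "integrable lborel (\<lambda>x. indicat_real fund x *\<^sub>R (H x * cnj (H x - T x)))"
      by (intro fund_integrable continuous_intros H cT)
    have i4: "integrable lborel (\<lambda>x. indicat_real fund x * norm (H x))"
      using integrable_norm[OF fund_integrable[OF H]] by simp
    have "N = N - (LINT x|lborel. indicat_real fund x *\<^sub>R (H x * cnj (T x)))"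
      using trig_poly_orthogonal[OF H zero trig_poly_cnj[OF T(1)]] by simp
    also have "\<dots> = (LINT x|lborel. indicat_real fund x *\<^sub>R (H x * cnj (H x - T x)))"
      unfolding N_def using i by (subst Bochner_Integration.integral_diff[symmetric]) (auto simp: algebra_simps)
    finally have "norm N \<le> (LINT x|lborel. norm (indicat_real fund x *\<^sub>R (H x * cnj (H x - T x))))"
      by (simp only: integral_norm_bound)
    also have "\<dots> \<le> (LINT x|lborel. e * (indicat_real fund x * norm (H x)))"
    proof (rule integral_mono)
      fix x
      have "norm (H x) * norm (H x - T x) \<le> norm (H x) * e" by (intro mult_left_mono T) simp
      then show "norm (indicat_real fund x *\<^sub>R (H x * cnj (H x - T x))) \<le> e * (indicat_real fund x * norm (H x))"
        by (auto simp: norm_mult indicator_def mult.commute simp del: complex_cnj_diff)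
    qed (use integrable_norm[OF i3] i4 in \<open>simp_all only: integrable_mult_right\<close>)
    finally show ?thesis by simp
  qed
  then have "norm N \<le> 0"
  proof -
    define M where "M = (LINT x|lborel. indicat_real fund x * norm (H x))"
    assume le: "\<And>e. e > 0 \<Longrightarrow> norm N \<le> e * (LINT x|lborel. indicat_real fund x * norm (H x))"
    have "((\<lambda>e. e * M) \<longlongrightarrow> 0 * M) (at_right 0)" by (intro tendsto_intros)
    moreover have "eventually (\<lambda>e. norm N \<le> e * M) (at_right 0)"
      using le unfolding M_def by (auto simp: eventually_at_right_field intro!: exI[of _ 1])
    ultimately show ?thesis using tendsto_lowerbound[of _ "0 * M"] by fastforce
  qed
  then have N: "N = 0" by simp
  define c where "c = of_real (1/2) * w1 + of_real (1/2) * w2"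
  \<comment> \<open>the translation by \<open>v\<close> moves \<open>x0\<close> to the centre \<open>c\<close>\<close>
  define v where "v = x0 - c"
  define G where "G = (\<lambda>x. H x * cnj (H x))"
  have G: "continuous_on UNIV G" "\<And>x l. l \<in> L \<Longrightarrow> G (x + l) = G x" unfolding G_def using per
    by (auto intro!: continuous_intros H)
  have cv: "continuous_on UNIV (\<lambda>x. H (x + v))"
    by (rule continuous_on_compose2[OF H]) (auto intro!: continuous_intros)
  have eq: "indicat_real fund x *\<^sub>R G (x + v) = of_real (indicat_real fund x * (norm (H (x + v)))\<^sup>2)" for x
    unfolding G_def by (simp add: complex_norm_square[symmetric] scaleR_conv_of_real)
  have "(LINT x|lborel. indicat_real fund x *\<^sub>R G (x + v)) = 0"
    using fund_integral_translate[OF G, of v] N unfolding N_def G_def by simp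
  then have z: "(LINT x|lborel. indicat_real fund x * (norm (H (x + v)))\<^sup>2) = 0"
    unfolding eq integral_complex_of_real by simp
  have "integrable lborel (\<lambda>x. indicat_real fund x *\<^sub>R G (x + v))"
    unfolding G_def by (intro fund_integrable continuous_intros cv)
  then have "integrable lborel (\<lambda>x. indicat_real fund x * (norm (H (x + v)))\<^sup>2)"
    unfolding eq by (simp only: complex_of_real_integrable_eq)
  then have "(\<lambda>x. (norm (H (x + v)))\<^sup>2) (of_real (1/2) * w1 + of_real (1/2) * w2) = 0"
    by (rule fund_zero_integral[OF _ _ _ z, rotated 2]) (intro continuous_intros cv, rule zero_le_power2)
  then have "(norm (H (c + v)))\<^sup>2 = 0" unfolding c_def .
  then show ?thesis unfolding v_def by simp
qed

subsection \<open>Poisson summation\<close>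

text \<open>A majorant on each ball suffices, because continuity is local.\<close>

lemma continuous_on_infsum_M_test:
  fixes f :: "'a \<Rightarrow> complex \<Rightarrow> complex"
  assumes cont: "\<And>a. a \<in> A \<Longrightarrow> continuous_on UNIV (f a)"
    and bd: "\<And>R. \<exists>M. M summable_on A \<and> (\<forall>a\<in>A. \<forall>x. norm x \<le> R \<longrightarrow> norm (f a x) \<le> M a)"
  shows "continuous_on UNIV (\<lambda>x. \<Sum>\<^sub>\<infinity>a\<in>A. f a x)"
proof -
  have "isCont (\<lambda>x. \<Sum>\<^sub>\<infinity>a\<in>A. f a x) x" for x
  proof -
    obtain M where M: "M summable_on A" "\<And>a y. a \<in> A \<Longrightarrow> norm y \<le> norm x + 1 \<Longrightarrow> norm (f a y) \<le> M a"
      using bd[of "norm x + 1"] by blast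
    have "uniform_limit (cball 0 (norm x + 1)) (\<lambda>X y. \<Sum>a\<in>X. f a y) (\<lambda>y. \<Sum>\<^sub>\<infinity>a\<in>A. f a y) (finite_subsets_at_top A)"
      by (rule Weierstrass_m_test_general[OF _ M(1)]) (auto intro: M(2))
    moreover have "eventually (\<lambda>X. continuous_on (cball 0 (norm x + 1)) (\<lambda>y. \<Sum>a\<in>X. f a y)) (finite_subsets_at_top A)"
      by (intro eventually_finite_subsets_at_top_weakI continuous_on_sum continuous_on_subset[OF cont]) auto
    ultimately have "continuous_on (cball 0 (norm x + 1)) (\<lambda>y. \<Sum>\<^sub>\<infinity>a\<in>A. f a y)"
      by (metis uniform_limit_theorem finite_subsets_at_top_neq_bot)
    then show ?thesis by (rule continuous_on_interior) simp
  qed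
  then show ?thesis by (simp add: continuous_on_eq_continuous_at)
qed

text \<open>Both sides are continuous and periodic, and they have the same Fourier coefficients: those of the left-hand
  side are found by unfolding, those of the right-hand side by the orthogonality of the characters.\<close>

theorem Poisson_summation:
  fixes f :: "complex \<Rightarrow> complex"
  assumes f: "continuous_on UNIV f" "integrable lborel f"
    and bd: "\<And>R. \<exists>M. M summable_on L \<and> (\<forall>l\<in>L. \<forall>x. norm x \<le> R \<longrightarrow> norm (f (x + l)) \<le> M l)"
    and c: "\<And>\<mu>. \<mu> \<in> dual_lattice L \<Longrightarrow> (LINT x|lborel. f x * lattice_char (- \<mu>) x) = c \<mu>"
    and sum: "(\<lambda>\<mu>. norm (c \<mu>)) summable_on dual_lattice L"
  shows "(\<Sum>\<^sub>\<infinity>l\<in>L. f (x + l)) = 1 / of_real fund_area * (\<Sum>\<^sub>\<infinity>\<mu>\<in>dual_lattice L. c \<mu> * lattice_char \<mu> x)"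
proof -
  let ?D = "dual_lattice L"
  define F where "F = (\<lambda>x. \<Sum>\<^sub>\<infinity>l\<in>L. f (x + l))"
  define G where "G = (\<lambda>x. \<Sum>\<^sub>\<infinity>\<mu>\<in>?D. c \<mu> * lattice_char \<mu> x)"
  have [measurable]: "f \<in> borel_measurable borel" using f(2) by auto
  have pt: "(\<lambda>l. norm (f (x + l))) summable_on L" for x
  proof -
    obtain M where M: "M summable_on L" "\<And>l y. l \<in> L \<Longrightarrow> norm y \<le> norm x \<Longrightarrow> norm (f (y + l)) \<le> M l"
      using bd[of "norm x"] by blast
    then show ?thesis by (intro summable_on_comparison_test[OF M(1)]) auto
  qed
  have F: "continuous_on UNIV F" unfolding F_def
    by (rule continuous_on_infsum_M_test[OF _ bd])
       (rule continuous_on_compose2[OF f(1)], auto intro: continuous_intros)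
  have G: "continuous_on UNIV G" unfolding G_def
  proof (rule continuous_on_infsum_M_test)
    show "\<exists>M. M summable_on ?D \<and> (\<forall>\<mu>\<in>?D. \<forall>x. norm x \<le> R \<longrightarrow> norm (c \<mu> * lattice_char \<mu> x) \<le> M \<mu>)" for R
      by (intro exI[of _ "\<lambda>\<mu>. norm (c \<mu>)"] conjI sum) (simp add: norm_mult)
  qed (intro continuous_intros)
  have F_per: "F (x + l) = F x" if l: "l \<in> L" for x l
  proof -
    have "bij_betw ((+) l) L L"
      by (rule bij_betw_byWitness[where f' = "\<lambda>y. y - l"]) (use l L_group in auto)
    from infsum_reindex_bij_betw[OF this, of "\<lambda>l. f (x + l)"] show ?thesis
      unfolding F_def by (simp add: add.assoc)
  qed
  have G_per: "G (x + l) = G x" if l: "l \<in> L" for x l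
    unfolding G_def by (intro infsum_cong) (simp add: lattice_char_periodic l)
  define H where "H = (\<lambda>x. of_real fund_area * F x - G x)"
  have "H x = 0"
  proof (rule Fourier_uniqueness[of H])
    show H: "continuous_on UNIV H" unfolding H_def by (intro continuous_intros F G)
    show "H (x + l) = H x" if "l \<in> L" for x l unfolding H_def using F_per G_per that by simp
    fix \<nu> assume \<nu>: "\<nu> \<in> ?D"
    have "(LINT x|lborel. indicat_real fund x *\<^sub>R (F x * lattice_char \<nu> x)) = (LINT x|lborel. indicat_real fund x *\<^sub>R (\<Sum>\<^sub>\<infinity>l\<in>L. f (x + l) * lattice_char \<nu> (x + l)))"
      unfolding F_def by (intro Bochner_Integration.integral_cong refl) (simp add: infsum_cmult_left'[symmetric] lattice_char_periodic[OF \<nu>] cong: infsum_cong)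
    also have "\<dots> = (LINT x|lborel. f x * lattice_char \<nu> x)"
    proof (rule unfold_integral[of "\<lambda>x. f x * lattice_char \<nu> x"])
      show "integrable lborel (\<lambda>x. f x * lattice_char \<nu> x)"
        by (rule Bochner_Integration.integrable_bound[OF f(2)]) (auto simp: norm_mult)
      show "(\<lambda>l. norm (f (x + l) * lattice_char \<nu> (x + l))) summable_on L" for x
        using pt[of x] by (simp add: norm_mult)
    qed
    also have "\<dots> = c (- \<nu>)" using c[of "- \<nu>"] dual_lattice_group(2)[OF \<nu>] by simp
    finally have cF: "(LINT x|lborel. indicat_real fund x *\<^sub>R (F x * lattice_char \<nu> x)) = c (- \<nu>)" .
    have "(LINT x|lborel. indicat_real fund x *\<^sub>R (G x * lattice_char \<nu> x)) =
        (LINT x|lborel. (\<Sum>\<^sub>\<infinity>\<mu>\<in>?D. indicat_real fund x *\<^sub>R (c \<mu> * lattice_char (\<mu> + \<nu>) x)))"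
      unfolding G_def by (simp add: infsum_cmult_left'[symmetric] infsum_scaleR_right[symmetric] lattice_char_add_left mult.assoc)
    also have "\<dots> = (\<Sum>\<^sub>\<infinity>\<mu>\<in>?D. LINT x|lborel. indicat_real fund x *\<^sub>R (c \<mu> * lattice_char (\<mu> + \<nu>) x))"
    proof (rule integral_infsum(1)[OF countable_dual])
      show "integrable lborel (\<lambda>x. indicat_real fund x *\<^sub>R (c \<mu> * lattice_char (\<mu> + \<nu>) x))" for \<mu>
        by (intro fund_integrable continuous_intros)
      show "(\<lambda>\<mu>. LINT x|lborel. norm (indicat_real fund x *\<^sub>R (c \<mu> * lattice_char (\<mu> + \<nu>) x))) summable_on ?D"
        using summable_on_cmult_right[OF sum, of fund_area] by (simp add: norm_mult fund_area_def mult.commute)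
      show "(\<lambda>\<mu>. norm (indicat_real fund x *\<^sub>R (c \<mu> * lattice_char (\<mu> + \<nu>) x))) summable_on ?D" for x
        using sum by (auto simp: norm_mult indicator_def)
    qed
    also have "\<dots> = (\<Sum>\<^sub>\<infinity>\<mu>\<in>?D. c \<mu> * (if \<mu> + \<nu> = 0 then of_real fund_area else 0))"
    proof (rule infsum_cong)
      fix \<mu> assume "\<mu> \<in> ?D"
      then have "(LINT x|lborel. indicat_real fund x *\<^sub>R lattice_char (\<mu> + \<nu>) x) = (if \<mu> + \<nu> = 0 then of_real fund_area else 0)"
        using \<nu> by (intro lattice_char_integral dual_lattice_group)
      then show "(LINT x|lborel. indicat_real fund x *\<^sub>R (c \<mu> * lattice_char (\<mu> + \<nu>) x)) = c \<mu> * (if \<mu> + \<nu> = 0 then of_real fund_area else 0)"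
        by (simp only: mult_scaleR_right[symmetric] integral_mult_right_zero)
    qed
    also have "\<dots> = c (- \<nu>) * of_real fund_area"
    proof -
      have "(\<Sum>\<^sub>\<infinity>\<mu>\<in>?D. c \<mu> * (if \<mu> + \<nu> = 0 then of_real fund_area else 0)) = (\<Sum>\<^sub>\<infinity>\<mu>\<in>{- \<nu>}. c \<mu> * (if \<mu> + \<nu> = 0 then of_real fund_area else 0))"
        using dual_lattice_group(2)[OF \<nu>] by (intro infsum_cong_neutral) (auto simp: eq_neg_iff_add_eq_0)
      then show ?thesis by simp
    qed
    finally have cG: "(LINT x|lborel. indicat_real fund x *\<^sub>R (G x * lattice_char \<nu> x)) = c (- \<nu>) * of_real fund_area" .
    have i: "integrable lborel (\<lambda>x. indicat_real fund x *\<^sub>R (F x * lattice_char \<nu> x))"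
      "integrable lborel (\<lambda>x. indicat_real fund x *\<^sub>R (G x * lattice_char \<nu> x))"
      by (intro fund_integrable continuous_intros F G)+
    have "(LINT x|lborel. indicat_real fund x *\<^sub>R (H x * lattice_char \<nu> x)) =
      (LINT x|lborel. of_real fund_area * (indicat_real fund x *\<^sub>R (F x * lattice_char \<nu> x)) - indicat_real fund x *\<^sub>R (G x * lattice_char \<nu> x))"
      unfolding H_def by (simp add: algebra_simps)
    also have "\<dots> = of_real fund_area * (LINT x|lborel. indicat_real fund x *\<^sub>R (F x * lattice_char \<nu> x))
        - (LINT x|lborel. indicat_real fund x *\<^sub>R (G x * lattice_char \<nu> x))"
      by (subst Bochner_Integration.integral_diff) (use i in \<open>auto simp del: mult_scaleR_right\<close>)
    also have "\<dots> = 0" unfolding cF cG by simp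
    finally show "(LINT x|lborel. indicat_real fund x *\<^sub>R (H x * lattice_char \<nu> x)) = 0" .
  qed
  then show ?thesis using fund_area_pos unfolding H_def F_def G_def by (simp add: field_simps)
qed

end

section \<open>Integrals over the real line\<close>

lemma of_real_powr_exp: "x > 0 \<Longrightarrow> of_real x powr s = exp (s * of_real (ln x) :: complex)"
  by (simp add: powr_def Ln_of_real)

lemma has_bochner_integral_lborel_if_absolutely:
  fixes f :: "real \<Rightarrow> complex"
  assumes "set_integrable lebesgue UNIV f" and [measurable]: "f \<in> borel_measurable borel"
  shows "has_bochner_integral lborel f (integral UNIV f)"
proof -
  have "integrable lebesgue f" using assms(1) by (simp add: set_integrable_def)
  then have i: "integrable lborel f" by (simp add: integrable_completion)
  moreover have "integral\<^sup>L lborel f = integral UNIV f"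
    using integral_unique[OF has_integral_integral_lborel[OF i]] by simp
  ultimately show ?thesis using has_bochner_integral_integrable by metis
qed

text \<open>Euler's integral in the variable \<open>v = exp u\<close>; the factor \<open>t\<close> becomes a translation by \<open>ln t\<close>.\<close>

lemma Gamma_exp_integral:
  assumes p: "Re p > 0" and t: "t > 0"
  shows "has_bochner_integral lborel (\<lambda>u. exp (p * of_real u) * of_real (exp (- t * exp u)))
           (Gamma p * of_real t powr (- p))"
proof -
  define h :: "real \<Rightarrow> complex" where "h = (\<lambda>u. exp (p * of_real u) * of_real (exp (- exp u)))"
  define g :: "real \<Rightarrow> complex" where "g = (\<lambda>v. of_real v powr (p - 1) / of_real (exp v))"
  have img: "exp ` UNIV = {0::real<..}" 
  proof -
    have "x \<in> range exp" if "x > 0" for x :: real using exp_ln[OF that] by (metis rangeI)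
    then show ?thesis by auto
  qed
  have "set_integrable lebesgue (exp ` UNIV) g" "integral (exp ` UNIV) g = Gamma p"
    unfolding img g_def using absolutely_integrable_Gamma_integral'[OF p] Gamma_integral_complex'[OF p]
    by (simp_all add: integral_unique)
  then have "set_integrable lebesgue UNIV (\<lambda>u. \<bar>exp u\<bar> *\<^sub>R g (exp u)) \<and> integral UNIV (\<lambda>u. \<bar>exp u\<bar> *\<^sub>R g (exp u)) = Gamma p"
    by (subst has_absolute_integral_change_of_variables_real)
       (auto intro!: derivative_eq_intros simp: inj_on_def)
  moreover have "\<bar>exp u\<bar> *\<^sub>R g (exp u) = h u" for u
  proof -
    have "of_real (exp u) * (of_real (exp u) powr (p - 1)) = exp (of_real u + (p - 1) * of_real u)"
      by (simp add: of_real_powr_exp exp_add exp_of_real)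
    also have "of_real u + (p - 1) * of_real u = p * of_real u" by (simp add: algebra_simps)
    finally show ?thesis unfolding g_def h_def
      by (simp add: scaleR_conv_of_real exp_minus field_simps)
  qed
  ultimately have h: "set_integrable lebesgue UNIV h" "integral UNIV h = Gamma p" by simp_all
  have [measurable]: "h \<in> borel_measurable borel" unfolding h_def
    by (intro borel_measurable_continuous_onI continuous_intros)
  have "has_bochner_integral lborel h (Gamma p)" using has_bochner_integral_lborel_if_absolutely[OF h(1)] h(2) by simp
  then have hi: "integrable lborel h" "integral\<^sup>L lborel h = Gamma p"
    by (auto simp: has_bochner_integral_iff)
  have "integrable lborel (\<lambda>u. h (u + ln t))" "integral\<^sup>L lborel (\<lambda>u. h (u + ln t)) = Gamma p"
    using lborel_integrable_translate[OF hi(1)] lborel_integral_translate[of h] hi(2) by auto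
  then have "has_bochner_integral lborel (\<lambda>u. h (u + ln t)) (Gamma p)"
    by (simp add: has_bochner_integral_iff)
  then have "has_bochner_integral lborel (\<lambda>u. h (u + ln t) * of_real t powr (- p)) (Gamma p * of_real t powr (- p))"
    by (rule has_bochner_integral_mult_left)
  moreover have "h (u + ln t) * of_real t powr (- p) = exp (p * of_real u) * of_real (exp (- t * exp u))" for u
    using t unfolding h_def
    by (simp add: of_real_powr_exp distrib_left exp_add exp_minus[of "p * of_real (ln t)"] mult_ac)
  ultimately show ?thesis by simp
qed

lemma Gamma_exp_integral_real:
  fixes p t :: real
  assumes "p > 0" "t > 0"
  shows "has_bochner_integral lborel (\<lambda>u. exp (p * u) * exp (- t * exp u)) (Gamma p * t powr (- p))"
proof -
  have "has_bochner_integral lborel (\<lambda>u. exp (of_real p * of_real u) * of_real (exp (- t * exp u)))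
           (Gamma (of_real p) * of_real t powr (- of_real p) :: complex)"
    by (rule Gamma_exp_integral) (use assms in auto)
  then have "has_bochner_integral lborel (\<lambda>u. Re (exp (of_real p * of_real u) * of_real (exp (- t * exp u))))
           (Re (Gamma (of_real p) * of_real t powr (- of_real p)))"
    by (rule has_bochner_integral_Re)
  moreover have "Gamma (of_real p) * of_real t powr (- of_real p) = (of_real (Gamma p * t powr (- p)) :: complex)"
    using assms by (simp add: Gamma_complex_of_real powr_of_real[symmetric])
  moreover have "exp (of_real p * of_real u) * of_real (exp (- t * exp u)) = (of_real (exp (p * u) * exp (- t * exp u)) :: complex)" for u
    by (simp add: exp_of_real[symmetric])
  ultimately show ?thesis by simp
qed

text \<open>Both exponentials in the exponent together beat any linear term, because
  \<open>exp \<bar>u\<bar> \<ge> u\<^sup>2 / 2\<close>.\<close>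

lemma exp_exp_integrable:
  fixes p a b :: real
  assumes a: "a > 0" and b: "b > 0"
  shows "integrable lborel (\<lambda>u. exp (p * u - a * exp u - b * exp (- u)))"
proof -
  define m where "m = min a b"
  have m: "m > 0" "m \<le> a" "m \<le> b" unfolding m_def using a b by auto
  have quad: "x\<^sup>2 / 2 \<le> exp x" if "x \<ge> 0" for x :: real
  proof -
    have "x\<^sup>2 / 2 \<le> (1 + x + x\<^sup>2 / 2)" using that by simp
    also have "\<dots> \<le> exp x" using exp_lower_Taylor_quadratic[OF that] by simp
    finally show ?thesis .
  qed
  have bound: "exp (p * u - a * exp u - b * exp (- u)) \<le> exp (p\<^sup>2 / m) * exp (- (m * u\<^sup>2 / 4))" for u
  proof -
    have "m * (u\<^sup>2 / 2) \<le> a * exp u + b * exp (- u)"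
    proof (cases "u \<ge> 0")
      case True
      have "m * (u\<^sup>2 / 2) \<le> a * exp u" using quad[OF True] m by (intro mult_mono) auto
      then show ?thesis using b by (smt (verit) mult_pos_pos exp_gt_zero)
    next
      case False
      then have "m * ((- u)\<^sup>2 / 2) \<le> b * exp (- u)" using quad[of "- u"] m by (intro mult_mono) auto
      then show ?thesis using a by (smt (verit) mult_pos_pos exp_gt_zero power2_minus)
    qed
    moreover have "p * u \<le> p\<^sup>2 / m + m * u\<^sup>2 / 4"
    proof -
      have "0 \<le> (p - m * u / 2)\<^sup>2 / m" using m by simp
      also have "\<dots> = p\<^sup>2 / m + m * u\<^sup>2 / 4 - p * u" using m by (simp add: power2_eq_square field_simps)
      finally show ?thesis by simp
    qed
    ultimately have "p * u - a * exp u - b * exp (- u) \<le> p\<^sup>2 / m + - (m * u\<^sup>2 / 4)" by (simp add: field_simps)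
    then show ?thesis by (subst exp_add[symmetric]) simp
  qed
  define sg where "sg = sqrt (2 / m)"
  have sg: "sg > 0" "sg\<^sup>2 = 2 / m" unfolding sg_def using m by auto
  have "integrable lborel (\<lambda>u. (exp (p\<^sup>2 / m) * sqrt (2 * pi * sg\<^sup>2)) * normal_density 0 sg u)"
    using integrable_normal_density[OF sg(1)] by simp
  then show ?thesis
  proof (rule Bochner_Integration.integrable_bound)
    show "AE u in lborel. norm (exp (p * u - a * exp u - b * exp (- u)))
        \<le> norm ((exp (p\<^sup>2 / m) * sqrt (2 * pi * sg\<^sup>2)) * normal_density 0 sg u)"
    proof (rule AE_I2)
      fix u
      have "(exp (p\<^sup>2 / m) * sqrt (2 * pi * sg\<^sup>2)) * normal_density 0 sg u = exp (p\<^sup>2 / m) * exp (- (m * u\<^sup>2 / 4))"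
        unfolding normal_density_def using sg m by (simp add: field_simps)
      then have "(exp (p\<^sup>2 / m) * sqrt (2 * pi * sg\<^sup>2)) * normal_density 0 sg u \<ge> exp (p * u - a * exp u - b * exp (- u))"
        using bound[of u] by (simp only:)
      then show "norm (exp (p * u - a * exp u - b * exp (- u)))
        \<le> norm ((exp (p\<^sup>2 / m) * sqrt (2 * pi * sg\<^sup>2)) * normal_density 0 sg u)"
        by simp
    qed
  qed simp
qed

section \<open>Holomorphic dependence on a parameter\<close>

text \<open>Cauchy's inequality bounds the difference quotients by the same function that bounds the
  integrand, so that dominated convergence applies to them.\<close>

lemma holomorphic_integral:
  fixes f :: "complex \<Rightarrow> 'a \<Rightarrow> complex"
  assumes U: "open U" and holo: "\<And>x. (\<lambda>y. f y x) holomorphic_on U"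
    and meas: "\<And>y. y \<in> U \<Longrightarrow> f y \<in> borel_measurable M"
    and dom: "\<And>y0. y0 \<in> U \<Longrightarrow> \<exists>r>0. \<exists>g. cball y0 r \<subseteq> U \<and> integrable M g \<and>
                 (\<forall>y\<in>cball y0 r. \<forall>x. norm (f y x) \<le> g x)"
  shows "(\<lambda>y. LINT x|M. f y x) holomorphic_on U"
proof (rule holomorphic_onI)
  fix y0 assume y0: "y0 \<in> U"
  obtain r g where r: "r > 0" "cball y0 r \<subseteq> U" and g: "integrable M g"
    and le: "\<And>y x. y \<in> cball y0 r \<Longrightarrow> norm (f y x) \<le> g x"
    using dom[OF y0] by blast
  define f' where "f' = (\<lambda>y x. deriv (\<lambda>y. f y x) y)"
  have der: "((\<lambda>y. f y x) has_field_derivative f' y x) (at y)" if "y \<in> U" for y x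
    unfolding f'_def using holomorphic_derivI[OF holo U that] .
  have int: "integrable M (f y)" if "y \<in> cball y0 r" for y
  proof (rule Bochner_Integration.integrable_bound[OF g])
    show "AE x in M. norm (f y x) \<le> norm (g x)"
      by (rule AE_I2, rule order_trans[OF le[OF that]]) simp
  qed (use that r meas in blast)
  have f'_le: "norm (f' y x) \<le> 2 / r * g x" if y: "y \<in> ball y0 (r / 2)" for y x
  proof -
    have sub: "cball y (r / 2) \<subseteq> cball y0 r"
    proof
      fix w assume "w \<in> cball y (r / 2)"
      then show "w \<in> cball y0 r" using y dist_triangle[of y0 w y] by (auto simp: dist_commute)
    qed
    have "norm ((deriv ^^ 1) (\<lambda>y. f y x) y) \<le> fact 1 * g x / (r / 2) ^ 1"
    proof (rule Cauchy_inequality)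
      show "(\<lambda>y. f y x) holomorphic_on ball y (r / 2)"
        using holomorphic_on_subset[OF holo] sub r ball_subset_cball by blast
      show "continuous_on (cball y (r / 2)) (\<lambda>y. f y x)"
        using holomorphic_on_imp_continuous_on[OF holo] sub r continuous_on_subset by (metis subset_trans)
      show "norm (f z x) \<le> g x" if "cmod (y - z) = r / 2" for z
        using sub that by (intro le) (auto simp: dist_norm)
    qed (use r in auto)
    then show ?thesis unfolding f'_def by (simp add: field_simps)
  qed
  have lip: "norm (f y x - f y0 x) \<le> 2 / r * g x * norm (y - y0)" if y: "y \<in> ball y0 (r / 2)" for y x
  proof (rule field_differentiable_bound[of "ball y0 (r / 2)" _ "\<lambda>y. f' y x"])
    show "((\<lambda>y. f y x) has_field_derivative f' z x) (at z within ball y0 (r / 2))" if "z \<in> ball y0 (r / 2)" for z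
      using that r by (intro has_field_derivative_at_within[OF der]) auto
  qed (use y r f'_le in auto)
  have "((\<lambda>y. ((LINT x|M. f y x) - (LINT x|M. f y0 x)) / (y - y0)) \<longlongrightarrow> (LINT x|M. f' y0 x)) (at y0)"
  proof (subst tendsto_at_iff_sequentially, intro allI impI)
    fix X :: "nat \<Rightarrow> complex" assume X: "\<forall>i. X i \<in> UNIV - {y0}" "X \<longlonglongrightarrow> y0"
    have "eventually (\<lambda>n. X n \<in> ball y0 (r / 2)) sequentially"
      using X(2) r by (intro topological_tendstoD) auto
    then obtain N where N: "\<And>n. n \<ge> N \<Longrightarrow> X n \<in> ball y0 (r / 2)" unfolding eventually_sequentially by blast
    define Y where "Y n = X (n + N)" for n
    have Y: "Y n \<in> ball y0 (r / 2)" "Y n \<noteq> y0" "Y \<longlonglongrightarrow> y0" for n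
      using N X(1) LIMSEQ_ignore_initial_segment[OF X(2)] unfolding Y_def by auto
    have Yc: "Y n \<in> cball y0 r" for n using Y(1)[of n] r by auto
    define q where "q n x = (f (Y n) x - f y0 x) / (Y n - y0)" for n x
    have lim: "(\<lambda>n. q n x) \<longlonglongrightarrow> f' y0 x" for x
    proof -
      have "((\<lambda>y. (f y x - f y0 x) / (y - y0)) \<longlongrightarrow> f' y0 x) (at y0)"
        using der[OF y0] unfolding has_field_derivative_iff .
      moreover have "filterlim Y (at y0) sequentially" using Y by (simp add: filterlim_at)
      ultimately show ?thesis unfolding q_def by (rule filterlim_compose)
    qed
    have qm: "q n \<in> borel_measurable M" for n
    proof -
      have [measurable]: "f (Y n) \<in> borel_measurable M" "f y0 \<in> borel_measurable M"
        using Yc r y0 by (auto intro!: meas)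
      show ?thesis unfolding q_def by measurable
    qed
    have "(\<lambda>n. LINT x|M. q n x) \<longlonglongrightarrow> (LINT x|M. f' y0 x)"
    proof (rule integral_dominated_convergence[where w = "\<lambda>x. 2 / r * g x"])
      show "f' y0 \<in> borel_measurable M"
        by (rule borel_measurable_LIMSEQ_metric[of q]) (use qm lim in auto)
      show "AE x in M. norm (q n x) \<le> 2 / r * g x" for n
        using lip[OF Y(1)[of n]] Y(2)[of n] unfolding q_def by (simp add: norm_divide divide_le_eq)
    qed (use qm lim g in auto)
    moreover have "(LINT x|M. q n x) = ((LINT x|M. f (Y n) x) - (LINT x|M. f y0 x)) / (Y n - y0)" for n
      unfolding q_def using int[OF Yc[of n]] int[of y0] r by simp
    ultimately have "(\<lambda>n. ((LINT x|M. f (X (n + N)) x) - (LINT x|M. f y0 x)) / (X (n + N) - y0)) \<longlonglongrightarrow> (LINT x|M. f' y0 x)"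
      unfolding Y_def by simp
    then have "(\<lambda>n. ((LINT x|M. f (X n) x) - (LINT x|M. f y0 x)) / (X n - y0)) \<longlonglongrightarrow> (LINT x|M. f' y0 x)"
      by (rule LIMSEQ_offset)
    then show "((\<lambda>y. ((LINT x|M. f y x) - (LINT x|M. f y0 x)) / (y - y0)) \<circ> X) \<longlonglongrightarrow> (LINT x|M. f' y0 x)"
      by (simp add: o_def)
  qed
  then have "((\<lambda>y. LINT x|M. f y x) has_field_derivative (LINT x|M. f' y0 x)) (at y0)"
    unfolding has_field_derivative_iff .
  then show "(\<lambda>y. LINT x|M. f y x) field_differentiable at y0 within U"
    using field_differentiable_at_within field_differentiable_def by blast
qed

section \<open>The modified Bessel function of the first kind\<close>

definition bessel_coeff :: "complex \<Rightarrow> nat \<Rightarrow> complex" where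
  "bessel_coeff s k = rGamma (s + of_nat k + 1) / fact k"

text \<open>The entire function \<open>H\<^sub>s\<close> with \<open>I\<^sub>s(x) = (x/2)\<^sup>s H\<^sub>s(x\<^sup>2)\<close>.\<close>

definition bessel_H :: "complex \<Rightarrow> complex \<Rightarrow> complex" where
  "bessel_H s q = (\<Sum>k. bessel_coeff s k * (q / 4) ^ k)"

lemma Gamma_plus1_pos: "Re z > 0 \<Longrightarrow> Gamma (z + 1) = z * Gamma z" "Re z > 0 \<Longrightarrow> z \<notin> \<int>\<^sub>\<le>\<^sub>0"
proof -
  show nn: "Re z > 0 \<Longrightarrow> z \<notin> \<int>\<^sub>\<le>\<^sub>0" by (auto elim!: nonpos_Ints_cases)
  then show "Re z > 0 \<Longrightarrow> Gamma (z + 1) = z * Gamma z" by (simp add: Gamma_plus1)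
qed

lemma bessel_coeff_Suc:
  assumes "Re s > 0"
  shows "of_nat (Suc k) * (s + of_nat (Suc k)) * bessel_coeff s (Suc k) = bessel_coeff s k"
proof -
  have "(s + of_nat k + 1) * rGamma (s + of_nat k + 1 + 1) = rGamma (s + of_nat k + 1)"
    by (rule rGamma_plus1)
  moreover have "s + of_nat (Suc k) = s + of_nat k + 1" by simp
  ultimately have "(s + of_nat (Suc k)) * rGamma (s + of_nat (Suc k) + 1) = rGamma (s + of_nat k + 1)" by (simp only:)
  moreover have "(fact (Suc k) :: complex) = of_nat (Suc k) * fact k" by simp
  moreover have "of_nat (Suc k) * x * (R / (of_nat (Suc k) * fact k)) = x * R / fact k" for x R :: complex
    by (simp del: of_nat_Suc)
  ultimately show ?thesis unfolding bessel_coeff_def by (simp only:)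
qed

lemma bessel_coeff_bound:
  assumes s: "Re s > 0"
  shows "norm (bessel_coeff s k) \<le> norm (rGamma (s + 1)) / (fact k)\<^sup>2"
proof (induction k)
  case 0
  then show ?case by (simp add: bessel_coeff_def)
next
  case (Suc k)
  have "real (Suc k) \<le> norm (s + of_nat (Suc k))"
    using complex_Re_le_cmod[of "s + of_nat (Suc k)"] s by simp
  then have "real (Suc k) * real (Suc k) * norm (bessel_coeff s (Suc k))
      \<le> real (Suc k) * norm (s + of_nat (Suc k)) * norm (bessel_coeff s (Suc k))"
    by (intro mult_right_mono mult_left_mono) auto
  also have "\<dots> = norm (bessel_coeff s k)"
    by (subst bessel_coeff_Suc[OF s, symmetric]) (simp add: norm_mult del: of_nat_Suc)
  also have "\<dots> \<le> norm (rGamma (s + 1)) / (fact k)\<^sup>2" by (rule Suc.IH)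
  finally have "norm (bessel_coeff s (Suc k)) \<le> norm (rGamma (s + 1)) / (fact k)\<^sup>2 / (real (Suc k) * real (Suc k))"
    by (subst pos_le_divide_eq) (simp_all add: mult_ac del: of_nat_Suc)
  then show ?case by (simp add: power2_eq_square mult_ac)
qed

text \<open>The recurrence divides by \<open>s + k + 1\<close>, whose absolute value is at least \<open>Re s + k + 1\<close>. This reduces
  absolute convergence for the order \<open>s\<close> to convergence for the order \<open>Re s\<close>, where all coefficients are
  positive.\<close>

lemma bessel_coeff_compare:
  assumes s: "Re s > 0"
  shows "norm (bessel_coeff s k) \<le> norm (rGamma (s + 1)) * Gamma (Re s + 1) * (rGamma (Re s + of_nat k + 1) / fact k)"
proof (induction k)
  case 0
  have "Gamma (Re s + 1) * rGamma (Re s + 1) = 1" using s by (simp add: rGamma_inverse_Gamma Gamma_eq_zero_iff nonpos_Ints_def)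
  then show ?case by (simp add: bessel_coeff_def mult.assoc)
next
  case (Suc k)
  have pos: "Re s + real (Suc k) > 0" using s by simp
  have "(Re s + real (Suc k)) * (real (Suc k) * norm (bessel_coeff s (Suc k)))
      \<le> norm (s + of_nat (Suc k)) * (real (Suc k) * norm (bessel_coeff s (Suc k)))"
    using complex_Re_le_cmod[of "s + of_nat (Suc k)"] by (intro mult_right_mono) auto
  also have "\<dots> = norm (bessel_coeff s k)"
    by (subst bessel_coeff_Suc[OF s, symmetric]) (simp add: norm_mult mult_ac del: of_nat_Suc)
  also have "\<dots> \<le> norm (rGamma (s + 1)) * Gamma (Re s + 1) * (rGamma (Re s + of_nat k + 1) / fact k)" by (rule Suc.IH)
  also have "rGamma (Re s + of_nat k + 1) = (Re s + real (Suc k)) * rGamma (Re s + of_nat (Suc k) + 1)"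
    using rGamma_plus1[of "Re s + of_nat k + 1"] by (simp add: algebra_simps)
  finally have "(Re s + real (Suc k)) * (real (Suc k) * norm (bessel_coeff s (Suc k)))
     \<le> (Re s + real (Suc k)) * (norm (rGamma (s + 1)) * Gamma (Re s + 1) * rGamma (Re s + of_nat (Suc k) + 1) / fact k)"
    by (simp add: mult_ac)
  then have "real (Suc k) * norm (bessel_coeff s (Suc k))
     \<le> norm (rGamma (s + 1)) * Gamma (Re s + 1) * rGamma (Re s + of_nat (Suc k) + 1) / fact k"
    by (rule mult_left_le_imp_le[OF _ pos])
  then have "norm (bessel_coeff s (Suc k))
     \<le> norm (rGamma (s + 1)) * Gamma (Re s + 1) * rGamma (Re s + of_nat (Suc k) + 1) / fact k / real (Suc k)"
    by (subst pos_le_divide_eq) (simp_all add: mult_ac del: of_nat_Suc)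
  then show ?case by (simp add: mult_ac del: of_nat_Suc)
qed

text \<open>With \<open>a k = (sqrt \<bar>q\<bar> / 2) ^ k / k!\<close>, the summands are bounded by a multiple of the squares of the \<open>a k\<close>,
  whose sum is at most the square of the sum of the \<open>a k\<close>. The growth of order \<open>1/2\<close> is slow enough for
  the integrals with \<open>x < X\<close> below.\<close>

lemma bessel_H_summable_bound:
  assumes s: "Re s > 0"
  shows "summable (\<lambda>k. norm (bessel_coeff s k * (q / 4) ^ k))"
    and "(\<Sum>k. norm (bessel_coeff s k * (q / 4) ^ k)) \<le> norm (rGamma (s + 1)) * exp (sqrt (norm q))"
    and "norm (bessel_H s q) \<le> norm (rGamma (s + 1)) * exp (sqrt (norm q))"
proof -
  define a where "a k = (sqrt (norm q) / 2) ^ k / fact k" for k :: nat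
  have a0: "a k \<ge> 0" for k unfolding a_def by simp
  have a_sums: "a sums exp (sqrt (norm q) / 2)"
    using exp_converges[of "sqrt (norm q) / 2"] unfolding a_def by (simp add: field_simps)
  have term_le: "norm (bessel_coeff s k * (q / 4) ^ k) \<le> norm (rGamma (s + 1)) * (a k)\<^sup>2" for k
  proof -
    have "(a k)\<^sup>2 = ((sqrt (norm q) / 2)\<^sup>2) ^ k / (fact k)\<^sup>2"
      unfolding a_def power_divide[of _ "fact k"] by (metis power_mult mult.commute)
    also have "(sqrt (norm q) / 2)\<^sup>2 = norm q / 4" by (simp add: power_divide)
    finally have "norm (rGamma (s + 1)) * (a k)\<^sup>2 = norm (rGamma (s + 1)) / (fact k)\<^sup>2 * norm ((q / 4) ^ k)"
      by (simp add: norm_power norm_divide)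
    then show ?thesis
      unfolding norm_mult using mult_right_mono[OF bessel_coeff_bound[OF s, of k], of "norm ((q / 4) ^ k)"] by simp
  qed
  have a_le: "a k \<le> exp (sqrt (norm q) / 2)" for k
    using sum_le_suminf[of a "{k}"] a_sums a0 by (auto simp: sums_iff)
  have sq_le: "(a k)\<^sup>2 \<le> a k * exp (sqrt (norm q) / 2)" for k
    unfolding power2_eq_square using a_le a0 by (intro mult_left_mono)
  have sq: "summable (\<lambda>k. (a k)\<^sup>2)"
    by (rule summable_comparison_test'[OF summable_mult2[OF sums_summable[OF a_sums]], of 0])
       (use sq_le in auto)
  then have sm: "summable (\<lambda>k. norm (rGamma (s + 1)) * (a k)\<^sup>2)" by (rule summable_mult)
  show 1: "summable (\<lambda>k. norm (bessel_coeff s k * (q / 4) ^ k))"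
    by (rule summable_comparison_test'[OF sm, of 0]) (use term_le in auto)
  have "(\<Sum>k. norm (bessel_coeff s k * (q / 4) ^ k)) \<le> (\<Sum>k. norm (rGamma (s + 1)) * (a k)\<^sup>2)"
    by (rule suminf_le[OF term_le 1 sm])
  also have "\<dots> = norm (rGamma (s + 1)) * (\<Sum>k. (a k)\<^sup>2)" by (rule suminf_mult[OF sq])
  also have "(\<Sum>k. (a k)\<^sup>2) \<le> (\<Sum>k. a k * exp (sqrt (norm q) / 2))"
    by (rule suminf_le[OF sq_le sq summable_mult2[OF sums_summable[OF a_sums]]])
  also have "\<dots> = exp (sqrt (norm q) / 2) * exp (sqrt (norm q) / 2)"
    using sums_mult2[OF a_sums] by (simp add: sums_iff)
  also have "\<dots> = exp (sqrt (norm q))" by (simp flip: exp_add)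
  finally show 2: "(\<Sum>k. norm (bessel_coeff s k * (q / 4) ^ k)) \<le> norm (rGamma (s + 1)) * exp (sqrt (norm q))"
    by (simp add: mult_left_mono)
  show "norm (bessel_H s q) \<le> norm (rGamma (s + 1)) * exp (sqrt (norm q))"
    unfolding bessel_H_def using summable_norm[OF 1] 2 by linarith
qed

lemma bessel_H_holomorphic: assumes s: "Re s > 0" shows "bessel_H s holomorphic_on A"
proof -
  have hol: "bessel_H s holomorphic_on ball 0 R" for R
  proof (rule power_series_holomorphic)
    fix w :: complex
    have "(\<lambda>n. bessel_coeff s n * (w / 4) ^ n) sums bessel_H s w"
      unfolding bessel_H_def using summable_norm_cancel[OF bessel_H_summable_bound(1)[OF s]] by (rule summable_sums)
    then show "(\<lambda>n. (bessel_coeff s n / 4 ^ n) * (w - 0) ^ n) sums bessel_H s w"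
      by (simp add: power_divide)
  qed
  have "bessel_H s field_differentiable at q" for q
    by (rule holomorphic_on_imp_differentiable_at[OF hol[of "norm q + 1"]]) simp_all
  then show ?thesis by (meson holomorphic_onI field_differentiable_at_within)
qed

lemma continuous_on_bessel_H [continuous_intros]:
  assumes "Re s > 0" "continuous_on A f" shows "continuous_on A (\<lambda>x. bessel_H s (f x))"
  using continuous_on_compose2[OF holomorphic_on_imp_continuous_on[OF bessel_H_holomorphic[OF assms(1), of UNIV]] assms(2)]
  by auto

lemma bessel_I_eq:
  assumes x: "x > 0" and s: "Re s > 0"
  shows "bessel_I s x = of_real (x / 2) powr s * bessel_H s (of_real (x\<^sup>2))"
proof -
  have "of_real (x / 2) powr (s + 2 * of_nat k) * rGamma (s + of_nat k + 1) / fact k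
      = of_real (x / 2) powr s * (bessel_coeff s k * (of_real (x\<^sup>2) / 4) ^ k)" for k
  proof -
    have "of_real (x / 2) powr (s + 2 * of_nat k) = of_real (x / 2) powr s * of_real (x / 2) powr (of_nat (2 * k))"
      using x by (simp add: powr_add)
    also have "of_real (x / 2) powr (of_nat (2 * k)) = (of_real (x / 2) :: complex) ^ (2 * k)"
      using x by (subst powr_nat') auto
    also have "\<dots> = (of_real (x\<^sup>2) / 4) ^ k" by (simp add: power_mult power_divide)
    finally show ?thesis by (simp add: bessel_coeff_def)
  qed
  then have "bessel_I s x = (\<Sum>k. of_real (x / 2) powr s * (bessel_coeff s k * (of_real (x\<^sup>2) / 4) ^ k))"
    unfolding bessel_I_def by simp
  also have "\<dots> = of_real (x / 2) powr s * bessel_H s (of_real (x\<^sup>2))"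
    unfolding bessel_H_def using summable_norm_cancel[OF bessel_H_summable_bound(1)[OF s]] by (rule suminf_mult)
  finally show ?thesis .
qed

lemma bessel_I_bound:
  assumes x: "x > 0" and s: "Re s > 0"
  shows "norm (bessel_I s x) \<le> norm (rGamma (s + 1)) * x powr Re s * exp x"
proof -
  have "norm (of_real (x / 2) powr s :: complex) = (x / 2) powr Re s" using x by (subst norm_powr_real_powr) auto
  also have "\<dots> \<le> x powr Re s" using x s by (intro powr_mono2) auto
  finally have 1: "norm (of_real (x / 2) powr s :: complex) \<le> x powr Re s" .
  have 2: "norm (bessel_H s (of_real (x\<^sup>2))) \<le> norm (rGamma (s + 1)) * exp x"
    using bessel_H_summable_bound(3)[OF s, of "of_real (x\<^sup>2)"] x by (simp add: norm_power real_sqrt_abs)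
  show ?thesis unfolding bessel_I_eq[OF x s] norm_mult using mult_mono[OF 1 2] by (simp add: mult_ac)
qed

section \<open>The Laplace transform of the Bessel function\<close>

lemma one_plus_csqrt_facts:
  assumes "norm (z::complex) < 1/4"
  shows "1 - 4 * z \<notin> \<real>\<^sub>\<le>\<^sub>0" "Re (csqrt (1 - 4 * z)) > 0" "csqrt (1 - 4 * z) \<noteq> 0"
    "1 + csqrt (1 - 4 * z) \<noteq> 0" "(1 + csqrt (1 - 4 * z)) / 2 \<notin> \<real>\<^sub>\<le>\<^sub>0"
    "4 * z = (1 - csqrt (1 - 4 * z)) * (1 + csqrt (1 - 4 * z))"
proof -
  let ?w = "1 - 4 * z"
  have "Re (4 * z) < 1" using complex_Re_le_cmod[of "4 * z"] assms by (simp add: norm_mult)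
  then have re: "Re ?w > 0" by simp
  then show "?w \<notin> \<real>\<^sub>\<le>\<^sub>0" by (auto simp: complex_nonpos_Reals_iff)
  have "cmod ?w + Re ?w > 0" using re by (intro add_nonneg_pos) auto
  then show pos: "Re (csqrt ?w) > 0" by (simp only: csqrt.sel) simp
  then show "csqrt ?w \<noteq> 0" by fastforce
  have "Re (1 + csqrt ?w) > 0" using pos by (simp del: csqrt.sel)
  then show "1 + csqrt ?w \<noteq> 0" by fastforce
  have "Re ((1 + csqrt ?w) / 2) > 0" using pos by (simp del: csqrt.sel)
  then show "(1 + csqrt ?w) / 2 \<notin> \<real>\<^sub>\<le>\<^sub>0" by (auto simp: complex_nonpos_Reals_iff simp del: Re_divide_numeral)
  have "csqrt ?w ^ 2 = ?w" by simp
  then show "4 * z = (1 - csqrt ?w) * (1 + csqrt ?w)" by (simp add: power2_eq_square algebra_simps)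
qed

text \<open>Let \<open>B\<close> and \<open>F\<close> be the two sums claimed. They satisfy \<open>F = 2 z B' + s B\<close> and
  \<open>z (1 - 4 z) F' = 2 (s + 1) z F - s F / 2 + s\<^sup>2 B / 2\<close>. Comparing the coefficients of these equations gives
  a two-term recurrence for those of \<open>B\<close>, which the coefficients on the left-hand side obey as well.\<close>

lemma Gamma_bessel_series:
  assumes s: "Re s > 0" and z: "norm (z::complex) < 1/4"
  shows "(\<lambda>k. Gamma (s + of_nat (2 * k)) * bessel_coeff s k * z ^ k) sums
            (((1 + csqrt (1 - 4 * z)) / 2) powr (- s) / s)" (is ?th1)
    and "(\<lambda>k. Gamma (s + of_nat (2 * k) + 1) * bessel_coeff s k * z ^ k) sums
            (((1 + csqrt (1 - 4 * z)) / 2) powr (- s) / csqrt (1 - 4 * z))" (is ?th2)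
proof -
  define t where "t z = csqrt (1 - 4 * z)" for z :: complex
  define p where "p z = ((1 + t z) / 2) powr (- s)" for z
  define B where "B z = p z / s" for z
  define F where "F z = p z / t z" for z
  have s0: "s \<noteq> 0" using s by auto
  note facts = one_plus_csqrt_facts[folded t_def]
  have dt: "(t has_field_derivative - 2 / t z) (at z)" if "norm z < 1/4" for z
    unfolding t_def using facts(1,3)[OF that]
    by (auto intro!: derivative_eq_intros DERIV_chain2[OF has_field_derivative_csqrt] simp: t_def field_simps)
  have dp: "(p has_field_derivative 2 * s * p z / ((1 + t z) * t z)) (at z)" if z: "norm z < 1/4" for z
  proof -
    have "((\<lambda>z. ((1 + t z) / 2) powr (- s)) has_field_derivative
        (- s * ((1 + t z) / 2) powr (- s - 1)) * ((- 2 / t z) / 2)) (at z)"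
      using facts(5)[OF z] dt[OF z]
      by (intro DERIV_chain2[OF has_field_derivative_powr]) (auto intro!: derivative_eq_intros)
    moreover have "((1 + t z) / 2) powr (- s - 1) = p z / ((1 + t z) / 2)"
      unfolding p_def using facts(4)[OF z] by (simp add: powr_diff)
    ultimately show ?thesis unfolding p_def using facts(3,4)[OF z] by (simp add: field_simps)
  qed
  have dB: "(B has_field_derivative 2 * p z / ((1 + t z) * t z)) (at z)" if z: "norm z < 1/4" for z
  proof -
    have "2 * s * p z / ((1 + t z) * t z) / s = 2 * p z / ((1 + t z) * t z)" using s0 by simp
    then show ?thesis using DERIV_cdivide[OF dp[OF z], of s] unfolding B_def by (simp only:)
  qed
  have dF: "(F has_field_derivative (2 * s * p z / ((1 + t z) * t z)) / t z + 2 * p z / (t z) ^ 3) (at z)" if z: "norm z < 1/4" for z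
  proof -
    have "(F has_field_derivative (2 * s * p z / ((1 + t z) * t z) * t z - p z * (- 2 / t z)) / (t z * t z)) (at z)"
      unfolding F_def using dp[OF z] dt[OF z] facts(3)[OF z] by (intro DERIV_divide) auto
    moreover have "(2 * s * a / (u * v) * v - a * (- 2 / v)) / (v * v) = (2 * s * a / (u * v)) / v + 2 * a / v ^ 3"
      if "u \<noteq> 0" "v \<noteq> 0" for a u v :: complex
      using that by (simp add: field_simps power3_eq_cube)
    from this[OF facts(4,3)[OF z]]
    have "(2 * s * p z / ((1 + t z) * t z) * t z - p z * (- 2 / t z)) / (t z * t z)
       = (2 * s * p z / ((1 + t z) * t z)) / t z + 2 * p z / (t z) ^ 3" .
    ultimately show ?thesis by simp
  qed
  have holo: "B holomorphic_on ball 0 (1/4)" "F holomorphic_on ball 0 (1/4)"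
    using dB dF by (auto simp: holomorphic_on_open intro!: exI)
  define FB where "FB = fps_expansion B 0"
  define FF where "FF = fps_expansion F 0"
  have eB: "B has_fps_expansion FB" and eF: "F has_fps_expansion FF"
    unfolding FB_def FF_def by (rule has_fps_expansion_fps_expansion[of "ball 0 (1/4)"]; use holo in simp)+
  have near: "eventually (\<lambda>z. z \<in> ball 0 (1/4)) (nhds (0::complex))"
    by (rule eventually_nhds_in_open) auto
  have eq1: "FF = 2 * fps_X * fps_deriv FB + fps_const s * FB"
  proof (rule fps_expansion_unique_complex[OF eF])
    have "(\<lambda>z. 2 * z * deriv B z + s * B z) has_fps_expansion 2 * fps_X * fps_deriv FB + fps_const s * FB"
      by (intro fps_expansion_intros eB)
    moreover have "eventually (\<lambda>z. 2 * z * deriv B z + s * B z = F z) (nhds 0)"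
      using near
    proof eventually_elim
      case (elim z)
      then have z: "norm z < 1/4" by simp
      have "2 * z * deriv B z + s * B z = (4 * z) * p z / ((1 + t z) * t z) + p z"
        using DERIV_imp_deriv[OF dB[OF z]] s0 by (simp add: B_def)
      also have "\<dots> = F z" 
      proof -
        have "(1 - T) * (1 + T) * a / ((1 + T) * T) + a = a / T" if "T \<noteq> 0" "1 + T \<noteq> 0" for a T :: complex
        proof -
          have "(1 - T) * (1 + T) * a / ((1 + T) * T) = (1 - T) * a / T" using that(2) by simp
          then show ?thesis using that(1) by (simp add: field_simps)
        qed
        from this[OF facts(3,4)[OF z]] show ?thesis unfolding F_def facts(6)[OF z] .
      qed
      finally show ?case .
    qed
    ultimately show "F has_fps_expansion 2 * fps_X * fps_deriv FB + fps_const s * FB"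
      by (subst (asm) has_fps_expansion_cong) auto
  qed
  have eq2: "fps_X * fps_deriv FF - 4 * (fps_X * (fps_X * fps_deriv FF)) =
      fps_const (2 * (s + 1)) * (fps_X * FF) - fps_const (s / 2) * FF + fps_const (s\<^sup>2 / 2) * FB"
  proof (rule fps_expansion_unique_complex)
    show "(\<lambda>z. z * deriv F z - 4 * (z * (z * deriv F z))) has_fps_expansion fps_X * fps_deriv FF - 4 * (fps_X * (fps_X * fps_deriv FF))"
      by (intro fps_expansion_intros eF)
    have "(\<lambda>z. (2 * (s + 1)) * (z * F z) - (s / 2) * F z + (s\<^sup>2 / 2) * B z) has_fps_expansion
       fps_const (2 * (s + 1)) * (fps_X * FF) - fps_const (s / 2) * FF + fps_const (s\<^sup>2 / 2) * FB"
      by (intro fps_expansion_intros eF eB)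
    moreover have "eventually (\<lambda>z. (2 * (s + 1)) * (z * F z) - (s / 2) * F z + (s\<^sup>2 / 2) * B z = z * deriv F z - 4 * (z * (z * deriv F z))) (nhds 0)"
      using near
    proof eventually_elim
      case (elim z)
      then have z: "norm z < 1/4" by simp
      define T where "T = t z"
      have "z = (4 * z) / 4" by simp
      also note facts(6)[OF z]
      finally have T: "T \<noteq> 0" "1 + T \<noteq> 0" "z = (1 - T) * (1 + T) / 4"
        using facts(3,4)[OF z] unfolding T_def by blast+
      have dFz: "deriv F z = (2 * s * p z / ((1 + T) * T)) / T + 2 * p z / T ^ 3"
        using DERIV_imp_deriv[OF dF[OF z]] unfolding T_def .
      have "z * deriv F z - 4 * (z * (z * deriv F z)) = z * (1 - 4 * z) * deriv F z" by (simp add: algebra_simps)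
      also have "1 - 4 * z = T * T" unfolding T(3) by (simp add: field_simps)
      also have "z * (T * T) * deriv F z = p z * (z * (2 * s / (1 + T) + 2 / T))"
      proof -
        have "z * (T * T) * ((2 * s * a / (u * T)) / T + 2 * a / T ^ 3) = a * (z * (2 * s / u + 2 / T))"
          if "u \<noteq> 0" for a u using that T(1) by (simp add: field_simps power3_eq_cube)
        from this[OF T(2)] show ?thesis unfolding dFz .
      qed
      also have "z * (2 * s / (1 + T) + 2 / T) = s * (1 - T) / 2 + (1 - T) * (1 + T) / (2 * T)"
      proof -
        have "(1 - T) * u / 4 * (2 * s / u + 2 / T) = s * (1 - T) / 2 + (1 - T) * u / (2 * T)"
          if "u \<noteq> 0" for u using that T(1) by (simp add: field_simps)
        from this[OF T(2)] show ?thesis unfolding T(3)[symmetric] .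
      qed
      also have "p z * (s * (1 - T) / 2 + (1 - T) * (1 + T) / (2 * T)) =
          (2 * (s + 1)) * (((1 - T) * (1 + T) / 4) * (p z / T)) - (s / 2) * (p z / T) + (s\<^sup>2 / 2) * (p z / s)"
        using T(1) s0 by (simp add: field_simps power2_eq_square)
      also have "\<dots> = (2 * (s + 1)) * (z * F z) - (s / 2) * F z + (s\<^sup>2 / 2) * B z"
        unfolding F_def B_def T_def[symmetric] T(3)[symmetric] by simp
      finally show ?case by simp
    qed
    ultimately show "(\<lambda>z. z * deriv F z - 4 * (z * (z * deriv F z))) has_fps_expansion
       fps_const (2 * (s + 1)) * (fps_X * FF) - fps_const (s / 2) * FF + fps_const (s\<^sup>2 / 2) * FB"
      by (subst (asm) has_fps_expansion_cong) auto
  qed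
  have c1: "fps_nth FF n = (2 * of_nat n + s) * fps_nth FB n" for n
  proof -
    have "fps_nth FF n = fps_nth (fps_const 2 * (fps_X * fps_deriv FB) + fps_const s * FB) n"
      unfolding eq1 by (simp add: mult.assoc numeral_fps_const)
    then show ?thesis by (cases n) (simp_all add: algebra_simps)
  qed
  have c2: "of_nat (Suc n) * (s + of_nat (Suc n)) * fps_nth FB (Suc n)
      = (s + of_nat (2 * n) + 1) * (s + of_nat (2 * n)) * fps_nth FB n" for n
  proof -
    have "fps_nth (fps_X * fps_deriv FF - fps_const 4 * (fps_X * (fps_X * fps_deriv FF))) (Suc n) =
      fps_nth (fps_const (2 * (s + 1)) * (fps_X * FF) - fps_const (s / 2) * FF + fps_const (s\<^sup>2 / 2) * FB) (Suc n)"
      using eq2 by (simp add: numeral_fps_const)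
    moreover have "fps_nth (fps_X * fps_deriv FF) n = of_nat n * fps_nth FF n"
      by (cases n) (simp_all add: algebra_simps)
    ultimately have "of_nat (Suc n) * fps_nth FF (Suc n) - 4 * (of_nat n * fps_nth FF n) =
      (2 * (s + 1)) * fps_nth FF n - (s / 2) * fps_nth FF (Suc n) + (s\<^sup>2 / 2) * fps_nth FB (Suc n)"
      by (simp only: fps_sub_nth fps_add_nth fps_mult_left_const_nth fps_X_mult_nth fps_deriv_nth)
         (cases n; simp del: of_nat_Suc)
    then show ?thesis unfolding c1 by (simp add: field_simps power2_eq_square) algebra
  qed
  have nthB: "fps_nth FB n = Gamma (s + of_nat (2 * n)) * bessel_coeff s n" for n
  proof (induction n)
    case 0
    have "fps_nth FB 0 = B 0" using has_fps_expansion_imp_0_eq_fps_nth_0[OF eB] by simp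
    also have "B 0 = 1 / s" unfolding B_def p_def t_def by simp
    also have "\<dots> = Gamma s * rGamma (s + 1)"
    proof -
      have "Gamma s * rGamma s = 1" using Gamma_plus1_pos(2)[OF s] rGamma_inverse_Gamma[of s]
        by (simp add: Gamma_eq_zero_iff)
      then have "Gamma s * (s * rGamma (s + 1)) = 1" unfolding rGamma_plus1 .
      then have "s * (Gamma s * rGamma (s + 1)) = 1" by (simp only: mult_ac)
      then show ?thesis using s0 by (simp add: field_simps)
    qed
    finally show ?case by (simp add: bessel_coeff_def)
  next
    case (Suc n)
    have G: "Gamma (s + of_nat (2 * Suc n)) = (s + of_nat (2 * n) + 1) * ((s + of_nat (2 * n)) * Gamma (s + of_nat (2 * n)))"
    proof -
      have "Gamma (s + of_nat (2 * n) + 1 + 1) = (s + of_nat (2 * n) + 1) * Gamma (s + of_nat (2 * n) + 1)"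
        by (rule Gamma_plus1_pos) (use s in simp)
      moreover have "Gamma (s + of_nat (2 * n) + 1) = (s + of_nat (2 * n)) * Gamma (s + of_nat (2 * n))"
        by (rule Gamma_plus1_pos) (use s in simp)
      moreover have "s + of_nat (2 * Suc n) = s + of_nat (2 * n) + 1 + 1" by simp
      ultimately show ?thesis by (simp only:)
    qed
    have ne: "of_nat (Suc n) * (s + of_nat (Suc n)) \<noteq> 0"
    proof -
      have "Re (s + of_nat (Suc n)) > 0" using s by simp
      then have "s + of_nat (Suc n) \<noteq> 0" by (metis less_irrefl zero_complex.sel(1))
      then show ?thesis by (simp del: of_nat_Suc)
    qed
    have "of_nat (Suc n) * (s + of_nat (Suc n)) * fps_nth FB (Suc n)
       = of_nat (Suc n) * (s + of_nat (Suc n)) * (Gamma (s + of_nat (2 * Suc n)) * bessel_coeff s (Suc n))"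
      unfolding c2 Suc.IH G bessel_coeff_Suc[OF s, of n, symmetric] by (simp add: mult_ac)
    then show ?case using ne by (metis mult_left_cancel)
  qed
  have zr: "ereal (cmod z) < ereal (1/4)" using z by simp
  have h2: "B holomorphic_on eball 0 (ereal (1/4))" "F holomorphic_on eball 0 (ereal (1/4))"
    using holo by (simp_all only: eball_ereal)
  have "(\<lambda>n. fps_nth FB n * z ^ n) sums B z" by (rule has_fps_expansion_imp_sums_complex[OF eB h2(1) zr])
  then show ?th1 unfolding nthB B_def p_def t_def .
  have nthF: "fps_nth FF n = Gamma (s + of_nat (2 * n) + 1) * bessel_coeff s n" for n
  proof -
    have "Gamma (s + of_nat (2 * n) + 1) = (s + of_nat (2 * n)) * Gamma (s + of_nat (2 * n))"
      by (rule Gamma_plus1_pos) (use s in simp)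
    then show ?thesis unfolding c1 nthB by (simp add: algebra_simps)
  qed
  have "(\<lambda>n. fps_nth FF n * z ^ n) sums F z" by (rule has_fps_expansion_imp_sums_complex[OF eF h2(2) zr])
  then show ?th2 unfolding nthF F_def p_def t_def .
qed

lemma continuous_on_bessel_I [continuous_intros]:
  fixes f :: "'a::topological_space \<Rightarrow> real"
  assumes s: "Re s > 0" and f: "continuous_on A f" "\<And>x. x \<in> A \<Longrightarrow> f x > 0"
  shows "continuous_on A (\<lambda>x. bessel_I s (f x))"
proof -
  have "continuous_on A (\<lambda>x. exp (s * of_real (ln (f x / 2))) * bessel_H s (of_real ((f x)\<^sup>2)))"
    using f(2) by (intro continuous_intros f(1) s) fastforce+
  moreover have "exp (s * of_real (ln (f x / 2))) * bessel_H s (of_real ((f x)\<^sup>2)) = bessel_I s (f x)" if "x \<in> A" for x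
    using f(2)[OF that] s by (simp add: bessel_I_eq of_real_powr_exp[symmetric])
  ultimately show ?thesis by (simp cong: continuous_on_cong)
qed

text \<open>Termwise integration of the power series of \<open>I\<^sub>s\<close>; absolute convergence is inherited from the series for
  the order \<open>Re s\<close>. The two values of \<open>e\<close> belong to the measures \<open>dv / v\<close> and \<open>dv\<close> with \<open>v = exp u\<close>.\<close>

lemma bessel_Laplace_series:
  assumes s: "Re s > 0" and T: "T > 1" and e: "e = 0 \<or> e = (1::real)"
  shows "integrable lborel (\<lambda>u. of_real (exp (e * u) * exp (- T * exp u)) * bessel_I s (exp u))"
    and "(\<lambda>k. of_real 2 powr (- s) * of_real T powr (- (s + of_real e)) *
             (Gamma (s + of_nat (2 * k) + of_real e) * bessel_coeff s k * of_real (1 / (4 * T\<^sup>2)) ^ k)) sums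
         (LINT u|lborel. of_real (exp (e * u) * exp (- T * exp u)) * bessel_I s (exp u))"
proof -
  define f :: "nat \<Rightarrow> real \<Rightarrow> complex" where
    "f k u = (of_real 2 powr (- s) * bessel_coeff s k / 4 ^ k) *
       (exp ((s + of_nat (2 * k) + of_real e) * of_real u) * of_real (exp (- T * exp u)))" for k u
  have pe: "Re (s + of_nat (2 * k) + of_real e) > 0" for k using s e by auto
  have hb: "has_bochner_integral lborel (f k) ((of_real 2 powr (- s) * bessel_coeff s k / 4 ^ k) *
      (Gamma (s + of_nat (2 * k) + of_real e) * of_real T powr (- (s + of_nat (2 * k) + of_real e))))" for k
    unfolding f_def using T by (intro has_bochner_integral_mult_right Gamma_exp_integral pe) auto
  have Tp: "of_real T powr (- (s + of_nat (2 * k) + of_real e)) = of_real T powr (- (s + of_real e)) * (1 / of_real (T\<^sup>2) ^ k :: complex)" for k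
  proof -
    have "of_real T powr (- (s + of_nat (2 * k) + of_real e)) = of_real T powr (- (s + of_real e) - of_nat (2 * k))"
      by (simp add: algebra_simps)
    also have "\<dots> = of_real T powr (- (s + of_real e)) / of_real T ^ (2 * k)"
    proof -
      have "of_real T powr (of_nat (2 * k)) = (of_real T :: complex) ^ (2 * k)" using T by (subst powr_nat') auto
      then show ?thesis by (simp only: powr_diff)
    qed
    finally show ?thesis by (simp add: power_mult)
  qed
  have ints: "integral\<^sup>L lborel (f k) = of_real 2 powr (- s) * of_real T powr (- (s + of_real e)) *
             (Gamma (s + of_nat (2 * k) + of_real e) * bessel_coeff s k * of_real (1 / (4 * T\<^sup>2)) ^ k)" for k
    using hb[of k] Tp[of k] by (simp add: has_bochner_integral_iff power_mult_distrib power_divide mult_ac)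
  have fsum: "(\<lambda>k. f k u) sums (of_real (exp (e * u) * exp (- T * exp u)) * bessel_I s (exp u))"
    "summable (\<lambda>k. norm (f k u))" for u
  proof -
    have feq: "f k u = (of_real (exp (e * u) * exp (- T * exp u)) * of_real (exp u / 2) powr s) * (bessel_coeff s k * (of_real ((exp u)\<^sup>2) / 4) ^ k)" for k
    proof -
      have "exp ((s + of_nat (2 * k) + of_real e) * of_real u) = exp (s * of_real u) * exp (of_nat (2 * k) * of_real u) * (of_real (exp (e * u)) :: complex)"
        by (simp add: exp_add[symmetric] exp_of_real[symmetric] algebra_simps)
      also have "exp (of_nat (2 * k) * of_real u) = (of_real ((exp u)\<^sup>2) :: complex) ^ k"
        by (simp only: exp_of_nat_mult exp_of_real power_mult of_real_power)
      finally have 1: "exp ((s + of_nat (2 * k) + of_real e) * of_real u) = exp (s * of_real u) * (of_real ((exp u)\<^sup>2) :: complex) ^ k * of_real (exp (e * u))" .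
      have "of_real (exp u / 2) powr s = exp (s * of_real u) * (of_real 2 powr (- s) :: complex)"
        by (simp only: of_real_powr_exp exp_gt_zero half_gt_zero zero_less_numeral) (simp add: ln_div algebra_simps flip: exp_add)
      then show ?thesis unfolding f_def 1 by (simp add: power_divide mult_ac)
    qed
    show "summable (\<lambda>k. norm (f k u))"
      unfolding feq norm_mult[of "_ * _ powr _"] by (rule summable_mult[OF bessel_H_summable_bound(1)[OF s]])
    have "(\<lambda>k. bessel_coeff s k * (of_real ((exp u)\<^sup>2) / 4) ^ k) sums bessel_H s (of_real ((exp u)\<^sup>2))"
      unfolding bessel_H_def using summable_norm_cancel[OF bessel_H_summable_bound(1)[OF s]] by (rule summable_sums)
    from sums_mult[OF this, of "of_real (exp (e * u) * exp (- T * exp u)) * of_real (exp u / 2) powr s"]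
    show "(\<lambda>k. f k u) sums (of_real (exp (e * u) * exp (- T * exp u)) * bessel_I s (exp u))"
      unfolding feq bessel_I_eq[OF exp_gt_zero s] by (simp add: mult.assoc)
  qed
  define \<sigma> where "\<sigma> = Re s"
  have \<sigma>: "\<sigma> > 0" "Re (of_real \<sigma>) > 0" using s unfolding \<sigma>_def by auto
  have z: "norm (of_real (1 / (4 * T\<^sup>2)) :: complex) < 1/4"
  proof -
    have "1 < T\<^sup>2" using T by (simp add: power2_eq_square less_1_mult)
    moreover have "\<bar>1 / (4 * a)\<bar> < 1 / 4" if "1 < a" for a :: real using that by (simp add: field_simps)
    ultimately show ?thesis unfolding norm_of_real by blast
  qed
  define g where "g k = Gamma (\<sigma> + of_nat (2 * k) + e) * (rGamma (\<sigma> + of_nat k + 1) / fact k) * (1 / (4 * T\<^sup>2)) ^ k" for k :: nat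
  have sg: "summable g"
  proof -
    have eq: "Gamma (of_real \<sigma> + of_nat (2 * k) + of_real e) * bessel_coeff (of_real \<sigma>) k * of_real (1 / (4 * T\<^sup>2)) ^ k = (of_real (g k) :: complex)" for k
    proof -
      have "of_real \<sigma> + of_nat (2 * k) + of_real e = (of_real (\<sigma> + of_nat (2 * k) + e) :: complex)" 
        "of_real \<sigma> + of_nat k + 1 = (of_real (\<sigma> + of_nat k + 1) :: complex)" by simp_all
      then show ?thesis unfolding g_def bessel_coeff_def
        by (simp only: Gamma_complex_of_real rGamma_complex_of_real of_real_mult of_real_divide of_real_power of_real_fact)
    qed
    have "summable (\<lambda>k. complex_of_real (g k))"
      unfolding eq[symmetric] using Gamma_bessel_series[OF \<sigma>(2) z] e by (auto simp: sums_iff)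
    then show ?thesis by (simp add: summable_of_real_iff)
  qed
  have norm_int: "summable (\<lambda>k. LINT u|lborel. norm (f k u))"
  proof -
    define C where "C = norm (of_real 2 powr (- s) :: complex) * (norm (rGamma (s + 1)) * Gamma (Re s + 1)) * T powr (- (\<sigma> + e))"
    have nf: "norm (f k u) = (norm (of_real 2 powr (- s) :: complex) * norm (bessel_coeff s k) / 4 ^ k) * (exp ((\<sigma> + of_nat (2 * k) + e) * u) * exp (- T * exp u))" for k u
      unfolding f_def by (simp add: norm_mult norm_divide norm_power \<sigma>_def)
    have "has_bochner_integral lborel (\<lambda>u. norm (f k u)) ((norm (of_real 2 powr (- s) :: complex) * norm (bessel_coeff s k) / 4 ^ k) * 
        (Gamma (\<sigma> + of_nat (2 * k) + e) * T powr (- (\<sigma> + of_nat (2 * k) + e))))" for k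
      unfolding nf using T \<sigma>(1) e by (intro has_bochner_integral_mult_right Gamma_exp_integral_real) auto
    then have val: "(LINT u|lborel. norm (f k u)) = (norm (of_real 2 powr (- s) :: complex) * norm (bessel_coeff s k) / 4 ^ k) * 
        (Gamma (\<sigma> + of_nat (2 * k) + e) * T powr (- (\<sigma> + of_nat (2 * k) + e)))" for k
      by (simp add: has_bochner_integral_iff)
    have "norm (LINT u|lborel. norm (f k u)) \<le> C * g k" for k
    proof -
      have Gp: "Gamma (\<sigma> + of_nat (2 * k) + e) > 0" using \<sigma> e by (intro Gamma_real_pos) auto
      have "T powr (- (\<sigma> + of_nat (2 * k) + e)) = T powr (- (\<sigma> + e)) / T powr (real (2 * k))"
        by (simp add: powr_diff[symmetric] algebra_simps)
      also have "T powr (real (2 * k)) = (T\<^sup>2) ^ k" using T by (subst powr_realpow) (auto simp: power_mult)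
      finally have Tr: "T powr (- (\<sigma> + of_nat (2 * k) + e)) = T powr (- (\<sigma> + e)) / (T\<^sup>2) ^ k" .
      have "norm (LINT u|lborel. norm (f k u)) = norm (bessel_coeff s k) * (norm (of_real 2 powr (- s) :: complex) / 4 ^ k *
         (Gamma (\<sigma> + of_nat (2 * k) + e) * (T powr (- (\<sigma> + e)) / (T\<^sup>2) ^ k)))"
        unfolding val Tr using Gp by (simp add: abs_mult mult_ac)
      also have "\<dots> \<le> (norm (rGamma (s + 1)) * Gamma (Re s + 1) * (rGamma (Re s + of_nat k + 1) / fact k)) * (norm (of_real 2 powr (- s) :: complex) / 4 ^ k *
         (Gamma (\<sigma> + of_nat (2 * k) + e) * (T powr (- (\<sigma> + e)) / (T\<^sup>2) ^ k)))"
        using Gp by (intro mult_right_mono bessel_coeff_compare s) auto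
      also have "\<dots> = C * g k" unfolding C_def g_def \<sigma>_def by (simp add: power_mult_distrib power_divide mult_ac)
      finally show ?thesis .
    qed
    then show ?thesis by (intro summable_comparison_test'[OF summable_mult[OF sg, of C], of 0]) auto
  qed
  have int_f: "integrable lborel (f k)" for k using hb[of k] by (simp add: has_bochner_integral_iff)
  have sm: "(\<Sum>k. f k u) = of_real (exp (e * u) * exp (- T * exp u)) * bessel_I s (exp u)" for u
    using fsum(1) by (simp add: sums_iff)
  have AEs: "AE u in lborel. summable (\<lambda>k. norm (f k u))" using fsum(2) by simp
  show "integrable lborel (\<lambda>u. of_real (exp (e * u) * exp (- T * exp u)) * bessel_I s (exp u))"
    using integrable_suminf[OF int_f AEs norm_int] unfolding sm .
  show "(\<lambda>k. of_real 2 powr (- s) * of_real T powr (- (s + of_real e)) *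
             (Gamma (s + of_nat (2 * k) + of_real e) * bessel_coeff s k * of_real (1 / (4 * T\<^sup>2)) ^ k)) sums
         (LINT u|lborel. of_real (exp (e * u) * exp (- T * exp u)) * bessel_I s (exp u))"
    using sums_integral[OF int_f AEs norm_int] unfolding sm ints .
qed

text \<open>The two series are evaluated at \<open>z = 1 / (4 T\<^sup>2)\<close>, where \<open>csqrt (1 - 4 z) = sqrt (T\<^sup>2 - 1) / T\<close>. The second
  integral is the Laplace transform of \<open>I\<^sub>s\<close>; the first one, with the measure \<open>dv / v\<close>, appears at the
  frequency \<open>0\<close> of the Poisson summation.\<close>

lemma bessel_Laplace:
  assumes s: "Re s > 0" and T: "T > 1"
  shows "(LINT u|lborel. of_real (exp (- T * exp u)) * bessel_I s (exp u)) = of_real (T + sqrt (T\<^sup>2 - 1)) powr (- s) / s"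
    and "(LINT u|lborel. of_real (exp u * exp (- T * exp u)) * bessel_I s (exp u)) = green_phi s T"
proof -
  have T2: "T\<^sup>2 > 1" using T by (simp add: power2_eq_square less_1_mult)
  have z: "norm (of_real (1 / (4 * T\<^sup>2)) :: complex) < 1/4"
  proof -
    have "\<bar>1 / (4 * a)\<bar> < 1 / 4" if "1 < a" for a :: real using that by (simp add: field_simps)
    from this[OF T2] show ?thesis unfolding norm_of_real .
  qed
  define r where "r = sqrt (1 - 1 / T\<^sup>2)"
  have r: "r > 0" "T * r = sqrt (T\<^sup>2 - 1)"
  proof -
    have "1 / a < 1" if "1 < a" for a :: real using that by (simp add: field_simps)
    from this[OF T2] have "1 / T\<^sup>2 < 1" .
    then show "r > 0" unfolding r_def by simp
    have "T * r = sqrt (T\<^sup>2) * sqrt (1 - 1 / T\<^sup>2)" unfolding r_def using T by simp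
    also have "\<dots> = sqrt (T\<^sup>2 - 1)" using T by (subst real_sqrt_mult[symmetric]) (simp add: field_simps)
    finally show "T * r = sqrt (T\<^sup>2 - 1)" .
  qed
  have cs: "csqrt (1 - 4 * of_real (1 / (4 * T\<^sup>2))) = of_real r"
  proof -
    have "1 - 4 * of_real (1 / (4 * T\<^sup>2)) = (of_real (1 - 1 / T\<^sup>2) :: complex)" by simp
    moreover have "1 - 1 / T\<^sup>2 \<ge> 0" using r(1) unfolding r_def by simp
    ultimately show ?thesis unfolding r_def by (simp only: of_real_sqrt)
  qed
  have comb: "of_real 2 powr (- s) * of_real T powr (- s) * ((1 + of_real r) / 2) powr (- s) = (of_real (T + sqrt (T\<^sup>2 - 1)) powr (- s) :: complex)"
  proof -
    have "(1 + of_real r) / 2 = (of_real ((1 + r) / 2) :: complex)" by simp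
    then have "of_real 2 powr (- s) * of_real T powr (- s) * ((1 + of_real r) / 2) powr (- s) =
        exp (- s * of_real (ln 2 + ln T + ln ((1 + r) / 2)))"
    proof -
      have "(of_real 2 :: complex) powr (- s) = exp (- s * of_real (ln 2))"
        "(of_real T :: complex) powr (- s) = exp (- s * of_real (ln T))"
        "(of_real ((1 + r) / 2) :: complex) powr (- s) = exp (- s * of_real (ln ((1 + r) / 2)))"
        by (rule of_real_powr_exp, use T r in simp)+
      moreover assume "(1 + of_real r) / 2 = (of_real ((1 + r) / 2) :: complex)"
      ultimately show ?thesis
        by (simp only: exp_add[symmetric] of_real_add distrib_left)
    qed
    also have "ln 2 + ln T + ln ((1 + r) / 2) = ln (2 * T * ((1 + r) / 2))"
      using T r by (simp add: ln_mult ln_div)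
    also have "2 * T * ((1 + r) / 2) = T + sqrt (T\<^sup>2 - 1)" using r(2) by (simp add: algebra_simps)
    also have "exp (- s * of_real (ln (T + sqrt (T\<^sup>2 - 1)))) = of_real (T + sqrt (T\<^sup>2 - 1)) powr (- s)"
      using T T2 by (subst of_real_powr_exp) (auto intro: add_pos_nonneg)
    finally show ?thesis .
  qed
  have "(\<lambda>k. of_real 2 powr (- s) * of_real T powr (- s) *
             (Gamma (s + of_nat (2 * k)) * bessel_coeff s k * of_real (1 / (4 * T\<^sup>2)) ^ k)) sums
         (of_real 2 powr (- s) * of_real T powr (- s) * (((1 + of_real r) / 2) powr (- s) / s))"
    using sums_mult[OF Gamma_bessel_series(1)[OF s z]] unfolding cs .
  then show "(LINT u|lborel. of_real (exp (- T * exp u)) * bessel_I s (exp u)) = of_real (T + sqrt (T\<^sup>2 - 1)) powr (- s) / s"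
    using bessel_Laplace_series(2)[OF s T, of 0] comb by (simp add: sums_unique2)
  have "(\<lambda>k. of_real 2 powr (- s) * of_real T powr (- (s + of_real 1)) *
             (Gamma (s + of_nat (2 * k) + of_real 1) * bessel_coeff s k * of_real (1 / (4 * T\<^sup>2)) ^ k)) sums
         (of_real 2 powr (- s) * of_real T powr (- (s + of_real 1)) * (((1 + of_real r) / 2) powr (- s) / of_real r))"
    using sums_mult[OF Gamma_bessel_series(2)[OF s z]] unfolding cs by simp
  moreover have "of_real 2 powr (- s) * of_real T powr (- (s + of_real 1)) * (((1 + of_real r) / 2) powr (- s) / of_real r) = green_phi s T"
  proof -
    have "of_real T powr (- (s + of_real 1)) = of_real T powr (- s) / (of_real T :: complex)"
      using T by (simp only: minus_add_distrib diff_conv_add_uminus[symmetric] powr_diff) simp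
    then have "of_real 2 powr (- s) * of_real T powr (- (s + of_real 1)) * (((1 + of_real r) / 2) powr (- s) / of_real r)
        = (of_real 2 powr (- s) * of_real T powr (- s) * ((1 + of_real r) / 2) powr (- s)) / (of_real (T * r) :: complex)"
      by (simp add: field_simps)
    also have "\<dots> = green_phi s T"
      unfolding comb r(2) green_phi_def using T2
      by (simp add: powr_minus powr_half_sqrt field_simps)
    finally show ?thesis .
  qed
  ultimately show "(LINT u|lborel. of_real (exp u * exp (- T * exp u)) * bessel_I s (exp u)) = green_phi s T"
    using bessel_Laplace_series(2)[OF s T, of 1] sums_unique2 by fastforce
qed

section \<open>The modified Bessel function of the second kind\<close>

text \<open>The moments \<open>M\<^sub>p\<close> of the kernel \<open>exp (- (w + X\<^sup>2 / w) / 2)\<close> in the variable \<open>w = exp u\<close>; they are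
  \<open>X powr (- p)\<close> times the Bessel function of the second kind of order \<open>p\<close>.\<close>

definition kernel_moment :: "real \<Rightarrow> complex \<Rightarrow> complex" where
  "kernel_moment X p = (1/2) * (LINT u|lborel. exp (- p * of_real u) * of_real (exp (- exp u / 2 - X\<^sup>2 * exp (- u) / 2)))"

lemma exp_kernel_integrable:
  assumes a: "a > 0" and b: "b > 0"
  shows "integrable lborel (\<lambda>u. exp (- p * of_real u) * of_real (exp (- a * exp u - b * exp (- u))) :: complex)"
proof (rule Bochner_Integration.integrable_bound[OF exp_exp_integrable[OF a b, of "- Re p"]])
  have "(\<lambda>u. exp (- p * of_real u) * of_real (exp (- a * exp u - b * exp (- u))) :: complex) \<in> borel_measurable borel"
    by (intro borel_measurable_continuous_onI continuous_intros)
  then show "(\<lambda>u. exp (- p * of_real u) * of_real (exp (- a * exp u - b * exp (- u))) :: complex) \<in> borel_measurable lborel"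
    by simp
  show "AE u in lborel. norm (exp (- p * of_real u) * of_real (exp (- a * exp u - b * exp (- u))) :: complex)
      \<le> norm (exp (- Re p * u - a * exp u - b * exp (- u)))"
  proof (rule AE_I2)
    fix u :: real
    have "norm (exp (- p * of_real u) * of_real (exp (- a * exp u - b * exp (- u))) :: complex)
      = exp (- Re p * u) * exp (- a * exp u - b * exp (- u))" by (simp add: norm_mult)
    also have "\<dots> = exp (- Re p * u - a * exp u - b * exp (- u))" by (simp flip: exp_add)
    finally show "norm (exp (- p * of_real u) * of_real (exp (- a * exp u - b * exp (- u))) :: complex)
      \<le> norm (exp (- Re p * u - a * exp u - b * exp (- u)))" by simp
  qed
qed

lemma kernel_integrable:
  assumes X: "X > 0"
  shows "integrable lborel (\<lambda>u. exp (- p * of_real u) * of_real (exp (- exp u / 2 - X\<^sup>2 * exp (- u) / 2)) :: complex)"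
  using exp_kernel_integrable[of "1/2" "X\<^sup>2 / 2" p] X by simp

lemma tendsto_exp_exp:
  assumes X: "X > 0"
  shows "((\<lambda>u. exp (- p * of_real u) * of_real (exp (- exp u / 2 - X\<^sup>2 * exp (- u) / 2)) :: complex) \<longlongrightarrow> 0) at_top"
    and "((\<lambda>u. exp (- p * of_real u) * of_real (exp (- exp u / 2 - X\<^sup>2 * exp (- u) / 2)) :: complex) \<longlongrightarrow> 0) at_bot"
proof -
  let ?F = "\<lambda>u. exp (- p * of_real u) * of_real (exp (- exp u / 2 - X\<^sup>2 * exp (- u) / 2)) :: complex"
  have n: "norm (?F u) = exp (- Re p * u - exp u / 2 - X\<^sup>2 * exp (- u) / 2)" for u
    by (simp add: norm_mult flip: exp_add)
  have "((\<lambda>u. exp (- Re p * u - exp u / 2 - X\<^sup>2 * exp (- u) / 2)) \<longlongrightarrow> 0) at_top" using X by real_asymp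
  then show "(?F \<longlongrightarrow> 0) at_top" using n tendsto_norm_zero_iff[of ?F at_top] by simp
  have "((\<lambda>u. exp (- Re p * u - exp u / 2 - X\<^sup>2 * exp (- u) / 2)) \<longlongrightarrow> 0) at_bot" using X by real_asymp
  then show "(?F \<longlongrightarrow> 0) at_bot" using n tendsto_norm_zero_iff[of ?F at_bot] by simp
qed

text \<open>The derivative of the integrand is a combination of the integrands for \<open>p - 1\<close>, \<open>p\<close> and \<open>p + 1\<close>, and its
  integral over the line is zero.\<close>

lemma kernel_moment_recurrence:
  assumes X: "X > 0"
  shows "kernel_moment X (p - 1) = of_real (X\<^sup>2) * kernel_moment X (p + 1) - 2 * p * kernel_moment X p"
proof -
  define F :: "complex \<Rightarrow> real \<Rightarrow> complex" where
    "F p u = exp (- p * of_real u) * of_real (exp (- exp u / 2 - X\<^sup>2 * exp (- u) / 2))" for p u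
  define F' where "F' u = - p * F p u - 1/2 * F (p - 1) u + of_real (X\<^sup>2 / 2) * F (p + 1) u" for u
  have intF: "integrable lborel (F p)" for p unfolding F_def by (rule kernel_integrable[OF X])
  have intF': "integrable lborel F'" unfolding F'_def
    by (intro Bochner_Integration.integrable_add Bochner_Integration.integrable_diff integrable_mult_right intF)
  have shift: "F (p - 1) u = of_real (exp u) * F p u" "F (p + 1) u = of_real (exp (- u)) * F p u" for u
    unfolding F_def by (simp_all add: algebra_simps exp_add exp_diff exp_minus exp_of_real field_simps)
  have der: "(F p has_vector_derivative F' u) (at u)" for u
  proof -
    define \<Phi> where "\<Phi> z = exp (- p * z) * exp (- exp z / 2 - of_real (X\<^sup>2) * exp (- z) / 2)" for z
    have F\<Phi>: "F p u = \<Phi> (of_real u)" for u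
      unfolding F_def \<Phi>_def by (simp add: exp_of_real[symmetric])
    have "(\<Phi> has_field_derivative (- p - exp z / 2 + of_real (X\<^sup>2) * exp (- z) / 2) * \<Phi> z) (at z)" for z
      unfolding \<Phi>_def by (auto intro!: derivative_eq_intros simp: algebra_simps)
    then have "((\<lambda>u. \<Phi> (of_real u)) has_vector_derivative (- p - exp (of_real u) / 2 + of_real (X\<^sup>2) * exp (- of_real u) / 2) * \<Phi> (of_real u)) (at u)"
      by (rule has_vector_derivative_real_field)
    moreover have "(\<lambda>u. \<Phi> (of_real u)) = F p" using F\<Phi> by (rule ext[OF sym])
    ultimately have "(F p has_vector_derivative (- p - exp (of_real u) / 2 + of_real (X\<^sup>2) * exp (- of_real u) / 2) * F p u) (at u)"
      by (simp only: F\<Phi>)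
    then show ?thesis unfolding F'_def shift
      by (simp add: exp_of_real[symmetric] algebra_simps)
  qed
  have "(LBINT u=-\<infinity>..\<infinity>. F' u) = 0 - 0"
  proof (rule interval_integral_FTC_integrable[where F = "F p"])
    have "continuous_on UNIV (\<lambda>u. F p u)" for p unfolding F_def by (intro continuous_intros) auto
    then have "continuous_on UNIV (\<lambda>u. F' u)" unfolding F'_def
      by (intro continuous_on_add continuous_on_diff continuous_on_mult continuous_on_const)
    then show "isCont F' u" for u by (simp add: continuous_on_eq_continuous_at)
    show "set_integrable lborel (einterval (- \<infinity>) \<infinity>) F'" using intF' by (simp add: set_integrable_def einterval_eq)
    show "((F p \<circ> real_of_ereal) \<longlongrightarrow> 0) (at_right (- \<infinity>))" "((F p \<circ> real_of_ereal) \<longlongrightarrow> 0) (at_left \<infinity>)"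
      using tendsto_exp_exp[OF X, of p] unfolding F_def ereal_tendsto_simps by simp_all
  qed (use der in auto)
  then have "integral\<^sup>L lborel F' = 0"
    by (simp add: interval_lebesgue_integral_def einterval_eq set_lebesgue_integral_def)
  moreover have "integral\<^sup>L lborel F' = - p * integral\<^sup>L lborel (F p) - 1/2 * integral\<^sup>L lborel (F (p - 1)) + of_real (X\<^sup>2 / 2) * integral\<^sup>L lborel (F (p + 1))"
    unfolding F'_def using intF by simp
  moreover have "integral\<^sup>L lborel (F p) = 2 * kernel_moment X p" for p unfolding kernel_moment_def F_def by simp
  ultimately show ?thesis by (simp add: field_simps)
qed

lemma lborel_integral_reflect:
  fixes f :: "real \<Rightarrow> complex"
  assumes [measurable]: "f \<in> borel_measurable borel"
  shows "(LINT u|lborel. f (- u)) = (LINT u|lborel. f u)"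
  by (subst (2) lborel_distr_uminus[symmetric]) (simp add: integral_distr)

lemma lborel_integrable_reflect:
  fixes f :: "real \<Rightarrow> complex"
  assumes "integrable lborel f"
  shows "integrable lborel (\<lambda>u. f (- u))"
proof -
  have [measurable]: "f \<in> borel_measurable borel" using assms by auto
  have "integrable (distr lborel borel uminus) f" using assms by (simp add: lborel_distr_uminus)
  then show ?thesis by (subst (asm) integrable_distr_eq) auto
qed

text \<open>\<open>cosh (s u)\<close> is the even part of \<open>exp (- s u)\<close>.\<close>

lemma bessel_K_full_line:
  assumes X: "X > 0"
  shows "integrable lborel (\<lambda>u. exp (- s * of_real u) * of_real (exp (- X * cosh u)))"
    and "bessel_K s X = (1/2) * (LINT u|lborel. exp (- s * of_real u) * of_real (exp (- X * cosh u)))"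
proof -
  define h :: "real \<Rightarrow> complex" where "h u = exp (- s * of_real u) * of_real (exp (- X * cosh u))" for u
  have h: "integrable lborel h"
    using exp_kernel_integrable[of "X / 2" "X / 2" s] X unfolding h_def cosh_def
    by (simp add: field_simps)
  then show "integrable lborel (\<lambda>u. exp (- s * of_real u) * of_real (exp (- X * cosh u)))" unfolding h_def .
  have [measurable]: "h \<in> borel_measurable borel" using h by auto
  define g where "g u = indicat_real {0..} u *\<^sub>R h u + indicat_real {0..} u *\<^sub>R h (- u)" for u
  have i1: "integrable lborel (\<lambda>u. indicat_real {0..} u *\<^sub>R h u)"
    by (rule Bochner_Integration.integrable_bound[OF h]) (auto simp: indicator_def)
  have i2: "integrable lborel (\<lambda>u. indicat_real {0..} (- u) *\<^sub>R h u)"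
    by (rule Bochner_Integration.integrable_bound[OF h]) (auto simp: indicator_def)
  have i3: "integrable lborel (\<lambda>u. indicat_real {0..} u *\<^sub>R h (- u))"
    using lborel_integrable_reflect[OF i2] by simp
  have "integral\<^sup>L lborel h = (LINT u|lborel. indicat_real {0..} u *\<^sub>R h u + indicat_real {0..} (- u) *\<^sub>R h u)"
  proof (rule integral_cong_AE)
    have "AE u in lborel. u \<noteq> (0::real)" using AE_lborel_singleton by blast
    then show "AE u in lborel. h u = indicat_real {0..} u *\<^sub>R h u + indicat_real {0..} (- u) *\<^sub>R h u"
      by eventually_elim (auto simp: indicator_def)
  qed auto
  also have "\<dots> = (LINT u|lborel. indicat_real {0..} u *\<^sub>R h u) + (LINT u|lborel. indicat_real {0..} (- u) *\<^sub>R h u)"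
    using i1 i2 by simp
  also have "(LINT u|lborel. indicat_real {0..} (- u) *\<^sub>R h u) = (LINT u|lborel. indicat_real {0..} u *\<^sub>R h (- u))"
    using lborel_integral_reflect[of "\<lambda>u. indicat_real {0..} u *\<^sub>R h (- u)"] by simp
  also have "(LINT u|lborel. indicat_real {0..} u *\<^sub>R h u) + \<dots> = (LINT u|lborel. indicat_real {0..} u *\<^sub>R h u + indicat_real {0..} u *\<^sub>R h (- u))"
    using i1 i3 by simp
  also have "\<dots> = (LINT u|lborel. 2 * (indicat_real {0..} u *\<^sub>R (of_real (exp (- X * cosh u)) * cosh (s * of_real u))))"
  proof (rule Bochner_Integration.integral_cong[OF refl])
    fix u :: real
    have "h u + h (- u) = 2 * (of_real (exp (- X * cosh u)) * cosh (s * of_real u))"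
      unfolding h_def by (simp add: cosh_def scaleR_conv_of_real algebra_simps)
    then show "indicat_real {0..} u *\<^sub>R h u + indicat_real {0..} u *\<^sub>R h (- u) = 2 * (indicat_real {0..} u *\<^sub>R (of_real (exp (- X * cosh u)) * cosh (s * of_real u)))"
      by (metis mult_scaleR_right scaleR_right_distrib)
  qed
  also have "\<dots> = 2 * bessel_K s X" unfolding bessel_K_def set_lebesgue_integral_def by (simp only: integral_mult_right_zero)
  finally show "bessel_K s X = (1/2) * (LINT u|lborel. exp (- s * of_real u) * of_real (exp (- X * cosh u)))"
    unfolding h_def by simp
qed

text \<open>The translation by \<open>ln X\<close> balances the two exponentials in the exponent.\<close>

lemma kernel_moment_eq_bessel_K:
  assumes X: "X > 0"
  shows "of_real X powr s * kernel_moment X s = bessel_K s X"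
proof -
  define h :: "real \<Rightarrow> complex" where "h u = exp (- s * of_real u) * of_real (exp (- exp u / 2 - X\<^sup>2 * exp (- u) / 2))" for u
  have [measurable]: "h \<in> borel_measurable borel" using kernel_integrable[OF X, of s] unfolding h_def by auto
  have "of_real X powr s * h (u + ln X) = exp (- s * of_real u) * of_real (exp (- X * cosh u))" for u
  proof -
    have 1: "of_real X powr s * exp (- s * of_real (u + ln X)) = exp (- s * of_real u)"
      unfolding of_real_powr_exp[OF X] exp_add[symmetric] by (simp add: algebra_simps)
    have "exp (u + ln X) = X * exp u" "exp (- (u + ln X)) = exp (- u) / X"
      using X by (simp_all add: exp_add exp_diff exp_minus field_simps)
    then have 2: "- exp (u + ln X) / 2 - X\<^sup>2 * exp (- (u + ln X)) / 2 = - X * cosh u"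
      using X by (simp add: cosh_def power2_eq_square field_simps)
    show ?thesis unfolding h_def 2 using 1 by (simp only: mult.assoc[symmetric])
  qed
  then have "(LINT u|lborel. of_real X powr s * h (u + ln X)) = 2 * bessel_K s X"
    using bessel_K_full_line(2)[OF X, of s] by (simp only:) simp
  then have "of_real X powr s * (LINT u|lborel. h u) = 2 * bessel_K s X"
    using lborel_integral_translate[of h "ln X"] by simp
  then show ?thesis unfolding kernel_moment_def h_def[symmetric] by simp
qed

text \<open>Since \<open>cosh u \<ge> 1\<close>, the exponential decay of the Bessel function can be split off.\<close>

lemma bessel_K_bound:
  assumes x0: "x0 > 0"
  shows "\<exists>C\<ge>0. \<forall>x\<ge>x0. norm (bessel_K s x) \<le> C * exp (- x)"
proof -
  define g where "g u = exp (- Re s * u) * exp (- x0 * (cosh u - 1))" for u :: real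
  have g: "integrable lborel g"
  proof -
    have "integrable lborel (\<lambda>u. norm (exp (- s * of_real u) * of_real (exp (- x0 * cosh u)) :: complex) * exp x0)"
      using integrable_norm[OF bessel_K_full_line(1)[OF x0, of s]] by simp
    moreover have "norm (exp (- s * of_real u) * of_real (exp (- x0 * cosh u)) :: complex) * exp x0 = g u" for u
      unfolding g_def by (simp add: norm_mult algebra_simps flip: exp_add)
    ultimately show ?thesis by (simp only:)
  qed
  have "norm (bessel_K s x) \<le> (1/2 * integral\<^sup>L lborel g) * exp (- x)" if x: "x \<ge> x0" for x
  proof -
    have xp: "x > 0" using x x0 by simp
    have "norm (bessel_K s x) = 1/2 * norm (LINT u|lborel. exp (- s * of_real u) * of_real (exp (- x * cosh u)) :: complex)"
      unfolding bessel_K_full_line(2)[OF xp] norm_mult by simp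
    also have "\<dots> \<le> 1/2 * (LINT u|lborel. norm (exp (- s * of_real u) * of_real (exp (- x * cosh u)) :: complex))"
      by (intro mult_left_mono integral_norm_bound) simp
    also have "(LINT u|lborel. norm (exp (- s * of_real u) * of_real (exp (- x * cosh u)) :: complex)) \<le> (LINT u|lborel. g u * exp (- x))"
    proof (rule integral_mono)
      show "integrable lborel (\<lambda>u. norm (exp (- s * of_real u) * of_real (exp (- x * cosh u)) :: complex))"
        by (rule integrable_norm[OF bessel_K_full_line(1)[OF xp]])
      fix u :: real
      have "x0 * (cosh u - 1) \<le> x * (cosh u - 1)" using x cosh_real_ge_1[of u] by (intro mult_right_mono) auto
      then have "exp (- x * cosh u) \<le> exp (- x0 * (cosh u - 1)) * exp (- x)"
        by (simp add: algebra_simps flip: exp_add)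
      then show "norm (exp (- s * of_real u) * of_real (exp (- x * cosh u)) :: complex) \<le> g u * exp (- x)"
        unfolding g_def by (simp add: norm_mult)
    qed (use g in simp)
    finally show ?thesis by simp
  qed
  moreover have "0 \<le> 1/2 * integral\<^sup>L lborel g" by (simp add: g_def)
  ultimately show ?thesis by blast
qed

section \<open>The product formula for the two Bessel functions\<close>

text \<open>Let \<open>v = exp (- u)\<close>. In the power series of \<open>exp (- y v / 2) H\<^sub>s(X\<^sup>2 v\<^sup>2 y)\<close> the coefficient of \<open>y ^ n\<close> is
  the sum over \<open>k\<close> of \<open>mixed_coeff s n k * (X\<^sup>2 / 4) ^ k * v ^ (n + k)\<close>, so integration against the kernel
  turns it into a combination of moments.\<close>

definition mixed_coeff :: "complex \<Rightarrow> nat \<Rightarrow> nat \<Rightarrow> complex" where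
  "mixed_coeff s n k = (if k \<le> n then (- 1/2) ^ (n - k) / fact (n - k) * bessel_coeff s k else 0)"

lemma mixed_coeff_recurrence:
  assumes s: "Re s > 0" and k: "k \<le> Suc n"
  shows "4 * of_nat (Suc n) * (s + of_nat (Suc n)) * mixed_coeff s (Suc n) k =
    (if k = 0 then 0 else 4 * mixed_coeff s n (k - 1)) - 2 * (s + of_nat (n + k + 1)) * mixed_coeff s n k"
proof (cases "k = Suc n")
  case True
  have "mixed_coeff s (Suc n) (Suc n) = bessel_coeff s (Suc n)" "mixed_coeff s n (Suc n) = 0"
    "mixed_coeff s n n = bessel_coeff s n"
    unfolding mixed_coeff_def by simp_all
  then show ?thesis using True bessel_coeff_Suc[OF s, of n] by (simp add: mult.assoc del: of_nat_Suc)
next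
  case False
  define m where "m = n - k"
  have n: "n = k + m" using False k unfolding m_def by simp
  define c where "c = (- 1/2 :: complex) ^ m / fact m"
  have c': "(- 1/2 :: complex) ^ Suc m / fact (Suc m) = - c / (2 * of_nat (Suc m))"
    unfolding c_def by (simp add: field_simps del: of_nat_Suc)
  have m0: "(of_nat (Suc m) :: complex) \<noteq> 0" by (simp del: of_nat_Suc)
  have A: "mixed_coeff s (Suc n) k = - c / (2 * of_nat (Suc m)) * bessel_coeff s k"
    unfolding mixed_coeff_def c'[symmetric] using n by (simp add: Suc_diff_le)
  have B: "mixed_coeff s n k = c * bessel_coeff s k" unfolding mixed_coeff_def c_def using n by simp
  show ?thesis
  proof (cases k)
    case 0
    then show ?thesis unfolding A B using m0 n by (simp add: field_simps del: of_nat_Suc)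
  next
    case (Suc j)
    have C: "mixed_coeff s n j = - c / (2 * of_nat (Suc m)) * (of_nat (Suc j) * (s + of_nat (Suc j)) * bessel_coeff s k)"
    proof -
      have "mixed_coeff s n j = (- 1/2) ^ Suc m / fact (Suc m) * bessel_coeff s j"
        unfolding mixed_coeff_def using n Suc by simp
      then show ?thesis unfolding c' Suc using bessel_coeff_Suc[OF s, of j] by simp
    qed
    have "4 * of_nat (Suc n) * (s + of_nat (Suc n)) =
      4 * (of_nat (Suc j) * (s + of_nat (Suc j))) + 4 * of_nat (Suc m) * (s + of_nat (n + k + 1) :: complex)"
      using n Suc by (simp add: algebra_simps)
    then have "4 * of_nat (Suc n) * (s + of_nat (Suc n)) * (- c / (2 * of_nat (Suc m)) * bessel_coeff s k) =
      (4 * (of_nat (Suc j) * (s + of_nat (Suc j))) + 4 * of_nat (Suc m) * (s + of_nat (n + k + 1))) * (- c / (2 * of_nat (Suc m)) * bessel_coeff s k)"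
      by (simp only:)
    also have "\<dots> = 4 * (- c / (2 * of_nat (Suc m)) * (of_nat (Suc j) * (s + of_nat (Suc j)) * bessel_coeff s k))
        - 2 * (s + of_nat (n + k + 1)) * (c * bessel_coeff s k)"
      using m0 by (simp add: field_simps del: of_nat_Suc of_nat_add)
    finally show ?thesis unfolding A B using C Suc by simp
  qed
qed

definition kernel_coeff :: "complex \<Rightarrow> real \<Rightarrow> nat \<Rightarrow> complex" where
  "kernel_coeff s X n = (\<Sum>k\<le>n. mixed_coeff s n k * of_real (X\<^sup>2 / 4) ^ k * kernel_moment X (s + of_nat (n + k)))"

text \<open>The recurrence of the moments splits each moment in the sum into two neighbouring ones; after a shift of the
  index the recurrence of the mixed coefficients puts them together again.\<close>

lemma kernel_coeff_Suc:
  assumes s: "Re s > 0" and X: "X > 0"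
  shows "4 * of_nat (Suc n) * (s + of_nat (Suc n)) * kernel_coeff s X (Suc n) = kernel_coeff s X n"
proof -
  define y where "y = (of_real (X\<^sup>2 / 4) :: complex)"
  define M where "M k = kernel_moment X (s + of_nat (n + k + 1))" for k
  have rec: "kernel_moment X (s + of_nat (n + k)) = 4 * y * M (Suc k) - 2 * (s + of_nat (n + k + 1)) * M k" for k
    using kernel_moment_recurrence[OF X, of "s + of_nat (n + k + 1)"] unfolding M_def y_def
    by (simp add: algebra_simps)
  have "kernel_coeff s X n = (\<Sum>k\<le>n. 4 * mixed_coeff s n k * y ^ Suc k * M (Suc k)) - (\<Sum>k\<le>n. 2 * (s + of_nat (n + k + 1)) * mixed_coeff s n k * y ^ k * M k)"
    unfolding kernel_coeff_def rec y_def[symmetric] sum_subtractf[symmetric]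
    by (intro sum.cong refl) (simp add: algebra_simps)
  also have "(\<Sum>k\<le>n. 4 * mixed_coeff s n k * y ^ Suc k * M (Suc k)) = (\<Sum>k\<le>Suc n. (if k = 0 then 0 else 4 * mixed_coeff s n (k - 1)) * y ^ k * M k)"
    by (subst sum.atMost_Suc_shift) simp
  also have "(\<Sum>k\<le>n. 2 * (s + of_nat (n + k + 1)) * mixed_coeff s n k * y ^ k * M k) = (\<Sum>k\<le>Suc n. 2 * (s + of_nat (n + k + 1)) * mixed_coeff s n k * y ^ k * M k)"
    by (simp add: mixed_coeff_def)
  also have "(\<Sum>k\<le>Suc n. (if k = 0 then 0 else 4 * mixed_coeff s n (k - 1)) * y ^ k * M k) - \<dots> =
     (\<Sum>k\<le>Suc n. (4 * of_nat (Suc n) * (s + of_nat (Suc n)) * mixed_coeff s (Suc n) k) * y ^ k * M k)"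
    unfolding sum_subtractf[symmetric]
  proof (rule sum.cong[OF refl])
    fix k assume "k \<in> {..Suc n}"
    then have "k \<le> Suc n" by simp
    from mixed_coeff_recurrence[OF s this]
    show "(if k = 0 then 0 else 4 * mixed_coeff s n (k - 1)) * y ^ k * M k - 2 * (s + of_nat (n + k + 1)) * mixed_coeff s n k * y ^ k * M k
       = (4 * of_nat (Suc n) * (s + of_nat (Suc n)) * mixed_coeff s (Suc n) k) * y ^ k * M k"
      by (simp only:) (simp only: left_diff_distrib)
  qed
  also have "\<dots> = 4 * of_nat (Suc n) * (s + of_nat (Suc n)) * kernel_coeff s X (Suc n)"
    unfolding kernel_coeff_def y_def M_def sum_distrib_left by (intro sum.cong refl) (simp add: mult_ac)
  finally show ?thesis by simp
qed

text \<open>The integrated coefficients obey the recurrence of the coefficients of \<open>H\<^sub>s\<close>, so the two power series are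
  proportional.\<close>

lemma kernel_coeff_eq:
  assumes s: "Re s > 0" and X: "X > 0"
  shows "kernel_coeff s X n = bessel_coeff s n / 4 ^ n * kernel_moment X s"
proof (induction n)
  case 0
  then show ?case by (simp add: kernel_coeff_def mixed_coeff_def)
next
  case (Suc n)
  have "Re (s + of_nat (Suc n)) > 0" using s by simp
  then have "s + of_nat (Suc n) \<noteq> 0" by (metis less_irrefl zero_complex.sel(1))
  then have ne: "4 * of_nat (Suc n) * (s + of_nat (Suc n)) \<noteq> 0" by (simp del: of_nat_Suc)
  have "4 * of_nat (Suc n) * (s + of_nat (Suc n)) * kernel_coeff s X (Suc n)
    = 4 * of_nat (Suc n) * (s + of_nat (Suc n)) * (bessel_coeff s (Suc n) / 4 ^ Suc n * kernel_moment X s)"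
    unfolding kernel_coeff_Suc[OF s X] Suc.IH bessel_coeff_Suc[OF s, of n, symmetric] by (simp del: of_nat_Suc)
  then show ?case using ne by (metis mult_left_cancel)
qed

text \<open>For \<open>y = x\<^sup>2\<close> this is the integrand of the product formula up to a constant factor. The complex variable
  \<open>y\<close> makes analytic continuation available.\<close>

definition product_kernel :: "complex \<Rightarrow> real \<Rightarrow> complex \<Rightarrow> real \<Rightarrow> complex" where
  "product_kernel s X y u = exp (- s * of_real u) * of_real (exp (- exp u / 2 - X\<^sup>2 * exp (- u) / 2)) *
     (exp (- y * of_real (exp (- u) / 2)) * bessel_H s (of_real (X\<^sup>2 * exp (- 2 * u)) * y))"

definition product_bound :: "complex \<Rightarrow> real \<Rightarrow> real \<Rightarrow> real" where
  "product_bound s d u = norm (rGamma (s + 1)) * exp (- Re s * u - 1/2 * exp u - d * exp (- u))"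

lemma product_bound_integrable: "d > 0 \<Longrightarrow> integrable lborel (product_bound s d)"
  unfolding product_bound_def[abs_def] by (intro integrable_mult_right exp_exp_integrable) auto

lemma exp_sqrt_kernel: 
  assumes X: "X > 0"
  shows "sqrt (norm (of_real (X\<^sup>2 * exp (- 2 * u)) * y :: complex)) = X * sqrt (norm y) * exp (- u)"
proof -
  have "exp (- 2 * u) = (exp (- u))\<^sup>2" by (simp add: power2_eq_square flip: exp_add)
  then show ?thesis using X by (simp add: norm_mult real_sqrt_mult norm_power)
qed

text \<open>The growth of \<open>H\<^sub>s\<close> contributes \<open>X sqrt \<bar>y\<bar> exp (- u)\<close> to the exponent, which is weaker than the decay of
  the kernel as long as \<open>X\<^sup>2 + Re y - 2 X sqrt \<bar>y\<bar>\<close> is positive.\<close>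

lemma product_kernel_bound:
  assumes s: "Re s > 0" and X: "X > 0" and d: "2 * d \<le> X\<^sup>2 + Re y - 2 * X * sqrt (norm y)"
  shows "norm (product_kernel s X y u) \<le> product_bound s d u"
proof -
  have "norm (product_kernel s X y u) = exp (- Re s * u) * exp (- exp u / 2 - X\<^sup>2 * exp (- u) / 2) * (exp (- Re y * (exp (- u) / 2)) * norm (bessel_H s (of_real (X\<^sup>2 * exp (- 2 * u)) * y)))"
    unfolding product_kernel_def norm_mult norm_exp_eq_Re by simp
  also have "\<dots> \<le> exp (- Re s * u) * exp (- exp u / 2 - X\<^sup>2 * exp (- u) / 2) * (exp (- Re y * (exp (- u) / 2)) * (norm (rGamma (s + 1)) * exp (X * sqrt (norm y) * exp (- u))))"
    using bessel_H_summable_bound(3)[OF s, of "of_real (X\<^sup>2 * exp (- 2 * u)) * y"] unfolding exp_sqrt_kernel[OF X]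
    by (intro mult_left_mono) auto
  also have "\<dots> = norm (rGamma (s + 1)) * exp (- Re s * u - 1/2 * exp u - (X\<^sup>2 + Re y - 2 * X * sqrt (norm y)) / 2 * exp (- u))"
    by (simp add: exp_add[symmetric] exp_diff[symmetric] algebra_simps add_divide_distrib diff_divide_distrib)
       (simp add: exp_add[symmetric] algebra_simps)?
  also have "\<dots> \<le> product_bound s d u"
    unfolding product_bound_def using d by (intro mult_left_mono) (auto intro!: mult_right_mono)
  finally show ?thesis .
qed

lemma product_kernel_measurable [measurable]:
  assumes s: "Re s > 0" shows "product_kernel s X y \<in> borel_measurable borel"
proof -
  have c1: "continuous_on UNIV (\<lambda>u. bessel_H s (of_real (X\<^sup>2 * exp (- 2 * u)) * y))"
    by (rule continuous_on_bessel_H[OF s]) (intro continuous_intros)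
  have c2: "continuous_on UNIV (\<lambda>u. exp (- s * of_real u) * of_real (exp (- exp u / 2 - X\<^sup>2 * exp (- u) / 2)) :: complex)"
    and c3: "continuous_on UNIV (\<lambda>u. exp (- y * of_real (exp (- u) / 2)))"
    by (intro continuous_intros; simp)+
  show ?thesis unfolding product_kernel_def[abs_def]
    by (rule borel_measurable_continuous_onI[OF continuous_on_mult[OF c2 continuous_on_mult[OF c3 c1]]])
qed

text \<open>The second condition makes the integral converge. The first one selects a part of the region that is
  star-shaped about 0, so that the identity of power series near 0 continues to all of it.\<close>

definition product_domain :: "real \<Rightarrow> complex set" where
  "product_domain X = {y. norm y < X\<^sup>2 \<and> 0 < X\<^sup>2 + Re y - 2 * X * sqrt (norm y)}"

lemma product_domain_open: "open (product_domain X)"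
proof -
  have "product_domain X = {y. norm y < X\<^sup>2} \<inter> {y. 0 < X\<^sup>2 + Re y - 2 * X * sqrt (norm y)}"
    unfolding product_domain_def by auto
  then show ?thesis by (auto intro!: open_Int open_Collect_less continuous_intros)
qed

lemma product_domain_connected: assumes X: "X > 0" shows "connected (product_domain X)"
proof (rule starlike_imp_connected)
  show "starlike (product_domain X)"
    unfolding starlike_def
  proof (intro bexI ballI subsetI)
    show "0 \<in> product_domain X" using X by (simp add: product_domain_def)
    fix y w assume y: "y \<in> product_domain X" and "w \<in> closed_segment 0 y"
    then obtain c where c: "0 \<le> c" "c \<le> 1" "w = of_real c * y"
      by (auto simp: in_segment scaleR_conv_of_real)
    \<comment> \<open>on the points \<open>m\<^sup>2 y\<close> of the segment the quantity \<open>X\<^sup>2 + m\<^sup>2 Re y - 2 X m sqrt \<bar>y\<bar>\<close> is smallest for \<open>m = 1\<close>\<close>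
    define m where "m = sqrt c"
    define q where "q = sqrt (norm y)"
    have m: "0 \<le> m" "m \<le> 1" "c = m\<^sup>2" using c unfolding m_def by (auto simp: real_sqrt_le_1_iff)
    have q: "q \<ge> 0" "norm y = q\<^sup>2" "q < X"
      using y X unfolding q_def product_domain_def by (auto intro: real_less_lsqrt)
    have nw: "norm w = (m * q)\<^sup>2" unfolding c(3) norm_mult norm_of_real using c(1) m q by (simp add: power_mult_distrib)
    have "(m * q)\<^sup>2 \<le> q\<^sup>2" using m q by (intro power_mono mult_left_le_one_le) auto
    then have 1: "norm w < X\<^sup>2" using y nw q unfolding product_domain_def by auto
    have "Re y \<le> q\<^sup>2" using complex_Re_le_cmod[of y] q by simp
    have "(1 + m) * Re y \<le> 2 * X * q"
    proof (cases "Re y \<ge> 0")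
      case True
      have "(1 + m) * Re y \<le> 2 * q\<^sup>2" using m \<open>Re y \<le> q\<^sup>2\<close> True by (intro mult_mono) auto
      also have "\<dots> \<le> 2 * X * q" using q by (simp add: power2_eq_square mult_right_mono)
      finally show ?thesis .
    next
      case False
      then have "(1 + m) * Re y \<le> 0" using m by (intro mult_nonneg_nonpos) auto
      also have "0 \<le> 2 * X * q" using X q by simp
      finally show ?thesis .
    qed
    then have "0 \<le> (1 - m) * (2 * X * q - (1 + m) * Re y)" using m by (intro mult_nonneg_nonneg) auto
    then have "X\<^sup>2 + Re y - 2 * X * q \<le> X\<^sup>2 + m\<^sup>2 * Re y - 2 * X * (m * q)"
      by (simp add: algebra_simps power2_eq_square)
    moreover have "0 < X\<^sup>2 + Re y - 2 * X * q" using y unfolding product_domain_def q_def by simp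
    moreover have "Re w = m\<^sup>2 * Re y" unfolding c(3) m(3) by simp
    moreover have "sqrt (norm w) = m * q" unfolding nw using m q by simp
    ultimately show "w \<in> product_domain X" unfolding product_domain_def using 1 by simp
  qed
qed

lemma product_integral_holomorphic:
  assumes s: "Re s > 0" and X: "X > 0"
  shows "(\<lambda>y. LINT u|lborel. product_kernel s X y u) holomorphic_on product_domain X"
proof -
  let ?S = "product_domain X"
  show ?thesis
  proof (rule holomorphic_integral[OF product_domain_open])
    show "(\<lambda>y. product_kernel s X y u) holomorphic_on ?S" for u
    proof -
      have "(\<lambda>y. bessel_H s (of_real (X\<^sup>2 * exp (- 2 * u)) * y)) holomorphic_on ?S"
        by (rule holomorphic_on_compose_gen[OF _ bessel_H_holomorphic[OF s, of UNIV], unfolded o_def])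
           (auto intro!: holomorphic_intros)
      then show ?thesis unfolding product_kernel_def by (intro holomorphic_intros)
    qed
    show "product_kernel s X y \<in> borel_measurable lborel" for y using product_kernel_measurable[OF s] by simp
    fix y0 assume y0: "y0 \<in> ?S"
    define \<phi> where "\<phi> y = X\<^sup>2 + Re y - 2 * X * sqrt (norm y)" for y :: complex
    have \<phi>0: "\<phi> y0 > 0" using y0 unfolding \<phi>_def product_domain_def by simp
    define V where "V = ?S \<inter> {y. \<phi> y0 / 2 < \<phi> y}"
    have "open V" unfolding V_def \<phi>_def
      by (intro open_Int product_domain_open open_Collect_less continuous_intros)
    moreover have "y0 \<in> V" unfolding V_def using y0 \<phi>0 by simp
    ultimately obtain r where r: "r > 0" "cball y0 r \<subseteq> V" using open_contains_cball by blast
    show "\<exists>r>0. \<exists>g. cball y0 r \<subseteq> ?S \<and> integrable lborel g \<and> (\<forall>y\<in>cball y0 r. \<forall>u. norm (product_kernel s X y u) \<le> g u)"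
    proof (intro exI[of _ r] conjI exI[of _ "product_bound s (\<phi> y0 / 4)"] ballI allI)
      show "integrable lborel (product_bound s (\<phi> y0 / 4))" using \<phi>0 by (intro product_bound_integrable) simp
      fix y u assume "y \<in> cball y0 r"
      then have "\<phi> y0 / 2 < \<phi> y" using r unfolding V_def by auto
      then show "norm (product_kernel s X y u) \<le> product_bound s (\<phi> y0 / 4) u"
        unfolding \<phi>_def by (intro product_kernel_bound s X) simp
    qed (use r V_def in auto)
  qed
qed

lemma exp_sums: "(\<lambda>k. x ^ k / fact k) sums exp (x :: 'a :: {real_normed_field, banach})"
proof -
  have "x ^ k /\<^sub>R fact k = x ^ k / fact k" for k by (simp add: scaleR_conv_of_real field_simps)
  then show ?thesis using exp_converges[of x] by (simp only:)
qed

text \<open>Both factors are expanded in powers of \<open>y\<close> and the Cauchy product is integrated term by term. The radius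
  \<open>X\<^sup>2 / 16\<close> leaves the margin \<open>X\<^sup>2 / 8\<close> in the exponent of the dominating function.\<close>

lemma product_series_near_0:
  assumes s: "Re s > 0" and X: "X > 0" and y: "norm y < X\<^sup>2 / 16"
  shows "(\<lambda>n. 2 * kernel_coeff s X n * y ^ n) sums (LINT u|lborel. product_kernel s X y u)"
proof -
  define E where "E u = exp (- s * of_real u) * of_real (exp (- exp u / 2 - X\<^sup>2 * exp (- u) / 2))" for u :: real
  define a where "a u k = bessel_coeff s k * ((of_real (X\<^sup>2 * exp (- 2 * u)) * y) / 4) ^ k" for u k
  define b where "b u k = (- y * of_real (exp (- u) / 2)) ^ k / fact k" for u k
  define c where "c u n = (\<Sum>k\<le>n. a u k * b u (n - k))" for u n
  have a_sum: "summable (\<lambda>k. norm (a u k))" "(\<Sum>k. norm (a u k)) \<le> norm (rGamma (s + 1)) * exp (X * sqrt (norm y) * exp (- u))" for u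
    using bessel_H_summable_bound(1,2)[OF s, of "of_real (X\<^sup>2 * exp (- 2 * u)) * y"]
    unfolding a_def exp_sqrt_kernel[OF X] by auto
  have nb: "norm (b u k) = (norm y * exp (- u) / 2) ^ k / fact k" for u k
    unfolding b_def by (simp add: norm_divide norm_power norm_mult)
  have b_sum: "(\<lambda>k. norm (b u k)) sums exp (norm y * exp (- u) / 2)" for u
    unfolding nb by (rule exp_sums)
  have b_eq: "(\<Sum>k. b u k) = exp (- y * of_real (exp (- u) / 2))" for u
    unfolding b_def by (rule sums_unique[OF exp_sums, symmetric])
  have a_eq: "(\<Sum>k. a u k) = bessel_H s (of_real (X\<^sup>2 * exp (- 2 * u)) * y)" for u
    unfolding a_def bessel_H_def ..
  have c_sums: "(\<lambda>n. E u * c u n) sums product_kernel s X y u" for u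
    using sums_mult[OF Cauchy_product_sums[OF a_sum(1) sums_summable[OF b_sum]], of "E u" u u]
    unfolding c_def a_eq b_eq product_kernel_def E_def by (simp add: mult_ac)
  have partial: "norm (\<Sum>n<N. E u * c u n) \<le> product_bound s (X\<^sup>2 / 8) u" for N u
  proof -
    have na: "summable (\<lambda>k. norm (norm (a u k)))" "summable (\<lambda>k. norm (norm (b u k)))"
      using a_sum(1) sums_summable[OF b_sum] by auto
    have "norm (\<Sum>n<N. E u * c u n) \<le> (\<Sum>n<N. norm (E u * c u n))" by (rule norm_sum)
    also have "\<dots> = norm (E u) * (\<Sum>n<N. norm (c u n))" by (simp add: norm_mult sum_distrib_left)
    also have "(\<Sum>n<N. norm (c u n)) \<le> (\<Sum>n<N. \<Sum>k\<le>n. norm (a u k) * norm (b u (n - k)))"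
      unfolding c_def by (intro sum_mono order_trans[OF norm_sum] sum_mono) (simp add: norm_mult)
    also have "\<dots> \<le> (\<Sum>n. \<Sum>k\<le>n. norm (a u k) * norm (b u (n - k)))"
      by (rule sum_le_suminf[OF sums_summable[OF Cauchy_product_sums[OF na]]]) (auto intro: sum_nonneg)
    also have "\<dots> = (\<Sum>k. norm (a u k)) * (\<Sum>k. norm (b u k))"
      using Cauchy_product_sums[OF na] by (simp add: sums_iff)
    also have "\<dots> \<le> norm (rGamma (s + 1)) * exp (X * sqrt (norm y) * exp (- u)) * exp (norm y * exp (- u) / 2)"
      using a_sum b_sum by (intro mult_mono) (auto simp: sums_iff suminf_nonneg)
    finally have "norm (\<Sum>n<N. E u * c u n) \<le> norm (E u) * (norm (rGamma (s + 1)) * exp (X * sqrt (norm y) * exp (- u)) * exp (norm y * exp (- u) / 2))"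
      by (simp add: mult_left_mono)
    also have "norm (E u) = exp (- Re s * u - exp u / 2 - X\<^sup>2 * exp (- u) / 2)"
      unfolding E_def by (simp add: norm_mult flip: exp_add)
    also have "exp (- Re s * u - exp u / 2 - X\<^sup>2 * exp (- u) / 2) * (norm (rGamma (s + 1)) * exp (X * sqrt (norm y) * exp (- u)) * exp (norm y * exp (- u) / 2))
       = norm (rGamma (s + 1)) * exp ((- Re s * u - exp u / 2 - X\<^sup>2 * exp (- u) / 2) + X * sqrt (norm y) * exp (- u) + norm y * exp (- u) / 2)"
      by (simp only: exp_add mult_ac)
    also have "\<dots> \<le> product_bound s (X\<^sup>2 / 8) u"
    proof -
      have "sqrt (norm y) \<le> X / 4"
        using y X by (intro real_le_lsqrt) (auto simp: power_divide)
      then have "X * sqrt (norm y) \<le> X * (X / 4)" using X by (intro mult_left_mono) auto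
      moreover have "X * (X / 4) = X\<^sup>2 / 4" by (simp add: power2_eq_square)
      ultimately have "X * sqrt (norm y) + norm y / 2 + X\<^sup>2 / 8 \<le> X\<^sup>2 / 2" using y norm_ge_zero[of y] by linarith
      then have "(X * sqrt (norm y) + norm y / 2 + X\<^sup>2 / 8) * exp (- u) \<le> X\<^sup>2 / 2 * exp (- u)" by (intro mult_right_mono) auto
      then show ?thesis unfolding product_bound_def
        by (intro mult_left_mono) (auto simp: algebra_simps)
    qed
    finally show ?thesis .
  qed
  have Ec: "integrable lborel (\<lambda>u. E u * c u n) \<and> (LINT u|lborel. E u * c u n) = 2 * kernel_coeff s X n * y ^ n" for n
  proof -
    have summand: "E u * (a u k * b u (n - k)) = (mixed_coeff s n k * of_real (X\<^sup>2 / 4) ^ k * y ^ n) *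
        (exp (- (s + of_nat (n + k)) * of_real u) * of_real (exp (- exp u / 2 - X\<^sup>2 * exp (- u) / 2)))" if k: "k \<le> n" for u k
    proof -
      define q where "q = (of_real (exp (- u)) :: complex)"
      have e2: "of_real (X\<^sup>2 * exp (- 2 * u)) * y / 4 = of_real (X\<^sup>2 / 4) * q\<^sup>2 * y"
        unfolding q_def by (simp add: power2_eq_square flip: exp_add of_real_mult)
      have "a u k * b u (n - k) = bessel_coeff s k * (of_real (X\<^sup>2 / 4) * q\<^sup>2 * y) ^ k * ((- 1/2) * q * y) ^ (n - k) / fact (n - k)"
        unfolding a_def b_def e2 unfolding q_def by (simp add: mult_ac)
      also have "\<dots> = mixed_coeff s n k * of_real (X\<^sup>2 / 4) ^ k * (y ^ k * y ^ (n - k)) * (q ^ (2 * k) * q ^ (n - k))"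
      proof -
        have "(of_real (X\<^sup>2 / 4) * q\<^sup>2 * y) ^ k = of_real (X\<^sup>2 / 4) ^ k * q ^ (2 * k) * y ^ k"
          "((- 1/2) * q * y) ^ (n - k) = (- 1/2) ^ (n - k) * q ^ (n - k) * y ^ (n - k)"
          by (simp_all only: power_mult_distrib power_mult)
        then show ?thesis unfolding mixed_coeff_def using k by (simp only: if_True times_divide_eq_left times_divide_eq_right mult_ac)
      qed
      also have "y ^ k * y ^ (n - k) = y ^ n" using k by (simp flip: power_add)
      also have "q ^ (2 * k) * q ^ (n - k) = q ^ (n + k)" using k by (simp add: mult_2 add.commute flip: power_add)
      also have "q ^ (n + k) = exp (- of_nat (n + k) * of_real u)"
        unfolding q_def by (simp add: exp_of_real[symmetric] exp_of_nat_mult[symmetric] del: of_nat_add)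
      finally have 1: "a u k * b u (n - k) = mixed_coeff s n k * of_real (X\<^sup>2 / 4) ^ k * y ^ n * exp (- of_nat (n + k) * of_real u)" .
      have "exp (- (s + of_nat (n + k)) * of_real u) = exp (- s * of_real u) * exp (- of_nat (n + k) * of_real u)"
        by (subst exp_add[symmetric]) (simp add: algebra_simps)
      then show ?thesis unfolding 1 E_def by (simp only: mult_ac)
    qed
    have Ecs: "E u * c u n = (\<Sum>k\<le>n. (mixed_coeff s n k * of_real (X\<^sup>2 / 4) ^ k * y ^ n) *
        (exp (- (s + of_nat (n + k)) * of_real u) * of_real (exp (- exp u / 2 - X\<^sup>2 * exp (- u) / 2))))" for u
      unfolding c_def sum_distrib_left by (intro sum.cong refl summand) auto
    have "integrable lborel (\<lambda>u. E u * c u n)"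
      unfolding Ecs by (intro Bochner_Integration.integrable_sum integrable_mult_right kernel_integrable X)
    moreover have "(LINT u|lborel. E u * c u n) = (\<Sum>k\<le>n. (mixed_coeff s n k * of_real (X\<^sup>2 / 4) ^ k * y ^ n) * (2 * kernel_moment X (s + of_nat (n + k))))"
      unfolding Ecs
    proof (subst Bochner_Integration.integral_sum)
      have "(LINT u|lborel. c * (exp (- p * of_real u) * of_real (exp (- exp u / 2 - X\<^sup>2 * exp (- u) / 2)))) = c * (2 * kernel_moment X p)" for c p
        unfolding kernel_moment_def by simp
      then show "(\<Sum>k\<le>n. LINT u|lborel. (mixed_coeff s n k * of_real (X\<^sup>2 / 4) ^ k * y ^ n) *
        (exp (- (s + of_nat (n + k)) * of_real u) * of_real (exp (- exp u / 2 - X\<^sup>2 * exp (- u) / 2)))) =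
        (\<Sum>k\<le>n. (mixed_coeff s n k * of_real (X\<^sup>2 / 4) ^ k * y ^ n) * (2 * kernel_moment X (s + of_nat (n + k))))"
        by (simp only:)
    qed (intro integrable_mult_right kernel_integrable X)
    moreover have "\<dots> = 2 * kernel_coeff s X n * y ^ n"
      unfolding kernel_coeff_def sum_distrib_left sum_distrib_right by (intro sum.cong refl) (simp add: mult_ac)
    ultimately show ?thesis by simp
  qed
  have "(\<lambda>N. LINT u|lborel. (\<Sum>n<N. E u * c u n)) \<longlonglongrightarrow> (LINT u|lborel. product_kernel s X y u)"
  proof (rule integral_dominated_convergence[where w = "product_bound s (X\<^sup>2 / 8)"])
    show "(\<lambda>u. \<Sum>n<N. E u * c u n) \<in> borel_measurable lborel" for N
      using Ec by (intro borel_measurable_sum borel_measurable_integrable) auto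
    show "AE u in lborel. (\<lambda>N. \<Sum>n<N. E u * c u n) \<longlonglongrightarrow> product_kernel s X y u"
      using c_sums unfolding sums_def by simp
    show "AE u in lborel. norm (\<Sum>n<N. E u * c u n) \<le> product_bound s (X\<^sup>2 / 8) u" for N
      using partial by simp
  qed (use product_kernel_measurable[OF s] product_bound_integrable X in auto)
  moreover have "(LINT u|lborel. (\<Sum>n<N. E u * c u n)) = (\<Sum>n<N. 2 * kernel_coeff s X n * y ^ n)" for N
    using Ec by (subst Bochner_Integration.integral_sum) auto
  ultimately show ?thesis unfolding sums_def by simp
qed

lemma product_integral_eq:
  assumes s: "Re s > 0" and X: "X > 0" and y: "y \<in> product_domain X"
  shows "(LINT u|lborel. product_kernel s X y u) = 2 * kernel_moment X s * bessel_H s y"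
proof (rule analytic_continuation_open[of "ball 0 (X\<^sup>2 / 16)" "product_domain X"
    "\<lambda>y. LINT u|lborel. product_kernel s X y u" "\<lambda>y. 2 * kernel_moment X s * bessel_H s y"])
  show "ball 0 (X\<^sup>2 / 16) \<subseteq> product_domain X"
  proof
    fix y :: complex assume "y \<in> ball 0 (X\<^sup>2 / 16)"
    then have n: "norm y < X\<^sup>2 / 16" by simp
    have "sqrt (norm y) \<le> X / 4" using n X by (intro real_le_lsqrt) (auto simp: power_divide)
    then have "X * sqrt (norm y) \<le> X * (X / 4)" using X by (intro mult_left_mono) auto
    then have "2 * X * sqrt (norm y) \<le> X\<^sup>2 / 2" by (simp add: power2_eq_square)
    moreover have "- norm y \<le> Re y" using abs_Re_le_cmod[of y] by simp
    ultimately have "0 < X\<^sup>2 + Re y - 2 * X * sqrt (norm y)" "norm y < X\<^sup>2"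
      using n norm_ge_zero[of y] by linarith+
    then show "y \<in> product_domain X" unfolding product_domain_def by simp
  qed
  show "ball 0 (X\<^sup>2 / 16) \<noteq> ({} :: complex set)" using X by simp
  show "(\<lambda>y. 2 * kernel_moment X s * bessel_H s y) holomorphic_on product_domain X"
    by (intro holomorphic_intros bessel_H_holomorphic s)
  fix y :: complex assume "y \<in> ball 0 (X\<^sup>2 / 16)"
  then have n: "norm y < X\<^sup>2 / 16" by simp
  have "(\<lambda>n. bessel_coeff s n * (y / 4) ^ n) sums bessel_H s y"
    unfolding bessel_H_def using summable_norm_cancel[OF bessel_H_summable_bound(1)[OF s]] by (rule summable_sums)
  then have "(\<lambda>n. 2 * kernel_moment X s * (bessel_coeff s n * (y / 4) ^ n)) sums (2 * kernel_moment X s * bessel_H s y)"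
    by (rule sums_mult)
  moreover have "2 * kernel_moment X s * (bessel_coeff s n * (y / 4) ^ n) = 2 * kernel_coeff s X n * y ^ n" for n
    unfolding kernel_coeff_eq[OF s X] by (simp add: power_divide)
  ultimately show "(LINT u|lborel. product_kernel s X y u) = 2 * kernel_moment X s * bessel_H s y"
    using product_series_near_0[OF s X n] sums_unique2 by fastforce
qed (use product_domain_open product_domain_connected[OF X] product_integral_holomorphic[OF s X] y in auto)

text \<open>The point \<open>y = x\<^sup>2\<close> lies in the domain of continuation because
  \<open>X\<^sup>2 + Re y - 2 X sqrt \<bar>y\<bar> = (X - x)\<^sup>2\<close> is positive.\<close>

lemma bessel_product_formula:
  assumes s: "Re s > 0" and x: "0 < x" "x < X"
  shows "(LINT u|lborel. of_real (exp (- exp u / 2 - (X\<^sup>2 + x\<^sup>2) * exp (- u) / 2)) * bessel_I s (X * x * exp (- u)))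
     = 2 * bessel_I s x * bessel_K s X"
proof -
  have X: "X > 0" using x by simp
  have y: "of_real (x\<^sup>2) \<in> product_domain X"
  proof -
    have "x\<^sup>2 < X\<^sup>2" using x by (intro power_strict_mono) auto
    moreover have "0 < (X - x)\<^sup>2" using x by simp
    ultimately show ?thesis unfolding product_domain_def mem_Collect_eq norm_of_real using x by (simp add: power2_diff)
  qed
  have eq: "of_real (exp (- exp u / 2 - (X\<^sup>2 + x\<^sup>2) * exp (- u) / 2)) * bessel_I s (X * x * exp (- u))
      = (of_real (x / 2) powr s * of_real X powr s) * product_kernel s X (of_real (x\<^sup>2)) u" for u
  proof -
    have pos: "X * x * exp (- u) > 0" using x X by simp
    have "of_real (X * x * exp (- u) / 2) powr s = exp (s * of_real (ln (x / 2) + ln X - u))"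
    proof -
      have "ln (X * x * exp (- u) / 2) = ln (x / 2) + ln X - u" using x X by (simp add: ln_mult ln_div)
      moreover have "X * x * exp (- u) / 2 > 0" using pos by simp
      ultimately show ?thesis by (simp only: of_real_powr_exp)
    qed
    also have "\<dots> = of_real (x / 2) powr s * of_real X powr s * exp (- s * of_real u)"
    proof -
      have "of_real (x / 2) powr s = exp (s * of_real (ln (x / 2)))" "of_real X powr s = exp (s * of_real (ln X))"
        by (rule of_real_powr_exp, use x X in simp)+
      then show ?thesis by (simp only: exp_add[symmetric]) (simp add: algebra_simps)
    qed
    finally have 1: "of_real (X * x * exp (- u) / 2) powr s = of_real (x / 2) powr s * of_real X powr s * exp (- s * of_real u)" .
    have 2: "of_real ((X * x * exp (- u))\<^sup>2) = (of_real (X\<^sup>2 * exp (- 2 * u)) * of_real (x\<^sup>2) :: complex)"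
      by (simp add: power_mult_distrib power2_eq_square[of "exp _"] flip: exp_add)
    have 3: "of_real (exp (- exp u / 2 - (X\<^sup>2 + x\<^sup>2) * exp (- u) / 2)) =
      of_real (exp (- exp u / 2 - X\<^sup>2 * exp (- u) / 2)) * (exp (- of_real (x\<^sup>2) * of_real (exp (- u) / 2)) :: complex)"
    proof -
      have "exp (- of_real (x\<^sup>2) * of_real (exp (- u) / 2)) = (of_real (exp (- x\<^sup>2 * (exp (- u) / 2))) :: complex)"
        by (simp add: exp_of_real[symmetric])
      then show ?thesis by (simp only: of_real_mult[symmetric] exp_add[symmetric]) (simp add: algebra_simps add_divide_distrib)
    qed
    show ?thesis unfolding bessel_I_eq[OF pos s] 1 2 3 product_kernel_def by (simp only: mult_ac)
  qed
  have "(LINT u|lborel. of_real (exp (- exp u / 2 - (X\<^sup>2 + x\<^sup>2) * exp (- u) / 2)) * bessel_I s (X * x * exp (- u)))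
     = (of_real (x / 2) powr s * of_real X powr s) * (2 * kernel_moment X s * bessel_H s (of_real (x\<^sup>2)))"
    unfolding eq product_integral_eq[OF s X y, symmetric] by (rule integral_mult_right_zero)
  also have "\<dots> = 2 * bessel_I s x * bessel_K s X"
    unfolding bessel_I_eq[OF x(1) s] kernel_moment_eq_bessel_K[OF X, symmetric] by (simp only: mult_ac)
  finally show ?thesis .
qed

section \<open>Convergence of lattice sums\<close>

lemma summable_on_product_nonneg:
  fixes f :: "'a \<Rightarrow> real" and g :: "'b \<Rightarrow> real"
  assumes f: "f summable_on A" "\<And>x. x \<in> A \<Longrightarrow> f x \<ge> 0" and g: "g summable_on B" "\<And>y. y \<in> B \<Longrightarrow> g y \<ge> 0"
  shows "(\<lambda>(x, y). f x * g y) summable_on (A \<times> B)"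
proof (rule summable_on_SigmaI)
  show "((\<lambda>y. case (x, y) of (x, y) \<Rightarrow> f x * g y) has_sum f x * infsum g B) B" for x
    using has_sum_cmult_right[OF has_sum_infsum[OF g(1)], of "f x"] by simp
  show "(\<lambda>x. f x * infsum g B) summable_on A" by (rule summable_on_cmult_left[OF f(1)])
qed (use f g in auto)

lemma summable_on_int_powr:
  fixes q :: real
  assumes q: "q > 1/2"
  shows "(\<lambda>n::int. (1 + (real_of_int n)\<^sup>2) powr (- q)) summable_on UNIV"
proof -
  have s: "summable (\<lambda>n. (1 + (real n)\<^sup>2) powr (- q))"
  proof (rule summable_comparison_test'[of "\<lambda>n. real n powr (- (2 * q))" 1])
    show "summable (\<lambda>n. real n powr (- (2 * q)))" using q by (simp add: summable_real_powr_iff)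
    fix n :: nat assume n: "n \<ge> 1"
    have "(1 + (real n)\<^sup>2) powr (- q) \<le> ((real n)\<^sup>2) powr (- q)" using n q by (intro powr_mono2') auto
    also have "\<dots> = real n powr (- (2 * q))" using n by (simp add: powr_powr flip: powr_numeral)
    finally show "norm ((1 + (real n)\<^sup>2) powr (- q)) \<le> real n powr (- (2 * q))" by simp
  qed
  then have n: "(\<lambda>n::nat. (1 + (real n)\<^sup>2) powr (- q)) summable_on UNIV"
    by (subst summable_on_UNIV_nonneg_real_iff) auto
  let ?f = "\<lambda>n::int. (1 + (real_of_int n)\<^sup>2) powr (- q)"
  have "?f summable_on range int"
    using n by (subst summable_on_reindex) (auto simp: o_def)
  moreover have "?f summable_on range (\<lambda>n. - 1 - int n)"
  proof (subst summable_on_reindex)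
    show "(?f \<circ> (\<lambda>n. - 1 - int n)) summable_on UNIV"
    proof (rule summable_on_comparison_test[OF n])
      fix k :: nat
      have "(real k)\<^sup>2 \<le> (- 1 - real k)\<^sup>2" by (simp add: power2_eq_square algebra_simps)
      then show "(?f \<circ> (\<lambda>n. - 1 - int n)) k \<le> (1 + (real k)\<^sup>2) powr (- q)"
        using q by (simp, intro powr_mono2') (auto simp: add_pos_nonneg)
    qed auto
  qed (auto simp: inj_def)
  ultimately have "?f summable_on (range int \<union> range (\<lambda>n. - 1 - int n))"
    by (rule summable_on_Un_disjoint) auto
  moreover have "range int \<union> range (\<lambda>n. - 1 - int n) = UNIV"
  proof -
    have "k \<in> range int \<union> range (\<lambda>n. - 1 - int n)" for k
      by (cases "k \<ge> 0") (auto simp: image_iff intro: exI[of _ "nat k"] exI[of _ "nat (- 1 - k)"])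
    then show ?thesis by auto
  qed
  ultimately show ?thesis by simp
qed

text \<open>The numbers \<open>1 + (f a)\<^sup>2\<close> and \<open>1 + (g a)\<^sup>2\<close> are both at most a multiple of \<open>1 + (N a)\<^sup>2\<close>, so the sum is
  dominated by a product of two sums over the integers with exponent \<open>p / 2 > 1/2\<close>.\<close>

lemma summable_on_integer_coordinates:
  fixes N :: "'a \<Rightarrow> real" and f g :: "'a \<Rightarrow> int"
  assumes inj: "inj_on (\<lambda>a. (f a, g a)) A" and c: "c > 0" and p: "p > 1"
    and f: "\<And>a. a \<in> A \<Longrightarrow> \<bar>real_of_int (f a)\<bar> \<le> c * N a" and g: "\<And>a. a \<in> A \<Longrightarrow> \<bar>real_of_int (g a)\<bar> \<le> c * N a"
  shows "(\<lambda>a. (1 + (N a)\<^sup>2) powr (- p)) summable_on A"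
proof -
  define C where "C = max 1 (c\<^sup>2)"
  have C: "C \<ge> 1" "C \<ge> c\<^sup>2" unfolding C_def by auto
  let ?h = "\<lambda>n::int. (1 + (real_of_int n)\<^sup>2) powr (- (p / 2))"
  have h: "?h summable_on UNIV" by (rule summable_on_int_powr) (use p in simp)
  have "(\<lambda>(m, n). ?h m * ?h n) summable_on (UNIV \<times> UNIV)"
    by (rule summable_on_product_nonneg[OF h _ h]) auto
  then have "(\<lambda>(m, n). ?h m * ?h n) summable_on ((\<lambda>a. (f a, g a)) ` A)"
    by (rule summable_on_subset_banach) auto
  then have "(\<lambda>a. ?h (f a) * ?h (g a)) summable_on A"
    by (subst (asm) summable_on_reindex[OF inj]) (simp add: o_def)
  then have s: "(\<lambda>a. C powr p * (?h (f a) * ?h (g a))) summable_on A" by (rule summable_on_cmult_right)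
  show ?thesis
  proof (rule summable_on_comparison_test[OF s])
    fix a assume a: "a \<in> A"
    have le: "(1 + (N a)\<^sup>2) powr (- (p / 2)) \<le> C powr (p / 2) * ?h n" if n: "\<bar>real_of_int n\<bar> \<le> c * N a" for n
    proof -
      have "(real_of_int n)\<^sup>2 \<le> (c * N a)\<^sup>2" using n abs_le_square_iff[of "real_of_int n" "c * N a"] by simp
      also have "\<dots> \<le> C * (N a)\<^sup>2" using C by (simp add: power_mult_distrib mult_right_mono)
      finally have "1 + (real_of_int n)\<^sup>2 \<le> C * (1 + (N a)\<^sup>2)" using C by (simp add: algebra_simps)
      then have "(1 + (real_of_int n)\<^sup>2) / C \<le> 1 + (N a)\<^sup>2" using C by (simp add: field_simps)
      then have "(1 + (N a)\<^sup>2) powr (- (p / 2)) \<le> ((1 + (real_of_int n)\<^sup>2) / C) powr (- (p / 2))"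
        using p C by (intro powr_mono2') (auto simp: add_pos_nonneg)
      also have "\<dots> = C powr (p / 2) * ?h n"
      proof -
        have "((1 + (real_of_int n)\<^sup>2) / C) powr (- (p / 2)) = ?h n / C powr (- (p / 2))"
          by (rule powr_divide)
        also have "C powr (- (p / 2)) = inverse (C powr (p / 2))" by (rule powr_minus)
        finally show ?thesis by (simp only: divide_inverse inverse_inverse_eq mult.commute)
      qed
      finally show ?thesis .
    qed
    have "(1 + (N a)\<^sup>2) powr (- p) = (1 + (N a)\<^sup>2) powr (- (p / 2)) * (1 + (N a)\<^sup>2) powr (- (p / 2))"
      by (simp flip: powr_add)
    also have "\<dots> \<le> (C powr (p / 2) * ?h (f a)) * (C powr (p / 2) * ?h (g a))"
      by (intro mult_mono le f g a) auto
    also have "\<dots> = C powr p * (?h (f a) * ?h (g a))"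
    proof -
      have "C powr (p / 2) * C powr (p / 2) = C powr p" by (simp flip: powr_add)
      moreover have "(x * A) * (x * B) = (x * x) * (A * B)" for x A B :: real by simp
      ultimately show ?thesis by (simp only:)
    qed
    finally show "(1 + (N a)\<^sup>2) powr (- p) \<le> C powr p * (?h (f a) * ?h (g a))" .
  qed simp
qed

context planar_lattice
begin

lemma lattice_powr_summable:
  assumes p: "p > 1" shows "(\<lambda>l. (1 + (norm l)\<^sup>2) powr (- p)) summable_on L"
proof -
  define c where "c = (norm w1 + norm w2 + 1) / \<bar>coord_det\<bar>"
  have c: "c > 0" unfolding c_def using coord_det_nonzero by (intro divide_pos_pos add_nonneg_pos) auto
  have le: "\<bar>co1 l\<bar> \<le> c * norm l" "\<bar>co2 l\<bar> \<le> c * norm l" for l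
  proof -
    have "\<bar>Im (l * cnj w)\<bar> \<le> norm l * norm w" for w
      using abs_Im_le_cmod[of "l * cnj w"] by (simp add: norm_mult)
    moreover have "norm l * norm w1 \<le> norm l * (norm w1 + norm w2 + 1)" "norm l * norm w2 \<le> norm l * (norm w1 + norm w2 + 1)"
      by (intro mult_left_mono; simp)+
    ultimately have "\<bar>Im (l * cnj w1)\<bar> \<le> norm l * (norm w1 + norm w2 + 1)" "\<bar>Im (l * cnj w2)\<bar> \<le> norm l * (norm w1 + norm w2 + 1)"
      by (meson order_trans)+
    then show "\<bar>co1 l\<bar> \<le> c * norm l" "\<bar>co2 l\<bar> \<le> c * norm l"
      unfolding co1_def co2_def c_def by (simp_all add: abs_divide divide_right_mono mult.commute)
  qed
  have fl: "real_of_int \<lfloor>co1 l\<rfloor> = co1 l" "real_of_int \<lfloor>co2 l\<rfloor> = co2 l" if "l \<in> L" for l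
    using that L_iff by (auto elim!: Ints_cases)
  show ?thesis
  proof (rule summable_on_integer_coordinates[OF _ c p, where f = "\<lambda>l. \<lfloor>co1 l\<rfloor>" and g = "\<lambda>l. \<lfloor>co2 l\<rfloor>"])
    show "inj_on (\<lambda>a. (\<lfloor>co1 a\<rfloor>, \<lfloor>co2 a\<rfloor>)) L"
    proof (rule inj_onI)
      fix x y assume *: "x \<in> L" "y \<in> L" "(\<lfloor>co1 x\<rfloor>, \<lfloor>co2 x\<rfloor>) = (\<lfloor>co1 y\<rfloor>, \<lfloor>co2 y\<rfloor>)"
      then have "co1 x = co1 y" "co2 x = co2 y" using fl[OF *(1)] fl[OF *(2)] by (metis Pair_inject)+
      then show "x = y" by (metis co_eq)
    qed
  qed (simp_all add: fl le)
qed

lemma dual_co_le: "\<mu> \<in> dual_lattice L \<Longrightarrow> \<bar>real_of_int (fst (dual_co \<mu>))\<bar> \<le> (2 * (norm w1 + norm w2 + 1)) * norm \<mu>"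
  "\<mu> \<in> dual_lattice L \<Longrightarrow> \<bar>real_of_int (snd (dual_co \<mu>))\<bar> \<le> (2 * (norm w1 + norm w2 + 1)) * norm \<mu>"
proof -
  assume \<mu>: "\<mu> \<in> dual_lattice L"
  have "\<bar>2 * Re (\<mu> * w)\<bar> \<le> 2 * norm w * norm \<mu>" for w
    using abs_Re_le_cmod[of "\<mu> * w"] by (simp add: norm_mult mult.commute)
  moreover have "2 * norm w1 * norm \<mu> \<le> (2 * (norm w1 + norm w2 + 1)) * norm \<mu>" "2 * norm w2 * norm \<mu> \<le> (2 * (norm w1 + norm w2 + 1)) * norm \<mu>"
    by (intro mult_right_mono; simp)+
  ultimately have "\<bar>2 * Re (\<mu> * w1)\<bar> \<le> (2 * (norm w1 + norm w2 + 1)) * norm \<mu>" "\<bar>2 * Re (\<mu> * w2)\<bar> \<le> (2 * (norm w1 + norm w2 + 1)) * norm \<mu>"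
    by (meson order_trans)+
  moreover have "real_of_int (fst (dual_co \<mu>)) = 2 * Re (\<mu> * w1)" "real_of_int (snd (dual_co \<mu>)) = 2 * Re (\<mu> * w2)"
    using co_dual[OF \<mu>] unfolding dual_co_def by (auto elim!: Ints_cases)
  ultimately show "\<bar>real_of_int (fst (dual_co \<mu>))\<bar> \<le> (2 * (norm w1 + norm w2 + 1)) * norm \<mu>"
    "\<bar>real_of_int (snd (dual_co \<mu>))\<bar> \<le> (2 * (norm w1 + norm w2 + 1)) * norm \<mu>" by simp_all
qed

lemma dual_powr_summable:
  assumes p: "p > 1" shows "(\<lambda>\<mu>. (1 + (norm \<mu>)\<^sup>2) powr (- p)) summable_on dual_lattice L"
proof (rule summable_on_integer_coordinates[OF _ _ p, where f = "\<lambda>\<mu>. fst (dual_co \<mu>)" and g = "\<lambda>\<mu>. snd (dual_co \<mu>)"])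
  show "inj_on (\<lambda>\<mu>. (fst (dual_co \<mu>), snd (dual_co \<mu>))) (dual_lattice L)" using dual_co_inj by simp
  show "2 * (norm w1 + norm w2 + 1) > 0" by (intro mult_pos_pos add_nonneg_pos) auto
qed (use dual_co_le in auto)

text \<open>A nonzero element pairs with one of the two basis vectors to a nonzero integer.\<close>

lemma dual_norm_lower_bound: "\<exists>m>0. \<forall>\<mu>\<in>dual_lattice L - {0}. m \<le> norm \<mu>"
proof (intro exI[of _ "1 / (2 * (norm w1 + norm w2 + 1))"] conjI ballI)
  have pos: "2 * (norm w1 + norm w2 + 1) > 0" by (intro mult_pos_pos add_nonneg_pos) auto
  then show "1 / (2 * (norm w1 + norm w2 + 1)) > 0" by simp
  fix \<mu> assume \<mu>: "\<mu> \<in> dual_lattice L - {0}"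
  have "dual_co \<mu> \<noteq> dual_co 0" using dual_co_inj \<mu> dual_lattice_group(1) by (auto dest: inj_onD)
  then have "fst (dual_co \<mu>) \<noteq> 0 \<or> snd (dual_co \<mu>) \<noteq> 0" by (auto simp: dual_co_def)
  then have "1 \<le> \<bar>real_of_int (fst (dual_co \<mu>))\<bar> \<or> 1 \<le> \<bar>real_of_int (snd (dual_co \<mu>))\<bar>" by linarith
  then have "1 \<le> (2 * (norm w1 + norm w2 + 1)) * norm \<mu>" using dual_co_le[of \<mu>] \<mu> by fastforce
  then show "1 / (2 * (norm w1 + norm w2 + 1)) \<le> norm \<mu>" using pos by (simp add: divide_le_eq mult.commute)
qed

lemma dual_exp_summable:
  fixes \<delta> a :: real
  assumes d: "\<delta> > 0" and a: "a > 0"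
  shows "(\<lambda>\<mu>. norm \<mu> powr a * exp (- \<delta> * norm \<mu>)) summable_on dual_lattice L"
proof -
  define h where "h x = x powr a * exp (- \<delta> * x) * (1 + x\<^sup>2)\<^sup>2" for x :: real
  have "(h \<longlongrightarrow> 0) at_top" unfolding h_def using d a by real_asymp
  then have "eventually (\<lambda>x. h x < 1) at_top" by (rule order_tendstoD) simp
  then obtain x0 where x0: "\<And>x. x \<ge> x0 \<Longrightarrow> h x < 1" unfolding eventually_at_top_linorder by blast
  define x1 where "x1 = max 1 x0"
  define C where "C = max 1 (x1 powr a * (1 + x1\<^sup>2)\<^sup>2)"
  have h_le: "h x \<le> C" if "x \<ge> 0" for x
  proof (cases "x \<ge> x1")
    case True
    then show ?thesis using x0[of x] unfolding C_def x1_def by auto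
  next
    case False
    then have "h x \<le> x1 powr a * 1 * (1 + x1\<^sup>2)\<^sup>2"
      unfolding h_def using that d a by (intro mult_mono power_mono add_mono powr_mono2) auto
    then show ?thesis unfolding C_def by simp
  qed
  have s: "(\<lambda>\<mu>. C * (1 + (norm \<mu>)\<^sup>2) powr (- 2)) summable_on dual_lattice L"
    by (intro summable_on_cmult_right dual_powr_summable) simp
  show ?thesis
  proof (rule summable_on_comparison_test[OF s])
    fix \<mu>
    have pos: "1 + (norm \<mu>)\<^sup>2 > 0" by (intro add_pos_nonneg) auto
    have "norm \<mu> powr a * exp (- \<delta> * norm \<mu>) * (1 + (norm \<mu>)\<^sup>2)\<^sup>2 \<le> C" using h_le[of "norm \<mu>"] unfolding h_def by simp
    moreover have "(1 + (norm \<mu>)\<^sup>2) powr (- 2) = inverse ((1 + (norm \<mu>)\<^sup>2)\<^sup>2)"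
      using pos by (simp add: powr_minus powr_numeral)
    ultimately have "norm \<mu> powr a * exp (- \<delta> * norm \<mu>) * (1 + (norm \<mu>)\<^sup>2)\<^sup>2 * (1 + (norm \<mu>)\<^sup>2) powr (- 2) \<le> C * (1 + (norm \<mu>)\<^sup>2) powr (- 2)"
      by (intro mult_right_mono) auto
    moreover have "(1 + (norm \<mu>)\<^sup>2)\<^sup>2 * (1 + (norm \<mu>)\<^sup>2) powr (- 2) = 1"
      using pos \<open>(1 + (norm \<mu>)\<^sup>2) powr (- 2) = inverse ((1 + (norm \<mu>)\<^sup>2)\<^sup>2)\<close> by simp
    ultimately show "norm \<mu> powr a * exp (- \<delta> * norm \<mu>) \<le> C * (1 + (norm \<mu>)\<^sup>2) powr (- 2)"
      by (simp only: mult.assoc mult_1_right)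
  qed simp
qed

end

section \<open>The Fourier transform of the point-pair invariant\<close>

text \<open>The characteristic function of the normal distribution, rescaled.\<close>

lemma Gaussian_Fourier_real:
  assumes a: "a > 0"
  shows "integrable lborel (\<lambda>p. of_real (exp (- a * p\<^sup>2)) * exp (\<i> * of_real (c * p)) :: complex)"
    and "(LINT p|lborel. of_real (exp (- a * p\<^sup>2)) * exp (\<i> * of_real (c * p))) = of_real (sqrt (pi / a) * exp (- c\<^sup>2 / (4 * a)))"
proof -
  define b where "b = sqrt (2 * a)"
  have b: "b > 0" "b\<^sup>2 = 2 * a" unfolding b_def using a by auto
  define t where "t = c / b"
  define f :: "real \<Rightarrow> complex" where "f y = std_normal_density y *\<^sub>R exp (\<i> * of_real (t * y))" for y
  have [measurable]: "f \<in> borel_measurable borel" unfolding f_def[abs_def] by measurable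
  have f_int: "integrable lborel f"
    by (rule Bochner_Integration.integrable_bound[OF integrable_normal_density[of 1 0]])
       (auto simp: f_def)
  have "integral\<^sup>L lborel f = char std_normal_distribution t"
    unfolding char_def f_def by (subst integral_density) auto
  then have f_val: "integral\<^sup>L lborel f = of_real (exp (- t\<^sup>2 / 2))" by (simp add: char_std_normal_distribution)
  have fb: "f (b * p) = of_real (1 / sqrt (2 * pi)) * (of_real (exp (- a * p\<^sup>2)) * exp (\<i> * of_real (c * p)))" for p
  proof -
    have s1: "std_normal_density (b * p) = 1 / sqrt (2 * pi) * exp (- a * p\<^sup>2)"
      unfolding std_normal_density_def using b by (simp add: power_mult_distrib)
    have s2: "t * (b * p) = c * p" unfolding t_def using b by simp
    show ?thesis unfolding f_def s1 s2 by (simp add: scaleR_conv_of_real)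
  qed
  have eq: "of_real (exp (- a * p\<^sup>2)) * exp (\<i> * of_real (c * p)) = of_real (sqrt (2 * pi)) * f (b * p)" for p
    unfolding fb by simp
  have "integrable lborel (\<lambda>p. f (0 + b * p))" using f_int b by (intro lborel_integrable_real_affine) auto
  then show "integrable lborel (\<lambda>p. of_real (exp (- a * p\<^sup>2)) * exp (\<i> * of_real (c * p)) :: complex)"
    unfolding eq by simp
  have "integral\<^sup>L lborel f = b *\<^sub>R (LINT p|lborel. f (b * p))"
    using lborel_integral_real_affine[of b f 0] b by simp
  then have "(LINT p|lborel. f (b * p)) = of_real (exp (- t\<^sup>2 / 2) / b)"
    unfolding f_val using b by (simp add: scaleR_conv_of_real field_simps)
  then have "(LINT p|lborel. of_real (exp (- a * p\<^sup>2)) * exp (\<i> * of_real (c * p))) = of_real (sqrt (2 * pi) * (exp (- t\<^sup>2 / 2) / b))"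
    unfolding eq by simp
  also have "- t\<^sup>2 / 2 = - c\<^sup>2 / (4 * a)" unfolding t_def using b a by (simp add: power_divide)
  also have "sqrt (2 * pi) * (exp (- c\<^sup>2 / (4 * a)) / b) = sqrt (pi / a) * exp (- c\<^sup>2 / (4 * a))"
    unfolding b_def using a by (simp add: real_sqrt_mult real_sqrt_divide)
  finally show "(LINT p|lborel. of_real (exp (- a * p\<^sup>2)) * exp (\<i> * of_real (c * p))) = of_real (sqrt (pi / a) * exp (- c\<^sup>2 / (4 * a)))" .
qed

lemma lborel_complex_eq: "(lborel :: complex measure) = distr (lborel \<Otimes>\<^sub>M lborel) borel (\<lambda>(p, q). Complex p q)"
proof (rule lborel_eqI)
  have m: "(\<lambda>(p, q). Complex p q) \<in> borel_measurable (lborel \<Otimes>\<^sub>M lborel)"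
    unfolding lborel_prod measurable_lborel2
    by (intro borel_measurable_continuous_onI) (auto simp: case_prod_unfold Complex_eq intro!: continuous_intros)
  fix l u :: complex assume le: "\<And>b. b \<in> Basis \<Longrightarrow> l \<bullet> b \<le> u \<bullet> b"
  then have lu: "Re l \<le> Re u" "Im l \<le> Im u" using le[of 1] le[of \<i>] by (auto simp: Basis_complex_def)
  have "emeasure (distr (lborel \<Otimes>\<^sub>M lborel) borel (\<lambda>(p, q). Complex p q)) (box l u)
      = emeasure (lborel \<Otimes>\<^sub>M lborel) ((\<lambda>(p, q). Complex p q) -` box l u \<inter> space (lborel \<Otimes>\<^sub>M lborel))"
    by (rule emeasure_distr[OF m]) auto
  also have "(\<lambda>(p, q). Complex p q) -` box l u \<inter> space (lborel \<Otimes>\<^sub>M lborel) = {Re l<..<Re u} \<times> {Im l<..<Im u}"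
    by (auto simp: in_box_complex_iff space_pair_measure)
  also have "emeasure (lborel \<Otimes>\<^sub>M lborel) \<dots> = ennreal (Re u - Re l) * ennreal (Im u - Im l)"
    using lu by (subst lborel.emeasure_pair_measure_Times) auto
  also have "\<dots> = ennreal (prod ((\<bullet>) (u - l)) Basis)"
    using lu by (simp add: Basis_complex_def ennreal_mult)
  finally show "emeasure (distr (lborel \<Otimes>\<^sub>M lborel) borel (\<lambda>(p, q). Complex p q)) (box l u) = ennreal (prod ((\<bullet>) (u - l)) Basis)" .
qed simp

lemma integral_complex_product:
  fixes f g :: "real \<Rightarrow> complex"
  assumes f: "integrable lborel f" and g: "integrable lborel g"
  shows "integrable lborel (\<lambda>x::complex. f (Re x) * g (Im x))"
    and "(LINT x|lborel. f (Re x) * g (Im x)) = (LINT p|lborel. f p) * (LINT q|lborel. g q)"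
proof -
  have [measurable]: "f \<in> borel_measurable borel" "g \<in> borel_measurable borel" using f g by auto
  have m: "(\<lambda>(p, q). Complex p q) \<in> borel_measurable (lborel \<Otimes>\<^sub>M lborel)"
    unfolding lborel_prod measurable_lborel2
    by (intro borel_measurable_continuous_onI) (auto simp: case_prod_unfold Complex_eq intro!: continuous_intros)
  have [measurable]: "Re \<in> borel_measurable borel" "Im \<in> borel_measurable borel"
    by (intro borel_measurable_continuous_onI continuous_intros)+
  have mfg: "(\<lambda>x::complex. f (Re x) * g (Im x)) \<in> borel_measurable borel" by measurable
  have i: "integrable (lborel \<Otimes>\<^sub>M lborel) (\<lambda>x. f (fst x) * g (snd x))"
  proof (rule lborel_pair.Fubini_integrable)
    show "integrable lborel (\<lambda>x. LINT y|lborel. norm (f (fst (x, y)) * g (snd (x, y))))"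
      using integrable_norm[OF f] by (simp add: norm_mult)
    show "AE x in lborel. integrable lborel (\<lambda>y. f (fst (x, y)) * g (snd (x, y)))"
      using g by simp
  qed measurable
  then show "integrable lborel (\<lambda>x::complex. f (Re x) * g (Im x))"
    by (subst lborel_complex_eq, subst integrable_distr_eq[OF m mfg]) (simp add: case_prod_unfold)
  have "(LINT x|lborel. f (Re x) * g (Im x)) = (LINT x|(lborel \<Otimes>\<^sub>M lborel). f (fst x) * g (snd x))"
    by (subst lborel_complex_eq, subst integral_distr[OF m mfg]) (simp add: case_prod_unfold)
  also have "\<dots> = (LINT p|lborel. (LINT q|lborel. f p * g q))"
    using lborel_pair.integral_fst'[OF i] by simp
  also have "\<dots> = (LINT p|lborel. f p) * (LINT q|lborel. g q)" by simp
  finally show "(LINT x|lborel. f (Re x) * g (Im x)) = (LINT p|lborel. f p) * (LINT q|lborel. g q)" .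
qed

text \<open>\<open>tr (\<nu> x)\<close> is a linear form in \<open>Re x\<close> and \<open>Im x\<close>, so the integral is a product of two integrals over the
  line.\<close>

lemma Gaussian_Fourier:
  assumes a: "a > 0"
  shows "integrable lborel (\<lambda>x::complex. of_real (exp (- a * (norm x)\<^sup>2)) * lattice_char \<nu> x)"
    and "(LINT x|lborel. of_real (exp (- a * (norm x)\<^sup>2)) * lattice_char \<nu> x)
       = of_real (pi / a * exp (- (4 * pi * norm \<nu>)\<^sup>2 / (4 * a)))"
proof -
  have eq: "of_real (exp (- a * (norm x)\<^sup>2)) * lattice_char \<nu> x =
    (of_real (exp (- a * (Re x)\<^sup>2)) * exp (\<i> * of_real ((4 * pi * Re \<nu>) * Re x))) *
    (of_real (exp (- a * (Im x)\<^sup>2)) * exp (\<i> * of_real ((- 4 * pi * Im \<nu>) * Im x)))" for x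
  proof -
    have "lattice_char \<nu> x = exp (\<i> * of_real ((4 * pi * Re \<nu>) * Re x) + \<i> * of_real ((- 4 * pi * Im \<nu>) * Im x))"
      unfolding lattice_char_altdef by (simp add: algebra_simps)
    moreover have "exp (- a * (norm x)\<^sup>2) = exp (- a * (Re x)\<^sup>2) * exp (- a * (Im x)\<^sup>2)"
      unfolding cmod_power2 exp_add[symmetric] by (simp add: algebra_simps)
    ultimately show ?thesis by (simp only: exp_add of_real_mult mult_ac)
  qed
  show "integrable lborel (\<lambda>x::complex. of_real (exp (- a * (norm x)\<^sup>2)) * lattice_char \<nu> x)"
    unfolding eq by (rule integral_complex_product(1)[OF Gaussian_Fourier_real(1)[OF a] Gaussian_Fourier_real(1)[OF a]])
  have "(LINT x|lborel. of_real (exp (- a * (norm x)\<^sup>2)) * lattice_char \<nu> x)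
    = of_real (sqrt (pi / a) * exp (- (4 * pi * Re \<nu>)\<^sup>2 / (4 * a))) * of_real (sqrt (pi / a) * exp (- (- 4 * pi * Im \<nu>)\<^sup>2 / (4 * a)))"
    unfolding eq integral_complex_product(2)[OF Gaussian_Fourier_real(1)[OF a] Gaussian_Fourier_real(1)[OF a]]
      Gaussian_Fourier_real(2)[OF a] ..
  also have "\<dots> = of_real ((sqrt (pi / a) * sqrt (pi / a)) * (exp (- (4 * pi * Re \<nu>)\<^sup>2 / (4 * a)) * exp (- (- 4 * pi * Im \<nu>)\<^sup>2 / (4 * a))))"
    by (simp only: of_real_mult mult_ac)
  also have "sqrt (pi / a) * sqrt (pi / a) = pi / a" using a by simp
  also have "exp (- (4 * pi * Re \<nu>)\<^sup>2 / (4 * a)) * exp (- (- 4 * pi * Im \<nu>)\<^sup>2 / (4 * a)) = exp (- (4 * pi * norm \<nu>)\<^sup>2 / (4 * a))"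
    unfolding exp_add[symmetric] power_mult_distrib cmod_power2 using a by (simp add: field_simps)
  finally show "(LINT x|lborel. of_real (exp (- a * (norm x)\<^sup>2)) * lattice_char \<nu> x)
       = of_real (pi / a * exp (- (4 * pi * norm \<nu>)\<^sup>2 / (4 * a)))" .
qed

text \<open>The argument of the point-pair invariant, \<open>cosh\<close> of the distance of two points of
  heights \<open>r\<close> and \<open>r'\<close> whose first coordinates differ by \<open>x\<close>.\<close>

definition cosh_dist :: "real \<Rightarrow> real \<Rightarrow> complex \<Rightarrow> real" where
  "cosh_dist r r' x = ((norm x)\<^sup>2 + r\<^sup>2 + r'\<^sup>2) / (2 * r * r')"

lemma cosh_dist_split:
  "cosh_dist r r' x = cosh_dist r r' 0 + (norm x)\<^sup>2 / (2 * r * r')"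
  unfolding cosh_dist_def by (simp add: add_divide_distrib)

lemma cosh_dist_mono_height:
  assumes "0 < r'" "r' \<le> \<rho>" "\<rho> < r"
  shows "1 < cosh_dist r \<rho> 0" "cosh_dist r \<rho> 0 \<le> cosh_dist r r' x"
proof -
  have pos: "0 < \<rho>" "0 < r" using assms by auto
  have "0 < (r - \<rho>)\<^sup>2" using assms by simp
  then show "1 < cosh_dist r \<rho> 0" unfolding cosh_dist_def using pos
    by (simp add: less_divide_eq power2_diff)
  have "\<rho> * r' \<le> r * r" using assms by (intro mult_mono) auto
  then have "0 \<le> (\<rho> - r') * (r * r - \<rho> * r')" using assms by (intro mult_nonneg_nonneg) auto
  also have "\<dots> = \<rho> * (r\<^sup>2 + r'\<^sup>2) - r' * (r\<^sup>2 + \<rho>\<^sup>2)" by (simp add: algebra_simps power2_eq_square)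
  finally have "cosh_dist r \<rho> 0 \<le> cosh_dist r r' 0"
  proof -
    assume "0 \<le> \<rho> * (r\<^sup>2 + r'\<^sup>2) - r' * (r\<^sup>2 + \<rho>\<^sup>2)"
    then have "(r\<^sup>2 + \<rho>\<^sup>2) / \<rho> \<le> (r\<^sup>2 + r'\<^sup>2) / r'" using assms pos by (simp add: field_simps)
    then have "(r\<^sup>2 + \<rho>\<^sup>2) / \<rho> / (2 * r) \<le> (r\<^sup>2 + r'\<^sup>2) / r' / (2 * r)" using pos by (intro divide_right_mono) auto
    then show ?thesis unfolding cosh_dist_def by (simp add: mult_ac)
  qed
  also have "\<dots> \<le> cosh_dist r r' x" unfolding cosh_dist_split[of r r' x] using assms pos by simp
  finally show "cosh_dist r \<rho> 0 \<le> cosh_dist r r' x" .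
qed

lemma cosh_dist_gt_1: "0 < r' \<Longrightarrow> r' < r \<Longrightarrow> 1 < cosh_dist r r' x"
  using less_le_trans[OF cosh_dist_mono_height(1)[of r' r' r] cosh_dist_mono_height(2)[of r' r' r x]] by auto

lemma continuous_on_cosh_dist [continuous_intros]:
  "continuous_on A f \<Longrightarrow> continuous_on A (\<lambda>x. cosh_dist r r' (f x))"
  unfolding cosh_dist_def divide_inverse by (intro continuous_intros)

lemma continuous_on_green_phi:
  assumes f: "continuous_on A f" "\<And>x. x \<in> A \<Longrightarrow> f x > 1"
  shows "continuous_on A (\<lambda>x. green_phi s (f x))"
proof -
  have sq: "(f x)\<^sup>2 > 1" if "x \<in> A" for x using f(2)[OF that] by (simp add: power2_eq_square less_1_mult)
  have pos: "f x + sqrt ((f x)\<^sup>2 - 1) > 0" if "x \<in> A" for x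
    using f(2)[OF that] sq[OF that] by (intro add_pos_nonneg) auto
  have "continuous_on A (\<lambda>x. exp (- s * of_real (ln (f x + sqrt ((f x)\<^sup>2 - 1)))) * of_real (((f x)\<^sup>2 - 1) powr (- 1 / 2)))"
    using pos sq by (intro continuous_intros f(1) ballI) fastforce+
  moreover have "exp (- s * of_real (ln (f x + sqrt ((f x)\<^sup>2 - 1)))) * of_real (((f x)\<^sup>2 - 1) powr (- 1 / 2)) = green_phi s (f x)" if "x \<in> A" for x
    unfolding green_phi_def of_real_powr_exp[OF pos[OF that]] ..
  ultimately show ?thesis by (simp cong: continuous_on_cong)
qed

text \<open>\<open>t\<^sup>2 - 1\<close> is at least \<open>(1 - 1 / t0\<^sup>2) t\<^sup>2\<close> for \<open>t \<ge> t0\<close>.\<close>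

lemma green_phi_bound:
  assumes s: "Re s > 0" and t: "1 < t0" "t0 \<le> t"
  shows "norm (green_phi s t) \<le> (1 - 1 / t0\<^sup>2) powr (- 1/2) * t powr (- (1 + Re s))"
proof -
  have tp: "t > 1" using t by simp
  have t02: "t0\<^sup>2 > 1" using t by (simp add: power2_eq_square less_1_mult)
  have inv1: "1 / a < 1" if "1 < a" for a :: real using that by (simp add: field_simps)
  have c: "1 - 1 / t0\<^sup>2 > 0" using inv1[OF t02] by simp
  have t2: "t0\<^sup>2 \<le> t\<^sup>2" using t by (intro power_mono) auto
  have "norm (of_real (t + sqrt (t\<^sup>2 - 1)) powr (- s) :: complex) = (t + sqrt (t\<^sup>2 - 1)) powr (- Re s)"
    using tp t2 t02 by (subst norm_powr_real_powr) (auto intro: add_nonneg_nonneg)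
  also have "\<dots> \<le> t powr (- Re s)" using tp t2 t02 s by (intro powr_mono2') auto
  finally have 1: "norm (of_real (t + sqrt (t\<^sup>2 - 1)) powr (- s) :: complex) \<le> t powr (- Re s)" .
  have "(1 - 1 / t0\<^sup>2) * t\<^sup>2 \<le> t\<^sup>2 - 1"
  proof -
    have "1 \<le> t\<^sup>2 / t0\<^sup>2" using t2 t02 by (subst le_divide_eq) auto
    then show ?thesis by (simp add: algebra_simps)
  qed
  then have "(t\<^sup>2 - 1) powr (- 1 / 2) \<le> ((1 - 1 / t0\<^sup>2) * t\<^sup>2) powr (- 1 / 2)"
    using c tp by (intro powr_mono2') auto
  also have "\<dots> = (1 - 1 / t0\<^sup>2) powr (- 1/2) * t powr (- 1)"
  proof -
    have "(t\<^sup>2) powr (- 1 / 2) = t powr (- 1)" using tp by (simp add: powr_powr flip: powr_numeral)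
    then show ?thesis using c tp by (simp add: powr_mult)
  qed
  finally have 2: "(t\<^sup>2 - 1) powr (- 1 / 2) \<le> (1 - 1 / t0\<^sup>2) powr (- 1/2) * t powr (- 1)" .
  have "norm (green_phi s t) = norm (of_real (t + sqrt (t\<^sup>2 - 1)) powr (- s) :: complex) * (t\<^sup>2 - 1) powr (- 1 / 2)"
    unfolding green_phi_def by (simp add: norm_mult)
  also have "\<dots> \<le> t powr (- Re s) * ((1 - 1 / t0\<^sup>2) powr (- 1/2) * t powr (- 1))"
    by (intro mult_mono 1 2) auto
  also have "\<dots> = (1 - 1 / t0\<^sup>2) powr (- 1/2) * t powr (- (1 + Re s))"
  proof -
    have "t powr (- Re s) * t powr (- 1) = t powr (- Re s + - 1)" by (simp only: powr_add)
    also have "- Re s + - 1 = - (1 + Re s)" by simp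
    finally show ?thesis by (metis mult.left_commute)
  qed
  finally show ?thesis .
qed

text \<open>The argument of \<open>\<phi>\<^sub>s\<close> is an affine function of \<open>\<bar>x\<bar>\<^sup>2\<close>, so the Laplace transform presents \<open>\<phi>\<^sub>s\<close> as a
  superposition of Gaussians in \<open>x\<close>. By Fubini's theorem each of them is transformed separately.\<close>

lemma green_phi_Fourier_Gaussian:
  assumes s: "Re s > 0" and r: "0 < r'" "r' < r"
  shows "integrable lborel (\<lambda>x. green_phi s (cosh_dist r r' x) * lattice_char \<nu> x)"
    and "(LINT x|lborel. green_phi s (cosh_dist r r' x) * lattice_char \<nu> x) =
      of_real (2 * pi * r * r') * (LINT u|lborel. of_real (exp (- cosh_dist r r' 0 * exp u - (4 * pi * norm \<nu>)\<^sup>2 * r * r' * exp (- u) / 2)) * bessel_I s (exp u))"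
proof -
  define t0 where "t0 = cosh_dist r r' 0"
  have t0: "t0 > 1" unfolding t0_def by (rule cosh_dist_gt_1[OF r])
  have rr: "2 * r * r' > 0" using r by simp
  define H where "H u x = of_real (exp u * exp (- cosh_dist r r' x * exp u)) * bessel_I s (exp u) * lattice_char \<nu> x" for u x
  define A where "A u = of_real (exp u * exp (- t0 * exp u)) * bessel_I s (exp u)" for u :: real
  define a where "a u = exp u / (2 * r * r')" for u :: real
  have a: "a u > 0" for u unfolding a_def using rr by simp
  have H_eq: "H u x = A u * (of_real (exp (- a u * (norm x)\<^sup>2)) * lattice_char \<nu> x)" for u x
  proof -
    have "- cosh_dist r r' x * exp u = - t0 * exp u + - a u * (norm x)\<^sup>2"
      unfolding cosh_dist_split[of r r' x] t0_def a_def by (simp add: algebra_simps)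
    then show ?thesis unfolding H_def A_def by (simp only: exp_add of_real_mult mult_ac)
  qed
  have norm_H: "norm (H u x) = norm (A u) * exp (- a u * (norm x)\<^sup>2)" for u x
    unfolding H_eq by (simp add: norm_mult)
  have gauss: "integrable lborel (\<lambda>x::complex. exp (- a u * (norm x)\<^sup>2))" "(LINT x|lborel. exp (- a u * (norm (x::complex))\<^sup>2)) = pi / a u" for u
  proof -
    have "integrable lborel (\<lambda>x::complex. complex_of_real (exp (- a u * (norm x)\<^sup>2)))"
      using Gaussian_Fourier(1)[OF a, of u 0] by simp
    then show "integrable lborel (\<lambda>x::complex. exp (- a u * (norm x)\<^sup>2))" by (simp only: complex_of_real_integrable_eq)
    have "complex_of_real (LINT x|lborel. exp (- a u * (norm (x::complex))\<^sup>2)) = of_real (pi / a u)"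
      using Gaussian_Fourier(2)[OF a, of u 0] by (simp flip: integral_complex_of_real)
    then show "(LINT x|lborel. exp (- a u * (norm (x::complex))\<^sup>2)) = pi / a u" by (simp only: of_real_eq_iff)
  qed
  have A_int: "integrable lborel (\<lambda>u. of_real (exp (- t0 * exp u)) * bessel_I s (exp u))"
    using bessel_Laplace_series(1)[OF s t0, of 0] by simp
  have A_scale: "norm (A u) * (pi / a u) = 2 * pi * r * r' * norm (of_real (exp (- t0 * exp u)) * bessel_I s (exp u))" for u
    unfolding A_def a_def by (simp add: norm_mult field_simps)
  have cont: "continuous_on UNIV (\<lambda>p. H (fst p) (snd p))"
    unfolding H_def by (intro continuous_intros s) auto
  have Hint: "integrable (lborel \<Otimes>\<^sub>M lborel) (\<lambda>p. H (fst p) (snd p))"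
  proof (rule lborel_pair.Fubini_integrable)
    show "(\<lambda>p. H (fst p) (snd p)) \<in> borel_measurable (lborel \<Otimes>\<^sub>M lborel)"
      unfolding lborel_prod measurable_lborel2 by (rule borel_measurable_continuous_onI[OF cont])
    have "(LINT x|lborel. norm (H (fst (u, x)) (snd (u, x)))) = 2 * pi * r * r' * norm (of_real (exp (- t0 * exp u)) * bessel_I s (exp u))" for u
      unfolding fst_conv snd_conv norm_H A_scale[symmetric] gauss(2)[symmetric] by (rule integral_mult_right_zero)
    then show "integrable lborel (\<lambda>u. LINT x|lborel. norm (H (fst (u, x)) (snd (u, x))))"
      using integrable_norm[OF A_int] by simp
    show "AE u in lborel. integrable lborel (\<lambda>x. H (fst (u, x)) (snd (u, x)))"
      unfolding fst_conv snd_conv H_eq by (intro AE_I2 integrable_mult_right Gaussian_Fourier(1) a)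
  qed
  then have Hint': "integrable (lborel \<Otimes>\<^sub>M lborel) (\<lambda>(u, x). H u x)" by (simp add: case_prod_unfold)
  have inner: "(LINT u|lborel. H u x) = green_phi s (cosh_dist r r' x) * lattice_char \<nu> x" for x
    unfolding H_def integral_mult_left_zero bessel_Laplace(2)[OF s cosh_dist_gt_1[OF r]] ..
  show "integrable lborel (\<lambda>x. green_phi s (cosh_dist r r' x) * lattice_char \<nu> x)"
    using lborel_pair.integrable_snd[OF Hint'] unfolding inner .
  have "(LINT x|lborel. green_phi s (cosh_dist r r' x) * lattice_char \<nu> x) = (LINT x|lborel. (LINT u|lborel. H u x))"
    unfolding inner ..
  also have "\<dots> = (LINT u|lborel. (LINT x|lborel. H u x))" by (rule lborel_pair.Fubini_integral[OF Hint'])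
  also have "(\<lambda>u. LINT x|lborel. H u x) = (\<lambda>u. of_real (2 * pi * r * r') * (of_real (exp (- t0 * exp u - (4 * pi * norm \<nu>)\<^sup>2 * r * r' * exp (- u) / 2)) * bessel_I s (exp u)))"
  proof
    fix u
    have "(LINT x|lborel. H u x) = A u * of_real (pi / a u * exp (- (4 * pi * norm \<nu>)\<^sup>2 / (4 * a u)))"
      unfolding H_eq Gaussian_Fourier(2)[OF a, symmetric] by (rule integral_mult_right_zero)
    also have "- (4 * pi * norm \<nu>)\<^sup>2 / (4 * a u) = - ((4 * pi * norm \<nu>)\<^sup>2 * r * r' * exp (- u) / 2)"
      unfolding a_def using r by (simp add: exp_minus field_simps)
    also have "A u * of_real (pi / a u * exp (- ((4 * pi * norm \<nu>)\<^sup>2 * r * r' * exp (- u) / 2))) =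
        of_real (exp u * pi / a u) * (of_real (exp (- t0 * exp u) * exp (- ((4 * pi * norm \<nu>)\<^sup>2 * r * r' * exp (- u) / 2))) * bessel_I s (exp u))"
      unfolding A_def by (simp only: of_real_mult of_real_divide times_divide_eq_left times_divide_eq_right mult_ac)
    also have "exp u * pi / a u = 2 * pi * r * r'" unfolding a_def using r by simp
    also have "exp (- t0 * exp u) * exp (- ((4 * pi * norm \<nu>)\<^sup>2 * r * r' * exp (- u) / 2)) = exp (- t0 * exp u - (4 * pi * norm \<nu>)\<^sup>2 * r * r' * exp (- u) / 2)"
      by (simp flip: exp_add)
    finally show "(LINT x|lborel. H u x) = of_real (2 * pi * r * r') * (of_real (exp (- t0 * exp u - (4 * pi * norm \<nu>)\<^sup>2 * r * r' * exp (- u) / 2)) * bessel_I s (exp u))" .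
  qed
  finally show "(LINT x|lborel. green_phi s (cosh_dist r r' x) * lattice_char \<nu> x) =
      of_real (2 * pi * r * r') * (LINT u|lborel. of_real (exp (- cosh_dist r r' 0 * exp u - (4 * pi * norm \<nu>)\<^sup>2 * r * r' * exp (- u) / 2)) * bessel_I s (exp u))"
    unfolding t0_def by simp
qed

text \<open>The Gaussians contribute only their total mass, which changes the measure \<open>dv\<close> of the Laplace transform to
  \<open>dv / v\<close>. At \<open>T = (r\<^sup>2 + r'\<^sup>2) / (2 r r')\<close> one has \<open>T + sqrt (T\<^sup>2 - 1) = r / r'\<close>.\<close>

lemma green_phi_Fourier_0:
  assumes s: "Re s > 0" and r: "0 < r'" "r' < r"
  shows "(LINT x|lborel. green_phi s (cosh_dist r r' x)) = 2 * of_real pi * (of_real r powr (1 - s) / s) * of_real r' powr (s + 1)"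
proof -
  define t0 where "t0 = cosh_dist r r' 0"
  have t0: "t0 > 1" unfolding t0_def by (rule cosh_dist_gt_1[OF r])
  have rpos: "r > 0" using r by simp
  have "t0\<^sup>2 - 1 = ((r\<^sup>2 - r'\<^sup>2) / (2 * r * r'))\<^sup>2"
    unfolding t0_def cosh_dist_def using r by (simp add: power_divide field_simps) (simp add: power2_eq_square algebra_simps)
  moreover have "r'\<^sup>2 \<le> r\<^sup>2" using r by (intro power_mono) auto
  ultimately have "sqrt (t0\<^sup>2 - 1) = (r\<^sup>2 - r'\<^sup>2) / (2 * r * r')" using r by simp
  then have e: "t0 + sqrt (t0\<^sup>2 - 1) = r / r'"
    unfolding t0_def cosh_dist_def using r by (simp add: field_simps power2_eq_square)
  have "(LINT x|lborel. green_phi s (cosh_dist r r' x)) = of_real (2 * pi * r * r') * (of_real (r / r') powr (- s) / s)"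
    using green_phi_Fourier_Gaussian(2)[OF s r, of 0] bessel_Laplace(1)[OF s t0] e unfolding t0_def by simp
  also have "\<dots> = 2 * of_real pi * ((of_real r * of_real r' * of_real (r / r') powr (- s)) / s)" by simp
  also have "of_real r * of_real r' * of_real (r / r') powr (- s) = of_real r powr (1 - s) * (of_real r' powr (s + 1) :: complex)"
  proof -
    have "of_real r = exp (of_real (ln r) :: complex)" "of_real r' = exp (of_real (ln r') :: complex)"
      using rpos r by (simp_all add: exp_of_real)
    moreover have "of_real (r / r') powr (- s) = exp (- s * of_real (ln r - ln r'))"
      using rpos r by (subst of_real_powr_exp) (auto simp: ln_div)
    moreover have "of_real r powr (1 - s) = exp ((1 - s) * of_real (ln r))" "of_real r' powr (s + 1) = exp ((s + 1) * of_real (ln r'))"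
      by (rule of_real_powr_exp; use rpos r in simp)+
    ultimately show ?thesis by (simp only: exp_add[symmetric]) (simp add: algebra_simps)
  qed
  finally show ?thesis by simp
qed

text \<open>With \<open>X = 4 \<pi> \<bar>\<nu>\<bar> r\<close> and \<open>x = 4 \<pi> \<bar>\<nu>\<bar> r'\<close> the integral over the Gaussians becomes the product integral
  when \<open>exp u\<close> is replaced by \<open>X x exp (- u)\<close>.\<close>

lemma green_phi_Fourier:
  assumes s: "Re s > 0" and r: "0 < r'" "r' < r" and \<nu>: "\<nu> \<noteq> 0"
  shows "(LINT x|lborel. green_phi s (cosh_dist r r' x) * lattice_char \<nu> x)
     = of_real (4 * pi * r * r') * bessel_I s (4 * pi * norm \<nu> * r') * bessel_K s (4 * pi * norm \<nu> * r)"
proof -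
  define k where "k = 4 * pi * norm \<nu>"
  have k: "k > 0" unfolding k_def using \<nu> by simp
  define X where "X = k * r"
  define x where "x = k * r'"
  have xX: "0 < x" "x < X" unfolding x_def X_def using k r by auto
  have Xp: "X > 0" "X * x > 0" using xX by auto
  define g :: "real \<Rightarrow> complex" where "g u = of_real (exp (- exp u / 2 - (X\<^sup>2 + x\<^sup>2) * exp (- u) / 2)) * bessel_I s (X * x * exp (- u))" for u
  have gm: "g \<in> borel_measurable borel" unfolding g_def[abs_def]
    by (intro borel_measurable_continuous_onI continuous_intros s) (use Xp in auto)
  have refl: "g (- (u + - ln (X * x))) = of_real (exp (- cosh_dist r r' 0 * exp u - k\<^sup>2 * r * r' * exp (- u) / 2)) * bessel_I s (exp u)" for u
  proof -
    have e1: "exp (- (u + - ln (X * x))) = X * x * exp (- u)" using Xp(2) xX by (simp add: exp_diff exp_minus divide_inverse)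
    have e2: "exp (- (- (u + - ln (X * x)))) = exp u / (X * x)" using Xp(2) xX by (simp add: exp_diff)
    have e3: "(X\<^sup>2 + x\<^sup>2) * (exp u / (X * x)) / 2 = cosh_dist r r' 0 * exp u"
      unfolding X_def x_def cosh_dist_def using k r by (simp add: power_mult_distrib field_simps power2_eq_square)
    have e4: "- (X * x * exp (- u)) / 2 = - (k\<^sup>2 * r * r' * exp (- u) / 2)" unfolding X_def x_def by (simp add: power2_eq_square)
    have e5: "X * x * (exp u / (X * x)) = exp u" using Xp xX by simp
    show ?thesis unfolding g_def e1 e2 e5 e3 e4 by (simp add: algebra_simps)
  qed
  have m1: "(\<lambda>u. g (- u)) \<in> borel_measurable borel" using gm by measurable
  have "(LINT u|lborel. g u) = (LINT u|lborel. g (- u))" by (rule lborel_integral_reflect[OF gm, symmetric])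
  also have "\<dots> = (LINT u|lborel. g (- (u + - ln (X * x))))" by (rule lborel_integral_translate[OF m1, symmetric])
  also have "\<dots> = (LINT u|lborel. of_real (exp (- cosh_dist r r' 0 * exp u - k\<^sup>2 * r * r' * exp (- u) / 2)) * bessel_I s (exp u))"
    unfolding refl ..
  finally have "(LINT u|lborel. of_real (exp (- cosh_dist r r' 0 * exp u - k\<^sup>2 * r * r' * exp (- u) / 2)) * bessel_I s (exp u)) = 2 * bessel_I s x * bessel_K s X"
    using bessel_product_formula[OF s xX] unfolding g_def by simp
  then show ?thesis
    unfolding green_phi_Fourier_Gaussian(2)[OF s r] k_def[symmetric] x_def X_def by simp
qed

section \<open>Poisson summation for the point-pair invariant\<close>

context planar_lattice
begin

text \<open>The argument of \<open>\<phi>\<^sub>s\<close> is at least a constant times \<open>(1 + \<bar>l\<bar>\<^sup>2) / r'\<close> as long as \<open>x\<close> is bounded.\<close>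

lemma green_phi_lattice_bound:
  assumes s: "Re s > 0" and \<rho>: "0 < \<rho>" "\<rho> < r"
  shows "\<exists>C\<ge>0. \<forall>r' x l. 0 < r' \<longrightarrow> r' \<le> \<rho> \<longrightarrow> norm x \<le> R \<longrightarrow>
    norm (green_phi s (cosh_dist r r' (x + l))) \<le> C * r' powr (1 + Re s) * (1 + (norm l)\<^sup>2) powr (- (1 + Re s))"
proof -
  define t0 where "t0 = cosh_dist r \<rho> 0"
  define p where "p = 1 + Re s"
  have p: "p > 0" unfolding p_def using s by simp
  define B where "B = max 2 ((2 * R\<^sup>2 + 1) / r\<^sup>2)"
  define C where "C = (1 - 1 / t0\<^sup>2) powr (- 1/2) * (2 * r * B) powr p"
  have rpos: "r > 0" using \<rho> by simp
  have B: "B \<ge> 2" "2 * R\<^sup>2 + 1 \<le> B * r\<^sup>2"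
  proof -
    have "(2 * R\<^sup>2 + 1) / r\<^sup>2 \<le> B" unfolding B_def by simp
    then show "2 * R\<^sup>2 + 1 \<le> B * r\<^sup>2" using rpos by (simp add: divide_le_eq)
  qed (simp add: B_def)
  have "norm (green_phi s (cosh_dist r r' (x + l))) \<le> C * r' powr p * (1 + (norm l)\<^sup>2) powr (- p)"
    if r': "0 < r'" "r' \<le> \<rho>" and x: "norm x \<le> R" for r' x l
  proof -
    define t where "t = cosh_dist r r' (x + l)"
    have t: "1 < t0" "t0 \<le> t" using cosh_dist_mono_height[OF r' \<rho>(2)] unfolding t0_def t_def by auto
    have "norm l \<le> norm (x + l) + R" using norm_triangle_ineq4[of "x + l" x] x by simp
    then have "(norm l)\<^sup>2 \<le> (norm (x + l) + R)\<^sup>2" by (intro power_mono) auto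
    also have "\<dots> \<le> 2 * (norm (x + l))\<^sup>2 + 2 * R\<^sup>2"
      using zero_le_power2[of "norm (x + l) - R"] by (simp add: power2_eq_square algebra_simps)
    finally have "1 + (norm l)\<^sup>2 \<le> 2 * (norm (x + l))\<^sup>2 + (2 * R\<^sup>2 + 1)" by simp
    also have "\<dots> \<le> B * (norm (x + l))\<^sup>2 + B * r\<^sup>2" using B by (intro add_mono mult_right_mono) auto
    also have "\<dots> \<le> B * ((norm (x + l))\<^sup>2 + r\<^sup>2 + r'\<^sup>2)" using B by (simp add: algebra_simps)
    also have "\<dots> = B * (2 * r * r' * t)" unfolding t_def cosh_dist_def using rpos r' by simp
    finally have "(1 + (norm l)\<^sup>2) / (2 * r * B * r') \<le> t"
      using rpos r' B by (simp add: divide_le_eq mult_ac)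
    moreover have "0 < (1 + (norm l)\<^sup>2) / (2 * r * B * r')" using rpos r' B by (intro divide_pos_pos mult_pos_pos add_pos_nonneg) auto
    ultimately have "t powr (- p) \<le> ((1 + (norm l)\<^sup>2) / (2 * r * B * r')) powr (- p)"
      using p by (intro powr_mono2') auto
    also have "\<dots> = (2 * r * B) powr p * r' powr p * (1 + (norm l)\<^sup>2) powr (- p)"
    proof -
      have "((1 + (norm l)\<^sup>2) / (2 * r * B * r')) powr (- p) = (1 + (norm l)\<^sup>2) powr (- p) / (2 * r * B * r') powr (- p)"
        by (rule powr_divide)
      also have "(2 * r * B * r') powr (- p) = inverse ((2 * r * B * r') powr p)" by (rule powr_minus)
      also have "(2 * r * B * r') powr p = (2 * r * B) powr p * r' powr p" by (rule powr_mult)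
      finally show ?thesis by (simp only: divide_inverse inverse_inverse_eq mult_ac)
    qed
    finally have tp: "t powr (- p) \<le> (2 * r * B) powr p * r' powr p * (1 + (norm l)\<^sup>2) powr (- p)" .
    have "norm (green_phi s t) \<le> (1 - 1 / t0\<^sup>2) powr (- 1/2) * t powr (- p)"
      unfolding p_def by (rule green_phi_bound[OF s t])
    also have "\<dots> \<le> (1 - 1 / t0\<^sup>2) powr (- 1/2) * ((2 * r * B) powr p * r' powr p * (1 + (norm l)\<^sup>2) powr (- p))"
      by (intro mult_left_mono tp) simp
    finally show ?thesis unfolding C_def t_def by (simp only: mult.assoc)
  qed
  moreover have "C \<ge> 0" unfolding C_def by simp
  ultimately show ?thesis unfolding p_def by blast
qed

text \<open>A bound for the lattice sum that is uniform in the point; by periodicity the point may be moved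
  into the fundamental parallelogram.\<close>

lemma green_phi_lattice_sum_bound:
  assumes s: "Re s > 0" and \<rho>: "0 < \<rho>" "\<rho> < r"
  shows "\<exists>C. \<forall>r' x. 0 < r' \<longrightarrow> r' \<le> \<rho> \<longrightarrow>
    (\<lambda>l. norm (green_phi s (cosh_dist r r' (x + l)))) summable_on L \<and>
    (\<Sum>\<^sub>\<infinity>l\<in>L. norm (green_phi s (cosh_dist r r' (x + l)))) \<le> C * r' powr (1 + Re s)"
proof -
  define R where "R = norm w1 + norm w2"
  obtain C where C: "C \<ge> 0" "\<And>r' x l. 0 < r' \<Longrightarrow> r' \<le> \<rho> \<Longrightarrow> norm x \<le> R \<Longrightarrow>
    norm (green_phi s (cosh_dist r r' (x + l))) \<le> C * r' powr (1 + Re s) * (1 + (norm l)\<^sup>2) powr (- (1 + Re s))"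
    using green_phi_lattice_bound[OF s \<rho>, of R] by blast
  define S where "S = (\<Sum>\<^sub>\<infinity>l\<in>L. (1 + (norm l)\<^sup>2) powr (- (1 + Re s)))"
  have sm: "(\<lambda>l. (1 + (norm l)\<^sup>2) powr (- (1 + Re s))) summable_on L"
    by (rule lattice_powr_summable) (use s in simp)
  show ?thesis
  proof (intro exI[of _ "C * S"] allI impI)
    fix r' x assume r': "0 < r'" "r' \<le> \<rho>"
    obtain l0 where l0: "l0 \<in> L" "x + l0 \<in> fund" using fund_unique_translate by blast
    have bij: "bij_betw ((+) l0) L L"
      by (rule bij_betw_byWitness[where f' = "\<lambda>y. y - l0"]) (use l0 L_group in auto)
    let ?g = "\<lambda>l. norm (green_phi s (cosh_dist r r' (x + l0 + l)))"
    have nx: "norm (x + l0) \<le> R" unfolding R_def using fund_bounded[OF l0(2)] .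
    have le: "?g l \<le> C * r' powr (1 + Re s) * (1 + (norm l)\<^sup>2) powr (- (1 + Re s))" for l
      using C(2)[OF r' nx] .
    have s2: "(\<lambda>l. C * r' powr (1 + Re s) * (1 + (norm l)\<^sup>2) powr (- (1 + Re s))) summable_on L"
      by (rule summable_on_cmult_right[OF sm])
    have gs: "?g summable_on L" by (rule summable_on_comparison_test[OF s2 le]) simp
    have re: "(\<lambda>l. norm (green_phi s (cosh_dist r r' (x + l)))) (l0 + l) = ?g l" for l by (simp add: add.assoc)
    have "(\<lambda>l. norm (green_phi s (cosh_dist r r' (x + l)))) summable_on L"
      using summable_on_reindex_bij_betw[OF bij, of "\<lambda>l. norm (green_phi s (cosh_dist r r' (x + l)))"] gs unfolding re by simp
    moreover have "(\<Sum>\<^sub>\<infinity>l\<in>L. norm (green_phi s (cosh_dist r r' (x + l)))) = infsum ?g L"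
      using infsum_reindex_bij_betw[OF bij, of "\<lambda>l. norm (green_phi s (cosh_dist r r' (x + l)))"] unfolding re by simp
    moreover have "infsum ?g L \<le> C * r' powr (1 + Re s) * S"
      unfolding S_def infsum_cmult_right[OF sm, symmetric] by (rule infsum_mono[OF gs s2 le])
    ultimately show "(\<lambda>l. norm (green_phi s (cosh_dist r r' (x + l)))) summable_on L \<and>
      (\<Sum>\<^sub>\<infinity>l\<in>L. norm (green_phi s (cosh_dist r r' (x + l)))) \<le> C * S * r' powr (1 + Re s)" by (simp add: mult_ac)
  qed
qed

text \<open>\<open>I\<^sub>s\<close> grows at most like \<open>exp (4 \<pi> \<bar>\<mu>\<bar> r')\<close> and \<open>K\<^sub>s\<close> decays like \<open>exp (- 4 \<pi> \<bar>\<mu>\<bar> r)\<close>, which leaves the gap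
  \<open>r - \<rho>\<close> in the exponent. The power of \<open>r'\<close> is kept, because it makes the sum over the cosets converge.\<close>

lemma bessel_IK_bound:
  assumes s: "Re s > 0" and \<rho>: "0 < \<rho>" "\<rho> < r"
  shows "\<exists>W. W summable_on (dual_lattice L - {0}) \<and> (\<forall>r' \<mu>. 0 < r' \<longrightarrow> r' \<le> \<rho> \<longrightarrow> \<mu> \<in> dual_lattice L - {0} \<longrightarrow>
     norm (of_real r' * bessel_I s (4 * pi * norm \<mu> * r') * bessel_K s (4 * pi * norm \<mu> * r)) \<le> r' powr (1 + Re s) * W \<mu>)"
proof -
  obtain m where m: "m > 0" "\<And>\<mu>. \<mu> \<in> dual_lattice L - {0} \<Longrightarrow> m \<le> norm \<mu>" using dual_norm_lower_bound by blast
  have rpos: "r > 0" using \<rho> by simp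
  obtain C where C: "C \<ge> 0" "\<And>x. x \<ge> 4 * pi * m * r \<Longrightarrow> norm (bessel_K s x) \<le> C * exp (- x)"
    using bessel_K_bound[of "4 * pi * m * r" s] m(1) rpos by auto
  define G where "G = norm (rGamma (s + 1))"
  define \<delta> where "\<delta> = 4 * pi * (r - \<rho>)"
  have \<delta>: "\<delta> > 0" unfolding \<delta>_def using \<rho> by simp
  define W where "W \<mu> = (G * C * (4 * pi) powr Re s) * (norm \<mu> powr Re s * exp (- \<delta> * norm \<mu>))" for \<mu> :: complex
  have "W summable_on dual_lattice L"
    unfolding W_def[abs_def] by (rule summable_on_cmult_right[OF dual_exp_summable[OF \<delta> s]])
  then have "W summable_on (dual_lattice L - {0})" by (rule summable_on_subset_banach) auto
  moreover have "norm (of_real r' * bessel_I s (4 * pi * norm \<mu> * r') * bessel_K s (4 * pi * norm \<mu> * r)) \<le> r' powr (1 + Re s) * W \<mu>"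
    if r': "0 < r'" "r' \<le> \<rho>" and \<mu>: "\<mu> \<in> dual_lattice L - {0}" for r' \<mu>
  proof -
    define k where "k = 4 * pi * norm \<mu>"
    have k: "k > 0" unfolding k_def using \<mu> by simp
    have I: "norm (bessel_I s (k * r')) \<le> G * (k powr Re s * r' powr Re s) * exp (k * \<rho>)"
    proof -
      have "norm (bessel_I s (k * r')) \<le> G * (k * r') powr Re s * exp (k * r')"
        unfolding G_def by (rule bessel_I_bound[OF _ s]) (use k r' in simp)
      also have "\<dots> \<le> G * (k * r') powr Re s * exp (k * \<rho>)"
        using k r' by (intro mult_left_mono) (auto simp: G_def)
      also have "(k * r') powr Re s = k powr Re s * r' powr Re s" by (rule powr_mult)
      finally show ?thesis .
    qed
    have K: "norm (bessel_K s (k * r)) \<le> C * exp (- (k * r))"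
    proof (rule C(2))
      have "4 * pi * m \<le> k" unfolding k_def using m(2)[OF \<mu>] by simp
      then show "4 * pi * m * r \<le> k * r" using rpos by (intro mult_right_mono) auto
    qed
    have "norm (of_real r' * bessel_I s (k * r') * bessel_K s (k * r)) = r' * (norm (bessel_I s (k * r')) * norm (bessel_K s (k * r)))"
      using r' by (simp add: norm_mult)
    also have "\<dots> \<le> r' * ((G * (k powr Re s * r' powr Re s) * exp (k * \<rho>)) * (C * exp (- (k * r))))"
      using r' C(1) by (intro mult_left_mono mult_mono I K) (auto simp: G_def)
    also have "\<dots> = (r' * r' powr Re s) * (G * C * k powr Re s * (exp (k * \<rho>) * exp (- (k * r))))" by (simp only: mult_ac)
    also have "r' * r' powr Re s = r' powr (1 + Re s)" using r' by (simp add: powr_add)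
    also have "exp (k * \<rho>) * exp (- (k * r)) = exp (- \<delta> * norm \<mu>)"
      unfolding k_def \<delta>_def by (simp add: algebra_simps flip: exp_add)
    also have "k powr Re s = (4 * pi) powr Re s * norm \<mu> powr Re s" unfolding k_def by (rule powr_mult)
    finally show ?thesis unfolding W_def k_def by (simp only: mult_ac)
  qed
  ultimately show ?thesis by blast
qed

text \<open>The frequency \<open>0\<close> is separated because \<open>K\<^sub>s\<close> is singular at \<open>0\<close>.\<close>

theorem green_phi_Poisson:
  assumes s: "Re s > 0" and r: "0 < r'" "r' < r"
  shows "(\<Sum>\<^sub>\<infinity>l\<in>L. green_phi s (cosh_dist r r' (x + l))) = 1 / of_real fund_area *
     (2 * of_real pi * (of_real r powr (1 - s) / s) * of_real r' powr (s + 1) +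
      (\<Sum>\<^sub>\<infinity>\<mu>\<in>dual_lattice L - {0}. of_real (4 * pi * r * r') * bessel_I s (4 * pi * norm \<mu> * r') * bessel_K s (4 * pi * norm \<mu> * r) * lattice_char \<mu> x))"
proof -
  let ?D = "dual_lattice L"
  define c where "c \<mu> = (if \<mu> = 0 then 2 * of_real pi * (of_real r powr (1 - s) / s) * of_real r' powr (s + 1)
    else of_real (4 * pi * r * r') * bessel_I s (4 * pi * norm \<mu> * r') * bessel_K s (4 * pi * norm \<mu> * r))" for \<mu> :: complex
  obtain W where W: "W summable_on (?D - {0})" "\<And>\<mu>. \<mu> \<in> ?D - {0} \<Longrightarrow>
     norm (of_real r' * bessel_I s (4 * pi * norm \<mu> * r') * bessel_K s (4 * pi * norm \<mu> * r)) \<le> r' powr (1 + Re s) * W \<mu>"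
    using bessel_IK_bound[OF s r] r(1) by blast
  have cs0: "(\<lambda>\<mu>. norm (c \<mu>)) summable_on (?D - {0})"
  proof (rule summable_on_comparison_test[OF summable_on_cmult_right[OF W(1)]])
    fix \<mu> assume \<mu>: "\<mu> \<in> ?D - {0}"
    have "norm (c \<mu>) = 4 * pi * r * norm (of_real r' * bessel_I s (4 * pi * norm \<mu> * r') * bessel_K s (4 * pi * norm \<mu> * r))"
      unfolding c_def using \<mu> r by (simp add: norm_mult)
    also have "\<dots> \<le> 4 * pi * r * (r' powr (1 + Re s) * W \<mu>)" using r by (intro mult_left_mono W(2)[OF \<mu>]) auto
    finally show "norm (c \<mu>) \<le> (4 * pi * r * r' powr (1 + Re s)) * W \<mu>" by (simp only: mult.assoc)
  qed simp
  have D0: "?D = insert 0 (?D - {0})" using dual_lattice_group(1) by auto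
  have cs: "(\<lambda>\<mu>. norm (c \<mu>)) summable_on ?D"
    by (subst D0) (use cs0 in \<open>simp only: summable_on_insert_iff\<close>)
  have "(\<Sum>\<^sub>\<infinity>l\<in>L. green_phi s (cosh_dist r r' (x + l))) = 1 / of_real fund_area * (\<Sum>\<^sub>\<infinity>\<mu>\<in>?D. c \<mu> * lattice_char \<mu> x)"
  proof (rule Poisson_summation[where f = "\<lambda>x. green_phi s (cosh_dist r r' x)"])
    show "continuous_on UNIV (\<lambda>x. green_phi s (cosh_dist r r' x))"
      by (intro continuous_on_green_phi continuous_intros cosh_dist_gt_1 r)
    show "integrable lborel (\<lambda>x. green_phi s (cosh_dist r r' x))"
      using green_phi_Fourier_Gaussian(1)[OF s r, of 0] by simp
    show "\<exists>M. M summable_on L \<and> (\<forall>l\<in>L. \<forall>x. norm x \<le> R \<longrightarrow> norm (green_phi s (cosh_dist r r' (x + l))) \<le> M l)" for R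
    proof -
      obtain C where "C \<ge> 0" "\<And>x l. norm x \<le> R \<Longrightarrow>
        norm (green_phi s (cosh_dist r r' (x + l))) \<le> C * r' powr (1 + Re s) * (1 + (norm l)\<^sup>2) powr (- (1 + Re s))"
        using green_phi_lattice_bound[OF s r, of R] r(1) by blast
      moreover have "(\<lambda>l. C * r' powr (1 + Re s) * (1 + (norm l)\<^sup>2) powr (- (1 + Re s))) summable_on L"
        by (intro summable_on_cmult_right lattice_powr_summable) (use s in simp)
      ultimately show ?thesis by blast
    qed
    show "(LINT x|lborel. green_phi s (cosh_dist r r' x) * lattice_char (- \<mu>) x) = c \<mu>" for \<mu>
      unfolding c_def using green_phi_Fourier_0[OF s r] green_phi_Fourier[OF s r, of "- \<mu>"] by simp
  qed (rule cs)
  also have "(\<Sum>\<^sub>\<infinity>\<mu>\<in>?D. c \<mu> * lattice_char \<mu> x) = c 0 + (\<Sum>\<^sub>\<infinity>\<mu>\<in>?D - {0}. c \<mu> * lattice_char \<mu> x)"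
  proof -
    have "(\<lambda>\<mu>. c \<mu> * lattice_char \<mu> x) summable_on (?D - {0})"
      by (rule abs_summable_summable) (use cs0 in \<open>simp add: norm_mult\<close>)
    then show ?thesis by (subst D0, subst infsum_insert) auto
  qed
  also have "(\<Sum>\<^sub>\<infinity>\<mu>\<in>?D - {0}. c \<mu> * lattice_char \<mu> x) = (\<Sum>\<^sub>\<infinity>\<mu>\<in>?D - {0}. of_real (4 * pi * r * r') * bessel_I s (4 * pi * norm \<mu> * r') * bessel_K s (4 * pi * norm \<mu> * r) * lattice_char \<mu> x)"
    by (intro infsum_cong) (auto simp: c_def)
  also have "c 0 = 2 * of_real pi * (of_real r powr (1 - s) / s) * of_real r' powr (s + 1)" unfolding c_def by simp
  finally show ?thesis .
qed

end

section \<open>Sublattices of finite index\<close>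

lemma independent_if_Im_nonzero:
  assumes "Im (a * cnj b) \<noteq> 0"
  shows "a \<noteq> b \<and> independent {a, b}"
proof -
  have ab: "a \<noteq> b" using assms by (auto simp: complex_mult_cnj)
  have "a \<notin> span {b}"
  proof
    assume "a \<in> span {b}"
    then obtain c where "a = c *\<^sub>R b" by (auto simp: span_singleton)
    then have "Im (a * cnj b) = 0" by (simp add: complex_mult_cnj)
    with assms show False by simp
  qed
  moreover have "b \<noteq> 0" using assms by auto
  ultimately show ?thesis using ab by (auto simp: independent_insert)
qed

text \<open>The basis is found in Hermite normal form: a shortest vector on the first axis and a vector with
  the least positive second coordinate.\<close>

lemma sublattice_has_basis:
  fixes L :: "complex set"
  assumes diff: "\<And>x y. x \<in> L \<Longrightarrow> y \<in> L \<Longrightarrow> x - y \<in> L"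
    and sub: "\<And>x. x \<in> L \<Longrightarrow> \<exists>m n. x = of_int m * u + of_int n * v"
    and uv: "Im (u * cnj v) \<noteq> 0"
    and ab: "a \<in> L" "b \<in> L" "Im (a * cnj b) \<noteq> 0"
  shows "\<exists>w1 w2. lattice_basis L w1 w2"
proof -
  define \<phi> where "\<phi> m n = of_int m * u + of_int n * v" for m n :: int
  have zero: "0 \<in> L" using diff[OF ab(1) ab(1)] by simp
  have neg: "- x \<in> L" if "x \<in> L" for x using diff[OF zero that] by simp
  have add: "x + y \<in> L" if "x \<in> L" "y \<in> L" for x y using diff[OF that(1) neg[OF that(2)]] by simp
  have mult_nat: "of_nat k * x \<in> L" if "x \<in> L" for k :: nat and x
    by (induction k) (use zero add that in \<open>auto simp: distrib_right\<close>)
  have mult: "of_int k * x \<in> L" if "x \<in> L" for k :: int and x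
    using mult_nat[OF that, of "nat k"] neg[OF mult_nat[OF that, of "nat (- k)"]] by (cases "k \<ge> 0") auto
  have \<phi>_lin: "\<phi> m n - of_int k * \<phi> m' n' = \<phi> (m - k * m') (n - k * n')" for m n k m' n'
    unfolding \<phi>_def by (simp add: algebra_simps)
  have Im_\<phi>: "Im (\<phi> m n * cnj (\<phi> m' n')) = of_int (m * n' - n * m') * Im (u * cnj v)" for m n m' n'
    unfolding \<phi>_def by (simp add: algebra_simps)
  obtain m1 n1 m2 n2 where mn: "a = \<phi> m1 n1" "b = \<phi> m2 n2" using sub[OF ab(1)] sub[OF ab(2)] unfolding \<phi>_def by blast
  then have dt: "m1 * n2 - n1 * m2 \<noteq> 0" using ab(3) Im_\<phi>[of m1 n1 m2 n2] by (metis mult_zero_left of_int_0)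
  define P where "P d \<longleftrightarrow> d > 0 \<and> (\<exists>p. \<phi> p (int d) \<in> L)" for d :: nat
  define Q where "Q c \<longleftrightarrow> c > 0 \<and> \<phi> (int c) 0 \<in> L" for c :: nat
  have "\<exists>d. P d"
  proof -
    obtain m n where "n \<noteq> 0" "\<phi> m n \<in> L" using dt mn ab by (metis mult_zero_left mult_zero_right diff_self)
    then have "P (nat n) \<or> P (nat (- n))"
      using neg[of "\<phi> m n"] \<phi>_lin[of 0 0 1 m n] unfolding P_def by (cases "n > 0") (auto simp: \<phi>_def intro: exI[of _ m] exI[of _ "- m"])
    then show ?thesis by blast
  qed
  moreover have "\<exists>c. Q c"
  proof -
    define k where "k = n2 * m1 - n1 * m2"
    have "of_int n2 * a - of_int n1 * b \<in> L" using diff mult ab by blast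
    also have "of_int n2 * a - of_int n1 * b = \<phi> k 0" unfolding mn \<phi>_def k_def by (simp add: algebra_simps)
    finally have "\<phi> k 0 \<in> L" "- \<phi> k 0 \<in> L" using neg by auto
    moreover have "- \<phi> k 0 = \<phi> (- k) 0" unfolding \<phi>_def by simp
    moreover have "k \<noteq> 0" using dt unfolding k_def by (simp add: mult.commute)
    ultimately have "Q (nat k) \<or> Q (nat (- k))" unfolding Q_def by (cases "k > 0") auto
    then show ?thesis by blast
  qed
  ultimately obtain d c where d: "P d" "\<And>d'. d' < d \<Longrightarrow> \<not> P d'" and c: "Q c" "\<And>c'. c' < c \<Longrightarrow> \<not> Q c'"
    by (metis exists_least_iff)
  obtain p where p: "\<phi> p (int d) \<in> L" using d(1) unfolding P_def by blast
  have cL: "\<phi> (int c) 0 \<in> L" and pos: "c > 0" "d > 0" using c(1) d(1) unfolding P_def Q_def by auto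
  have d_dvd: "int d dvd n" if "\<phi> m n \<in> L" for m n
  proof -
    have "\<phi> m n - of_int (n div int d) * \<phi> p (int d) \<in> L" using diff mult that p by blast
    then have "\<phi> (m - n div int d * p) (int (nat (n mod int d))) \<in> L" 
      unfolding \<phi>_lin using pos by (simp add: minus_div_mult_eq_mod)
    then have ex: "\<exists>p. \<phi> p (int (nat (n mod int d))) \<in> L" by (rule exI)
    have "nat (n mod int d) < d" using pos by (simp add: nat_less_iff)
    then have "\<not> P (nat (n mod int d))" by (rule d(2))
    with ex have "\<not> nat (n mod int d) > 0" unfolding P_def by simp
    moreover have "n mod int d \<ge> 0" using pos by simp
    moreover have "x = 0" if "\<not> nat x > 0" "x \<ge> 0" for x using that by simp
    ultimately have "n mod int d = 0" by blast
    then show ?thesis by auto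
  qed
  have c_dvd: "int c dvd m" if "\<phi> m 0 \<in> L" for m
  proof -
    have "\<phi> m 0 - of_int (m div int c) * \<phi> (int c) 0 \<in> L" using diff mult that cL by blast
    then have "\<phi> (int (nat (m mod int c))) 0 \<in> L"
      unfolding \<phi>_lin using pos by (simp add: minus_div_mult_eq_mod)
    moreover have "nat (m mod int c) < c" using pos by (simp add: nat_less_iff)
    then have "\<not> Q (nat (m mod int c))" by (rule c(2))
    ultimately have "\<not> nat (m mod int c) > 0" unfolding Q_def by simp
    moreover have "m mod int c \<ge> 0" using pos by simp
    moreover have "x = 0" if "\<not> nat x > 0" "x \<ge> 0" for x using that by simp
    ultimately have "m mod int c = 0" by blast
    then show ?thesis by auto
  qed
  define w1 where "w1 = \<phi> (int c) 0"
  define w2 where "w2 = \<phi> p (int d)"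
  have "x \<in> {of_int m * w1 + of_int n * w2 | m n. True}" if x: "x \<in> L" for x
  proof -
    obtain m n where mn: "x = \<phi> m n" using sub[OF x] unfolding \<phi>_def by blast
    have "int d dvd n" using d_dvd x mn by simp
    then obtain q where q: "n = int d * q" by (rule dvdE)
    have "\<phi> m n - of_int q * w2 \<in> L" using diff mult x mn p unfolding w2_def by blast
    then have "\<phi> (m - q * p) 0 \<in> L" unfolding w2_def \<phi>_lin q by (simp add: mult.commute)
    then have "int c dvd m - q * p" by (rule c_dvd)
    then obtain k where k: "m - q * p = int c * k" by (rule dvdE)
    have "x = of_int k * w1 + of_int q * w2"
    proof -
      have "m = int c * k + q * p" using k by simp
      then show ?thesis unfolding mn w1_def w2_def \<phi>_def q by (simp add: algebra_simps)
    qed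
    then show ?thesis by blast
  qed
  moreover have "x \<in> L" if "x \<in> {of_int m * w1 + of_int n * w2 | m n. True}" for x
    using that add mult cL p unfolding w1_def w2_def by blast
  moreover have "w1 \<noteq> w2 \<and> independent {w1, w2}"
    by (rule independent_if_Im_nonzero) (use Im_\<phi>[of "int c" 0 p "int d"] uv pos in \<open>simp add: w1_def w2_def\<close>)
  ultimately show ?thesis unfolding lattice_basis_def by blast
qed

context imag_quadratic
begin

text \<open>Multiplication by \<open>c\<close> maps \<open>L\<close> into the lattice spanned by \<open>1 / (2 D)\<close> and \<open>w / (2 D)\<close>, and \<open>1\<close> and \<open>w\<close>
  show that the rank of \<open>L\<close> is two.\<close>

lemma fractional_ideal_lattice:
  assumes diff: "\<And>x y. x \<in> L \<Longrightarrow> y \<in> L \<Longrightarrow> x - y \<in> L"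
    and c: "c \<noteq> 0" "\<And>x. x \<in> L \<Longrightarrow> c * x \<in> ring_of_integers K" and L: "1 \<in> L" "w \<in> L"
  shows "\<exists>w1 w2. lattice_basis L w1 w2"
proof (rule sublattice_has_basis[of L "1 / (of_int (2 * D) * c)" "w / (of_int (2 * D) * c)" w 1])
  fix x assume "x \<in> L"
  then obtain m n where "c * x = (of_int m + of_int n * w) / of_int (2 * D)"
    using c(2) integers_in_lattice by blast
  moreover have "x = c * x / c" using c(1) by simp
  ultimately have "x = (of_int m + of_int n * w) / of_int (2 * D) / c" by (simp only:)
  then have "x = of_int m * (1 / (of_int (2 * D) * c)) + of_int n * (w / (of_int (2 * D) * c))"
    by (simp add: add_divide_distrib)
  then show "\<exists>m n. x = of_int m * (1 / (of_int (2 * D) * c)) + of_int n * (w / (of_int (2 * D) * c))" by blast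
next
  define e where "e = 1 / (of_int (2 * D) * c)"
  have "e \<noteq> 0" unfolding e_def using c(1) D_neg by auto
  have "1 / (of_int (2 * D) * c) * cnj (w / (of_int (2 * D) * c)) = (e * cnj e) * cnj w"
    unfolding e_def by simp
  also have "\<dots> = of_real ((norm e)\<^sup>2) * - w" unfolding complex_norm_square by simp
  also have "Im \<dots> = - ((norm e)\<^sup>2 * Im w)" by simp
  finally show "Im (1 / (of_int (2 * D) * c) * cnj (w / (of_int (2 * D) * c))) \<noteq> 0"
    using \<open>e \<noteq> 0\<close> Im_w(3) by simp
next
  show "Im (w * cnj 1) \<noteq> 0" using Im_w(3) by simp
qed (use diff L in auto)

lemma integers_lattice: "\<exists>w1 w2. lattice_basis (ring_of_integers K) w1 w2"
  by (rule fractional_ideal_lattice[of _ 1]) (auto intro: integers_diff integers_w)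

text \<open>The square \<open>a\<^sup>2\<close> of a nonzero coordinate of the cusp lies in the square of the ideal, so it clears all
  denominators; since the ideal consists of integers, its inverse contains \<open>1\<close> and \<open>w\<close>.\<close>

lemma cusp_lattice_lattice:
  fixes \<kappa> :: "complex^2"
  assumes \<kappa>: "\<kappa> \<noteq> 0" "\<And>i. \<kappa> $ i \<in> ring_of_integers K"
  shows "\<exists>w1 w2. lattice_basis (cusp_lattice K \<kappa>) w1 w2"
proof -
  let ?O = "ring_of_integers K"
  define I where "I = ideal_gen2 ?O (\<kappa> $ 1) (\<kappa> $ 2)"
  have L: "cusp_lattice K \<kappa> = {x \<in> K. \<forall>y\<in>ideal_mult I I. x * y \<in> ?O}"
    unfolding cusp_lattice_def ideal_inverse_def Let_def I_def ..
  have IO: "x \<in> ?O" if "x \<in> I" for x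
    using that \<kappa>(2) unfolding I_def ideal_gen2_def by (auto intro: integers_add integers_mult)
  have sumO: "(\<Sum>i<n. f i) \<in> ?O" if "\<And>i. i < n \<Longrightarrow> f i \<in> ?O" for n :: nat and f
    using that by (induction n) (auto intro: integers_add)
  have IIO: "y \<in> ?O" if "y \<in> ideal_mult I I" for y
    using that IO unfolding ideal_mult_def by (auto intro!: sumO integers_mult)
  have gens: "\<kappa> $ 1 \<in> I" "\<kappa> $ 2 \<in> I"
  proof -
    have "\<kappa> $ 1 = \<kappa> $ 1 * 1 + \<kappa> $ 2 * 0" "\<kappa> $ 2 = \<kappa> $ 1 * 0 + \<kappa> $ 2 * 1" by simp_all
    then show "\<kappa> $ 1 \<in> I" "\<kappa> $ 2 \<in> I"
      unfolding I_def ideal_gen2_def mem_Collect_eq using integers_0_1 by metis+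
  qed
  have "\<kappa> $ 1 \<noteq> 0 \<or> \<kappa> $ 2 \<noteq> 0" using \<kappa>(1) by (auto simp: vec_eq_iff forall_2)
  then obtain a where a: "a \<in> I" "a \<noteq> 0" using gens by blast
  have aa: "a * a \<in> ideal_mult I I"
    unfolding ideal_mult_def using a(1)
    by (intro CollectI exI[of _ "1::nat"] exI[of _ "\<lambda>_. a"]) auto
  show ?thesis
  proof (rule fractional_ideal_lattice[of _ "a * a"])
    fix x y assume "x \<in> cusp_lattice K \<kappa>" "y \<in> cusp_lattice K \<kappa>"
    then show "x - y \<in> cusp_lattice K \<kappa>" unfolding L
      using K_add[of x "- y"] K_minus[of y] by (auto simp: left_diff_distrib intro: integers_diff)
  next
    show "w \<in> cusp_lattice K \<kappa>" "1 \<in> cusp_lattice K \<kappa>"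
    proof -
      have "w \<in> K" using integers_w unfolding ring_of_integers_def by simp
      then show "w \<in> cusp_lattice K \<kappa>" unfolding L using integers_mult[OF integers_w IIO] by blast
      show "1 \<in> cusp_lattice K \<kappa>" unfolding L using IIO Rats_K[of 1] by simp
    qed
  qed (use a aa in \<open>auto simp: L mult.commute\<close>)
qed

text \<open>\<open>a * cnj a\<close> is a positive integer.\<close>

lemma integer_norm_ge_1:
  assumes "a \<in> ring_of_integers K" "a \<noteq> 0" shows "norm a \<ge> 1"
proof -
  have "a * cnj a \<in> \<int>"
    using assms(1) K_trace_norm_rational(2) rational_bounded_powers_imp_int bounded_powers_cnj bounded_powers_mult[OF ww]
    unfolding ring_of_integers_iff by metis
  then obtain n where n: "a * cnj a = of_int n" by (auto elim: Ints_cases)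
  then have "of_real ((norm a)\<^sup>2) = (of_real (of_int n) :: complex)" unfolding complex_norm_square by simp
  then have e: "(norm a)\<^sup>2 = of_int n" by (simp only: of_real_eq_iff)
  moreover have "(norm a)\<^sup>2 > 0" using assms(2) by simp
  ultimately have "n \<ge> 1" by (metis of_int_0_less_iff int_one_le_iff_zero_less)
  then have "1\<^sup>2 \<le> (norm a)\<^sup>2" unfolding e by simp
  then show ?thesis by (rule power2_le_imp_le) simp
qed

end

section \<open>Matrices and their action on hyperbolic space\<close>

definition mat2 :: "complex \<Rightarrow> complex \<Rightarrow> complex \<Rightarrow> complex \<Rightarrow> complex^2^2" where
  "mat2 a b c d = vector [vector [a, b], vector [c, d]]"

lemma mat2_nth [simp]: "mat2 a b c d $ 1 $ 1 = a" "mat2 a b c d $ 1 $ 2 = b"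
  "mat2 a b c d $ 2 $ 1 = c" "mat2 a b c d $ 2 $ 2 = d"
  unfolding mat2_def by simp_all

lemma mat2_eqI: "A $ 1 $ 1 = B $ 1 $ 1 \<Longrightarrow> A $ 1 $ 2 = B $ 1 $ 2 \<Longrightarrow> A $ 2 $ 1 = B $ 2 $ 1 \<Longrightarrow> A $ 2 $ 2 = B $ 2 $ 2 \<Longrightarrow> A = (B :: complex^2^2)"
  by (simp add: vec_eq_iff forall_2)

lemma mat2_mult_nth: "(A ** B) $ i $ j = A $ i $ 1 * B $ 1 $ j + A $ i $ 2 * B $ 2 $ j" for A B :: "complex^2^2"
  by (simp add: matrix_matrix_mult_def sum_2)

lemma mat1_nth [simp]: "(mat 1 :: complex^2^2) $ 1 $ 1 = 1" "(mat 1 :: complex^2^2) $ 1 $ 2 = 0"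
  "(mat 1 :: complex^2^2) $ 2 $ 1 = 0" "(mat 1 :: complex^2^2) $ 2 $ 2 = 1"
  by (simp_all add: mat_def)

definition adj2 :: "complex^2^2 \<Rightarrow> complex^2^2" where
  "adj2 A = mat2 (A $ 2 $ 2) (- A $ 1 $ 2) (- A $ 2 $ 1) (A $ 1 $ 1)"

lemma adj2_mult: assumes "det A = 1" shows "A ** adj2 A = mat 1" "adj2 A ** A = mat 1"
  using assms by (auto intro!: mat2_eqI simp: mat2_mult_nth adj2_def det_2 algebra_simps)

lemma det_adj2 [simp]: "det (adj2 A) = det A"
  by (simp add: det_2 adj2_def algebra_simps)

lemma matrix_neg_mult: "(- A) ** B = - (A ** B)" "A ** (- B) = - (A ** B)" for A B :: "complex^2^2"
  by (auto intro!: mat2_eqI simp: mat2_mult_nth)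

text \<open>The point \<open>z + r j\<close> corresponds to a positive definite Hermitian matrix of determinant 1, on which
  matrices act by \<open>H \<mapsto> A H A\<^sup>*\<close>. In this model the action is visibly associative, and the distance
  is a polarization of the determinant.\<close>

definition herm :: "complex \<times> real \<Rightarrow> complex^2^2" where
  "herm P = mat2 (of_real (((norm (fst P))\<^sup>2 + (snd P)\<^sup>2) / snd P)) (fst P / of_real (snd P))
               (cnj (fst P) / of_real (snd P)) (of_real (1 / snd P))"

definition adjoint2 :: "complex^2^2 \<Rightarrow> complex^2^2" where
  "adjoint2 A = mat2 (cnj (A $ 1 $ 1)) (cnj (A $ 2 $ 1)) (cnj (A $ 1 $ 2)) (cnj (A $ 2 $ 2))"

lemma adjoint2_mult: "adjoint2 (A ** B) = adjoint2 B ** adjoint2 A"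
  by (rule mat2_eqI) (simp_all add: adjoint2_def mat2_mult_nth)

lemma det_adjoint2: "det (adjoint2 A) = cnj (det A)"
  by (simp add: det_2 adjoint2_def mult.commute)

definition act_denom :: "complex^2^2 \<Rightarrow> complex \<times> real \<Rightarrow> real" where
  "act_denom A P = (norm (A $ 2 $ 1 * fst P + A $ 2 $ 2))\<^sup>2 + (norm (A $ 2 $ 1))\<^sup>2 * (snd P)\<^sup>2"

lemma snd_mat_act: "snd (mat_act A P) = snd P / act_denom A P"
  unfolding mat_act_def act_denom_def Let_def by simp

lemma act_denom_pos:
  assumes "det A = 1" "snd P > 0" shows "act_denom A P > 0"
proof (cases "A $ 2 $ 1 = 0")
  case True
  then have "A $ 2 $ 2 \<noteq> 0" using assms(1) by (auto simp: det_2)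
  then show ?thesis using True unfolding act_denom_def by simp
next
  case False
  then show ?thesis using assms(2) unfolding act_denom_def by (intro add_nonneg_pos) auto
qed

lemma herm_act:
  assumes A: "det A = 1" and P: "snd P > 0"
  shows "A ** herm P ** adjoint2 A = herm (mat_act A P)"
proof -
  define a b c d where "a = A $ 1 $ 1" and "b = A $ 1 $ 2" and "c = A $ 2 $ 1" and "d = A $ 2 $ 2"
  define z r where "z = fst P" and "r = snd P"
  define N where "N = act_denom A P"
  define q where "q = (a * z + b) * cnj (c * z + d) + a * cnj c * of_real (r\<^sup>2)"
  have dt: "a * d - b * c = 1" using A unfolding det_2 a_def b_def c_def d_def .
  have r: "r > 0" using P unfolding r_def .
  have N: "N > 0" unfolding N_def by (rule act_denom_pos[OF A P])
  have act: "mat_act A P = (q / of_real N, r / N)"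
    unfolding mat_act_def Let_def q_def N_def act_denom_def a_def b_def c_def d_def z_def r_def by simp
  have Nc: "of_real N = (c * z + d) * cnj (c * z + d) + c * cnj c * of_real (r\<^sup>2)"
    unfolding N_def act_denom_def c_def d_def z_def r_def of_real_add of_real_mult complex_norm_square by simp
  have zz: "of_real ((norm z)\<^sup>2) = z * cnj z" by (rule complex_norm_square)
  have hP: "herm P = mat2 ((z * cnj z + of_real r * of_real r) / of_real r) (z / of_real r) (cnj z / of_real r) (1 / of_real r)"
    unfolding herm_def z_def[symmetric] r_def[symmetric] by (simp add: zz[symmetric] power2_eq_square)
  have rc: "(of_real r :: complex) \<noteq> 0" using r by simp
  have Ncne: "(of_real N :: complex) \<noteq> 0" using N by simp
  define M where "M = (a * z + b) * cnj (a * z + b) + a * cnj a * of_real (r\<^sup>2)"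
  \<comment> \<open>\<open>M\<close>, \<open>q\<close> and \<open>N\<close> are the entries of \<open>A H A\<^sup>*\<close> up to the factor \<open>r\<close>; its determinant is 1 like that of \<open>H\<close>\<close>
  have key: "q * cnj q + of_real (r\<^sup>2) = M * of_real N"
  proof -
    have "M * of_real N - q * cnj q = of_real (r\<^sup>2) * ((a * d - b * c) * cnj (a * d - b * c))"
      unfolding M_def Nc q_def by (simp add: algebra_simps power2_eq_square)
    then show ?thesis unfolding dt by (simp add: algebra_simps)
  qed
  have e11: "(A ** herm P ** adjoint2 A) $ 1 $ 1 = M / of_real r"
    unfolding M_def mat2_mult_nth hP adjoint2_def using rc
    by (simp add: a_def[symmetric] b_def[symmetric] field_simps power2_eq_square)
  have e12: "(A ** herm P ** adjoint2 A) $ 1 $ 2 = q / of_real r"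
    unfolding q_def mat2_mult_nth hP adjoint2_def using rc
    by (simp add: a_def[symmetric] b_def[symmetric] c_def[symmetric] d_def[symmetric] field_simps power2_eq_square)
  have e21: "(A ** herm P ** adjoint2 A) $ 2 $ 1 = cnj q / of_real r"
    unfolding q_def mat2_mult_nth hP adjoint2_def using rc
    by (simp add: a_def[symmetric] b_def[symmetric] c_def[symmetric] d_def[symmetric] field_simps power2_eq_square)
  have e22: "(A ** herm P ** adjoint2 A) $ 2 $ 2 = of_real N / of_real r"
    unfolding Nc mat2_mult_nth hP adjoint2_def using rc
    by (simp add: c_def[symmetric] d_def[symmetric] field_simps power2_eq_square)
  have h11: "herm (mat_act A P) $ 1 $ 1 = M / of_real r"
  proof -
    have "herm (mat_act A P) $ 1 $ 1 = of_real ((norm (q / of_real N))\<^sup>2 + (r / N)\<^sup>2) / of_real (r / N)"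
      unfolding herm_def act by simp
    also have "of_real ((norm (q / of_real N))\<^sup>2 + (r / N)\<^sup>2) = (q * cnj q + of_real (r\<^sup>2)) / (of_real N * of_real N :: complex)"
      unfolding of_real_add complex_norm_square by (simp add: add_divide_distrib power2_eq_square)
    also have "\<dots> / of_real (r / N) = M / of_real r" unfolding key using rc Ncne by simp
    finally show ?thesis .
  qed
  have h: "herm (mat_act A P) $ 1 $ 2 = q / of_real r" "herm (mat_act A P) $ 2 $ 1 = cnj q / of_real r"
    "herm (mat_act A P) $ 2 $ 2 = of_real N / of_real r"
    unfolding herm_def act using Ncne by simp_all
  show ?thesis by (rule mat2_eqI) (simp_all only: e11 e12 e21 e22 h11 h)
qed

lemma snd_mat_act_pos: "det A = 1 \<Longrightarrow> snd P > 0 \<Longrightarrow> snd (mat_act A P) > 0"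
  unfolding snd_mat_act using act_denom_pos by simp

lemma herm_inj:
  assumes "herm P = herm Q" "snd P > 0" "snd Q > 0" shows "P = Q"
proof -
  have "herm P $ 2 $ 2 = herm Q $ 2 $ 2" "herm P $ 1 $ 2 = herm Q $ 1 $ 2" using assms(1) by auto
  then have e: "(of_real (1 / snd P) :: complex) = of_real (1 / snd Q)" "fst P / of_real (snd P) = fst Q / of_real (snd Q)"
    unfolding herm_def by simp_all
  then have "1 / snd P = 1 / snd Q" by (simp only: of_real_eq_iff)
  then have s: "snd P = snd Q" using assms(2,3) by simp
  then have "fst P = fst Q" using e(2) assms(2) by simp
  with s show ?thesis by (simp add: prod_eq_iff)
qed

lemma mat_act_mult:
  assumes A: "det A = 1" and B: "det B = 1" and P: "snd P > 0"
  shows "mat_act (A ** B) P = mat_act A (mat_act B P)"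
proof (rule herm_inj)
  have AB: "det (A ** B) = 1" using A B by (simp add: det_mul)
  have BP: "snd (mat_act B P) > 0" by (rule snd_mat_act_pos[OF B P])
  have "herm (mat_act (A ** B) P) = A ** (B ** herm P ** adjoint2 B) ** adjoint2 A"
    unfolding herm_act[OF AB P, symmetric] adjoint2_mult by (simp only: matrix_mul_assoc)
  then show "herm (mat_act (A ** B) P) = herm (mat_act A (mat_act B P))"
    unfolding herm_act[OF B P] herm_act[OF A BP] .
  show "snd (mat_act (A ** B) P) > 0" "snd (mat_act A (mat_act B P)) > 0"
    by (intro snd_mat_act_pos A B AB P BP)+
qed

lemma mat_act_uminus: "mat_act (- A) P = mat_act A P"
proof -
  have n: "norm (- x * y + - z) = norm (x * y + z)" for x y z :: complex
    by (metis minus_add_distrib minus_mult_left norm_minus_cancel)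
  show ?thesis unfolding mat_act_def Let_def by (simp add: n[simplified] algebra_simps norm_minus_commute)
qed

lemma mat_act_translation: "mat_act (mat2 1 l 0 1) P = (fst P + l, snd P)"
  unfolding mat_act_def Let_def by simp

definition cosh_arg :: "complex \<times> real \<Rightarrow> complex \<times> real \<Rightarrow> real" where
  "cosh_arg P Q = cosh_dist (snd P) (snd Q) (fst P - fst Q)"

lemma cosh_arg_det:
  assumes "snd P > 0" "snd Q > 0"
  shows "det (herm P + herm Q) = of_real (2 + 2 * cosh_arg P Q)"
proof -
  define z r where "z = fst P" and "r = snd P"
  define y t where "y = fst Q" and "t = snd Q"
  have ne: "(of_real r :: complex) \<noteq> 0" "(of_real t :: complex) \<noteq> 0" using assms unfolding r_def t_def by auto
  have "(of_real (2 + 2 * cosh_arg P Q) :: complex) = 2 + ((z - y) * cnj (z - y) + of_real r * of_real r + of_real t * of_real t) / (of_real r * of_real t)"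
    unfolding cosh_arg_def cosh_dist_def z_def[symmetric] y_def[symmetric] r_def[symmetric] t_def[symmetric]
  proof -
    have "(of_real (2 + 2 * (((norm (z - y))\<^sup>2 + r\<^sup>2 + t\<^sup>2) / (2 * r * t))) :: complex) = 2 + of_real ((norm (z - y))\<^sup>2 + r\<^sup>2 + t\<^sup>2) / (of_real r * of_real t)"
    proof -
      have "2 + 2 * (N / (2 * r * t)) = 2 + N / (r * t)" for N :: real by simp
      then show ?thesis by (simp only:) simp
    qed
    also have "(of_real ((norm (z - y))\<^sup>2 + r\<^sup>2 + t\<^sup>2) :: complex) = (z - y) * cnj (z - y) + of_real r * of_real r + of_real t * of_real t"
      unfolding of_real_add complex_norm_square by (simp add: power2_eq_square)
    finally show "(of_real (2 + 2 * (((norm (z - y))\<^sup>2 + r\<^sup>2 + t\<^sup>2) / (2 * r * t))) :: complex) = 2 + ((z - y) * cnj (z - y) + of_real r * of_real r + of_real t * of_real t) / (of_real r * of_real t)" .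
  qed
  moreover have "det (herm P + herm Q) = ((z * cnj z + of_real r * of_real r) / of_real r + (y * cnj y + of_real t * of_real t) / of_real t) * (1 / of_real r + 1 / of_real t)
     - (z / of_real r + y / of_real t) * (cnj z / of_real r + cnj y / of_real t)"
    unfolding det_2 herm_def z_def y_def r_def t_def
    by (simp add: complex_norm_square[symmetric] power2_eq_square[of "of_real _"])
  moreover have "\<dots> = 2 + ((z - y) * cnj (z - y) + of_real r * of_real r + of_real t * of_real t) / (of_real r * of_real t)"
    using ne by (simp add: field_simps)
  ultimately show ?thesis by simp
qed

lemma cosh_arg_invariant:
  assumes A: "det A = 1" and P: "snd P > 0" and Q: "snd Q > 0"
  shows "cosh_arg (mat_act A P) (mat_act A Q) = cosh_arg P Q"
proof -
  have dist: "A ** (B + C) = A ** B + A ** C" "(B + C) ** A = B ** A + C ** A" for A B C :: "complex^2^2"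
    by (rule mat2_eqI; simp add: mat2_mult_nth algebra_simps)+
  have "herm (mat_act A P) + herm (mat_act A Q) = A ** (herm P + herm Q) ** adjoint2 A"
    unfolding herm_act[OF A P, symmetric] herm_act[OF A Q, symmetric] dist ..
  then have "det (herm (mat_act A P) + herm (mat_act A Q)) = det (herm P + herm Q)"
    by (simp add: det_mul det_adjoint2 A)
  then have "(of_real (2 + 2 * cosh_arg (mat_act A P) (mat_act A Q)) :: complex) = of_real (2 + 2 * cosh_arg P Q)"
    by (simp only: cosh_arg_det P Q snd_mat_act_pos A)
  then have "2 + 2 * cosh_arg (mat_act A P) (mat_act A Q) = 2 + 2 * cosh_arg P Q" by (simp only: of_real_eq_iff)
  then show ?thesis by simp
qed

lemma cosh_hyp_dist:
  assumes P: "snd P > 0" and Q: "snd Q > 0"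
  shows "cosh (hyp_dist P Q) = cosh_arg P Q"
proof -
  have "0 \<le> (snd P - snd Q)\<^sup>2" by simp
  then have "2 * snd P * snd Q \<le> (snd P)\<^sup>2 + (snd Q)\<^sup>2" by (simp add: power2_diff)
  then have "2 * snd P * snd Q \<le> (cmod (fst P - fst Q))\<^sup>2 + (snd P)\<^sup>2 + (snd Q)\<^sup>2"
    using zero_le_power2[of "cmod (fst P - fst Q)"] by linarith
  then have "1 \<le> cosh_arg P Q" unfolding cosh_arg_def cosh_dist_def using P Q by (simp add: le_divide_eq)
  then show ?thesis unfolding hyp_dist_def cosh_arg_def cosh_dist_def by (simp add: cosh_arcosh_real)
qed

section \<open>Cosets of the unipotent stabilizer\<close>

definition psl_of :: "complex^2^2 \<Rightarrow> (complex^2^2) set" where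
  "psl_of A = {A, - A}"

lemma psl_of_eq_iff: "psl_of A = psl_of B \<longleftrightarrow> A = B \<or> A = - B"
  unfolding psl_of_def by (auto simp: doubleton_eq_iff)

lemma psl_class_eq: "psl_class a b c d = psl_of (mat2 a b c d)"
  unfolding psl_class_def psl_of_def mat2_def Let_def ..

lemma SL2_iff: "A \<in> carrier (SL2 R) \<longleftrightarrow> (\<forall>i j. A $ i $ j \<in> R) \<and> det A = 1"
  unfolding SL2_def by simp

lemma carrier_PSL2: "carrier (PSL2 R) = psl_of ` carrier (SL2 R)"
  unfolding PSL2_def FactGroup_def RCOSETS_def r_coset_def psl_of_def
  by (auto simp: SL2_def matrix_neg_mult)

lemma mult_PSL2: "psl_of A \<otimes>\<^bsub>PSL2 R\<^esub> psl_of B = psl_of (A ** B)"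
  unfolding PSL2_def FactGroup_def set_mult_def psl_of_def
  by (auto simp: SL2_def matrix_neg_mult)

lemma psl_of_mult_cong:
  assumes "psl_of A = psl_of A'" "psl_of B = psl_of B'"
  shows "psl_of (A ** B) = psl_of (A' ** B')"
  using assms by (simp only: mult_PSL2[where R = UNIV, symmetric])

lemma one_PSL2: "\<one>\<^bsub>PSL2 R\<^esub> = psl_of (mat 1)"
  unfolding PSL2_def FactGroup_def psl_of_def by simp

lemma psl_act_psl_of: "psl_act (psl_of A) P = mat_act A P"
proof -
  have "(SOME B. B \<in> psl_of A) \<in> psl_of A" by (rule someI_ex) (auto simp: psl_of_def)
  then have "(SOME B. B \<in> psl_of A) = A \<or> (SOME B. B \<in> psl_of A) = - A" unfolding psl_of_def by simp
  then show ?thesis unfolding psl_act_def by (metis mat_act_uminus)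
qed

lemma SL2_mult:
  assumes R: "\<And>x y. x \<in> R \<Longrightarrow> y \<in> R \<Longrightarrow> x + y \<in> R" "\<And>x y. x \<in> R \<Longrightarrow> y \<in> R \<Longrightarrow> x * y \<in> R"
    and A: "A \<in> carrier (SL2 R)" and B: "B \<in> carrier (SL2 R)"
  shows "A ** B \<in> carrier (SL2 R)"
  unfolding SL2_iff
proof (intro conjI allI)
  fix i j
  show "(A ** B) $ i $ j \<in> R" unfolding mat2_mult_nth using A B unfolding SL2_iff by (intro R) simp_all
  show "det (A ** B) = 1" using A B unfolding SL2_iff det_mul by simp
qed

lemma SL2_adj2:
  assumes neg: "\<And>x. x \<in> R \<Longrightarrow> - x \<in> R" and A: "A \<in> carrier (SL2 R)"
  shows "adj2 A \<in> carrier (SL2 R)"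
proof -
  have e: "A $ i $ j \<in> R" for i j using A unfolding SL2_iff by simp
  have "\<forall>i j. adj2 A $ i $ j \<in> R" unfolding forall_2 adj2_def by (simp add: e neg[OF e])
  then show ?thesis using A unfolding SL2_iff det_adj2 by simp
qed

lemma inv_PSL2:
  assumes A: "A \<in> carrier (SL2 R)" and neg: "\<And>x. x \<in> R \<Longrightarrow> - x \<in> R"
  shows "inv\<^bsub>PSL2 R\<^esub> (psl_of A) = psl_of (adj2 A)"
proof -
  have det: "det A = 1" using A unfolding SL2_iff by simp
  have adj: "adj2 A \<in> carrier (SL2 R)"
    by (rule SL2_adj2[OF neg A])
  show ?thesis unfolding m_inv_def
  proof (rule the_equality)
    show "psl_of (adj2 A) \<in> carrier (PSL2 R) \<and> psl_of A \<otimes>\<^bsub>PSL2 R\<^esub> psl_of (adj2 A) = \<one>\<^bsub>PSL2 R\<^esub> \<and> psl_of (adj2 A) \<otimes>\<^bsub>PSL2 R\<^esub> psl_of A = \<one>\<^bsub>PSL2 R\<^esub>"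
      unfolding mult_PSL2 one_PSL2 carrier_PSL2 using adj adj2_mult[OF det] by simp
    fix y assume y: "y \<in> carrier (PSL2 R) \<and> psl_of A \<otimes>\<^bsub>PSL2 R\<^esub> y = \<one>\<^bsub>PSL2 R\<^esub> \<and> y \<otimes>\<^bsub>PSL2 R\<^esub> psl_of A = \<one>\<^bsub>PSL2 R\<^esub>"
    then obtain B where B: "y = psl_of B" unfolding carrier_PSL2 by blast
    then have "A ** B = mat 1 \<or> A ** B = - mat 1" using y unfolding B mult_PSL2 one_PSL2 psl_of_eq_iff by blast
    moreover have "B = adj2 A ** (A ** B)" unfolding matrix_mul_assoc adj2_mult[OF det] by simp
    ultimately have "B = adj2 A \<or> B = - adj2 A" by (metis matrix_neg_mult(2) matrix_mul_rid)
    then show "y = psl_of (adj2 A)" unfolding B psl_of_eq_iff .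
  qed
qed

text \<open>\<open>S\<close> is the representative of the scaling matrix whose first column is the coordinate vector of the cusp
  itself rather than its negative.\<close>

locale cusp_setting = imag_quadratic +
  fixes \<xi> :: "complex^2" and \<sigma> :: "(complex^2^2) set" and S :: "complex^2^2"
  assumes \<xi>_nonzero: "\<xi> \<noteq> 0" and \<xi>_integral: "\<And>i. \<xi> $ i \<in> ring_of_integers K"
    and scaling: "scaling_matrix K \<xi> \<sigma>"
    and S: "S \<in> carrier (SL2 K)" "\<sigma> = psl_of S" "column 1 S = \<xi>"
begin

abbreviation "\<Lambda> \<equiv> cusp_lattice K \<xi>"
abbreviation "\<O> \<equiv> ring_of_integers K"
abbreviation "cosets \<equiv> rcosets\<^bsub>Bianchi K\<^esub> (cusp_unipotent K \<xi>)"

lemma det_S: "det S = 1" using S(1) unfolding SL2_iff by simp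

lemma S_inv: "S ** adj2 S = mat 1" "adj2 S ** S = mat 1" using adj2_mult[OF det_S] by auto

lemma inv_\<sigma>: "inv\<^bsub>PSL2 K\<^esub> \<sigma> = psl_of (adj2 S)"
  unfolding S(2) by (rule inv_PSL2[OF S(1) K_minus])

text \<open>The element of the stabilizer that the scaling matrix conjugates to the translation by \<open>l\<close>.\<close>

definition unip :: "complex \<Rightarrow> complex^2^2" where
  "unip l = S ** mat2 1 l 0 1 ** adj2 S"

lemma mat2_translation_mult: "mat2 1 a 0 1 ** mat2 1 b 0 1 = mat2 1 (a + b) 0 1"
  by (rule mat2_eqI) (simp_all add: mat2_mult_nth)

lemma unip_mult: "unip a ** unip b = unip (a + b)"
proof -
  have "unip a ** unip b = S ** mat2 1 a 0 1 ** (adj2 S ** S) ** mat2 1 b 0 1 ** adj2 S"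
    unfolding unip_def by (simp only: matrix_mul_assoc)
  also have "\<dots> = S ** (mat2 1 a 0 1 ** mat2 1 b 0 1) ** adj2 S"
    unfolding S_inv by (simp only: matrix_mul_rid matrix_mul_assoc)
  finally show ?thesis unfolding mat2_translation_mult unip_def .
qed

lemma unip_0: "unip 0 = mat 1"
proof -
  have "mat2 1 0 0 1 = mat 1" by (rule mat2_eqI) simp_all
  then show ?thesis unfolding unip_def using S_inv by simp
qed

lemma conj_S: "adj2 S ** A ** S = B \<Longrightarrow> A = S ** B ** adj2 S"
proof -
  assume "adj2 S ** A ** S = B"
  moreover have "S ** (adj2 S ** A ** S) ** adj2 S = (S ** adj2 S) ** A ** (S ** adj2 S)" by (simp only: matrix_mul_assoc)
  ultimately show ?thesis unfolding S_inv by simp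
qed

lemma cusp_unipotent_subset: "cusp_unipotent K \<xi> \<subseteq> carrier (Bianchi K)"
  unfolding cusp_unipotent_def cusp_stabilizer_def stabilizer_def by auto

lemma cusp_unipotent_eq: "cusp_unipotent K \<xi> = (\<lambda>l. psl_of (unip l)) ` \<Lambda>"
proof -
  have eq: "{inv\<^bsub>PSL2 K\<^esub> \<sigma> \<otimes>\<^bsub>PSL2 K\<^esub> g \<otimes>\<^bsub>PSL2 K\<^esub> \<sigma> | g. g \<in> cusp_unipotent K \<xi>} = {psl_class 1 l 0 1 | l. l \<in> \<Lambda>}"
    by (rule scaling[unfolded scaling_matrix_def, THEN conjunct2, THEN conjunct2, THEN conjunct2, THEN conjunct2])
  have conj: "inv\<^bsub>PSL2 K\<^esub> \<sigma> \<otimes>\<^bsub>PSL2 K\<^esub> psl_of A \<otimes>\<^bsub>PSL2 K\<^esub> \<sigma> = psl_of (adj2 S ** A ** S)" for A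
    unfolding inv_\<sigma> unfolding S(2) mult_PSL2 ..
  have key: "psl_of A = psl_of (unip l) \<longleftrightarrow> psl_of (adj2 S ** A ** S) = psl_of (mat2 1 l 0 1)" for A l
  proof
    assume "psl_of A = psl_of (unip l)"
    then have "psl_of (adj2 S ** A ** S) = psl_of (adj2 S ** unip l ** S)"
      by (intro psl_of_mult_cong refl)
    also have "adj2 S ** unip l ** S = (adj2 S ** S) ** mat2 1 l 0 1 ** (adj2 S ** S)"
      unfolding unip_def by (simp only: matrix_mul_assoc)
    finally show "psl_of (adj2 S ** A ** S) = psl_of (mat2 1 l 0 1)" unfolding S_inv by simp
  next
    assume "psl_of (adj2 S ** A ** S) = psl_of (mat2 1 l 0 1)"
    then have "psl_of (S ** (adj2 S ** A ** S) ** adj2 S) = psl_of (unip l)"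
      unfolding unip_def by (intro psl_of_mult_cong refl)
    then show "psl_of A = psl_of (unip l)" unfolding conj_S[OF refl, symmetric] .
  qed
  show ?thesis
  proof (intro equalityI subsetI)
    fix g assume g: "g \<in> cusp_unipotent K \<xi>"
    then obtain A where A: "g = psl_of A" using cusp_unipotent_subset carrier_PSL2 by blast
    have "psl_of (adj2 S ** A ** S) \<in> {psl_class 1 l 0 1 | l. l \<in> \<Lambda>}"
      unfolding conj[symmetric] eq[symmetric] using g unfolding A by (intro CollectI exI[of _ "psl_of A"] conjI refl)
    then obtain l where "l \<in> \<Lambda>" "psl_of (adj2 S ** A ** S) = psl_of (mat2 1 l 0 1)" unfolding psl_class_eq by blast
    then show "g \<in> (\<lambda>l. psl_of (unip l)) ` \<Lambda>" using key[of A l] A by (intro image_eqI[of _ _ l]) simp_all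
  next
    fix g assume "g \<in> (\<lambda>l. psl_of (unip l)) ` \<Lambda>"
    then obtain l where l: "l \<in> \<Lambda>" "g = psl_of (unip l)" by blast
    then have "psl_class 1 l 0 1 \<in> {inv\<^bsub>PSL2 K\<^esub> \<sigma> \<otimes>\<^bsub>PSL2 K\<^esub> g \<otimes>\<^bsub>PSL2 K\<^esub> \<sigma> | g. g \<in> cusp_unipotent K \<xi>}"
      unfolding eq by blast
    then obtain h where h: "h \<in> cusp_unipotent K \<xi>" "psl_class 1 l 0 1 = inv\<^bsub>PSL2 K\<^esub> \<sigma> \<otimes>\<^bsub>PSL2 K\<^esub> h \<otimes>\<^bsub>PSL2 K\<^esub> \<sigma>" by blast
    obtain A where A: "h = psl_of A" using h(1) cusp_unipotent_subset carrier_PSL2 by blast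
    have "psl_of (adj2 S ** A ** S) = psl_of (mat2 1 l 0 1)" using h(2) unfolding A conj psl_class_eq by simp
    then have "psl_of A = psl_of (unip l)" using key[of A l] by simp
    then show "g \<in> cusp_unipotent K \<xi>" using h(1) A l(2) by simp
  qed
qed

lemma coset_eq: "cusp_unipotent K \<xi> #>\<^bsub>Bianchi K\<^esub> psl_of A = (\<lambda>l. psl_of (unip l ** A)) ` \<Lambda>"
  unfolding r_coset_def cusp_unipotent_eq by (auto simp: mult_PSL2)

lemma \<Lambda>_basis: "\<exists>w1 w2. lattice_basis \<Lambda> w1 w2" by (rule cusp_lattice_lattice[OF \<xi>_nonzero \<xi>_integral])

lemma \<Lambda>_group: "0 \<in> \<Lambda>" "x \<in> \<Lambda> \<Longrightarrow> - x \<in> \<Lambda>" "x \<in> \<Lambda> \<Longrightarrow> y \<in> \<Lambda> \<Longrightarrow> x + y \<in> \<Lambda>"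
proof -
  obtain w1 w2 where "lattice_basis \<Lambda> w1 w2" using \<Lambda>_basis by blast
  then interpret planar_lattice \<Lambda> w1 w2 by unfold_locales
  show "0 \<in> \<Lambda>" "x \<in> \<Lambda> \<Longrightarrow> - x \<in> \<Lambda>" "x \<in> \<Lambda> \<Longrightarrow> y \<in> \<Lambda> \<Longrightarrow> x + y \<in> \<Lambda>" by (rule L_group; assumption)+
qed

text \<open>A matrix for the representative of a coset that occurs in the definition of the series.\<close>

definition rep :: "(complex^2^2) set set \<Rightarrow> complex^2^2" where
  "rep c = (SOME G. G \<in> carrier (SL2 \<O>) \<and> (SOME g. g \<in> c) = psl_of G)"

lemma rep:
  assumes c: "c \<in> cosets"
  shows "rep c \<in> carrier (SL2 \<O>)" "(SOME g. g \<in> c) = psl_of (rep c)" "c = (\<lambda>l. psl_of (unip l ** rep c)) ` \<Lambda>"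
proof -
  obtain A where A: "A \<in> carrier (SL2 \<O>)" "c = (\<lambda>l. psl_of (unip l ** A)) ` \<Lambda>"
    using c unfolding RCOSETS_def carrier_PSL2 by (auto simp: coset_eq)
  have "psl_of (unip 0 ** A) \<in> c" unfolding A(2) using \<Lambda>_group(1) by blast
  then have in_c: "(SOME g. g \<in> c) \<in> c" by (rule someI)
  then obtain l0 where l0: "l0 \<in> \<Lambda>" "(SOME g. g \<in> c) = psl_of (unip l0 ** A)" unfolding A(2) by auto
  have "psl_of (unip l0) \<in> carrier (Bianchi K)" using l0(1) cusp_unipotent_eq cusp_unipotent_subset by blast
  then obtain B where B: "B \<in> carrier (SL2 \<O>)" "psl_of (unip l0) = psl_of B" unfolding carrier_PSL2 by blast
  have "psl_of (unip l0 ** A) = psl_of (B ** A)" by (intro psl_of_mult_cong B(2) refl)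
  moreover have "B ** A \<in> carrier (SL2 \<O>)" by (rule SL2_mult[OF integers_add integers_mult B(1) A(1)])
  ultimately have "\<exists>G. G \<in> carrier (SL2 \<O>) \<and> (SOME g. g \<in> c) = psl_of G" using l0(2) by metis
  then have r: "rep c \<in> carrier (SL2 \<O>) \<and> (SOME g. g \<in> c) = psl_of (rep c)"
    unfolding rep_def by (rule someI_ex)
  then show "rep c \<in> carrier (SL2 \<O>)" "(SOME g. g \<in> c) = psl_of (rep c)" by auto
  have "psl_of (rep c) = psl_of (unip l0 ** A)" using r l0(2) by simp
  then have eq: "psl_of (unip l ** rep c) = psl_of (unip (l + l0) ** A)" for l
    unfolding unip_mult[symmetric] matrix_mul_assoc[symmetric] by (intro psl_of_mult_cong refl)
  show "c = (\<lambda>l. psl_of (unip l ** rep c)) ` \<Lambda>"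
  proof (intro equalityI subsetI)
    fix g assume "g \<in> c"
    then obtain l where l: "l \<in> \<Lambda>" "g = psl_of (unip l ** A)" unfolding A(2) by blast
    have "l - l0 \<in> \<Lambda>" using \<Lambda>_group(3)[OF l(1) \<Lambda>_group(2)[OF l0(1)]] by simp
    moreover have "g = psl_of (unip (l - l0) ** rep c)" unfolding eq l by simp
    ultimately show "g \<in> (\<lambda>l. psl_of (unip l ** rep c)) ` \<Lambda>" by blast
  next
    fix g assume "g \<in> (\<lambda>l. psl_of (unip l ** rep c)) ` \<Lambda>"
    then obtain l where l: "l \<in> \<Lambda>" "g = psl_of (unip l ** rep c)" by blast
    have "g = psl_of (unip (l + l0) ** A)" using l(2) eq[of l] by simp
    then show "g \<in> c" using \<Lambda>_group(3)[OF l(1) l0(1)] A(2) by blast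
  qed
qed

lemma coset_eqI:
  assumes "c1 \<in> cosets" "c2 \<in> cosets" "a \<in> \<Lambda>" "b \<in> \<Lambda>" "psl_of (unip a ** rep c1) = psl_of (unip b ** rep c2)"
  shows "c1 = c2"
proof -
  have shift: "psl_of (unip (l + a) ** rep c1) = psl_of (unip (l + b) ** rep c2)" for l
    unfolding unip_mult[symmetric] matrix_mul_assoc[symmetric] by (intro psl_of_mult_cong refl assms(5))
  have sub: "c \<subseteq> d" if c: "c \<in> cosets" and d: "d \<in> cosets" and a: "a \<in> \<Lambda>" and b: "b \<in> \<Lambda>"
    and sh: "\<And>l. psl_of (unip (l + a) ** rep c) = psl_of (unip (l + b) ** rep d)" for c d a b
  proof
    fix g assume "g \<in> c"
    then obtain l where l: "l \<in> \<Lambda>" "g = psl_of (unip l ** rep c)" using rep(3)[OF c] by blast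
    have "g = psl_of (unip (l - a + b) ** rep d)" using sh[of "l - a"] l by simp
    moreover have "l - a + b \<in> \<Lambda>" using \<Lambda>_group(3)[OF \<Lambda>_group(3)[OF l(1) \<Lambda>_group(2)[OF a]] b] by simp
    ultimately show "g \<in> d" using rep(3)[OF d] by blast
  qed
  show ?thesis using sub[OF assms(1-4) shift] sub[OF assms(2,1,4,3) shift[symmetric]] by blast
qed

text \<open>The group is the disjoint union of the cosets, and each coset is parametrized by the lattice. The sign of
  \<open>l\<close> makes the translation appear as \<open>z - w + l\<close> in the distance.\<close>

lemma coset_lattice_bij:
  "bij_betw (\<lambda>(c, l). psl_of (unip (- l) ** rep c)) (cosets \<times> \<Lambda>) (carrier (Bianchi K))"
  unfolding bij_betw_def
proof (intro conjI inj_onI)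
  fix x y assume xy: "x \<in> cosets \<times> \<Lambda>" "y \<in> cosets \<times> \<Lambda>"
    "(case x of (c, l) \<Rightarrow> psl_of (unip (- l) ** rep c)) = (case y of (c, l) \<Rightarrow> psl_of (unip (- l) ** rep c))"
  obtain c l d m where cl: "x = (c, l)" "y = (d, m)" by (cases x, cases y) auto
  have in1: "c \<in> cosets" "l \<in> \<Lambda>" "d \<in> cosets" "m \<in> \<Lambda>" using xy cl by auto
  have eq: "psl_of (unip (- l) ** rep c) = psl_of (unip (- m) ** rep d)" using xy(3) cl by simp
  have cd: "c = d" by (rule coset_eqI[OF in1(1,3) \<Lambda>_group(2)[OF in1(2)] \<Lambda>_group(2)[OF in1(4)] eq])
  have det: "det (rep c) = 1" using rep(1)[OF in1(1)] unfolding SL2_iff by simp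
  have cancel: "(A ** rep c) ** adj2 (rep c) = A" for A
    unfolding matrix_mul_assoc[symmetric] adj2_mult[OF det] by simp
  have pm: "unip (- l) = unip (- m) \<or> unip (- l) = - unip (- m)"
    using psl_of_mult_cong[OF eq refl, of "adj2 (rep c)"] unfolding cd[symmetric] cancel psl_of_eq_iff .
  have conj: "adj2 S ** unip a ** S = mat2 1 a 0 1" for a
  proof -
    have "adj2 S ** unip a ** S = (adj2 S ** S) ** mat2 1 a 0 1 ** (adj2 S ** S)"
      unfolding unip_def by (simp only: matrix_mul_assoc)
    then show ?thesis unfolding S_inv by simp
  qed
  have "mat2 1 (- l) 0 1 = mat2 1 (- m) 0 1 \<or> mat2 1 (- l) 0 1 = - mat2 1 (- m) 0 1"
    unfolding conj[symmetric] by (rule disjE[OF pm]) (simp_all only: matrix_neg_mult simp_thms)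
  then have "l = m"
  proof
    assume "mat2 1 (- l) 0 1 = mat2 1 (- m) 0 1"
    then have "mat2 1 (- l) 0 1 $ 1 $ 2 = mat2 1 (- m) 0 1 $ 1 $ 2" by (simp only:)
    then show "l = m" by simp
  next
    assume "mat2 1 (- l) 0 1 = - mat2 1 (- m) 0 1"
    then have "mat2 1 (- l) 0 1 $ 1 $ 1 = (- mat2 1 (- m) 0 1) $ 1 $ 1" by (simp only:)
    then show "l = m" by simp
  qed
  then show "x = y" using cd cl by simp
next
  have fwd: "psl_of (unip (- l) ** rep c) \<in> carrier (Bianchi K)" if c: "c \<in> cosets" and l: "l \<in> \<Lambda>" for c l
  proof -
    have "psl_of (unip (- l)) \<in> carrier (Bianchi K)"
      using \<Lambda>_group(2)[OF l] cusp_unipotent_eq cusp_unipotent_subset by blast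
    then obtain B where B: "B \<in> carrier (SL2 \<O>)" "psl_of (unip (- l)) = psl_of B" unfolding carrier_PSL2 by blast
    have "psl_of (unip (- l) ** rep c) = psl_of (B ** rep c)" by (intro psl_of_mult_cong B(2) refl)
    then show ?thesis unfolding carrier_PSL2 using SL2_mult[OF integers_add integers_mult B(1) rep(1)[OF c]] by blast
  qed
  have bwd: "\<exists>c\<in>cosets. \<exists>l\<in>\<Lambda>. g = psl_of (unip (- l) ** rep c)" if g: "g \<in> carrier (Bianchi K)" for g
  proof -
    obtain A where A: "A \<in> carrier (SL2 \<O>)" "g = psl_of A" using g unfolding carrier_PSL2 by blast
    define c where "c = cusp_unipotent K \<xi> #>\<^bsub>Bianchi K\<^esub> g"
    have c: "c \<in> cosets" unfolding c_def RCOSETS_def using g by blast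
    have "g \<in> c" unfolding c_def A(2) coset_eq using \<Lambda>_group(1) unip_0 by (intro image_eqI[of _ _ 0]) simp_all
    then obtain l where "l \<in> \<Lambda>" "g = psl_of (unip l ** rep c)" using rep(3)[OF c] by blast
    then show ?thesis using c \<Lambda>_group(2)[of l] by (intro bexI[of _ c] bexI[of _ "- l"]) auto
  qed
  show "(\<lambda>(c, l). psl_of (unip (- l) ** rep c)) ` (cosets \<times> \<Lambda>) = carrier (Bianchi K)"
    using fwd bwd by (auto simp: image_iff)
qed

lemma det_rep: "c \<in> cosets \<Longrightarrow> det (rep c) = 1" using rep(1) unfolding SL2_iff by blast

lemma coset_translate_eq:
  assumes c: "c \<in> cosets" and P: "snd P > 0"
  shows "coset_translate K \<sigma> c P = mat_act (adj2 S ** rep c) P"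
  unfolding coset_translate_def inv_\<sigma> rep(2)[OF c] psl_act_psl_of
  using mat_act_mult[of "adj2 S" "rep c" P] det_S det_rep[OF c] P by simp

lemma cosh_hyp_dist_coset:
  assumes c: "c \<in> cosets" and P: "r > 0" and Q: "snd Q > 0"
  shows "cosh (hyp_dist (psl_act \<sigma> (z, r)) (psl_act (psl_of (unip (- l) ** rep c)) Q)) =
     cosh_dist r (snd (coset_translate K \<sigma> c Q)) (z - fst (coset_translate K \<sigma> c Q) + l)"
proof -
  let ?R = "coset_translate K \<sigma> c Q"
  have dN: "det (mat2 1 (- l) 0 1) = 1" by (simp add: det_2)
  have dA: "det (adj2 S ** rep c) = 1" using det_rep[OF c] det_S by (simp add: det_mul)
  have R: "snd ?R > 0" unfolding coset_translate_eq[OF c Q] by (rule snd_mat_act_pos[OF dA Q])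
  have "unip (- l) ** rep c = S ** (mat2 1 (- l) 0 1 ** (adj2 S ** rep c))"
    unfolding unip_def by (simp only: matrix_mul_assoc)
  then have "mat_act (unip (- l) ** rep c) Q = mat_act S (mat_act (mat2 1 (- l) 0 1) ?R)"
    unfolding coset_translate_eq[OF c Q] using mat_act_mult det_S dN dA Q by (simp add: det_mul)
  also have "mat_act (mat2 1 (- l) 0 1) ?R = (fst ?R - l, snd ?R)" unfolding mat_act_translation by simp
  finally have act: "psl_act (psl_of (unip (- l) ** rep c)) Q = mat_act S (fst ?R - l, snd ?R)"
    unfolding psl_act_psl_of .
  have "cosh (hyp_dist (mat_act S (z, r)) (mat_act S (fst ?R - l, snd ?R))) = cosh_arg (z, r) (fst ?R - l, snd ?R)"
    using cosh_arg_invariant[OF det_S, of "(z, r)" "(fst ?R - l, snd ?R)"] P R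
    by (simp add: cosh_hyp_dist snd_mat_act_pos det_S)
  then show ?thesis unfolding act unfolding S(2) psl_act_psl_of cosh_arg_def
    by (simp add: algebra_simps)
qed

section \<open>Convergence of the Eisenstein series\<close>

text \<open>If the bottom rows of \<open>S\<^sup>-\<^sup>1 \<gamma>\<^sub>1\<close> and \<open>S\<^sup>-\<^sup>1 \<gamma>\<^sub>2\<close> agree, then \<open>S\<^sup>-\<^sup>1 \<gamma>\<^sub>1 \<gamma>\<^sub>2\<^sup>-\<^sup>1 S\<close> is a translation. So
  \<open>\<gamma>\<^sub>1 \<gamma>\<^sub>2\<^sup>-\<^sup>1\<close> is an element of the group that fixes the cusp and has trace 2, and it belongs to the unipotent
  stabilizer.\<close>

lemma bottom_row_inj:
  assumes c: "c1 \<in> cosets" "c2 \<in> cosets"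
    and row: "(adj2 S ** rep c1) $ 2 = (adj2 S ** rep c2) $ 2"
  shows "c1 = c2"
proof -
  define A where "A = adj2 S ** rep c1"
  define B where "B = adj2 S ** rep c2"
  have det: "det A = 1" "det B = 1" unfolding A_def B_def using det_rep[OF c(1)] det_rep[OF c(2)] det_S by (simp_all add: det_mul)
  have row': "A $ 2 $ 1 = B $ 2 $ 1" "A $ 2 $ 2 = B $ 2 $ 2" using row unfolding A_def B_def by simp_all
  define x where "x = (A ** adj2 B) $ 1 $ 2"
  have AB: "A ** adj2 B = mat2 1 x 0 1"
  proof (rule mat2_eqI)
    show "(A ** adj2 B) $ 1 $ 1 = mat2 1 x 0 1 $ 1 $ 1" "(A ** adj2 B) $ 2 $ 2 = mat2 1 x 0 1 $ 2 $ 2" "(A ** adj2 B) $ 2 $ 1 = mat2 1 x 0 1 $ 2 $ 1"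
      using det row' by (simp_all add: mat2_mult_nth adj2_def det_2 algebra_simps)
  qed (simp add: x_def)
  have adjB: "adj2 B = adj2 (rep c2) ** S"
    unfolding B_def by (rule mat2_eqI) (simp_all add: adj2_def mat2_mult_nth)
  define g where "g = rep c1 ** adj2 (rep c2)"
  have gS: "g = unip x"
  proof -
    have "adj2 S ** g ** S = A ** adj2 B" unfolding adjB A_def g_def by (simp only: matrix_mul_assoc)
    then show ?thesis unfolding AB unip_def by (rule conj_S)
  qed
  have gO: "g \<in> carrier (SL2 \<O>)" unfolding g_def
    by (intro SL2_mult[OF integers_add integers_mult] SL2_adj2 integers_minus rep(1) c)
  have S_e1: "S *v vector [1, 0] = \<xi>"
    using S(3) by (simp add: vec_eq_iff matrix_vector_mult_def sum_2 column_def)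
  have e1: "adj2 S *v \<xi> = vector [1, 0]"
    unfolding S_e1[symmetric] matrix_vector_mul_assoc S_inv by simp
  have "mat2 1 x 0 1 *v vector [1, 0] = vector [1, 0]"
    by (simp add: vec_eq_iff matrix_vector_mult_def sum_2 forall_2)
  then have fix_\<xi>: "g *v \<xi> = \<xi>"
    unfolding gS unip_def using S_e1 e1 by (simp add: matrix_vector_mul_assoc[symmetric])
  have neg_v: "(- g) *v v = - (g *v v)" for v :: "complex^2"
    by (simp add: vec_eq_iff matrix_vector_mult_def sum_2)
  have "proj_act (psl_of g) (proj_point \<xi>) = proj_point \<xi>"
  proof (intro equalityI subsetI)
    fix v assume "v \<in> proj_act (psl_of g) (proj_point \<xi>)"
    then obtain h k where hk: "h = g \<or> h = - g" "k \<noteq> 0" "v = h *v (k *s \<xi>)"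
      unfolding proj_act_def proj_point_def psl_of_def by blast
    have "g *v (k *s \<xi>) = k *s \<xi>" using fix_\<xi> by (simp only: vector_scalar_commute)
    then have "v = k *s \<xi> \<or> v = (- k) *s \<xi>" using hk neg_v by auto
    then show "v \<in> proj_point \<xi>" unfolding proj_point_def using hk(2) by fastforce
  next
    fix v assume "v \<in> proj_point \<xi>"
    then obtain k where k: "k \<noteq> 0" "v = k *s \<xi>" unfolding proj_point_def by blast
    have "g *v (k *s \<xi>) = k *s \<xi>" using fix_\<xi> by (simp only: vector_scalar_commute)
    then show "v \<in> proj_act (psl_of g) (proj_point \<xi>)"
      unfolding proj_act_def psl_of_def proj_point_def using k by (intro CollectI exI[of _ g] exI[of _ "k *s \<xi>"]) auto
  qed
  then have "psl_of g \<in> cusp_stabilizer K \<xi>"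
    unfolding cusp_stabilizer_def stabilizer_def carrier_PSL2 using gO by blast
  moreover have "trace g = 2"
  proof -
    have "trace g = trace (adj2 S ** (S ** mat2 1 x 0 1))"
      unfolding gS unip_def by (rule trace_mul_sym)
    also have "adj2 S ** (S ** mat2 1 x 0 1) = mat2 1 x 0 1" unfolding matrix_mul_assoc S_inv by simp
    finally show ?thesis by (simp add: trace_def sum_2)
  qed
  then have "parabolic (psl_of g) \<or> psl_of g = \<one>\<^bsub>PSL2 UNIV\<^esub>"
    unfolding parabolic_def psl_of_def by auto
  ultimately have "psl_of g \<in> cusp_unipotent K \<xi>" unfolding cusp_unipotent_def by blast
  then obtain l where l: "l \<in> \<Lambda>" "psl_of g = psl_of (unip l)" unfolding cusp_unipotent_eq by blast
  have "rep c1 = g ** rep c2"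
  proof -
    have "g ** rep c2 = rep c1 ** (adj2 (rep c2) ** rep c2)" unfolding g_def by (simp only: matrix_mul_assoc)
    then show ?thesis unfolding adj2_mult[OF det_rep[OF c(2)]] by simp
  qed
  then have "psl_of (unip 0 ** rep c1) = psl_of (unip l ** rep c2)"
    unfolding unip_0 matrix_mul_lid using psl_of_mult_cong[OF l(2) refl] by simp
  then show ?thesis using coset_eqI[OF c \<Lambda>_group(1) l(1)] by blast
qed

text \<open>The bottom row of \<open>S\<^sup>-\<^sup>1\<close> is \<open>(- \<xi> $ 2, \<xi> $ 1)\<close>, which is integral although the second column of \<open>S\<close> lies only in the field.\<close>

lemma bottom_row_integral:
  assumes c: "c \<in> cosets" shows "(adj2 S ** rep c) $ 2 $ j \<in> \<O>"
proof -
  have "S $ 1 $ 1 = \<xi> $ 1" "S $ 2 $ 1 = \<xi> $ 2" using S(3) by (auto simp: column_def)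
  then have "adj2 S $ 2 $ 1 \<in> \<O>" "adj2 S $ 2 $ 2 \<in> \<O>" using \<xi>_integral by (auto simp: adj2_def intro: integers_minus)
  moreover have "rep c $ i $ j \<in> \<O>" for i using rep(1)[OF c] unfolding SL2_iff by blast
  ultimately show ?thesis unfolding mat2_mult_nth by (intro integers_add integers_mult)
qed

text \<open>If \<open>(a, b)\<close> is the bottom row and \<open>Q = x + q j\<close>, the height is \<open>q / (\<bar>a x + b\<bar>\<^sup>2 + \<bar>a\<bar>\<^sup>2 q\<^sup>2)\<close>, and the
  denominator is at least a constant times \<open>1 + \<bar>a\<bar>\<^sup>2 + \<bar>b\<bar>\<^sup>2\<close>. The sum over all pairs of integers splits into
  two sums over a planar lattice with exponent \<open>p / 2 > 1\<close>.\<close>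

lemma Eisenstein_summable:
  assumes p: "p > 2" and Q: "snd Q > 0"
  shows "(\<lambda>c. snd (coset_translate K \<sigma> c Q) powr p) summable_on cosets"
proof -
  obtain v1 v2 where v: "lattice_basis \<O> v1 v2" using integers_lattice by blast
  interpret O: planar_lattice \<O> v1 v2 by unfold_locales (rule v)
  let ?h = "\<lambda>a::complex. (1 + (norm a)\<^sup>2) powr (- (p / 2))"
  have h: "?h summable_on \<O>" by (rule O.lattice_powr_summable) (use p in simp)
  have hh: "(\<lambda>(a, b). ?h a * ?h b) summable_on (\<O> \<times> \<O>)" by (rule summable_on_product_nonneg[OF h _ h]) auto
  define row where "row c = ((adj2 S ** rep c) $ 2 $ 1, (adj2 S ** rep c) $ 2 $ 2)" for c
  have inj: "inj_on row cosets"
  proof (rule inj_onI)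
    fix c1 c2 assume "c1 \<in> cosets" "c2 \<in> cosets" "row c1 = row c2"
    then show "c1 = c2" unfolding row_def by (intro bottom_row_inj) (auto simp: vec_eq_iff forall_2)
  qed
  have "(\<lambda>(a, b). ?h a * ?h b) summable_on (row ` cosets)"
    by (rule summable_on_subset_banach[OF hh]) (auto simp: row_def bottom_row_integral)
  then have s: "(\<lambda>c. ?h (fst (row c)) * ?h (snd (row c))) summable_on cosets"
    by (subst (asm) summable_on_reindex[OF inj]) (simp add: o_def case_prod_unfold)
  define x q where "x = fst Q" and "q = snd Q"
  define B where "B = max 2 ((1 + 2 * (norm x)\<^sup>2) / q\<^sup>2)"
  have qp: "q > 0" using Q unfolding q_def .
  have B: "B \<ge> 2" "1 + 2 * (norm x)\<^sup>2 \<le> B * q\<^sup>2"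
  proof -
    have "(1 + 2 * (norm x)\<^sup>2) / q\<^sup>2 \<le> B" unfolding B_def by simp
    then show "1 + 2 * (norm x)\<^sup>2 \<le> B * q\<^sup>2" using qp by (simp add: divide_le_eq)
  qed (simp add: B_def)
  have s': "(\<lambda>c. (2 * q * B) powr p * (?h (fst (row c)) * ?h (snd (row c)))) summable_on cosets"
    by (rule summable_on_cmult_right[OF s])
  show ?thesis
  proof (rule summable_on_comparison_test[OF s'])
    fix c assume c: "c \<in> cosets"
    define A where "A = adj2 S ** rep c"
    define a b where "a = A $ 2 $ 1" and "b = A $ 2 $ 2"
    have ab: "row c = (a, b)" unfolding row_def a_def b_def A_def ..
    have dA: "det A = 1" unfolding A_def using det_rep[OF c] det_S by (simp add: det_mul)
    define N where "N = act_denom A Q"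
    have N: "N = (norm (a * x + b))\<^sup>2 + (norm a)\<^sup>2 * q\<^sup>2" unfolding N_def act_denom_def a_def b_def x_def q_def ..
    have Npos: "N > 0" unfolding N_def by (rule act_denom_pos[OF dA Q])
    have sn: "snd (coset_translate K \<sigma> c Q) = q / N" unfolding coset_translate_eq[OF c Q] snd_mat_act A_def[symmetric] N_def q_def ..
    have abO: "a \<in> \<O>" "b \<in> \<O>" unfolding a_def b_def A_def by (rule bottom_row_integral[OF c])+
    have "a \<noteq> 0 \<or> b \<noteq> 0" using dA unfolding det_2 a_def b_def by auto
    then have "1 \<le> (norm a)\<^sup>2 \<or> 1 \<le> (norm b)\<^sup>2" using integer_norm_ge_1 abO by (meson one_le_power)
    then have one: "1 \<le> (norm a)\<^sup>2 + (norm b)\<^sup>2" using zero_le_power2[of "norm a"] zero_le_power2[of "norm b"] by linarith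
    have "norm b \<le> norm (a * x + b) + norm a * norm x" using norm_triangle_ineq4[of "a * x + b" "a * x"] by (simp add: norm_mult)
    then have "(norm b)\<^sup>2 \<le> (norm (a * x + b) + norm a * norm x)\<^sup>2" by (intro power_mono) auto
    also have "\<dots> \<le> 2 * (norm (a * x + b))\<^sup>2 + 2 * (norm a * norm x)\<^sup>2"
      using zero_le_power2[of "norm (a * x + b) - norm a * norm x"] by (simp add: power2_eq_square algebra_simps)
    finally have "(norm a)\<^sup>2 + (norm b)\<^sup>2 \<le> 2 * (norm (a * x + b))\<^sup>2 + (norm a)\<^sup>2 * (1 + 2 * (norm x)\<^sup>2)"
      by (simp add: power_mult_distrib algebra_simps)
    also have "\<dots> \<le> B * (norm (a * x + b))\<^sup>2 + (norm a)\<^sup>2 * (B * q\<^sup>2)"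
      using B by (intro add_mono mult_right_mono mult_left_mono) auto
    also have "\<dots> = B * N" unfolding N by (simp add: algebra_simps)
    finally have le: "1 + (norm a)\<^sup>2 + (norm b)\<^sup>2 \<le> 2 * B * N" using one by simp
    define M where "M = 1 + (norm a)\<^sup>2 + (norm b)\<^sup>2"
    have M: "M > 0" unfolding M_def by (intro add_pos_nonneg) auto
    have "q / N \<le> (2 * q * B) / M"
      using le M Npos qp unfolding M_def[symmetric] by (simp add: field_simps)
    then have "(q / N) powr p \<le> ((2 * q * B) / M) powr p" using qp Npos p by (intro powr_mono2) auto
    also have "\<dots> = (2 * q * B) powr p / M powr p" by (rule powr_divide)
    also have "\<dots> = (2 * q * B) powr p * M powr (- p)" by (simp add: powr_minus divide_inverse)
    also have "M powr (- p) \<le> ?h a * ?h b"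
    proof -
      have "M powr (- p) = M powr (- (p / 2)) * M powr (- (p / 2))" by (simp flip: powr_add)
      also have "\<dots> \<le> ?h a * ?h b"
        using p by (intro mult_mono powr_mono2') (auto simp: M_def add_pos_nonneg)
      finally show ?thesis .
    qed
    finally show "snd (coset_translate K \<sigma> c Q) powr p \<le> (2 * q * B) powr p * (?h (fst (row c)) * ?h (snd (row c)))"
      unfolding sn ab by (simp add: mult_left_mono)
  qed simp
qed

end

section \<open>The expansion of the Green function\<close>

context cusp_setting
begin

lemma coset_translate_snd_pos:
  assumes "c \<in> cosets" "snd Q > 0" shows "snd (coset_translate K \<sigma> c Q) > 0"
  unfolding coset_translate_eq[OF assms]
  by (rule snd_mat_act_pos) (use det_rep[OF assms(1)] det_S assms(2) in \<open>simp_all add: det_mul\<close>)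

text \<open>The third powers of the heights are summable, so only finitely many heights exceed \<open>r / 2\<close>.\<close>

lemma coset_heights_bounded_away:
  assumes Q: "snd Q > 0" and r: "r > 0"
    and lt: "\<And>c. c \<in> cosets \<Longrightarrow> snd (coset_translate K \<sigma> c Q) < r"
  shows "\<exists>\<rho>. 0 < \<rho> \<and> \<rho> < r \<and> (\<forall>c\<in>cosets. snd (coset_translate K \<sigma> c Q) \<le> \<rho>)"
proof -
  define h where "h c = snd (coset_translate K \<sigma> c Q)" for c
  define A where "A = {c \<in> cosets. r / 2 \<le> h c}"
  have sm: "(\<lambda>c. h c powr 3) summable_on cosets" unfolding h_def by (rule Eisenstein_summable[OF _ Q]) simp
  have fin: "finite A"
  proof (rule ccontr)
    assume inf: "infinite A"
    define q where "q = (r / 2) powr 3"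
    have q: "q > 0" unfolding q_def using r by simp
    obtain n :: nat where n: "(\<Sum>\<^sub>\<infinity>c\<in>cosets. h c powr 3) / q < of_nat n" using reals_Archimedean2 by blast
    obtain F where F: "finite F" "card F = n" "F \<subseteq> A" using infinite_arbitrarily_large[OF inf] by blast
    have "of_nat n * q = (\<Sum>c\<in>F. q)" using F(2) by simp
    also have "\<dots> \<le> (\<Sum>c\<in>F. h c powr 3)"
      unfolding q_def using F(3) r by (intro sum_mono powr_mono2) (auto simp: A_def)
    also have "\<dots> \<le> (\<Sum>\<^sub>\<infinity>c\<in>cosets. h c powr 3)"
      by (rule finite_sum_le_infsum[OF sm F(1)]) (use F(3) in \<open>auto simp: A_def\<close>)
    finally show False using n q by (simp add: field_simps)
  qed
  define \<rho> where "\<rho> = Max (insert (r / 2) (h ` A))"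
  have "r / 2 \<le> \<rho>" unfolding \<rho>_def using fin by (intro Max_ge) auto
  moreover have "\<rho> < r" unfolding \<rho>_def using fin lt r by (subst Max_less_iff) (auto simp: h_def A_def)
  moreover have "h c \<le> \<rho>" if "c \<in> cosets" for c
  proof (cases "c \<in> A")
    case True
    then show ?thesis unfolding \<rho>_def using fin by (intro Max_ge) auto
  next
    case False
    then show ?thesis using that \<open>r / 2 \<le> \<rho>\<close> unfolding A_def by auto
  qed
  ultimately show ?thesis using r unfolding h_def by (intro exI[of _ \<rho>]) auto
qed

theorem green_expansion:
  fixes z s :: complex and r :: real
  assumes Q: "snd Q > 0" and r: "r > 0" and s: "Re s > 1"
    and lt: "\<And>c. c \<in> cosets \<Longrightarrow> snd (coset_translate K \<sigma> c Q) < r"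
  defines "T \<equiv> (\<lambda>\<mu>. niebur_poincare K \<xi> \<sigma> (- \<mu>) Q s * of_real r * bessel_K s (4 * pi * cmod \<mu> * r) *
                 exp (2 * of_real pi * \<i> * complex_tr (\<mu> * z)))"
    and "M \<equiv> dual_lattice \<Lambda> - {0}"
  shows "T summable_on M \<and>
    green K s (psl_act \<sigma> (z, r)) Q =
      1 / of_real (covol \<Lambda>) * (of_real r powr (1 - s) / s * eisenstein K \<xi> \<sigma> Q s + 2 * (\<Sum>\<^sub>\<infinity>\<mu>\<in>M. T \<mu>))"
proof -
  define w where "w = (SOME (w1, w2). lattice_basis \<Lambda> w1 w2)"
  have wb: "lattice_basis \<Lambda> (fst w) (snd w)"
  proof -
    obtain w1 w2 where "lattice_basis \<Lambda> w1 w2" using \<Lambda>_basis by blast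
    then have "case (w1, w2) of (w1, w2) \<Rightarrow> lattice_basis \<Lambda> w1 w2" by simp
    then have "case w of (w1, w2) \<Rightarrow> lattice_basis \<Lambda> w1 w2" unfolding w_def by (rule someI)
    then show ?thesis by (simp add: case_prod_unfold)
  qed
  interpret L: planar_lattice \<Lambda> "fst w" "snd w" by unfold_locales (rule wb)
  have covol: "covol \<Lambda> = L.fund_area"
    unfolding covol_def w_def[symmetric] Let_def L.fund_area_def L.fund_eq by (simp only: case_prod_unfold)
  have area: "L.fund_area > 0" by (rule L.fund_area_pos)
  define h where "h c = snd (coset_translate K \<sigma> c Q)" for c
  define y where "y c = fst (coset_translate K \<sigma> c Q)" for c
  have yh: "coset_translate K \<sigma> c Q = (y c, h c)" for c unfolding h_def y_def by simp
  have h_pos: "0 < h c" if "c \<in> cosets" for c unfolding h_def by (rule coset_translate_snd_pos[OF that Q])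
  have h_lt: "h c < r" if "c \<in> cosets" for c unfolding h_def by (rule lt[OF that])
  obtain \<rho> where \<rho>: "0 < \<rho>" "\<rho> < r" "\<And>c. c \<in> cosets \<Longrightarrow> h c \<le> \<rho>"
    using coset_heights_bounded_away[OF Q r lt] unfolding h_def by blast
  have hs: "(\<lambda>c. h c powr (1 + Re s)) summable_on cosets"
    unfolding h_def by (rule Eisenstein_summable[OF _ Q]) (use s in simp)
  have s0: "Re s > 0" using s by simp

  \<comment> \<open>the summand of the Green function at the element \<open>l\<close> of the coset \<open>c\<close>\<close>
  define f where "f c l = green_phi s (cosh_dist r (h c) (z - y c + l))" for c l
  have f_abs: "(\<lambda>p. norm (case p of (c, l) \<Rightarrow> f c l)) summable_on (cosets \<times> \<Lambda>)"
  proof -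
    obtain B where B: "\<And>r' x. 0 < r' \<Longrightarrow> r' \<le> \<rho> \<Longrightarrow> (\<lambda>l. norm (green_phi s (cosh_dist r r' (x + l)))) summable_on \<Lambda> \<and>
        (\<Sum>\<^sub>\<infinity>l\<in>\<Lambda>. norm (green_phi s (cosh_dist r r' (x + l)))) \<le> B * r' powr (1 + Re s)"
      using L.green_phi_lattice_sum_bound[OF s0 \<rho>(1,2)] by blast
    have inner: "(\<lambda>l. norm (f c l)) summable_on \<Lambda>" "(\<Sum>\<^sub>\<infinity>l\<in>\<Lambda>. norm (f c l)) \<le> B * h c powr (1 + Re s)" if "c \<in> cosets" for c
      unfolding f_def using B[OF h_pos[OF that] \<rho>(3)[OF that], of "z - y c"] by auto
    have Bs: "(\<lambda>c. B * h c powr (1 + Re s)) summable_on cosets" by (rule summable_on_cmult_right[OF hs])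
    show ?thesis
    proof (rule summable_on_SigmaI)
      show "((\<lambda>l. norm (case (c, l) of (c, l) \<Rightarrow> f c l)) has_sum (\<Sum>\<^sub>\<infinity>l\<in>\<Lambda>. norm (f c l))) \<Lambda>" if "c \<in> cosets" for c
        using has_sum_infsum[OF inner(1)[OF that]] by simp
      show "(\<lambda>c. \<Sum>\<^sub>\<infinity>l\<in>\<Lambda>. norm (f c l)) summable_on cosets"
        by (rule summable_on_comparison_test[OF Bs]) (auto intro: inner(2) infsum_nonneg)
    qed simp
  qed
  have green: "green K s (psl_act \<sigma> (z, r)) Q = 1 / (2 * of_real pi) * (\<Sum>\<^sub>\<infinity>c\<in>cosets. \<Sum>\<^sub>\<infinity>l\<in>\<Lambda>. f c l)"
  proof -
    have "(\<Sum>\<^sub>\<infinity>g\<in>carrier (Bianchi K). green_phi s (cosh (hyp_dist (psl_act \<sigma> (z, r)) (psl_act g Q)))) =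
      (\<Sum>\<^sub>\<infinity>p\<in>cosets \<times> \<Lambda>. green_phi s (cosh (hyp_dist (psl_act \<sigma> (z, r)) (psl_act (case p of (c, l) \<Rightarrow> psl_of (unip (- l) ** rep c)) Q))))"
      by (rule infsum_reindex_bij_betw[OF coset_lattice_bij, symmetric])
    also have "\<dots> = (\<Sum>\<^sub>\<infinity>(c, l)\<in>cosets \<times> \<Lambda>. f c l)"
    proof (rule infsum_cong)
      fix p assume p: "p \<in> cosets \<times> \<Lambda>"
      then obtain c l where cl: "p = (c, l)" "c \<in> cosets" by auto
      show "green_phi s (cosh (hyp_dist (psl_act \<sigma> (z, r)) (psl_act (case p of (c, l) \<Rightarrow> psl_of (unip (- l) ** rep c)) Q))) = (case p of (c, l) \<Rightarrow> f c l)"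
        unfolding cl(1) prod.case cosh_hyp_dist_coset[OF cl(2) r Q] f_def h_def y_def ..
    qed
    also have "\<dots> = (\<Sum>\<^sub>\<infinity>c\<in>cosets. \<Sum>\<^sub>\<infinity>l\<in>\<Lambda>. f c l)"
      by (rule infsum_Sigma'_banach[symmetric]) (rule abs_summable_summable[OF f_abs])
    finally show ?thesis unfolding green_def by simp
  qed

  \<comment> \<open>the contribution of the coset \<open>c\<close> to the frequency \<open>\<mu>\<close>, without the factor \<open>4 \<pi> r\<close>\<close>
  define u where "u c \<mu> = of_real (h c) * bessel_I s (4 * pi * norm \<mu> * h c) * bessel_K s (4 * pi * norm \<mu> * r) * lattice_char \<mu> (z - y c)" for c \<mu>
  have u_sum: "(\<lambda>(c, \<mu>). u c \<mu>) summable_on (cosets \<times> M)"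
  proof -
    obtain W where W: "W summable_on M" and Wb: "\<And>r' \<mu>. 0 < r' \<Longrightarrow> r' \<le> \<rho> \<Longrightarrow> \<mu> \<in> M \<Longrightarrow>
        norm (of_real r' * bessel_I s (4 * pi * norm \<mu> * r') * bessel_K s (4 * pi * norm \<mu> * r)) \<le> r' powr (1 + Re s) * W \<mu>"
      using L.bessel_IK_bound[OF s0 \<rho>(1,2)] unfolding M_def by blast
    have W0: "W \<mu> \<ge> 0" if "\<mu> \<in> M" for \<mu>
    proof -
      have "0 \<le> \<rho> powr (1 + Re s) * W \<mu>" using Wb[OF \<rho>(1) order_refl that] norm_ge_zero order_trans by blast
      then show ?thesis using \<rho>(1) by (simp add: zero_le_mult_iff)
    qed
    have prod: "(\<lambda>(c, \<mu>). h c powr (1 + Re s) * W \<mu>) summable_on (cosets \<times> M)"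
      by (rule summable_on_product_nonneg[OF hs _ W]) (auto intro: W0)
    have "(\<lambda>p. norm (case p of (c, \<mu>) \<Rightarrow> u c \<mu>)) summable_on (cosets \<times> M)"
    proof (rule summable_on_comparison_test[OF prod])
      fix p assume "p \<in> cosets \<times> M"
      then obtain c \<mu> where p: "p = (c, \<mu>)" "c \<in> cosets" "\<mu> \<in> M" by auto
      show "norm (case p of (c, \<mu>) \<Rightarrow> u c \<mu>) \<le> (case p of (c, \<mu>) \<Rightarrow> h c powr (1 + Re s) * W \<mu>)"
        unfolding p(1) prod.case u_def norm_mult[of _ "lattice_char _ _"] norm_lattice_char mult_1_right
        by (rule Wb[OF h_pos[OF p(2)] \<rho>(3)[OF p(2)] p(3)])
    qed simp
    then show ?thesis by (rule abs_summable_summable)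
  qed
  have u_swap: "(\<lambda>(\<mu>, c). u c \<mu>) summable_on (M \<times> cosets)"
    using u_sum by (subst (asm) summable_on_swap) (simp add: o_def case_prod_unfold)
  have T: "T \<mu> = of_real r * (\<Sum>\<^sub>\<infinity>c\<in>cosets. u c \<mu>)" for \<mu>
  proof -
    define k where "k = of_real r * bessel_K s (4 * pi * cmod \<mu> * r) * lattice_char \<mu> z"
    have e: "exp (2 * of_real pi * \<i> * complex_tr (\<mu> * z)) = lattice_char \<mu> z" for \<mu> z
      unfolding lattice_char_def ..
    have "T \<mu> = niebur_poincare K \<xi> \<sigma> (- \<mu>) Q s * k"
      unfolding T_def k_def e by (simp only: mult.assoc)
    also have "\<dots> = (\<Sum>\<^sub>\<infinity>c\<in>cosets. of_real (h c) * bessel_I s (4 * pi * cmod \<mu> * h c) * lattice_char (- \<mu>) (y c) * k)"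
      unfolding niebur_poincare_def yh Let_def prod.case norm_minus_cancel e by (rule infsum_cmult_left'[symmetric])
    also have "\<dots> = (\<Sum>\<^sub>\<infinity>c\<in>cosets. of_real r * u c \<mu>)"
    proof (rule infsum_cong)
      fix c
      have "lattice_char \<mu> (z - y c) = lattice_char \<mu> z * lattice_char \<mu> (- y c)"
        unfolding lattice_char_add_right[symmetric] by simp
      also have "lattice_char \<mu> (- y c) = lattice_char (- \<mu>) (y c)" unfolding lattice_char_def by simp
      finally show "of_real (h c) * bessel_I s (4 * pi * cmod \<mu> * h c) * lattice_char (- \<mu>) (y c) * k = of_real r * u c \<mu>"
        unfolding u_def k_def by simp
    qed
    also have "\<dots> = of_real r * (\<Sum>\<^sub>\<infinity>c\<in>cosets. u c \<mu>)" by (rule infsum_cmult_right')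
    finally show ?thesis .
  qed
  have T_sum: "T summable_on M"
    unfolding T by (rule summable_on_cmult_right) (rule summable_on_Sigma_banach[OF u_swap])
  \<comment> \<open>here the sums over the frequencies and the cosets are exchanged\<close>
  have T_inf: "(\<Sum>\<^sub>\<infinity>\<mu>\<in>M. T \<mu>) = of_real r * (\<Sum>\<^sub>\<infinity>c\<in>cosets. \<Sum>\<^sub>\<infinity>\<mu>\<in>M. u c \<mu>)"
    unfolding T infsum_cmult_right' by (subst infsum_swap_banach[OF u_sum]) (rule refl)

  define e where "e c = (of_real (h c) :: complex) powr (s + 1)" for c
  have e_sum: "e summable_on cosets"
  proof -
    have "norm (e c) = h c powr (1 + Re s)" if "c \<in> cosets" for c
      unfolding e_def using h_pos[OF that] by (simp add: norm_powr_real_powr add.commute)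
    then have "(\<lambda>c. norm (e c)) summable_on cosets" using hs by (simp cong: summable_on_cong)
    then show ?thesis by (rule abs_summable_summable)
  qed
  have eis: "eisenstein K \<xi> \<sigma> Q s = (\<Sum>\<^sub>\<infinity>c\<in>cosets. e c)"
    unfolding eisenstein_def yh snd_conv e_def ..
  define a where "a = 2 * of_real pi * (of_real r powr (1 - s) / s)"
  define b where "b = (of_real (4 * pi * r) :: complex)"
  define q where "q = (1 / of_real L.fund_area :: complex)"
  have inner: "(\<Sum>\<^sub>\<infinity>l\<in>\<Lambda>. f c l) = q * (a * e c + b * (\<Sum>\<^sub>\<infinity>\<mu>\<in>M. u c \<mu>))" if c: "c \<in> cosets" for c
  proof -
    have "(\<Sum>\<^sub>\<infinity>\<mu>\<in>M. of_real (4 * pi * r * h c) * bessel_I s (4 * pi * norm \<mu> * h c) * bessel_K s (4 * pi * norm \<mu> * r) * lattice_char \<mu> (z - y c)) = (\<Sum>\<^sub>\<infinity>\<mu>\<in>M. b * u c \<mu>)"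
      unfolding u_def b_def by (rule infsum_cong) (simp add: mult.assoc)
    also have "\<dots> = b * (\<Sum>\<^sub>\<infinity>\<mu>\<in>M. u c \<mu>)" by (rule infsum_cmult_right')
    finally show ?thesis unfolding f_def L.green_phi_Poisson[OF s0 h_pos[OF c] h_lt[OF c]] q_def a_def e_def M_def by simp
  qed
  have us: "(\<lambda>c. \<Sum>\<^sub>\<infinity>\<mu>\<in>M. u c \<mu>) summable_on cosets" by (rule summable_on_Sigma_banach[OF u_sum])
  have "(\<Sum>\<^sub>\<infinity>c\<in>cosets. \<Sum>\<^sub>\<infinity>l\<in>\<Lambda>. f c l) = (\<Sum>\<^sub>\<infinity>c\<in>cosets. q * (a * e c + b * (\<Sum>\<^sub>\<infinity>\<mu>\<in>M. u c \<mu>)))"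
    by (rule infsum_cong) (rule inner)
  also have "\<dots> = q * (\<Sum>\<^sub>\<infinity>c\<in>cosets. a * e c + b * (\<Sum>\<^sub>\<infinity>\<mu>\<in>M. u c \<mu>))" by (rule infsum_cmult_right')
  also have "(\<Sum>\<^sub>\<infinity>c\<in>cosets. a * e c + b * (\<Sum>\<^sub>\<infinity>\<mu>\<in>M. u c \<mu>)) = (\<Sum>\<^sub>\<infinity>c\<in>cosets. a * e c) + (\<Sum>\<^sub>\<infinity>c\<in>cosets. b * (\<Sum>\<^sub>\<infinity>\<mu>\<in>M. u c \<mu>))"
    by (rule infsum_add; rule summable_on_cmult_right) (rule e_sum us)+
  also have "\<dots> = a * (\<Sum>\<^sub>\<infinity>c\<in>cosets. e c) + b * (\<Sum>\<^sub>\<infinity>c\<in>cosets. \<Sum>\<^sub>\<infinity>\<mu>\<in>M. u c \<mu>)"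
    unfolding infsum_cmult_right' ..
  also have "b * (\<Sum>\<^sub>\<infinity>c\<in>cosets. \<Sum>\<^sub>\<infinity>\<mu>\<in>M. u c \<mu>) = 4 * of_real pi * (\<Sum>\<^sub>\<infinity>\<mu>\<in>M. T \<mu>)"
    unfolding T_inf b_def by simp
  finally have sum: "(\<Sum>\<^sub>\<infinity>c\<in>cosets. \<Sum>\<^sub>\<infinity>l\<in>\<Lambda>. f c l) = q * (a * (\<Sum>\<^sub>\<infinity>c\<in>cosets. e c) + 4 * of_real pi * (\<Sum>\<^sub>\<infinity>\<mu>\<in>M. T \<mu>))" .
  have "green K s (psl_act \<sigma> (z, r)) Q = q * (of_real r powr (1 - s) / s * (\<Sum>\<^sub>\<infinity>c\<in>cosets. e c) + 2 * (\<Sum>\<^sub>\<infinity>\<mu>\<in>M. T \<mu>))"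
  proof -
    have "1 / (2 * p) * (q * (2 * p * X * E + 4 * p * Y)) = q * (X * E + 2 * Y)" if "p \<noteq> 0" for p X E Y :: complex
      using that by (simp add: field_simps)
    note alg = this
    show ?thesis unfolding green sum a_def by (rule alg) simp
  qed
  then show ?thesis using T_sum unfolding eis covol q_def by blast
qed

end

text \<open>The scaling matrix is given up to sign, and one of the two signs gives the prescribed first column.\<close>

lemma cusp_setting_if_scaling_matrix:
  fixes \<xi> :: "complex^2"
  assumes K: "imag_quadratic D w K"
    and \<xi>: "\<xi> \<noteq> 0" "\<And>i. \<xi> $ i \<in> ring_of_integers K" and \<sigma>: "scaling_matrix K \<xi> \<sigma>"
  shows "\<exists>S. cusp_setting D w K \<xi> \<sigma> S"
proof -
  interpret imag_quadratic D w K by (rule K)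
  have "\<sigma> \<in> carrier (PSL2 K)" "\<exists>A\<in>\<sigma>. column 1 A = \<xi>" using \<sigma> unfolding scaling_matrix_def by simp_all
  then obtain S B where B: "B \<in> carrier (SL2 K)" "\<sigma> = psl_of B" and S: "S \<in> psl_of B" "column 1 S = \<xi>"
    unfolding carrier_PSL2 by blast
  have eq: "S = B \<or> S = - B" using S(1) unfolding psl_of_def by simp
  have "- B \<in> carrier (SL2 K)" using B(1) unfolding SL2_iff by (simp add: K_minus det_2)
  then have "S \<in> carrier (SL2 K)" using eq B(1) by metis
  moreover have "\<sigma> = psl_of S" unfolding B(2) psl_of_eq_iff using eq by auto
  ultimately have "cusp_setting D w K \<xi> \<sigma> S" using K \<xi> \<sigma> S(2) by unfold_locales
  then show ?thesis ..
qed

theorem proposition3p1: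
  fixes K :: "complex set"
    and C :: "(complex^2) set"
    and \<sigma> :: "complex^2 \<Rightarrow> (complex^2^2) set"
    and \<xi> :: "complex^2"
    and Q :: "complex \<times> real"
    and z :: complex and r :: real and s :: complex
  assumes K: "imaginary_quadratic_field K"
    and C: "cusp_representatives K C"
    and \<sigma>: "\<And>\<kappa>. \<kappa> \<in> C \<Longrightarrow> scaling_matrix K \<kappa> (\<sigma> \<kappa>)"
    and \<sigma>_inf: "\<sigma> cusp_inf = \<one>\<^bsub>PSL2 K\<^esub>"
    and \<xi>: "\<xi> \<in> C"
    and Q: "Q \<in> hyp3"
    and P: "(z, r) \<in> hyp3"
    and r_gt: "\<And>g. g \<in> carrier (Bianchi K) \<Longrightarrow>
                 r > snd (psl_act (inv\<^bsub>PSL2 K\<^esub> (\<sigma> \<xi>)) (psl_act g Q))"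
    and s: "Re s > 1"
  shows "let T = (\<lambda>\<mu>. niebur_poincare K \<xi> (\<sigma> \<xi>) (- \<mu>) Q s * of_real r *
                       bessel_K s (4 * pi * cmod \<mu> * r) *
                       exp (2 * of_real pi * \<i> * complex_tr (\<mu> * z)));
             M = dual_lattice (cusp_lattice K \<xi>) - {0}
         in T summable_on M \<and>
            green K s (psl_act (\<sigma> \<xi>) (z, r)) Q =
              1 / of_real (covol (cusp_lattice K \<xi>)) *
              (of_real r powr (1 - s) / s * eisenstein K \<xi> (\<sigma> \<xi>) Q s + 2 * (\<Sum>\<^sub>\<infinity>\<mu>\<in>M. T \<mu>))"
proof -
  obtain D w where "imag_quadratic D w K" using imaginary_quadratic_field_imp_imag_quadratic[OF K] by blast
  moreover have "\<xi> \<noteq> 0" "\<And>i. \<xi> $ i \<in> ring_of_integers K"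
    using C \<xi> unfolding cusp_representatives_def by blast+
  ultimately obtain S where "cusp_setting D w K \<xi> (\<sigma> \<xi>) S"
    using cusp_setting_if_scaling_matrix[OF _ _ _ \<sigma>[OF \<xi>]] by blast
  then interpret cusp_setting D w K \<xi> "\<sigma> \<xi>" S .
  have pos: "snd Q > 0" "r > 0" using Q P unfolding hyp3_def by auto
  have lt: "snd (coset_translate K (\<sigma> \<xi>) c Q) < r" if c: "c \<in> cosets" for c
    unfolding coset_translate_def rep(2)[OF c]
    by (rule r_gt) (use rep(1)[OF c] in \<open>simp add: carrier_PSL2\<close>)
  show ?thesis unfolding Let_def by (rule green_expansion[OF pos s lt])
qed

end
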